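(* Let $\varepsilon=0$, $T>0$, $U_0>0$, $V_0>0$. The unique weak solution $w$ of the problem $$w_t=\mathcal{D}(w)_{xx}\ \text{ in }(0,\infty)\times(0,T),\qquad w(x,0)=-V_0\ \text{ for }x>0,\qquad w(0,t)=U_0\ \text{ for }t\in(0,T)$$ has a self-similar form: there exist a function $f:[0,\infty)\to\mathbb{R}$ and a constant $a>0$ such that $w(x,t)=f\left(\frac{x}{\sqrt t}\right)$ for (almost every) $(x,t)\in S_T$, and the free boundary is $\beta(t)=a\sqrt t$, $t\in[0,T]$ (that is, $w(x,t)>0$ if $x<\beta(t)$ and $w(x,t)<0$ if $x>\beta(t)$). Writing $\eta=x/\sqrt t$, $f$ satisfies the system $$\begin{aligned} &-\tfrac12\eta f'(\eta)=[\phi'(f(\eta))f'(\eta)]' &&\text{if }0<\eta<a,\\ &f(\eta)=-V_0 &&\text{if }\eta>a,\\ &f(0)=U_0,\qquad \lim_{\eta\nearrow a}f(\eta)=0,\\ &\lim_{\eta\nearrow a}\phi'(f(\eta))f'(\eta)=-\frac{aV_0}{2}, \end{aligned}$$ where a prime on $f$ or on a bracket denotes differentiation with respect to $\eta$.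
   Context: $\phi\in C^2(\mathbb{R})$ is such that $\phi$ and $\phi'$ are strictly increasing on $[0,\infty)$, $\phi(s)>0$ for $s>0$, $\phi(0)=\phi'(0)=0$, and $\int_0^1\frac{\phi'(s)}{s}\,ds<\infty$, $\int_1^\infty\frac{\phi'(s)}{s}\,ds=\infty$. Since $\varepsilon=0$, the function $\mathcal{D}$ is $\mathcal{D}(s)=\phi(s)$ for $s\ge0$ and $\mathcal{D}(s)=0$ for $s<0$. $\mathbb{R}^+=(0,\infty)$ and $S_T=\{(x,t):0\le x<\infty,\ 0<t<T\}$. Weak solution: with $w_0(x)=-V_0$, a function $w$ is a weak solution if (i) $w\in L^\infty(S_T)$; (ii) $\mathcal{D}(w)\in\mathcal{D}(\hat w)+L^2(0,T;W^{1,2}_0(\mathbb{R}^+))$, where $\hat w\in C^\infty([0,\infty))$ is a fixed smooth function of $x$ with $\hat w(0)=U_0$ and $\hat w(x)=-V_0$ for $x>1$; (iii) $\int_{\mathbb{R}^+}w_0(x)\xi(x,0)\,dx+\iint_{S_T}w\,\xi_t\,dx\,dt=\iint_{S_T}\mathcal{D}(w)_x\,\xi_x\,dx\,dt$ for all $\xi\in C^1([0,\infty)\times[0,T])$ with $\xi(0,t)=0$ for $t\in(0,T)$, $\xi(\cdot,T)=0$ and $\operatorname{supp}\xi\subset[0,J]\times[0,T]$ for some $J>0$. Solutions $f$ of the system are understood classically: $f$ is continuous and positive on $[0,a)$ and $C^2$ on $(0,a)$; the value of $f$ at $\eta=a$ is immaterial. *)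

theory Defs
  imports "HOL-Analysis.Analysis"
begin

section \<open>Smoothness\<close>

definition C2_on :: "real set \<Rightarrow> (real \<Rightarrow> real) \<Rightarrow> bool" where
  "C2_on S g \<longleftrightarrow>
     (\<forall>x\<in>S. g differentiable (at x)) \<and>
     (\<forall>x\<in>S. deriv g differentiable (at x)) \<and>
     continuous_on S (deriv (deriv g))"

text \<open>Derivatives are taken within \<open>S\<close>, so that on \<open>{0..}\<close> they are one-sided at \<open>0\<close>.\<close>

definition smooth_on :: "real set \<Rightarrow> (real \<Rightarrow> real) \<Rightarrow> bool" where
  "smooth_on S g \<longleftrightarrow>
     (\<exists>D :: nat \<Rightarrow> real \<Rightarrow> real. (\<forall>x\<in>S. D 0 x = g x) \<and>
        (\<forall>n. \<forall>x\<in>S. (D n has_real_derivative D (Suc n) x) (at x within S)))"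

section \<open>Lebesgue and Sobolev spaces\<close>

text \<open>
  Elements of the function spaces are represented by functions, so every notion below is
  insensitive to changes on null sets. The spaces \<open>W\<^sup>1\<^sup>,\<^sup>2\<close> and \<open>W\<^sub>0\<^sup>1\<^sup>,\<^sup>2\<close> are those of the half line
  \<open>{0<..}\<close>; values elsewhere are ignored.
\<close>

definition L2_on :: "'a::euclidean_space set \<Rightarrow> ('a \<Rightarrow> real) set" where
  "L2_on S = {u \<in> borel_measurable (lebesgue_on S). integrable (lebesgue_on S) (\<lambda>x. (u x)\<^sup>2)}"

definition Linf_on :: "'a::euclidean_space set \<Rightarrow> ('a \<Rightarrow> real) set" where
  "Linf_on S = {u \<in> borel_measurable (lebesgue_on S). \<exists>M. AE x in lebesgue_on S. \<bar>u x\<bar> \<le> M}"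

definition Cc_inf :: "(real \<Rightarrow> real) set" where
  "Cc_inf = {\<zeta>. smooth_on UNIV \<zeta> \<and> compact (closure {x. \<zeta> x \<noteq> 0}) \<and> closure {x. \<zeta> x \<noteq> 0} \<subseteq> {0<..}}"

definition has_weak_deriv :: "(real \<Rightarrow> real) \<Rightarrow> (real \<Rightarrow> real) \<Rightarrow> bool" where
  "has_weak_deriv u v \<longleftrightarrow>
     (\<forall>K. compact K \<and> K \<subseteq> {0<..} \<longrightarrow> integrable (lebesgue_on K) u \<and> integrable (lebesgue_on K) v) \<and>
     (\<forall>\<zeta>\<in>Cc_inf. (LINT x|lebesgue_on {0<..}. u x * deriv \<zeta> x) = - (LINT x|lebesgue_on {0<..}. v x * \<zeta> x))"

definition W12 :: "(real \<Rightarrow> real) set" where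
  "W12 = {u \<in> L2_on {0<..}. \<exists>v \<in> L2_on {0<..}. has_weak_deriv u v}"

text \<open>The weak derivative is determined up to null sets, so the choice does not affect the norm.\<close>

definition weak_deriv :: "(real \<Rightarrow> real) \<Rightarrow> real \<Rightarrow> real" where
  "weak_deriv u = (SOME v. has_weak_deriv u v)"

definition W12_norm :: "(real \<Rightarrow> real) \<Rightarrow> real" where
  "W12_norm u = sqrt ((LINT x|lebesgue_on {0<..}. (u x)\<^sup>2) + (LINT x|lebesgue_on {0<..}. (weak_deriv u x)\<^sup>2))"

definition W12_0 :: "(real \<Rightarrow> real) set" where
  "W12_0 = {u \<in> W12. \<exists>\<psi> :: nat \<Rightarrow> real \<Rightarrow> real.
      (\<forall>n. \<psi> n \<in> Cc_inf) \<and> (\<lambda>n. W12_norm (\<lambda>x. u x - \<psi> n x)) \<longlonglongrightarrow> 0}"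

text \<open>
  The Bochner space \<open>L\<^sup>2(0,T; W\<^sub>0\<^sup>1\<^sup>,\<^sup>2)\<close>. Its elements are written \<open>U t x\<close>; they are strongly
  measurable, i.e. almost everywhere limits in norm of \<open>W\<^sub>0\<^sup>1\<^sup>,\<^sup>2\<close>-valued simple functions.
\<close>

definition W12_0_simple :: "(real \<Rightarrow> real \<Rightarrow> real) \<Rightarrow> bool" where
  "W12_0_simple s \<longleftrightarrow>
     (\<exists>(k::nat) (A :: nat \<Rightarrow> real set) (g :: nat \<Rightarrow> real \<Rightarrow> real).
        (\<forall>i<k. A i \<in> sets lebesgue \<and> g i \<in> W12_0) \<and>
        (\<forall>t x. s t x = (\<Sum>i<k. indicator (A i) t * g i x)))"

definition L2_W12_0 :: "real \<Rightarrow> (real \<Rightarrow> real \<Rightarrow> real) set" where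
  "L2_W12_0 T = {U.
     (AE t in lebesgue_on {0<..<T}. U t \<in> W12_0) \<and>
     (\<exists>s :: nat \<Rightarrow> real \<Rightarrow> real \<Rightarrow> real. (\<forall>n. W12_0_simple (s n)) \<and>
        (AE t in lebesgue_on {0<..<T}. (\<lambda>n. W12_norm (\<lambda>x. U t x - s n t x)) \<longlonglongrightarrow> 0)) \<and>
     (\<integral>\<^sup>+ t. ennreal ((W12_norm (U t))\<^sup>2) \<partial>lebesgue_on {0<..<T}) < \<infinity>}"

section \<open>Weak solutions\<close>

definition \<D> :: "(real \<Rightarrow> real) \<Rightarrow> real \<Rightarrow> real" where
  "\<D> \<phi> s = (if s \<ge> 0 then \<phi> s else 0)"

text \<open>Points of the space-time strip are pairs \<open>(x, t)\<close>.\<close>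

definition strip :: "real \<Rightarrow> (real \<times> real) set" where
  "strip T = {0..} \<times> {0<..<T}"

text \<open>
  \<open>\<xi>x\<close> and \<open>\<xi>t\<close> are the partial derivatives of \<open>\<xi>\<close>, one-sided on the boundary of the closed domain.
\<close>

definition test_function ::
  "real \<Rightarrow> (real \<times> real \<Rightarrow> real) \<Rightarrow> (real \<times> real \<Rightarrow> real) \<Rightarrow> (real \<times> real \<Rightarrow> real) \<Rightarrow> bool" where
  "test_function T \<xi> \<xi>x \<xi>t \<longleftrightarrow>
     (\<forall>p \<in> {0..} \<times> {0..T}.
        (\<xi> has_derivative (\<lambda>(h, k). \<xi>x p * h + \<xi>t p * k)) (at p within {0..} \<times> {0..T})) \<and>
     continuous_on ({0..} \<times> {0..T}) \<xi>x \<and> continuous_on ({0..} \<times> {0..T}) \<xi>t \<and>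
     (\<forall>t \<in> {0<..<T}. \<xi> (0, t) = 0) \<and>
     (\<forall>x\<ge>0. \<xi> (x, T) = 0) \<and>
     (\<exists>J>0. closure {p \<in> {0..} \<times> {0..T}. \<xi> p \<noteq> 0} \<subseteq> {0..J} \<times> {0..T})"

text \<open>
  The function \<open>v\<close> is a jointly measurable representative of the weak derivative \<open>\<D>(w)\<^sub>x\<close>
  (unique up to null sets).
\<close>

definition weak_solution ::
  "(real \<Rightarrow> real) \<Rightarrow> real \<Rightarrow> real \<Rightarrow> (real \<Rightarrow> real) \<Rightarrow> (real \<times> real \<Rightarrow> real) \<Rightarrow> bool" where
  "weak_solution \<phi> T V\<^sub>0 w_hat w \<longleftrightarrow>
     w \<in> Linf_on (strip T) \<and>
     (\<lambda>t x. \<D> \<phi> (w (x, t)) - \<D> \<phi> (w_hat x)) \<in> L2_W12_0 T \<and>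
     (\<exists>v \<in> L2_on (strip T).
        (AE t in lebesgue_on {0<..<T}. has_weak_deriv (\<lambda>x. \<D> \<phi> (w (x, t))) (\<lambda>x. v (x, t))) \<and>
        (\<forall>\<xi> \<xi>x \<xi>t. test_function T \<xi> \<xi>x \<xi>t \<longrightarrow>
           (LINT x|lebesgue_on {0<..}. - V\<^sub>0 * \<xi> (x, 0)) + (LINT p|lebesgue_on (strip T). w p * \<xi>t p)
             = (LINT p|lebesgue_on (strip T). v p * \<xi>x p)))"

text \<open>The value of \<open>f\<close> at \<open>a\<close> is left unspecified.\<close>

definition self_similar_profile ::
  "(real \<Rightarrow> real) \<Rightarrow> real \<Rightarrow> real \<Rightarrow> real \<Rightarrow> (real \<Rightarrow> real) \<Rightarrow> bool" where
  "self_similar_profile \<phi> U\<^sub>0 V\<^sub>0 a f \<longleftrightarrow>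
     continuous_on {0..<a} f \<and> (\<forall>\<eta>\<in>{0..<a}. f \<eta> > 0) \<and> C2_on {0<..<a} f \<and>
     (\<forall>\<eta>\<in>{0<..<a}. - (1/2) * \<eta> * deriv f \<eta> = deriv (\<lambda>y. deriv \<phi> (f y) * deriv f y) \<eta>) \<and>
     (\<forall>\<eta>>a. f \<eta> = - V\<^sub>0) \<and>
     f 0 = U\<^sub>0 \<and>
     (f \<longlongrightarrow> 0) (at_left a) \<and>
     ((\<lambda>\<eta>. deriv \<phi> (f \<eta>) * deriv f \<eta>) \<longlongrightarrow> - (a * V\<^sub>0 / 2)) (at_left a)"

definition is_free_boundary :: "real \<Rightarrow> (real \<times> real \<Rightarrow> real) \<Rightarrow> (real \<Rightarrow> real) \<Rightarrow> bool" where
  "is_free_boundary T w \<beta> \<longleftrightarrow>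
     (AE (x, t) in lebesgue_on (strip T). (x < \<beta> t \<longrightarrow> w (x, t) > 0) \<and> (x > \<beta> t \<longrightarrow> w (x, t) < 0))"

end

theory Submission
  imports Defs
begin

text \<open>
  Existence: inverting the profile, the flux \<open>p(s) = - \<phi>'(f) f'\<close> as a function of \<open>s = f\<close> solves the regular
  two-point problem \<open>2 p p'' = - \<phi>'(s)\<close>, \<open>p(0) = V\<^sub>0 p'(0)\<close>, \<open>p'(U\<^sub>0) = 0\<close>, and \<open>\<eta> = 2 p'\<close>. After scaling out \<open>a\<close>
  it is solved by shooting in the coefficient of \<open>\<phi>'\<close>. The Rankine--Hugoniot condition at \<open>\<eta> = a\<close> says that
  \<open>2 F + \<eta> (f + V\<^sub>0)\<close>, with \<open>F = \<phi>'(f) f'\<close>, vanishes there; this function has derivative \<open>f + V\<^sub>0\<close>, which turns the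
  weak equation into the vanishing of a total time derivative.

  Uniqueness (Oleinik): for two solutions let \<open>W = w\<^sub>1 - w\<^sub>2\<close>, \<open>Z = \<D>(w\<^sub>1) - \<D>(w\<^sub>2)\<close>, \<open>v = Z\<^sub>x\<close>. Integrated in time, the
  equation reads \<open>W(t) = \<partial>\<^sub>x \<integral>\<^sub>0\<^sup>t v\<close> weakly in \<open>x\<close>. Testing with \<open>Z(t)\<close> times a cutoff and integrating over \<open>t\<close> gives
  \<open>\<integral>\<integral> W Z + (\<integral> (\<integral>\<^sub>0\<^sup>T v)\<^sup>2) / 2 = 0\<close>, where \<open>W Z \<ge> 0\<close>.
\<close>

subsection \<open>Smooth functions and bumps\<close>

text \<open>Because \<open>deriv \<phi> 0 = 0\<close>, the profile degenerates at the free boundary: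
  its slope is unbounded near \<open>a\<close> while its flux stays finite. With \<open>s\<close> as
  independent variable this point becomes \<open>s = 0\<close>, where the flux equation is regular
  since the flux is bounded below by a positive multiple of \<open>V\<^sub>0\<close>. Writing
  \<open>p = (a/2) q\<close> and \<open>m = 2 / a^2\<close> gives
  \<open>q'' = - m \<phi>' / q\<close> with \<open>q(0) = V\<^sub>0\<close> and
  \<open>q'(0) = 1\<close>, so the unknown \<open>a\<close> survives only in the parameter
  \<open>m\<close>.

  Two obstacles shape the uniqueness proof. \<open>Z(t)\<close> has no regularity in time and is
  inserted separately at almost every time; the exceptional null set depends on the test function,
  so only countably many test functions can be handled together. Moreover \<D> is constant on the
  negative half line, hence \<open>W Z = 0\<close> yields only \<open>Z = 0\<close>. Where both
  solutions are negative, \<open>W\<close> is recovered from the equation itself, in which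
  \<open>v = 0\<close> leaves \<open>W(t)\<close> orthogonal to every test function.\<close>

lemma smooth_on_UNIV:
  "smooth_on UNIV g \<longleftrightarrow> (\<exists>D. D 0 = g \<and> (\<forall>n x. (D n has_real_derivative D (Suc n) x) (at x)))"
  unfolding smooth_on_def by (auto simp: fun_eq_iff)

lemma smooth_onE:
  assumes "smooth_on UNIV g"
  obtains D where "D 0 = g" "\<And>n x. (D n has_real_derivative D (Suc n) x) (at x)"
  using assms unfolding smooth_on_UNIV by blast

lemma smooth_onI:
  assumes "D 0 = g" "\<And>n x. (D n has_real_derivative D (Suc n) x) (at x)"
  shows "smooth_on UNIV g"
  using assms unfolding smooth_on_UNIV by blast

lemma smooth_const: "smooth_on UNIV (\<lambda>x. c)"
proof -
  define D where "D = (\<lambda>n (x::real). if n = (0::nat) then c else 0)"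
  show ?thesis
  proof (rule smooth_onI)
  show "D 0 = (\<lambda>x. c)" by (simp add: D_def)
  show "(D n has_real_derivative D (Suc n) x) (at x)" for n x
    unfolding D_def by (cases n) (auto intro!: derivative_eq_intros)
  qed
qed

lemma smooth_add:
  assumes "smooth_on UNIV f" "smooth_on UNIV g"
  shows "smooth_on UNIV (\<lambda>x. f x + g x)"
proof -
  obtain D E where D: "D 0 = f" "\<And>n x. (D n has_real_derivative D (Suc n) x) (at x)"
    and E: "E 0 = g" "\<And>n x. (E n has_real_derivative E (Suc n) x) (at x)"
    using assms by (elim smooth_onE) blast
  show ?thesis
    by (rule smooth_onI[where D="\<lambda>n x. D n x + E n x"])
      (auto simp: D E intro!: derivative_eq_intros D(2) E(2))
qed

text \<open>Pascal's rule in the shape needed to differentiate the Leibniz sum of order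
  \<open>n\<close> term by term: the outcome is the sum of order \<open>n + 1\<close>, so the
  Leibniz sums form a derivative sequence for a product.\<close>

lemma leibniz_step:
  fixes a b :: "nat \<Rightarrow> real"
  shows "(\<Sum>k\<le>n. real (n choose k) * (a (Suc k) * b (n - k) + a k * b (Suc (n - k))))
     = (\<Sum>k\<le>Suc n. real (Suc n choose k) * (a k * b (Suc n - k)))"
proof -
  have "(\<Sum>k\<le>Suc n. real (Suc n choose k) * (a k * b (Suc n - k)))
      = a 0 * b (Suc n) + (\<Sum>k\<le>n. real (Suc n choose Suc k) * (a (Suc k) * b (n - k)))"
    by (subst sum.atMost_Suc_shift) simp
  also have "\<dots> = (\<Sum>k\<le>n. real (n choose k) * (a (Suc k) * b (n - k)))
       + (a 0 * b (Suc n) + (\<Sum>k\<le>n. real (n choose Suc k) * (a (Suc k) * b (n - k))))"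
    by (simp add: algebra_simps sum.distrib)
  also have "a 0 * b (Suc n) + (\<Sum>k\<le>n. real (n choose Suc k) * (a (Suc k) * b (n - k)))
      = (\<Sum>k\<le>Suc n. real (n choose k) * (a k * b (Suc n - k)))"
    by (subst sum.atMost_Suc_shift) simp
  also have "\<dots> = (\<Sum>k\<le>n. real (n choose k) * (a k * b (Suc (n - k))))"
    by (auto intro!: sum.cong simp: Suc_diff_le)
  finally show ?thesis by (simp add: algebra_simps sum.distrib)
qed

lemma smooth_mult:
  assumes "smooth_on UNIV f" "smooth_on UNIV g"
  shows "smooth_on UNIV (\<lambda>x. f x * g x)"
proof -
  obtain D E where D: "D 0 = f" "\<And>n x. (D n has_real_derivative D (Suc n) x) (at x)"
    and E: "E 0 = g" "\<And>n x. (E n has_real_derivative E (Suc n) x) (at x)"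
    using assms by (elim smooth_onE) blast
  define F where "F = (\<lambda>n x. \<Sum>k\<le>n. real (n choose k) * (D k x * E (n - k) x))"
  have "(F n has_real_derivative F (Suc n) x) (at x)" for n x
  proof -
    have "(F n has_real_derivative
        (\<Sum>k\<le>n. real (n choose k) * (D (Suc k) x * E (n - k) x + D k x * E (Suc (n - k)) x))) (at x)"
      unfolding F_def
      by (rule DERIV_sum, rule DERIV_cmult)
         (rule DERIV_cong[OF DERIV_mult[OF D(2) E(2)]], simp add: ac_simps)
    then show ?thesis unfolding F_def by (simp add: leibniz_step[of n "\<lambda>k. D k x" "\<lambda>k. E k x"])
  qed
  moreover have "F 0 = (\<lambda>x. f x * g x)" by (simp add: F_def D E)
  ultimately show ?thesis by (intro smooth_onI[where D=F])
qed

lemma smooth_affine: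
  assumes "smooth_on UNIV f"
  shows "smooth_on UNIV (\<lambda>x. f (c * x + d))"
proof -
  obtain D where D: "D 0 = f" "\<And>n x. (D n has_real_derivative D (Suc n) x) (at x)"
    using assms by (elim smooth_onE) blast
  show ?thesis
    by (rule smooth_onI[where D="\<lambda>n x. c ^ n * D n (c * x + d)"])
      (auto simp: D intro!: derivative_eq_intros DERIV_chain2[OF D(2)])
qed

lemma smooth_antideriv:
  assumes "smooth_on UNIV g" "\<And>x. (G has_real_derivative g x) (at x)"
  shows "smooth_on UNIV G"
proof -
  obtain D where D: "D 0 = g" "\<And>n x. (D n has_real_derivative D (Suc n) x) (at x)"
    using assms by (elim smooth_onE) blast
  show ?thesis
  proof (rule smooth_onI)
    show "((case n of 0 \<Rightarrow> G | Suc m \<Rightarrow> D m) has_real_derivative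
        (case Suc n of 0 \<Rightarrow> G | Suc m \<Rightarrow> D m) x) (at x)" for n x
      by (cases n) (auto simp: D assms)
  qed simp
qed

lemma smooth_deriv:
  assumes "smooth_on UNIV g"
  shows "smooth_on UNIV (deriv g)" "\<And>x. (g has_real_derivative deriv g x) (at x)"
proof -
  obtain D where D: "D 0 = g" "\<And>n x. (D n has_real_derivative D (Suc n) x) (at x)"
    using assms by (elim smooth_onE) blast
  have "deriv g x = D 1 x" for x
    using D(2)[of 0 x] D(1) by (auto intro: DERIV_imp_deriv)
  then have d: "deriv g = D 1" by auto
  show "\<And>x. (g has_real_derivative deriv g x) (at x)" using D(2)[of 0] by (simp add: d D(1))
  show "smooth_on UNIV (deriv g)"
    by (rule smooth_onI[where D="\<lambda>n. D (Suc n)"]) (auto simp: d D)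
qed

lemma smooth_continuous: "smooth_on UNIV g \<Longrightarrow> continuous_on A g"
  by (meson DERIV_continuous_on has_field_derivative_at_within smooth_deriv(2))

text \<open>Test functions are later manufactured from Weierstrass approximants, which therefore
  have to be smooth in the sense of \<open>smooth_on\<close>.\<close>

lemma smooth_real_polynomial: "real_polynomial_function p \<Longrightarrow> smooth_on UNIV (p :: real \<Rightarrow> real)"
proof (induction rule: real_polynomial_function.induct)
  case (linear h)
  then interpret bounded_linear h .
  have "h = (\<lambda>x. h 1 * x + 0)"
    using scale by (metis add.right_neutral mult.commute mult.right_neutral real_scaleR_def)
  moreover have "smooth_on UNIV (\<lambda>x::real. x)"
    by (rule smooth_antideriv[OF smooth_const[of 1]]) (rule DERIV_ident)
  ultimately show ?case using smooth_affine[of "\<lambda>x. x" "h 1" 0] by metis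
qed (auto intro: smooth_const smooth_add smooth_mult)

section \<open>Bump functions built from the flat function exp(-1/x)\<close>

definition expinv :: "real \<Rightarrow> real" where
  "expinv x = (if x > 0 then exp (- (1 / x)) else 0)"

lemma poly_exp_tendsto_0: "((\<lambda>y. poly p y * exp (- y)) \<longlongrightarrow> 0) (at_top :: real filter)"
proof -
  have "((\<lambda>y. y ^ k * exp (- y)) \<longlongrightarrow> 0) (at_top :: real filter)" for k
    using tendsto_power_div_exp_0[of k] by (simp add: exp_minus divide_inverse)
  then have "((\<lambda>y. \<Sum>i\<le>degree p. coeff p i * (y ^ i * exp (- y))) \<longlongrightarrow> (\<Sum>i\<le>degree p. coeff p i * 0)) (at_top :: real filter)"
    by (intro tendsto_sum tendsto_mult tendsto_const)
  then show ?thesis by (simp add: poly_altdef sum_distrib_right mult.assoc)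
qed

text \<open>On the positive axis the derivative of order \<open>n\<close> is \<open>P n\<close> at
  \<open>1/x\<close> times \<open>exp (- (1/x))\<close>. Differentiating once more replaces
  \<open>P\<close> by \<open>y^2 (P - P')\<close> in the variable \<open>y = 1/x\<close>, which is
  the recursion below; at 0 the exponential beats every polynomial.\<close>

lemma smooth_expinv: "smooth_on UNIV expinv"
proof -
  define P where "P = rec_nat 1 (\<lambda>_ p. [:0, 0, 1:] * (p - pderiv p) :: real poly)"
  have P: "P 0 = 1" "P (Suc n) = [:0,0,1:] * (P n - pderiv (P n))" for n by (simp_all add: P_def)
  define D where "D = (\<lambda>n x. if x > 0 then poly (P n) (1 / x) * exp (- (1 / x)) else 0)"
  have "(D n has_real_derivative D (Suc n) x) (at x)" for n and x :: real
  proof -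
    consider "x > 0" | "x < 0" | "x = 0" by linarith
    then show ?thesis
    proof cases
      case 1
      have "((\<lambda>x. poly (P n) (1 / x) * exp (- (1 / x))) has_real_derivative D (Suc n) x) (at x)"
        using 1 unfolding D_def P(2)
        by (auto intro!: derivative_eq_intros poly_DERIV[THEN DERIV_chain2]
            simp: field_simps power2_eq_square)
      moreover have "\<forall>\<^sub>F y in nhds x. D n y = poly (P n) (1 / y) * exp (- (1 / y))"
        using eventually_nhds_in_open[of "{0<..}" x] 1
        by (auto simp: D_def elim!: eventually_mono)
      ultimately show ?thesis by (subst DERIV_cong_ev[OF refl _ refl])
    next
      case 2
      have "\<forall>\<^sub>F y in nhds x. D n y = 0"
        using eventually_nhds_in_open[of "{..<0}" x] 2
        by (auto simp: D_def elim!: eventually_mono)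
      then have "(D n has_real_derivative 0) (at x)"
        by (subst DERIV_cong_ev[OF refl _ refl, where g="\<lambda>_. 0"]) auto
      then show ?thesis using 2 by (simp add: D_def)
    next
      case 3
      have 1: "((\<lambda>y. D n y / y) \<longlongrightarrow> 0) (at_right 0)"
      proof -
        \<comment> \<open>Dividing by \<open>y\<close> costs one more factor
          \<open>inverse y\<close>, that is, one multiplication of the polynomial by
          \<open>[:0,1:]\<close>.\<close>
        have "((\<lambda>y. poly ([:0,1:] * P n) (inverse y) * exp (- inverse y)) \<longlongrightarrow> 0) (at_right (0::real))"
          by (rule filterlim_compose[OF poly_exp_tendsto_0 filterlim_inverse_at_top_right])
        moreover have "\<forall>\<^sub>F y in at_right 0. poly ([:0,1:] * P n) (inverse y) * exp (- inverse y) = D n y / y"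
          unfolding eventually_at_right_field by (intro exI[of _ 1]) (auto simp: D_def field_simps)
        ultimately show ?thesis by (rule Lim_transform_eventually)
      qed
      have 2: "((\<lambda>y. D n y / y) \<longlongrightarrow> 0) (at_left 0)"
      proof -
        have "\<forall>\<^sub>F y in at_left 0. 0 = D n y / y"
          unfolding eventually_at_left_field by (intro exI[of _ "-1"]) (auto simp: D_def)
        from Lim_transform_eventually[OF tendsto_const this] show ?thesis .
      qed
      have "((\<lambda>y. D n y / y) \<longlongrightarrow> 0) (at 0)"
        using filterlim_split_at_real[OF 2 1] .
      then show ?thesis unfolding 3 has_field_derivative_iff by (simp add: D_def)
    qed
  qed
  moreover have "D 0 = expinv" by (auto simp: D_def expinv_def P(1))
  ultimately show ?thesis by (intro smooth_onI[where D=D])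
qed

lemma expinv_bounds: "0 \<le> expinv x" "expinv x \<le> 1"
  by (auto simp: expinv_def)

lemma expinv_pos: "x > 0 \<Longrightarrow> expinv x > 0"
  by (simp add: expinv_def)

lemma expinv_nonpos: "x \<le> 0 \<Longrightarrow> expinv x = 0"
  by (simp add: expinv_def)

text \<open>The factor \<open>real n\<close> steepens both flanks, so that the bumps tend to the
  indicator of the open interval. The arguments are multiplied out to affine form
  \<open>c * x + d\<close> in order to match \<open>smooth_affine\<close>.\<close>

definition bump :: "real \<Rightarrow> real \<Rightarrow> nat \<Rightarrow> real \<Rightarrow> real" where
  "bump p q n x = expinv (real n * x + (- real n * p)) * expinv (- real n * x + real n * q)"

lemma smooth_bump: "smooth_on UNIV (bump p q n)"
  using smooth_mult[OF smooth_affine[OF smooth_expinv] smooth_affine[OF smooth_expinv]]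
  unfolding bump_def[abs_def] .

lemma bump_bounds: "0 \<le> bump p q n x" "bump p q n x \<le> 1"
  unfolding bump_def using expinv_bounds by (auto intro: mult_le_one)

lemma bump_outside: "x \<le> p \<or> x \<ge> q \<Longrightarrow> bump p q n x = 0"
  using mult_left_mono[of x p "real n"] mult_left_mono[of q x "real n"]
  by (auto simp: bump_def expinv_nonpos)

lemma bump_tendsto:
  "(\<lambda>n. bump p q n x) \<longlonglongrightarrow> indicator {p<..<q} x"
proof (cases "p < x \<and> x < q")
  case True
  have *: "(\<lambda>n. expinv (real n * c)) \<longlonglongrightarrow> 1" if "c > 0" for c
  proof -
    have "(\<lambda>n. exp (- (1 / (real n * c)))) \<longlonglongrightarrow> exp (- 0)"
    proof (intro tendsto_intros)
      have "(\<lambda>n. inverse c * (1 / real n)) \<longlonglongrightarrow> inverse c * 0"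
        by (intro tendsto_mult tendsto_const lim_1_over_n)
      then show "(\<lambda>n. 1 / (real n * c)) \<longlonglongrightarrow> 0" by (simp add: field_simps)
    qed
    moreover have "\<forall>\<^sub>F n in sequentially. exp (- (1 / (real n * c))) = expinv (real n * c)"
      using eventually_gt_at_top[of 0] by eventually_elim (use that in \<open>simp add: expinv_def\<close>)
    ultimately show ?thesis by (simp add: Lim_transform_eventually)
  qed
  have "(\<lambda>n. expinv (real n * (x - p)) * expinv (real n * (q - x))) \<longlonglongrightarrow> 1 * 1"
    using True by (intro tendsto_mult *) auto
  then show ?thesis using True by (simp add: bump_def algebra_simps)
next
  case False
  then have "bump p q n x = 0" for n by (intro bump_outside) auto
  then show ?thesis using False by (auto simp: indicator_def)
qed

lemma bump_pos: "p < x \<Longrightarrow> x < q \<Longrightarrow> n > 0 \<Longrightarrow> bump p q n x > 0"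
  unfolding bump_def by (intro mult_pos_pos expinv_pos) (simp_all add: algebra_simps)

lemma Cc_infI:
  assumes "smooth_on UNIV \<zeta>" "0 < p" "\<And>x. x < p \<or> x > q \<Longrightarrow> \<zeta> x = 0"
  shows "\<zeta> \<in> Cc_inf"
proof -
  have "{x. \<zeta> x \<noteq> 0} \<subseteq> {p..q}" using assms(3) by force
  then have c: "closure {x. \<zeta> x \<noteq> 0} \<subseteq> {p..q}" by (simp add: closure_minimal)
  then have "compact (closure {x. \<zeta> x \<noteq> 0})"
    by (meson bounded_closed_interval bounded_subset closed_closure compact_eq_bounded_closed)
  then show ?thesis using c assms by (auto simp: Cc_inf_def)
qed

lemma bump_Cc_inf: "0 < p \<Longrightarrow> bump p q n \<in> Cc_inf"
  by (rule Cc_infI[of _ p q]) (auto intro: smooth_bump bump_outside)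

lemma Cc_infE:
  assumes "\<zeta> \<in> Cc_inf"
  obtains p q where "0 < p" "p < q" "\<And>x. x \<notin> {p..q} \<Longrightarrow> \<zeta> x = 0" "\<And>x. x \<notin> {p..q} \<Longrightarrow> deriv \<zeta> x = 0"
proof -
  let ?K = "closure {x. \<zeta> x \<noteq> 0}"
  have K: "compact ?K" "?K \<subseteq> {0<..}" using assms by (auto simp: Cc_inf_def)
  obtain p q where pq: "0 < p" "p < q" "?K \<subseteq> {p..q}"
  proof (cases "?K = {}")
    case True
    then show ?thesis using that[of 1 2] by auto
  next
    case False
    obtain s where s: "s \<in> ?K" "\<And>t. t \<in> ?K \<Longrightarrow> s \<le> t" using compact_attains_inf[OF K(1) False] by blast
    obtain u where u: "u \<in> ?K" "\<And>t. t \<in> ?K \<Longrightarrow> t \<le> u" using compact_attains_sup[OF K(1) False] by blast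
    \<comment> \<open>Widening the right end by 1 secures \<open>p < q\<close> without a discussion
      of supports that consist of one point.\<close>
    show ?thesis
      by (rule that[of s "u + 1"]) (use s u K(2) in force)+
  qed
  have z: "\<zeta> x = 0" if "x \<notin> {p..q}" for x
    using that pq(3) closure_subset[of "{x. \<zeta> x \<noteq> 0}"] by blast
  have "deriv \<zeta> x = 0" if "x \<notin> {p..q}" for x
  proof -
    have "open (- {p..q})" by (auto intro: open_Compl)
    then have "\<forall>\<^sub>F y in nhds x. \<zeta> y = 0"
      using eventually_nhds_in_open[of "- {p..q}" x] that
      by (auto elim!: eventually_mono intro: z)
    then have "(\<zeta> has_real_derivative 0) (at x)"
      by (subst DERIV_cong_ev[OF refl _ refl, where g="\<lambda>_. 0"]) auto
    then show ?thesis by (rule DERIV_imp_deriv)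
  qed
  with z pq show ?thesis using that by blast
qed

subsection \<open>The fundamental lemma and weak derivatives\<close>

lemma integrable_lebesgue_on_iff:
  fixes f :: "'a::euclidean_space \<Rightarrow> real"
  assumes "S \<in> sets lebesgue"
  shows "integrable (lebesgue_on S) f \<longleftrightarrow> integrable lebesgue (\<lambda>x. indicator S x * f x)"
  using assms by (subst integrable_restrict_space) auto

lemma integral_lebesgue_on_eq:
  fixes f :: "'a::euclidean_space \<Rightarrow> real"
  assumes "S \<in> sets lebesgue"
  shows "integral\<^sup>L (lebesgue_on S) f = integral\<^sup>L lebesgue (\<lambda>x. indicator S x * f x)"
  using assms by (subst integral_restrict_space) auto

lemma AE_lebesgue_on_iff:
  assumes "S \<in> sets lebesgue"
  shows "(AE x in lebesgue_on S. P x) \<longleftrightarrow> (AE x in lebesgue. x \<in> S \<longrightarrow> P x)"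
  using assms by (subst AE_restrict_space_iff) auto

text \<open>The positive and the negative part of \<open>g\<close> are densities of two measures
  that are finite and equal on all rays \<open>{x<..}\<close>. Rays determine such measures, and a
  density is unique almost everywhere.\<close>

lemma AE_zero_if_tail_integrals_zero:
  fixes g :: "real \<Rightarrow> real"
  assumes int: "integrable lborel g"
    and zero: "\<And>x. (LINT y|lborel. indicator {x<..} y * g y) = 0"
  shows "AE y in lborel. g y = 0"
proof -
  have [measurable]: "g \<in> borel_measurable lborel" using int by auto
  have intp: "integrable lborel (\<lambda>y. max (g y) 0)" "integrable lborel (\<lambda>y. max (- g y) 0)"
    using int by auto
  define M where "M = density lborel (\<lambda>y. ennreal (max (g y) 0))"
  define N where "N = density lborel (\<lambda>y. ennreal (max (- g y) 0))"
  have ind: "integrable lborel (\<lambda>y. indicator {x<..} y * h y)" if "integrable lborel h" for h :: "real \<Rightarrow> real" and x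
    using integrable_real_mult_indicator[of "{x<..}" lborel h] that by (simp add: mult.commute borel_open)
  have e: "emeasure (density lborel (\<lambda>y. ennreal (h y))) {x<..} = ennreal (LINT y|lborel. indicator {x<..} y * h y)"
    if "integrable lborel h" "\<And>y. h y \<ge> 0" for h :: "real \<Rightarrow> real" and x
  proof -
    have [measurable]: "h \<in> borel_measurable lborel" using that by auto
    have "emeasure (density lborel (\<lambda>y. ennreal (h y))) {x<..} = (\<integral>\<^sup>+ y. ennreal (indicator {x<..} y * h y) \<partial>lborel)"
      by (subst emeasure_density) (auto simp: indicator_def intro!: nn_integral_cong)
    also have "\<dots> = ennreal (LINT y|lborel. indicator {x<..} y * h y)"
      using that by (intro nn_integral_eq_integral ind) (auto simp: indicator_def)
    finally show ?thesis .
  qed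
  have "M = N"
  proof (rule measure_eqI_lessThan)
    fix x
    show "emeasure M {x<..} < \<infinity>" unfolding M_def by (subst e) (auto simp: intp)
    have "(LINT y|lborel. indicator {x<..} y * max (g y) 0) - (LINT y|lborel. indicator {x<..} y * max (- g y) 0)
        = (LINT y|lborel. indicator {x<..} y * max (g y) 0 - indicator {x<..} y * max (- g y) 0)"
      by (intro Bochner_Integration.integral_diff[symmetric] ind intp)
    also have "\<dots> = (LINT y|lborel. indicator {x<..} y * g y)"
      by (intro Bochner_Integration.integral_cong) (auto simp: max_def indicator_def)
    finally have "(LINT y|lborel. indicator {x<..} y * max (g y) 0) = (LINT y|lborel. indicator {x<..} y * max (- g y) 0)"
      using zero by simp
    then show "emeasure M {x<..} = emeasure N {x<..}"
      unfolding M_def N_def by (subst (1 2) e) (auto simp: intp)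
  qed (auto simp: M_def N_def)
  then have "AE y in lborel. ennreal (max (g y) 0) = ennreal (max (- g y) 0)"
    unfolding M_def N_def by (intro sigma_finite_measure.density_unique sigma_finite_lborel) auto
  then show ?thesis by eventually_elim (auto simp: max_def split: if_splits)
qed

lemma smooth_measurable:
  assumes "smooth_on UNIV g"
  shows "g \<in> borel_measurable borel" "g \<in> borel_measurable lebesgue"
proof -
  show *: "g \<in> borel_measurable borel"
    using smooth_continuous[OF assms] by (rule borel_measurable_continuous_onI)
  show "g \<in> borel_measurable lebesgue"
    using * by (simp add: measurable_completion)
qed

text \<open>Countability is the point: identities that hold for almost every time, with an
  exceptional set depending on the test function, hold for almost every time for all these functions
  simultaneously.\<close>

definition rat_bumps :: "(real \<Rightarrow> real) set" where
  "rat_bumps = {bump p q n | p q n. p \<in> \<rat> \<and> q \<in> \<rat> \<and> 0 < p}"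

lemma countable_rat_bumps: "countable rat_bumps"
proof -
  have "rat_bumps \<subseteq> (\<lambda>(p, q, n). bump p q n) ` (\<rat> \<times> \<rat> \<times> UNIV)"
    unfolding rat_bumps_def by force
  moreover have "countable ((\<rat> :: real set) \<times> (\<rat> :: real set) \<times> (UNIV :: nat set))"
    by (intro countable_SIGMA countable_rat) auto
  ultimately show ?thesis by (meson countable_image countable_subset)
qed

lemma rat_bumps_Cc_inf: "rat_bumps \<subseteq> Cc_inf"
  unfolding rat_bumps_def by (auto intro: bump_Cc_inf)

lemma rational_seq_down:
  fixes x :: real
  obtains r :: "nat \<Rightarrow> real" where "\<And>n. r n \<in> \<rat>" "\<And>n. x < r n" "r \<longlonglongrightarrow> x"
proof -
  have "\<exists>r\<in>\<rat>. x < r \<and> r < x + 1 / real (Suc n)" for n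
    using Rats_dense_in_real[of x "x + 1 / real (Suc n)"] by auto
  then obtain r where r: "\<And>n. r n \<in> \<rat>" "\<And>n. x < r n" "\<And>n. r n < x + 1 / real (Suc n)"
    by metis
  have "r \<longlonglongrightarrow> x"
  proof (rule tendsto_sandwich[OF _ _ tendsto_const])
    show "(\<lambda>n. x + 1 / real (Suc n)) \<longlonglongrightarrow> x"
      using tendsto_add[OF tendsto_const[of x] LIMSEQ_inverse_real_of_nat] by (simp add: field_simps)
  qed (use r in \<open>auto intro!: always_eventually less_imp_le\<close>)
  with r that show ?thesis by blast
qed

text \<open>Dominated convergence: the bumps tend to the indicator of the open interval and are
  bounded by that of the closed one.\<close>

lemma integral_interval_zero_if_bumps:
  fixes f :: "real \<Rightarrow> real"
  assumes int: "integrable lebesgue (\<lambda>x. indicator {p..q} x * f x)"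
    and zero: "\<And>n. (LINT x|lebesgue. f x * bump p q n x) = 0"
  shows "(LINT x|lebesgue. indicator {p<..<q} x * f x) = 0"
proof -
  have m: "(\<lambda>x. indicator {p..q} x * f x) \<in> borel_measurable lebesgue" using int by auto
  have eq: "f x * bump p q n x = (indicator {p..q} x * f x) * bump p q n x" for x n
    by (cases "x \<le> p \<or> q \<le> x") (auto simp: indicator_def bump_outside)
  have mb: "bump p q n \<in> borel_measurable lebesgue" for n
    using smooth_bump by (rule smooth_measurable)
  have "(\<lambda>n. LINT x|lebesgue. f x * bump p q n x) \<longlonglongrightarrow> (LINT x|lebesgue. indicator {p<..<q} x * f x)"
  proof (rule integral_dominated_convergence[where w="\<lambda>x. \<bar>indicator {p..q} x * f x\<bar>"])
    show "(\<lambda>x. f x * bump p q n x) \<in> borel_measurable lebesgue" for n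
      unfolding eq by (intro borel_measurable_times m mb)
    have "(\<lambda>x. indicator {p<..<q} x * f x) = (\<lambda>x. indicator {p<..<q} x * (indicator {p..q} x * f x))"
      by (auto simp: indicator_def)
    then show "(\<lambda>x. indicator {p<..<q} x * f x) \<in> borel_measurable lebesgue"
      using m by (auto intro!: borel_measurable_times borel_measurable_indicator)
    show "AE x in lebesgue. (\<lambda>n. f x * bump p q n x) \<longlonglongrightarrow> indicator {p<..<q} x * f x"
      by (intro AE_I2) (auto intro!: tendsto_eq_intros bump_tendsto simp: mult.commute)
    show "AE x in lebesgue. norm (f x * bump p q n x) \<le> \<bar>indicator {p..q} x * f x\<bar>" for n
      unfolding eq using bump_bounds[of p q n]
      by (intro AE_I2) (auto simp: abs_mult intro!: mult_left_le)
  qed (use int in auto)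
  then show ?thesis unfolding zero by (simp add: LIMSEQ_const_iff)
qed

text \<open>The fundamental lemma of the calculus of variations, with a countable family of test
  functions and integrability only away from 0. The bumps give vanishing integrals over rational
  intervals; these determine the tail integrals of \<open>f\<close> cut down to
  \<open>{p..q}\<close>, and the half line is exhausted by such intervals.\<close>

lemma AE_zero_if_rat_bumps:
  fixes f :: "real \<Rightarrow> real"
  assumes int: "\<And>p q. 0 < p \<Longrightarrow> integrable (lebesgue_on {p..q}) f"
    and zero: "\<And>\<zeta>. \<zeta> \<in> rat_bumps \<Longrightarrow> (LINT x|lebesgue_on {0<..}. f x * \<zeta> x) = 0"
  shows "AE x in lebesgue_on {0<..}. f x = 0"
proof -
  have int': "integrable lebesgue (\<lambda>x. indicator {p..q} x * f x)" if "0 < p" for p q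
    using int[OF that] by (subst (asm) integrable_lebesgue_on_iff) auto
  have z1: "(LINT x|lebesgue. indicator {p<..<q} x * f x) = 0" if "0 < p" "p \<in> \<rat>" "q \<in> \<rat>" for p q
  proof (rule integral_interval_zero_if_bumps[OF int'[OF \<open>0 < p\<close>]])
    fix n
    have "bump p q n \<in> rat_bumps" using that by (auto simp: rat_bumps_def)
    from zero[OF this] have "(LINT x|lebesgue. indicator {0<..} x * (f x * bump p q n x)) = 0"
      by (subst (asm) integral_lebesgue_on_eq) auto
    also have "(\<lambda>x. indicator {0<..} x * (f x * bump p q n x)) = (\<lambda>x. f x * bump p q n x)"
      using bump_outside[of _ p q n] \<open>0 < p\<close> by (auto simp: indicator_def fun_eq_iff not_less)
    finally show "(LINT x|lebesgue. f x * bump p q n x) = 0" .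
  qed
  \<comment> \<open>The left end becomes an arbitrary positive real by letting rationals decrease to
    it. The right end may stay rational, because it only serves to cut \<open>f\<close> off.\<close>
  have z2: "(LINT y|lebesgue. indicator {x<..<q} y * f y) = 0" if "0 < x" "q \<in> \<rat>" for x q
  proof -
    obtain r where r: "\<And>n. r n \<in> \<rat>" "\<And>n. x < r n" "r \<longlonglongrightarrow> x" using rational_seq_down by blast
    have sub: "(\<lambda>y. indicator {p<..<q} y * f y) = (\<lambda>y. indicator {p<..<q} y * (indicator {x..q} y * f y))"
      if "x \<le> p" for p using that by (auto simp: indicator_def)
    have m: "(\<lambda>y. indicator {p<..<q} y * f y) \<in> borel_measurable lebesgue" if "x \<le> p" for p
      unfolding sub[OF that] using int'[OF \<open>0 < x\<close>, of q]
      by (intro borel_measurable_times borel_measurable_indicator borel_measurable_integrable) auto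
    have "(\<lambda>n. LINT y|lebesgue. indicator {r n<..<q} y * f y) \<longlonglongrightarrow> (LINT y|lebesgue. indicator {x<..<q} y * f y)"
    proof (rule integral_dominated_convergence[where w="\<lambda>y. \<bar>indicator {x..q} y * f y\<bar>"])
      show "AE y in lebesgue. (\<lambda>n. indicator {r n<..<q} y * f y) \<longlonglongrightarrow> indicator {x<..<q} y * f y"
      proof (intro AE_I2)
        fix y
        show "(\<lambda>n. indicator {r n<..<q} y * f y) \<longlonglongrightarrow> indicator {x<..<q} y * f y"
        proof (cases "x < y")
          case True
          have "\<forall>\<^sub>F n in sequentially. r n < y" using order_tendstoD(2)[OF r(3) True] .
          then have "\<forall>\<^sub>F n in sequentially. indicator {r n<..<q} y * f y = indicator {x<..<q} y * f y"
            by eventually_elim (use True in \<open>auto simp: indicator_def\<close>)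
          then show ?thesis by (rule tendsto_eventually)
        next
          case False
          then have "indicator {r n<..<q} y * f y = indicator {x<..<q} y * f y" for n
            using r(2)[of n] by (auto simp: indicator_def)
          then show ?thesis by (simp only: tendsto_const)
        qed
      qed
      show "AE y in lebesgue. norm (indicator {r n<..<q} y * f y) \<le> \<bar>indicator {x..q} y * f y\<bar>" for n
        using r(2)[of n] by (intro AE_I2) (auto simp: indicator_def)
    qed (use int'[OF \<open>0 < x\<close>] m less_imp_le[OF r(2)] in auto)
    moreover have "(LINT y|lebesgue. indicator {r n<..<q} y * f y) = 0" for n
      using z1[of "r n" q] r that by (meson less_trans)
    ultimately show ?thesis by (simp add: LIMSEQ_const_iff)
  qed
  \<comment> \<open>The tail over \<open>{x<..}\<close> of \<open>f\<close> cut down to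
    \<open>{p..q}\<close> is, up to end points, the integral over the interval from
    \<open>max x p\<close> to \<open>q\<close>. A Borel representative \<open>g'\<close> is used
    because tails are compared under \<open>lborel\<close>.\<close>
  have z3: "AE y in lebesgue. indicator {p..q} y * f y = 0" if "0 < p" "q \<in> \<rat>" for p q
  proof -
    let ?g = "\<lambda>y. indicator {p..q} y * f y"
    obtain g' where g': "g' \<in> borel_measurable lborel" "AE x in lborel. ?g x = g' x"
      using completion_ex_borel_measurable_real[of ?g lborel] int'[OF \<open>0 < p\<close>, of q] by auto
    have ae: "AE x in lebesgue. ?g x = g' x" using g'(2) by (rule AE_completion)
    have g'm: "g' \<in> borel_measurable lebesgue" using g'(1) by (simp add: measurable_completion)
    have "integrable lebesgue g'"
      using int'[OF \<open>0 < p\<close>, of q] ae g'm by (subst integrable_cong_AE[symmetric, of ?g]) auto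
    then have ig: "integrable lborel g'" using g'(1) by (simp add: integrable_completion)
    have "AE y in lborel. g' y = 0"
    proof (rule AE_zero_if_tail_integrals_zero[OF ig])
      fix x
      have "(LINT y|lborel. indicator {x<..} y * g' y) = (LINT y|lebesgue. indicator {x<..} y * g' y)"
        using g'(1) by (intro integral_completion[symmetric]) auto
      also have "\<dots> = (LINT y|lebesgue. indicator {max x p<..<q} y * f y)"
      proof (rule integral_cong_AE)
        have "AE y in lebesgue. y \<noteq> p \<and> y \<noteq> q"
          unfolding AE_completion_iff using AE_lborel_singleton[of p] AE_lborel_singleton[of q] by auto
        with ae show "AE y in lebesgue. indicator {x<..} y * g' y = indicator {max x p<..<q} y * f y"
          by eventually_elim (auto simp: indicator_def)
        have "(\<lambda>y. indicator {max x p<..<q} y * f y) = (\<lambda>y. indicator {max x p<..<q} y * ?g y)"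
          by (auto simp: indicator_def)
        then show "(\<lambda>y. indicator {max x p<..<q} y * f y) \<in> borel_measurable lebesgue"
          by (simp only:) (intro borel_measurable_times borel_measurable_indicator
              borel_measurable_integrable[OF int'[OF \<open>0 < p\<close>]]; simp)
      qed (use g'm in \<open>auto intro!: borel_measurable_times borel_measurable_indicator\<close>)
      also have "\<dots> = 0" using z2[of "max x p" q] that by auto
      finally show "(LINT y|lborel. indicator {x<..} y * g' y) = 0" .
    qed
    then have "AE y in lebesgue. g' y = 0" by (rule AE_completion)
    with ae show ?thesis by eventually_elim auto
  qed
  have "AE y in lebesgue. \<forall>n. indicator {1 / real (Suc n)..real (Suc n)} y * f y = 0"
    unfolding AE_all_countable by (intro allI z3) auto
  then have "AE y in lebesgue. y \<in> {0<..} \<longrightarrow> f y = 0"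
  proof eventually_elim
    case (elim y)
    show ?case
    proof
      assume "y \<in> {0<..}"
      obtain n m where "1 / real (Suc n) < y" "y < real m"
        using \<open>y \<in> {0<..}\<close> reals_Archimedean2[of y] by (meson greaterThan_iff nat_approx_posE)
      then have "y \<in> {1 / real (Suc (n + m))..real (Suc (n + m))}"
        by (auto simp: field_simps) (smt (verit) \<open>y \<in> {0<..}\<close> greaterThan_iff mult_nonneg_nonneg of_nat_0_le_iff)
      then show "f y = 0" using elim[rule_format, of "n + m"] by (auto simp: indicator_def)
    qed
  qed
  then show ?thesis by (subst AE_lebesgue_on_iff) auto
qed

section \<open>Weak derivatives: integrability, uniqueness, linearity\<close>

lemma has_weak_deriv_integrable:
  assumes "has_weak_deriv u v" "0 < p"
  shows "integrable (lebesgue_on {p..q}) u" "integrable (lebesgue_on {p..q}) v"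
proof -
  have "compact {p..q}" "{p..q} \<subseteq> {0<..}" using assms by auto
  then show "integrable (lebesgue_on {p..q}) u" "integrable (lebesgue_on {p..q}) v"
    using assms(1) unfolding has_weak_deriv_def by blast+
qed

text \<open>Integrability is available only on intervals bounded away from 0, so measurability on
  the whole half line is obtained as a limit of restrictions to
  \<open>[1/(n+1), n+1]\<close>.\<close>

lemma measurable_if_locally_integrable:
  fixes u :: "real \<Rightarrow> real"
  assumes "\<And>p q. 0 < p \<Longrightarrow> integrable (lebesgue_on {p..q}) u"
  shows "u \<in> borel_measurable (lebesgue_on {0<..})"
proof -
  have "(\<lambda>x. if x \<in> {0<..} then u x else 0) \<in> borel_measurable lebesgue"
  proof (rule borel_measurable_LIMSEQ_real)
    fix n
    have "0 < 1 / real (Suc n)" by simp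
    from assms[OF this] have "integrable lebesgue (\<lambda>x. indicator {1 / real (Suc n)..real (Suc n)} x * u x)"
      by (simp add: integrable_lebesgue_on_iff)
    then show "(\<lambda>x. indicator {1 / real (Suc n)..real (Suc n)} x * u x) \<in> borel_measurable lebesgue" by auto
  next
    fix x :: real
    show "(\<lambda>n. indicator {1 / real (Suc n)..real (Suc n)} x * u x) \<longlonglongrightarrow> (if x \<in> {0<..} then u x else 0)"
    proof (cases "x > 0")
      case True
      have "\<forall>\<^sub>F n in sequentially. real n \<ge> max x (1 / x)"
        by (rule eventually_sequentiallyI[of "nat \<lceil>max x (1 / x)\<rceil>"]) linarith
      then have "\<forall>\<^sub>F n in sequentially. indicator {1 / real (Suc n)..real (Suc n)} x * u x = u x"
      proof eventually_elim
        case (elim n)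
        have "1 / x \<le> real (Suc n)" using elim by simp
        then have "1 / real (Suc n) \<le> x" using True by (simp add: field_simps)
        with elim show ?case by (auto simp: indicator_def)
      qed
      then show ?thesis using True by (simp add: tendsto_eventually)
    next
      case False
      have "\<not> 1 / real (Suc n) \<le> x" for n using False
        by (smt (verit) divide_pos_pos of_nat_0_less_iff zero_less_Suc)
      then show ?thesis using False by simp
    qed
  qed
  then show ?thesis by (rule borel_measurable_if_D)
qed

lemma integrable_times_Cc_inf:
  fixes f :: "real \<Rightarrow> real"
  assumes f: "\<And>p q. 0 < p \<Longrightarrow> integrable (lebesgue_on {p..q}) f" and z: "\<zeta> \<in> Cc_inf"
  shows "integrable (lebesgue_on {0<..}) (\<lambda>x. f x * \<zeta> x)"
    and "integrable (lebesgue_on {0<..}) (\<lambda>x. f x * deriv \<zeta> x)"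
proof -
  obtain p q where pq: "0 < p" "p < q" "\<And>x. x \<notin> {p..q} \<Longrightarrow> \<zeta> x = 0" "\<And>x. x \<notin> {p..q} \<Longrightarrow> deriv \<zeta> x = 0"
    using Cc_infE[OF z] by metis
  have s: "smooth_on UNIV \<zeta>" using z by (simp add: Cc_inf_def)
  have *: "integrable (lebesgue_on {0<..}) (\<lambda>x. f x * g x)"
    if g: "smooth_on UNIV g" and g0: "\<And>x. x \<notin> {p..q} \<Longrightarrow> g x = 0" for g
  proof -
    have "compact (g ` {p..q})" by (intro compact_continuous_image smooth_continuous g) auto
    then obtain B where B: "\<And>x. x \<in> {p..q} \<Longrightarrow> \<bar>g x\<bar> \<le> B"
      by (meson bounded_real compact_imp_bounded imageI)
    have i: "integrable lebesgue (\<lambda>x. indicator {p..q} x * f x)"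
      using f[OF pq(1), of q] by (simp add: integrable_lebesgue_on_iff)
    have "integrable lebesgue (\<lambda>x. (indicator {p..q} x * f x) * g x)"
    proof (rule Bochner_Integration.integrable_bound)
      show "integrable lebesgue (\<lambda>x. B * (indicator {p..q} x * f x))" using i by simp
      show "(\<lambda>x. indicator {p..q} x * f x * g x) \<in> borel_measurable lebesgue"
        by (rule borel_measurable_times[OF borel_measurable_integrable[OF i] smooth_measurable(2)[OF g]])
      show "AE x in lebesgue. norm (indicator {p..q} x * f x * g x) \<le> norm (B * (indicator {p..q} x * f x))"
      proof (intro AE_I2)
        fix x
        show "norm (indicator {p..q} x * f x * g x) \<le> norm (B * (indicator {p..q} x * f x))"
        proof (cases "x \<in> {p..q}")
          case True
          then have "\<bar>f x\<bar> * \<bar>g x\<bar> \<le> \<bar>f x\<bar> * \<bar>B\<bar>" using B[of x] by (intro mult_left_mono) auto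
          then show ?thesis using True by (simp add: abs_mult mult.commute)
        qed simp
      qed
    qed
    also have "(\<lambda>x. (indicator {p..q} x * f x) * g x) = (\<lambda>x. indicator {0<..} x * (f x * g x))"
      using g0 pq(1) by (auto simp: indicator_def fun_eq_iff)
    finally show ?thesis by (simp add: integrable_lebesgue_on_iff)
  qed
  show "integrable (lebesgue_on {0<..}) (\<lambda>x. f x * \<zeta> x)" using s pq(3) by (rule *)
  show "integrable (lebesgue_on {0<..}) (\<lambda>x. f x * deriv \<zeta> x)" using smooth_deriv(1)[OF s] pq(4) by (rule *)
qed

text \<open>The difference of the two derivatives is orthogonal to every test function. Letting
  \<open>u\<close> and \<open>u'\<close> differ on a null set is what later turns equality of
  \<D>(w) almost everywhere into equality of the fluxes.\<close>

lemma weak_deriv_unique: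
  assumes 1: "has_weak_deriv u v" and 2: "has_weak_deriv u' v'"
    and eq: "AE x in lebesgue_on {0<..}. u x = u' x"
  shows "AE x in lebesgue_on {0<..}. v x = v' x"
proof -
  note i1 = has_weak_deriv_integrable[OF 1] and i2 = has_weak_deriv_integrable[OF 2]
  have "AE x in lebesgue_on {0<..}. v x - v' x = 0"
  proof (rule AE_zero_if_rat_bumps)
    show "integrable (lebesgue_on {p..q}) (\<lambda>x. v x - v' x)" if "0 < p" for p q
      using i1[OF that, of q] i2[OF that, of q] by auto
    fix \<zeta> assume "\<zeta> \<in> rat_bumps"
    then have z: "\<zeta> \<in> Cc_inf" using rat_bumps_Cc_inf by auto
    have "(LINT x|lebesgue_on {0<..}. u x * deriv \<zeta> x) = (LINT x|lebesgue_on {0<..}. u' x * deriv \<zeta> x)"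
    proof (rule integral_cong_AE)
      show "(\<lambda>x. u x * deriv \<zeta> x) \<in> borel_measurable (lebesgue_on {0<..})"
        using integrable_times_Cc_inf(2)[OF i1(1) z] by auto
      show "(\<lambda>x. u' x * deriv \<zeta> x) \<in> borel_measurable (lebesgue_on {0<..})"
        using integrable_times_Cc_inf(2)[OF i2(1) z] by auto
      show "AE x in lebesgue_on {0<..}. u x * deriv \<zeta> x = u' x * deriv \<zeta> x"
        using eq by eventually_elim auto
    qed
    then have "(LINT x|lebesgue_on {0<..}. v x * \<zeta> x) = (LINT x|lebesgue_on {0<..}. v' x * \<zeta> x)"
      using 1 2 z unfolding has_weak_deriv_def by force
    then show "(LINT x|lebesgue_on {0<..}. (v x - v' x) * \<zeta> x) = 0"
      using integrable_times_Cc_inf(1)[OF i1(2) z] integrable_times_Cc_inf(1)[OF i2(2) z]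
      by (simp add: left_diff_distrib)
  qed
  then show ?thesis by eventually_elim auto
qed

lemma has_weak_deriv_weak_deriv: "has_weak_deriv u v \<Longrightarrow> has_weak_deriv u (weak_deriv u)"
  unfolding weak_deriv_def by (rule someI[where P="has_weak_deriv u"])

lemma weak_deriv_AE:
  assumes "has_weak_deriv u v"
  shows "AE x in lebesgue_on {0<..}. weak_deriv u x = v x"
  using weak_deriv_unique[OF has_weak_deriv_weak_deriv[OF assms] assms] by simp

lemma has_weak_deriv_measurable:
  assumes "has_weak_deriv u v"
  shows "u \<in> borel_measurable (lebesgue_on {0<..})" "v \<in> borel_measurable (lebesgue_on {0<..})"
  using has_weak_deriv_integrable[OF assms] by (auto intro: measurable_if_locally_integrable)

lemma has_weak_deriv_linear:
  assumes 1: "has_weak_deriv u v" and 2: "has_weak_deriv u' v'"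
  shows "has_weak_deriv (\<lambda>x. a * u x + b * u' x) (\<lambda>x. a * v x + b * v' x)"
  unfolding has_weak_deriv_def
proof (intro conjI allI impI ballI)
  fix K :: "real set" assume "compact K \<and> K \<subseteq> {0<..}"
  then have "integrable (lebesgue_on K) u" "integrable (lebesgue_on K) v"
    "integrable (lebesgue_on K) u'" "integrable (lebesgue_on K) v'"
    using 1 2 unfolding has_weak_deriv_def by blast+
  then show "integrable (lebesgue_on K) (\<lambda>x. a * u x + b * u' x)" "integrable (lebesgue_on K) (\<lambda>x. a * v x + b * v' x)"
    by auto
next
  fix \<zeta> assume z: "\<zeta> \<in> Cc_inf"
  note i1 = has_weak_deriv_integrable[OF 1] and i2 = has_weak_deriv_integrable[OF 2]
  note J = integrable_times_Cc_inf(2)[OF i1(1) z] integrable_times_Cc_inf(2)[OF i2(1) z]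
     integrable_times_Cc_inf(1)[OF i1(2) z] integrable_times_Cc_inf(1)[OF i2(2) z]
  have e: "(LINT x|lebesgue_on {0<..}. (a * f x + b * g x) * h x)
      = a * (LINT x|lebesgue_on {0<..}. f x * h x) + b * (LINT x|lebesgue_on {0<..}. g x * h x)"
    if "integrable (lebesgue_on {0<..}) (\<lambda>x. f x * h x)" "integrable (lebesgue_on {0<..}) (\<lambda>x. g x * h x)"
    for f g h :: "real \<Rightarrow> real"
  proof -
    have "(\<lambda>x. (a * f x + b * g x) * h x) = (\<lambda>x. a * (f x * h x) + b * (g x * h x))"
      by (auto simp: algebra_simps)
    then show ?thesis using that by simp
  qed
  have "(LINT x|lebesgue_on {0<..}. u x * deriv \<zeta> x) = - (LINT x|lebesgue_on {0<..}. v x * \<zeta> x)"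
    "(LINT x|lebesgue_on {0<..}. u' x * deriv \<zeta> x) = - (LINT x|lebesgue_on {0<..}. v' x * \<zeta> x)"
    using 1 2 z unfolding has_weak_deriv_def by blast+
  then show "(LINT x|lebesgue_on {0<..}. (a * u x + b * u' x) * deriv \<zeta> x)
      = - (LINT x|lebesgue_on {0<..}. (a * v x + b * v' x) * \<zeta> x)"
    by (simp add: e J)
qed

section \<open>Linear structure of the square integrable and Sobolev functions\<close>

lemma L2_onD:
  assumes "u \<in> L2_on S"
  shows "u \<in> borel_measurable (lebesgue_on S)" "integrable (lebesgue_on S) (\<lambda>x. (u x)\<^sup>2)"
  using assms by (auto simp: L2_on_def)

lemma abs_mult_le_squares: "\<bar>x * y\<bar> \<le> x\<^sup>2 + y\<^sup>2" for x y :: real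
proof -
  have "2 * \<bar>x\<bar> * \<bar>y\<bar> \<le> \<bar>x\<bar>\<^sup>2 + \<bar>y\<bar>\<^sup>2" by (rule sum_squares_bound)
  moreover have "0 \<le> \<bar>x\<bar> * \<bar>y\<bar>" by simp
  ultimately show ?thesis unfolding abs_mult power2_abs by linarith
qed

lemma L2_on_times:
  assumes "u \<in> L2_on S" "v \<in> L2_on S"
  shows "integrable (lebesgue_on S) (\<lambda>x. u x * v x)"
proof (rule Bochner_Integration.integrable_bound)
  show "integrable (lebesgue_on S) (\<lambda>x. (u x)\<^sup>2 + (v x)\<^sup>2)" using assms by (auto simp: L2_on_def)
  show "(\<lambda>x. u x * v x) \<in> borel_measurable (lebesgue_on S)" using assms by (auto simp: L2_on_def)
  show "AE x in lebesgue_on S. norm (u x * v x) \<le> norm ((u x)\<^sup>2 + (v x)\<^sup>2)"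
    using abs_mult_le_squares by (intro AE_I2) auto
qed

lemma L2_on_linear:
  assumes "u \<in> L2_on S" "v \<in> L2_on S"
  shows "(\<lambda>x. a * u x + b * v x) \<in> L2_on S"
proof -
  have "integrable (lebesgue_on S) (\<lambda>x. a\<^sup>2 * (u x)\<^sup>2 + b\<^sup>2 * (v x)\<^sup>2 + 2 * a * b * (u x * v x))"
    using L2_on_times[OF assms] assms by (auto simp: L2_on_def)
  also have "(\<lambda>x. a\<^sup>2 * (u x)\<^sup>2 + b\<^sup>2 * (v x)\<^sup>2 + 2 * a * b * (u x * v x)) = (\<lambda>x. (a * u x + b * v x)\<^sup>2)"
    by (auto simp: power2_eq_square algebra_simps)
  finally show ?thesis using assms by (auto simp: L2_on_def)
qed

lemma L2_on_cong_AE: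
  assumes "u \<in> L2_on S" "v \<in> borel_measurable (lebesgue_on S)" "AE x in lebesgue_on S. u x = v x"
  shows "v \<in> L2_on S"
proof -
  have "integrable (lebesgue_on S) (\<lambda>x. (u x)\<^sup>2) \<longleftrightarrow> integrable (lebesgue_on S) (\<lambda>x. (v x)\<^sup>2)"
    using assms(3) by (intro integrable_cong_AE) (use assms in \<open>auto simp: L2_on_def elim: eventually_mono\<close>)
  then show ?thesis using assms by (auto simp: L2_on_def)
qed

lemma W12I: "u \<in> L2_on {0<..} \<Longrightarrow> v \<in> L2_on {0<..} \<Longrightarrow> has_weak_deriv u v \<Longrightarrow> u \<in> W12"
  by (auto simp: W12_def)

lemma W12D:
  assumes "u \<in> W12"
  shows "u \<in> L2_on {0<..}" "has_weak_deriv u (weak_deriv u)" "weak_deriv u \<in> L2_on {0<..}"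
proof -
  obtain v where v: "v \<in> L2_on {0<..}" "has_weak_deriv u v" using assms by (auto simp: W12_def)
  show "u \<in> L2_on {0<..}" using assms by (simp add: W12_def)
  show w: "has_weak_deriv u (weak_deriv u)" using has_weak_deriv_weak_deriv[OF v(2)] .
  show "weak_deriv u \<in> L2_on {0<..}"
    by (rule L2_on_cong_AE[OF v(1) has_weak_deriv_measurable(2)[OF w]])
       (use weak_deriv_AE[OF v(2)] in \<open>auto elim: eventually_mono\<close>)
qed

lemma W12_norm_eq:
  assumes "has_weak_deriv u v"
  shows "W12_norm u = sqrt ((LINT x|lebesgue_on {0<..}. (u x)\<^sup>2) + (LINT x|lebesgue_on {0<..}. (v x)\<^sup>2))"
proof -
  have "(LINT x|lebesgue_on {0<..}. (weak_deriv u x)\<^sup>2) = (LINT x|lebesgue_on {0<..}. (v x)\<^sup>2)"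
    using weak_deriv_AE[OF assms] has_weak_deriv_measurable(2)[OF assms]
      has_weak_deriv_measurable(2)[OF has_weak_deriv_weak_deriv[OF assms]]
    by (intro integral_cong_AE) (auto elim: eventually_mono)
  then show ?thesis by (simp add: W12_norm_def)
qed

lemma W12_linear:
  assumes "u \<in> W12" "v \<in> W12"
  shows "(\<lambda>x. a * u x + b * v x) \<in> W12"
    and "AE x in lebesgue_on {0<..}. weak_deriv (\<lambda>x. a * u x + b * v x) x = a * weak_deriv u x + b * weak_deriv v x"
proof -
  have h: "has_weak_deriv (\<lambda>x. a * u x + b * v x) (\<lambda>x. a * weak_deriv u x + b * weak_deriv v x)"
    by (intro has_weak_deriv_linear W12D assms)
  show "(\<lambda>x. a * u x + b * v x) \<in> W12"
    by (rule W12I[OF _ _ h]) (intro L2_on_linear W12D assms)+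
  show "AE x in lebesgue_on {0<..}. weak_deriv (\<lambda>x. a * u x + b * v x) x = a * weak_deriv u x + b * weak_deriv v x"
    by (rule weak_deriv_AE[OF h])
qed

subsection \<open>Piecewise continuously differentiable functions\<close>

text \<open>The class that contains the explicit functions of the existence proof: their only kinks
  are at the free boundary or at the end of the transition zone of \<open>w_hat\<close>. The
  derivative \<open>v\<close> is carried along, so that norms can be computed without the chosen
  \<open>weak_deriv\<close>. At \<open>R\<close> itself \<open>v\<close> may be nonzero.\<close>

definition pw_C1 :: "real \<Rightarrow> real \<Rightarrow> (real \<Rightarrow> real) \<Rightarrow> (real \<Rightarrow> real) \<Rightarrow> bool" where
  "pw_C1 R M u v \<longleftrightarrow> R > 0 \<and> continuous_on {0..} u \<and> v \<in> borel_measurable borel \<and>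
     (\<forall>x. \<bar>v x\<bar> \<le> M) \<and> (\<forall>x>R. v x = 0) \<and> (\<forall>x\<ge>R. u x = 0) \<and>
     (\<exists>S. finite S \<and> (\<forall>x\<in>{0<..} - S. (u has_real_derivative v x) (at x)))"

lemma pw_C1_diff:
  assumes "pw_C1 R M u v" "pw_C1 R' M' u' v'"
  shows "pw_C1 (max R R') (M + M') (\<lambda>x. u x - u' x) (\<lambda>x. v x - v' x)"
proof -
  obtain S where S: "finite S" "\<forall>x\<in>{0<..} - S. (u has_real_derivative v x) (at x)"
    using assms(1) by (auto simp: pw_C1_def)
  obtain S' where S': "finite S'" "\<forall>x\<in>{0<..} - S'. (u' has_real_derivative v' x) (at x)"
    using assms(2) by (auto simp: pw_C1_def)
  have "\<bar>v x - v' x\<bar> \<le> M + M'" for x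
  proof -
    have "\<bar>v x\<bar> \<le> M" "\<bar>v' x\<bar> \<le> M'" using assms by (auto simp: pw_C1_def)
    then show ?thesis by linarith
  qed
  moreover have "\<exists>S. finite S \<and> (\<forall>x\<in>{0<..} - S. ((\<lambda>x. u x - u' x) has_real_derivative v x - v' x) (at x))"
    by (rule exI[of _ "S \<union> S'"]) (use S S' in \<open>auto intro!: derivative_intros\<close>)
  ultimately show ?thesis
    using assms unfolding pw_C1_def by (auto intro!: continuous_intros)
qed

lemma half_line_integral:
  fixes f :: "real \<Rightarrow> real"
  assumes z: "\<And>x. x > R \<Longrightarrow> f x = 0" and i: "integrable (lebesgue_on {0..R}) f"
  shows "integrable (lebesgue_on {0<..}) f"
    and "(LINT x|lebesgue_on {0<..}. f x) = (LINT x|lebesgue_on {0..R}. f x)"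
proof -
  have i': "integrable lebesgue (\<lambda>x. indicator {0..R} x * f x)" using i by (simp add: integrable_lebesgue_on_iff)
  have e: "indicator {0<..} x * f x = indicator {0<..} x * (indicator {0..R} x * f x)" for x
    using z[of x] by (auto simp: indicator_def)
  have "integrable lebesgue (\<lambda>x. indicator {0<..} x * (indicator {0..R} x * f x))"
    using integrable_real_mult_indicator[OF _ i', of "{0<..}"] by (simp add: mult.commute)
  then have i'': "integrable lebesgue (\<lambda>x. indicator {0<..} x * f x)" by (simp add: e)
  then show "integrable (lebesgue_on {0<..}) f" by (simp add: integrable_lebesgue_on_iff)
  have "AE x in lebesgue. x \<noteq> (0::real)"
    by (rule AE_completion) (rule AE_lborel_singleton)
  then have "(LINT x|lebesgue. indicator {0<..} x * f x) = (LINT x|lebesgue. indicator {0..R} x * f x)"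
    by (intro integral_cong_AE) (use i' i'' z in \<open>auto simp: indicator_def elim!: eventually_mono\<close>)
  then show "(LINT x|lebesgue_on {0<..}. f x) = (LINT x|lebesgue_on {0..R}. f x)"
    by (simp add: integral_lebesgue_on_eq)
qed

lemma bounded_integrable_Icc:
  fixes f :: "real \<Rightarrow> real"
  assumes "f \<in> borel_measurable (lebesgue_on {a..b})" "\<And>x. x \<in> {a..b} \<Longrightarrow> \<bar>f x\<bar> \<le> B"
  shows "integrable (lebesgue_on {a..b}) f"
proof -
  interpret finite_measure "lebesgue_on {a..b}" by (rule finite_measure_lebesgue_on) auto
  show ?thesis by (rule integrable_const_bound[where B=B]) (use assms in \<open>auto intro: AE_I2\<close>)
qed

lemma borel_measurable_Icc:
  fixes f :: "real \<Rightarrow> real"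
  shows "f \<in> borel_measurable borel \<Longrightarrow> f \<in> borel_measurable (lebesgue_on S)"
  by (simp add: measurable_completion measurable_restrict_space1)

lemma continuous_measurable_Icc:
  fixes f :: "real \<Rightarrow> real"
  shows "continuous_on S f \<Longrightarrow> S \<in> sets lebesgue \<Longrightarrow> f \<in> borel_measurable (lebesgue_on S)"
  by (rule continuous_imp_measurable_on_sets_lebesgue)

lemma pw_C1_measurable:
  assumes "pw_C1 R M u v" "S \<in> sets lebesgue" "S \<subseteq> {0..}"
  shows "u \<in> borel_measurable (lebesgue_on S)" "v \<in> borel_measurable (lebesgue_on S)"
proof -
  have "continuous_on S u" "v \<in> borel_measurable borel"
    using assms by (auto simp: pw_C1_def intro: continuous_on_subset)
  then show "u \<in> borel_measurable (lebesgue_on S)" "v \<in> borel_measurable (lebesgue_on S)"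
    using assms(2) by (simp_all add: continuous_measurable_Icc borel_measurable_Icc)
qed

lemma continuous_bounded_Icc:
  fixes f :: "real \<Rightarrow> real"
  assumes "continuous_on {a..b} f"
  obtains C where "C > 0" "\<And>x. x \<in> {a..b} \<Longrightarrow> \<bar>f x\<bar> \<le> C"
proof -
  have "compact (f ` {a..b})" using assms by (intro compact_continuous_image) auto
  then show ?thesis using that compact_imp_bounded bounded_pos by (metis imageI real_norm_def)
qed

lemma pw_C1_bound:
  assumes "pw_C1 R M u v"
  obtains B where "B > 0" "\<And>x. x \<ge> 0 \<Longrightarrow> \<bar>u x\<bar> \<le> B"
proof -
  have "continuous_on {0..R} u" using assms by (auto simp: pw_C1_def intro: continuous_on_subset)
  then obtain B where B: "B > 0" "\<And>x. x \<in> {0..R} \<Longrightarrow> \<bar>u x\<bar> \<le> B"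
    by (rule continuous_bounded_Icc) blast
  show ?thesis
  proof (rule that[OF B(1)])
    fix x :: real assume "x \<ge> 0"
    then show "\<bar>u x\<bar> \<le> B" using B(1) B(2)[of x] assms by (cases "x \<le> R") (auto simp: pw_C1_def)
  qed
qed

lemma pw_C1_L2:
  assumes "pw_C1 R M u v"
  shows "u \<in> L2_on {0<..}" "v \<in> L2_on {0<..}"
proof -
  obtain B where B: "B > 0" "\<And>x. x \<ge> 0 \<Longrightarrow> \<bar>u x\<bar> \<le> B" using pw_C1_bound[OF assms] by blast
  have m: "u \<in> borel_measurable (lebesgue_on S)" "v \<in> borel_measurable (lebesgue_on S)" if "S \<in> sets lebesgue" "S \<subseteq> {0..}" for S
    using pw_C1_measurable[OF assms that] .
  have "integrable (lebesgue_on {0..R}) (\<lambda>x. (u x)\<^sup>2)"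
  proof (rule bounded_integrable_Icc[where B="B\<^sup>2"])
    show "\<bar>(u x)\<^sup>2\<bar> \<le> B\<^sup>2" if "x \<in> {0..R}" for x
      using power_mono[OF B(2), of x 2] that by simp
  qed (simp add: m borel_measurable_power)
  then have "integrable (lebesgue_on {0<..}) (\<lambda>x. (u x)\<^sup>2)"
    by (rule half_line_integral(1)[rotated]) (use assms in \<open>simp add: pw_C1_def\<close>)
  then show "u \<in> L2_on {0<..}" using m[of "{0<..}"] by (simp add: L2_on_def greaterThan_def Collect_mono_iff subset_eq)
  have "integrable (lebesgue_on {0..R}) (\<lambda>x. (v x)\<^sup>2)"
  proof (rule bounded_integrable_Icc[where B="M\<^sup>2"])
    show "\<bar>(v x)\<^sup>2\<bar> \<le> M\<^sup>2" if "x \<in> {0..R}" for x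
    proof -
      have "\<bar>v x\<bar> \<le> M" using assms by (simp add: pw_C1_def)
      then show ?thesis using power_mono[of "\<bar>v x\<bar>" M 2] by simp
    qed
  qed (simp add: m borel_measurable_power)
  then have "integrable (lebesgue_on {0<..}) (\<lambda>x. (v x)\<^sup>2)"
    by (rule half_line_integral(1)[rotated]) (use assms in \<open>simp add: pw_C1_def\<close>)
  then show "v \<in> L2_on {0<..}" using m[of "{0<..}"] by (simp add: L2_on_def greaterThan_def Collect_mono_iff subset_eq)
qed

lemma pw_C1_FTC:
  assumes "pw_C1 R M u v" "0 \<le> a" "a \<le> b"
  shows "integrable (lebesgue_on {a..b}) v" "(LINT x|lebesgue_on {a..b}. v x) = u b - u a"
proof -
  show i: "integrable (lebesgue_on {a..b}) v"
    using assms by (intro bounded_integrable_Icc[where B=M] borel_measurable_Icc) (auto simp: pw_C1_def)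
  obtain S where S: "finite S" "\<forall>x\<in>{0<..} - S. (u has_real_derivative v x) (at x)"
    using assms(1) by (auto simp: pw_C1_def)
  have "(v has_integral (u b - u a)) {a..b}"
    using assms(1,2) S(2)
    by (intro fundamental_theorem_of_calculus_interior_strong[OF S(1) assms(3)])
       (auto simp: pw_C1_def has_real_derivative_iff_has_vector_derivative[symmetric] intro: continuous_on_subset)
  moreover have "(v has_integral (LINT x|lebesgue_on {a..b}. v x)) {a..b}"
    using i by (rule has_integral_integral_lebesgue_on) simp
  ultimately show "(LINT x|lebesgue_on {a..b}. v x) = u b - u a"
    by (rule has_integral_unique[symmetric])
qed

lemma pw_C1_has_weak_deriv:
  assumes "pw_C1 R M u v"
  shows "has_weak_deriv u v"
  unfolding has_weak_deriv_def
proof (intro conjI allI impI ballI)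
  obtain B where B: "B > 0" "\<And>x. x \<ge> 0 \<Longrightarrow> \<bar>u x\<bar> \<le> B" using pw_C1_bound[OF assms] by blast
  have m: "u \<in> borel_measurable (lebesgue_on S)" "v \<in> borel_measurable (lebesgue_on S)" if "S \<in> sets lebesgue" "S \<subseteq> {0..}" for S
    using pw_C1_measurable[OF assms that] .
  {
    fix K :: "real set" assume K: "compact K \<and> K \<subseteq> {0<..}"
    then have l: "K \<in> lmeasurable" by (simp add: lmeasurable_compact)
    interpret finite_measure "lebesgue_on K" using l by (rule finite_measure_lebesgue_on)
    show "integrable (lebesgue_on K) u"
      by (rule integrable_const_bound[where B=B]) (use K l B m(1)[of K] in \<open>auto simp: subset_iff fmeasurableD less_imp_le intro!: AE_I2\<close>)
    show "integrable (lebesgue_on K) v"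
      by (rule integrable_const_bound[where B=M]) (use K l assms m(2)[of K] in \<open>auto simp: pw_C1_def subset_iff fmeasurableD less_imp_le intro!: AE_I2\<close>)
  }
  fix \<zeta> assume z: "\<zeta> \<in> Cc_inf"
  obtain p q where pq: "0 < p" "p < q" "\<And>x. x \<notin> {p..q} \<Longrightarrow> \<zeta> x = 0" "\<And>x. x \<notin> {p..q} \<Longrightarrow> deriv \<zeta> x = 0"
    using Cc_infE[OF z] by metis
  have s: "smooth_on UNIV \<zeta>" using z by (simp add: Cc_inf_def)
  obtain S where S: "finite S" "\<forall>x\<in>{0<..} - S. (u has_real_derivative v x) (at x)"
    using assms by (auto simp: pw_C1_def)
  obtain C where C: "\<And>x. x \<in> {0..q+1} \<Longrightarrow> \<bar>\<zeta> x\<bar> \<le> C"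
    using continuous_bounded_Icc[OF smooth_continuous[OF s, of "{0..q+1}"]] by blast
  obtain C' where C': "\<And>x. x \<in> {0..q+1} \<Longrightarrow> \<bar>deriv \<zeta> x\<bar> \<le> C'"
    using continuous_bounded_Icc[OF smooth_continuous[OF smooth_deriv(1)[OF s], of "{0..q+1}"]] by blast
  have i1: "integrable (lebesgue_on {0..q+1}) (\<lambda>x. u x * deriv \<zeta> x)"
    by (rule bounded_integrable_Icc[where B="B * C'"],
        rule borel_measurable_times[OF m(1) borel_measurable_Icc[OF smooth_measurable(1)[OF smooth_deriv(1)[OF s]]]])
       (use B C' in \<open>auto simp: abs_mult intro!: mult_mono intro: less_imp_le\<close>)
  have i2: "integrable (lebesgue_on {0..q+1}) (\<lambda>x. v x * \<zeta> x)"
    by (rule bounded_integrable_Icc[where B="M * C"],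
        rule borel_measurable_times[OF m(2) borel_measurable_Icc[OF smooth_measurable(1)[OF s]]])
       (use C assms in \<open>auto simp: abs_mult pw_C1_def intro!: mult_mono intro: order_trans[OF abs_ge_zero]\<close>)
  \<comment> \<open>Integration by parts on an interval that exceeds the support of \<zeta> at both
    ends, so both boundary terms vanish.\<close>
  have "((\<lambda>x. v x * \<zeta> x + u x * deriv \<zeta> x) has_integral (u (q+1) * \<zeta> (q+1) - u 0 * \<zeta> 0)) {0..q+1}"
    using assms S(2) pq
    by (intro fundamental_theorem_of_calculus_interior_strong[OF S(1)])
       (auto simp: pw_C1_def has_real_derivative_iff_has_vector_derivative[symmetric] mult.commute add.commute
         intro!: derivative_eq_intros smooth_deriv(2)[OF s] continuous_intros smooth_continuous[OF s]
         intro: continuous_on_subset)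
  moreover have "((\<lambda>x. v x * \<zeta> x + u x * deriv \<zeta> x) has_integral
      ((LINT x|lebesgue_on {0..q+1}. v x * \<zeta> x) + (LINT x|lebesgue_on {0..q+1}. u x * deriv \<zeta> x))) {0..q+1}"
    by (intro has_integral_add has_integral_integral_lebesgue_on i1 i2) auto
  ultimately have "(LINT x|lebesgue_on {0..q+1}. v x * \<zeta> x) + (LINT x|lebesgue_on {0..q+1}. u x * deriv \<zeta> x)
      = u (q+1) * \<zeta> (q+1) - u 0 * \<zeta> 0" by (rule has_integral_unique[symmetric])
  also have "\<dots> = 0" using pq by auto
  finally show "(LINT x|lebesgue_on {0<..}. u x * deriv \<zeta> x) = - (LINT x|lebesgue_on {0<..}. v x * \<zeta> x)"
    using half_line_integral(2)[OF _ i1] half_line_integral(2)[OF _ i2] pq by auto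
qed

lemma pw_C1_W12: "pw_C1 R M u v \<Longrightarrow> u \<in> W12"
  using pw_C1_L2 pw_C1_has_weak_deriv by (blast intro: W12I)

section \<open>Approximation by test functions of functions vanishing at the origin\<close>

lemma Cc_inf_pw_C1:
  assumes "\<psi> \<in> Cc_inf"
  obtains R M where "pw_C1 R M \<psi> (deriv \<psi>)"
proof -
  obtain p q where pq: "0 < p" "p < q" "\<And>x. x \<notin> {p..q} \<Longrightarrow> \<psi> x = 0" "\<And>x. x \<notin> {p..q} \<Longrightarrow> deriv \<psi> x = 0"
    using Cc_infE[OF assms] by metis
  have s: "smooth_on UNIV \<psi>" using assms by (simp add: Cc_inf_def)
  obtain C where C: "\<And>x. x \<in> {p..q} \<Longrightarrow> \<bar>deriv \<psi> x\<bar> \<le> C"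
    using continuous_bounded_Icc[OF smooth_continuous[OF smooth_deriv(1)[OF s], of "{p..q}"]] by blast
  have "\<bar>deriv \<psi> x\<bar> \<le> max C 0" for x using C[of x] pq(4)[of x] by (cases "x \<in> {p..q}") auto
  then have "pw_C1 (q + 1) (max C 0) \<psi> (deriv \<psi>)"
    unfolding pw_C1_def using pq s
    by (auto intro: smooth_continuous smooth_measurable(1)[OF smooth_deriv(1)] smooth_deriv(2) intro!: exI[of _ "{}"])
  then show ?thesis using that by blast
qed

lemma Cc_inf_W12:
  assumes "\<psi> \<in> Cc_inf"
  shows "\<psi> \<in> W12" "has_weak_deriv \<psi> (deriv \<psi>)"
proof -
  obtain R M where "pw_C1 R M \<psi> (deriv \<psi>)" using Cc_inf_pw_C1[OF assms] .
  then show "\<psi> \<in> W12" "has_weak_deriv \<psi> (deriv \<psi>)" by (rule pw_C1_W12 pw_C1_has_weak_deriv)+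
qed

text \<open>In contrast to \<open>bump\<close> the left end \<open>1/(n+1)\<close> of the support
  moves to 0: each cutoff vanishes near the origin, yet the limit is 1 on all of the open interval
  from 0 to \<open>R\<close>.\<close>

definition cutoff :: "real \<Rightarrow> nat \<Rightarrow> real \<Rightarrow> real" where
  "cutoff R n x = expinv (real (Suc n) * x + (- 1)) * expinv (- real (Suc n) * x + real (Suc n) * R)"

lemma smooth_cutoff: "smooth_on UNIV (cutoff R n)"
  using smooth_mult[OF smooth_affine[OF smooth_expinv] smooth_affine[OF smooth_expinv]]
  unfolding cutoff_def[abs_def] .

lemma cutoff_bounds: "0 \<le> cutoff R n x" "cutoff R n x \<le> 1"
  unfolding cutoff_def using expinv_bounds by (auto intro: mult_le_one)

lemma cutoff_outside: "x \<le> 1 / real (Suc n) \<or> x \<ge> R \<Longrightarrow> cutoff R n x = 0"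
  using mult_left_mono[of x "1 / real (Suc n)" "real (Suc n)"] mult_left_mono[of R x "real (Suc n)"]
  by (auto simp: cutoff_def expinv_nonpos simp del: of_nat_Suc)

lemma cutoff_tendsto:
  assumes "0 < x" "x < R"
  shows "(\<lambda>n. cutoff R n x) \<longlonglongrightarrow> 1"
proof -
  have *: "(\<lambda>n. expinv (real (Suc n) * c - d)) \<longlonglongrightarrow> 1" if "c > 0" for c d :: real
  proof -
    have "filterlim (\<lambda>n. real n) at_top sequentially" by (rule filterlim_real_sequentially)
    then have "filterlim (\<lambda>n. real (Suc n)) at_top sequentially" by (rule filterlim_compose[OF _ filterlim_Suc])
    then have "filterlim (\<lambda>n. - d + c * real (Suc n)) at_top sequentially"
      by (intro filterlim_tendsto_add_at_top[OF tendsto_const] filterlim_tendsto_pos_mult_at_top[OF tendsto_const that])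
    then have lim: "filterlim (\<lambda>n. real (Suc n) * c - d) at_top sequentially" by (simp add: mult.commute)
    have "(\<lambda>n. exp (- (1 / (real (Suc n) * c - d)))) \<longlonglongrightarrow> exp (- 0)"
      by (intro tendsto_exp tendsto_minus tendsto_divide_0[OF tendsto_const] filterlim_at_top_imp_at_infinity lim)
    moreover have "\<forall>\<^sub>F n in sequentially. exp (- (1 / (real (Suc n) * c - d))) = expinv (real (Suc n) * c - d)"
      using filterlim_at_top_dense[THEN iffD1, rule_format, OF lim, of 0]
      by eventually_elim (simp add: expinv_def)
    ultimately show ?thesis by (simp add: Lim_transform_eventually)
  qed
  have "(\<lambda>n. expinv (real (Suc n) * x - 1) * expinv (real (Suc n) * (R - x) - 0)) \<longlonglongrightarrow> 1 * 1"
    using assms by (intro tendsto_mult *) auto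
  then show ?thesis by (simp add: cutoff_def algebra_simps)
qed

text \<open>A measurable function is an almost everywhere limit of continuous ones; truncating these
  at \<open>M\<close> preserves the limit. Weierstrass approximation within \<open>1/(n+1)\<close>
  costs at most 1, whence the bound \<open>M + 1\<close>.\<close>

lemma bounded_measurable_approx_polynomials:
  fixes v :: "real \<Rightarrow> real"
  assumes "v \<in> borel_measurable borel" "\<And>x. \<bar>v x\<bar> \<le> M"
  obtains p where "\<And>n. real_polynomial_function (p n)" "\<And>n x. x \<in> {0..R} \<Longrightarrow> \<bar>p n x\<bar> \<le> M + 1"
    "AE x in lebesgue. x \<in> {0..R} \<longrightarrow> (\<lambda>n. p n x) \<longlonglongrightarrow> v x"
proof -
  have "v \<in> borel_measurable lebesgue" using assms(1) by (simp add: measurable_completion)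
  then have "v measurable_on UNIV" by (intro lebesgue_measurable_imp_measurable_on) auto
  then obtain N G where N: "negligible N" and G: "\<And>n. continuous_on UNIV (G n :: real \<Rightarrow> real)"
    and lim: "\<And>x. x \<notin> N \<Longrightarrow> (\<lambda>n. G n x) \<longlonglongrightarrow> v x"
    unfolding measurable_on_def by auto
  define H where "H = (\<lambda>n x. max (- M) (min M (G n x)))"
  have "\<exists>q. real_polynomial_function q \<and> (\<forall>x\<in>{0..R}. \<bar>H n x - q x\<bar> < 1 / real (Suc n))" for n
  proof (rule Stone_Weierstrass_real_polynomial_function)
    show "continuous_on {0..R} (H n)" unfolding H_def
      by (intro continuous_intros continuous_on_subset[OF G]) auto
    show "compact {0..R}" by simp
    show "(0::real) < 1 / real (Suc n)" by simp
  qed auto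
  then obtain p where p: "\<And>n. real_polynomial_function (p n)"
      "\<And>n x. x \<in> {0..R} \<Longrightarrow> \<bar>H n x - p n x\<bar> < 1 / real (Suc n)" by metis
  have M: "M \<ge> 0" using assms(2)[of 0] by linarith
  show ?thesis
  proof (rule that[OF p(1)])
    fix n x assume x: "x \<in> {0..R}"
    have "\<bar>H n x\<bar> \<le> M" using M by (auto simp: H_def)
    moreover have "1 / real (Suc n) \<le> 1" by simp
    ultimately show "\<bar>p n x\<bar> \<le> M + 1" using p(2)[OF x, of n] by linarith
  next
    have "AE x in lebesgue. x \<notin> N"
      using N by (intro AE_not_in) (simp add: negligible_iff_null_sets)
    then show "AE x in lebesgue. x \<in> {0..R} \<longrightarrow> (\<lambda>n. p n x) \<longlonglongrightarrow> v x"
    proof eventually_elim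
      case (elim x)
      show ?case
      proof
        assume x: "x \<in> {0..R}"
        have "(\<lambda>n. H n x) \<longlonglongrightarrow> max (- M) (min M (v x))"
          unfolding H_def by (intro tendsto_intros lim elim)
        moreover have "max (- M) (min M (v x)) = v x" using assms(2)[of x] by (auto simp: max_def min_def)
        ultimately have H: "(\<lambda>n. H n x) \<longlonglongrightarrow> v x" by simp
        have "(\<lambda>n. H n x - p n x) \<longlonglongrightarrow> 0"
        proof (rule Lim_null_comparison)
          show "\<forall>\<^sub>F n in sequentially. norm (H n x - p n x) \<le> 1 / real (Suc n)"
            by (intro always_eventually allI) (use less_imp_le[OF p(2)[OF x]] in \<open>simp del: of_nat_Suc\<close>)
          show "(\<lambda>n. 1 / real (Suc n)) \<longlonglongrightarrow> 0" using LIMSEQ_inverse_real_of_nat by (simp add: inverse_eq_divide)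
        qed
        from tendsto_diff[OF H this] show "(\<lambda>n. p n x) \<longlonglongrightarrow> v x" by simp
      qed
    qed
  qed
qed

text \<open>The primitive vanishes near 0 because \<open>g\<close> does, and beyond \<open>R\<close>
  because \<open>g\<close> has integral zero; hence it is again compactly supported.\<close>

lemma Cc_inf_antiderivative:
  assumes s: "smooth_on UNIV g" and p: "0 < p" and z: "\<And>x. x \<le> p \<or> x \<ge> R \<Longrightarrow> g x = 0"
    and R: "p \<le> R" and int: "(LINT x|lebesgue_on {0..R}. g x) = 0"
  obtains \<psi> where "\<psi> \<in> Cc_inf" "deriv \<psi> = g" "\<And>x. x \<ge> R \<Longrightarrow> \<psi> x = 0"
proof -
  define \<psi> where "\<psi> = (\<lambda>x. integral {-1..x} g)"
  have c: "continuous_on A g" for A using s by (rule smooth_continuous)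
  have io: "g integrable_on {a..b}" for a b by (intro integrable_continuous_real c)
  have zero: "integral S g = 0" if "\<And>x. x \<in> S \<Longrightarrow> g x = 0" for S
    using Henstock_Kurzweil_Integration.integral_cong[of S g "\<lambda>_. 0"] that by simp
  have low: "\<psi> x = 0" if "x \<le> p" for x
    unfolding \<psi>_def using that z by (intro zero) auto
  have d: "(\<psi> has_real_derivative g x) (at x)" for x
  proof (cases "x < p")
    case True
    have "\<forall>\<^sub>F y in nhds x. \<psi> y = 0"
      using eventually_nhds_in_open[of "{..<p}" x] True by (auto elim!: eventually_mono intro: low)
    then have "(\<psi> has_real_derivative 0) (at x)"
      by (subst DERIV_cong_ev[OF refl _ refl, where g="\<lambda>_. 0"]) auto
    then show ?thesis using z[of x] True by simp
  next
    case False
    have "(\<psi> has_real_derivative g x) (at x within {-1..x+1})"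
      unfolding \<psi>_def by (rule integral_has_real_derivative[OF c]) (use False p in auto)
    moreover have "at x within {-1..x+1} = at x" using False p by (intro at_within_interior) auto
    ultimately show ?thesis by simp
  qed
  have iz: "integral {0..R} g = 0"
  proof -
    have "integrable (lebesgue_on {0..R}) g"
    proof -
      obtain C where "\<And>x. x \<in> {0..R} \<Longrightarrow> \<bar>g x\<bar> \<le> C" using continuous_bounded_Icc[OF c] by blast
      then show ?thesis by (intro bounded_integrable_Icc borel_measurable_Icc smooth_measurable s)
    qed
    then have "(g has_integral (LINT x|lebesgue_on {0..R}. g x)) {0..R}"
      by (rule has_integral_integral_lebesgue_on) simp
    then show ?thesis unfolding int by (rule integral_unique)
  qed
  have high: "\<psi> x = 0" if "x \<ge> R" for x
  proof -
    have "integral {-1..x} g = integral {-1..0} g + integral {0..x} g"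
      using that R p by (intro Henstock_Kurzweil_Integration.integral_combine[symmetric] io) auto
    also have "integral {0..x} g = integral {0..R} g + integral {R..x} g"
      using that R p by (intro Henstock_Kurzweil_Integration.integral_combine[symmetric] io) auto
    also have "integral {-1..0} g = 0" using z p by (intro zero) auto
    also have "integral {R..x} g = 0" using z by (intro zero) auto
    finally show ?thesis by (simp add: \<psi>_def iz)
  qed
  have "\<psi> \<in> Cc_inf"
    by (rule Cc_infI[OF smooth_antideriv[OF s d] p, of R]) (use low high in auto)
  moreover have "deriv \<psi> = g" using d by (auto intro: DERIV_imp_deriv)
  ultimately show ?thesis using that high by blast
qed

text \<open>Convergence of the derivatives alone suffices. A common bound on a bounded interval
  gives their convergence in mean and in mean square, and since \<open>u n 0 = 0\<close> the
  functions are bounded uniformly by the integral of the absolute derivative.\<close>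

lemma pw_C1_W12_norm_tendsto:
  assumes pw: "\<And>n. pw_C1 R K (u n) (v n)" and u0: "\<And>n. u n 0 = 0"
    and lim: "AE x in lebesgue. x \<in> {0..R} \<longrightarrow> (\<lambda>n. v n x) \<longlonglongrightarrow> 0"
  shows "(\<lambda>n. W12_norm (u n)) \<longlonglongrightarrow> 0"
proof -
  interpret finite_measure "lebesgue_on {0..R}" by (rule finite_measure_lebesgue_on) auto
  have R: "R > 0" and K: "\<bar>v n x\<bar> \<le> K" and vm: "v n \<in> borel_measurable borel"
    and z: "x > R \<Longrightarrow> v n x = 0" "x > R \<Longrightarrow> u n x = 0" for n x
    using pw[of n] by (auto simp: pw_C1_def)
  have K2: "(v n x)\<^sup>2 \<le> K\<^sup>2" for n x
    using power_mono[OF K[of n x], of 2] by simp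
  have vm': "v n \<in> borel_measurable (lebesgue_on S)" for n S using vm by (rule borel_measurable_Icc)
  have lim': "AE x in lebesgue_on {0..R}. (\<lambda>n. v n x) \<longlonglongrightarrow> 0"
    using lim by (simp add: AE_lebesgue_on_iff)
  have v2: "(\<lambda>n. LINT x|lebesgue_on {0..R}. (v n x)\<^sup>2) \<longlonglongrightarrow> (LINT x|lebesgue_on {0..R}. 0)"
  proof (rule integral_dominated_convergence[where w="\<lambda>_. K\<^sup>2"])
    show "AE x in lebesgue_on {0..R}. (\<lambda>n. (v n x)\<^sup>2) \<longlonglongrightarrow> 0"
      using lim' by eventually_elim (auto intro: tendsto_eq_intros)
    show "AE x in lebesgue_on {0..R}. norm ((v n x)\<^sup>2) \<le> K\<^sup>2" for n
      using K2 by (intro AE_I2) simp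
  qed (auto intro: borel_measurable_power vm')
  define e where "e = (\<lambda>n. LINT x|lebesgue_on {0..R}. \<bar>v n x\<bar>)"
  have e: "e \<longlonglongrightarrow> (LINT x|lebesgue_on {0..R}. 0)"
    unfolding e_def
  proof (rule integral_dominated_convergence[where w="\<lambda>_. K"])
    show "AE x in lebesgue_on {0..R}. (\<lambda>n. \<bar>v n x\<bar>) \<longlonglongrightarrow> 0"
      using lim' by eventually_elim (auto intro: tendsto_rabs_zero)
  qed (use K in \<open>auto intro: vm' borel_measurable_abs intro!: AE_I2\<close>)
  have ue: "\<bar>u n x\<bar> \<le> e n" if x: "x \<in> {0..R}" for n x
  proof -
    have i: "integrable (lebesgue_on {0..R}) (\<lambda>x. \<bar>v n x\<bar>)"
      by (rule bounded_integrable_Icc[where B=K]) (use K vm' in auto)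
    have "u n x = (LINT y|lebesgue_on {0..x}. v n y)"
      using pw_C1_FTC(2)[OF pw[of n], of 0 x] x u0 by simp
    also have "\<bar>\<dots>\<bar> \<le> (LINT y|lebesgue_on {0..x}. \<bar>v n y\<bar>)"
      using integral_abs_bound by blast
    also have "\<dots> = (LINT y|lebesgue. indicator {0..x} y * \<bar>v n y\<bar>)"
      by (simp add: integral_lebesgue_on_eq)
    also have "\<dots> \<le> (LINT y|lebesgue. indicator {0..R} y * \<bar>v n y\<bar>)"
    proof (rule integral_mono)
      show "integrable lebesgue (\<lambda>y. indicator {0..R} y * \<bar>v n y\<bar>)"
        using i by (simp add: integrable_lebesgue_on_iff)
      have "integrable (lebesgue_on {0..x}) (\<lambda>x. \<bar>v n x\<bar>)"
        by (rule bounded_integrable_Icc[where B=K]) (use K vm' in auto)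
      then show "integrable lebesgue (\<lambda>y. indicator {0..x} y * \<bar>v n y\<bar>)"
        by (simp add: integrable_lebesgue_on_iff)
    qed (use x in \<open>auto simp: indicator_def\<close>)
    also have "\<dots> = e n" by (simp add: integral_lebesgue_on_eq e_def)
    finally show ?thesis .
  qed
  have u2: "(LINT x|lebesgue_on {0..R}. (u n x)\<^sup>2) \<le> R * (e n)\<^sup>2" for n
  proof -
    have um: "u n \<in> borel_measurable (lebesgue_on {0..R})" by (rule pw_C1_measurable(1)[OF pw]) auto
    have b: "\<bar>(u n x)\<^sup>2\<bar> \<le> (e n)\<^sup>2" if "x \<in> {0..R}" for x
      using power_mono[OF ue[OF that, of n], of 2] by simp
    have "(LINT x|lebesgue_on {0..R}. (u n x)\<^sup>2) \<le> (LINT x|lebesgue_on {0..R}. (e n)\<^sup>2)"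
    proof (rule integral_mono)
      show "integrable (lebesgue_on {0..R}) (\<lambda>x. (u n x)\<^sup>2)"
        by (rule bounded_integrable_Icc[OF borel_measurable_power[OF um] b])
    qed (use b in auto)
    also have "\<dots> = R * (e n)\<^sup>2" using R by (simp add: measure_restrict_space)
    finally show ?thesis .
  qed
  have n: "W12_norm (u n) = sqrt ((LINT x|lebesgue_on {0..R}. (u n x)\<^sup>2) + (LINT x|lebesgue_on {0..R}. (v n x)\<^sup>2))" for n
  proof -
    obtain B where B: "\<And>x. x \<ge> 0 \<Longrightarrow> \<bar>u n x\<bar> \<le> B" using pw_C1_bound[OF pw] by blast
    have "integrable (lebesgue_on {0..R}) (\<lambda>x. (u n x)\<^sup>2)"
    proof (rule bounded_integrable_Icc[where B="B\<^sup>2"])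
      show "\<bar>(u n x)\<^sup>2\<bar> \<le> B\<^sup>2" if "x \<in> {0..R}" for x
        using power_mono[OF B[of x], of 2] that by simp
    qed (rule borel_measurable_power, rule pw_C1_measurable(1)[OF pw], auto)
    moreover have "integrable (lebesgue_on {0..R}) (\<lambda>x. (v n x)\<^sup>2)"
    proof (rule bounded_integrable_Icc[where B="K\<^sup>2"])
      show "\<bar>(v n x)\<^sup>2\<bar> \<le> K\<^sup>2" if "x \<in> {0..R}" for x
        using K2 by simp
    qed (rule borel_measurable_power, rule vm')
    ultimately show ?thesis
      unfolding W12_norm_eq[OF pw_C1_has_weak_deriv[OF pw]]
      by (subst (1 2) half_line_integral(2)[where R=R]) (auto simp: z)
  qed
  have "(\<lambda>n. (LINT x|lebesgue_on {0..R}. (u n x)\<^sup>2) + (LINT x|lebesgue_on {0..R}. (v n x)\<^sup>2)) \<longlonglongrightarrow> 0 + 0"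
  proof (rule tendsto_add)
    show "(\<lambda>n. LINT x|lebesgue_on {0..R}. (u n x)\<^sup>2) \<longlonglongrightarrow> 0"
    proof (rule tendsto_sandwich[OF _ _ tendsto_const])
      show "(\<lambda>n. R * (e n)\<^sup>2) \<longlonglongrightarrow> 0" using e by (auto intro!: tendsto_eq_intros)
    qed (use u2 in auto)
    show "(\<lambda>n. LINT x|lebesgue_on {0..R}. (v n x)\<^sup>2) \<longlonglongrightarrow> 0" using v2 by simp
  qed
  from tendsto_real_sqrt[OF this] show ?thesis by (simp add: n)
qed

text \<open>It is the derivative that is approximated: polynomials close to \<open>v\<close> are cut
  off near 0 and at \<open>R\<close>, their integral is corrected to 0 by a multiple of a fixed
  bump, and the primitives are the required test functions.\<close>

lemma pw_C1_W12_0: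
  assumes pw: "pw_C1 R M u v" and u0: "u 0 = 0"
  shows "u \<in> W12_0"
proof -
  interpret finite_measure "lebesgue_on {0..R}" by (rule finite_measure_lebesgue_on) auto
  have R: "R > 0" and M: "\<bar>v x\<bar> \<le> M" and vm: "v \<in> borel_measurable borel" and uR: "u R = 0"
    for x
    using pw by (auto simp: pw_C1_def)
  have M0: "M \<ge> 0" using M[of 0] by linarith
  obtain p where p: "\<And>n. real_polynomial_function (p n)" "\<And>n x. x \<in> {0..R} \<Longrightarrow> \<bar>p n x\<bar> \<le> M + 1"
    "AE x in lebesgue. x \<in> {0..R} \<longrightarrow> (\<lambda>n. p n x) \<longlonglongrightarrow> v x"
    using bounded_measurable_approx_polynomials[OF vm M] by blast
  define g where "g = (\<lambda>n x. p n x * cutoff R n x)"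
  have gs: "smooth_on UNIV (g n)" for n
    unfolding g_def by (intro smooth_mult smooth_real_polynomial p smooth_cutoff)
  have gz: "g n x = 0" if "x \<le> 1 / real (Suc n) \<or> x \<ge> R" for n x
    using cutoff_outside[OF that] by (simp add: g_def)
  have gb: "\<bar>g n x\<bar> \<le> M + 1" for n x
  proof (cases "x \<in> {0..R}")
    case True
    have "\<bar>g n x\<bar> \<le> (M + 1) * 1" unfolding g_def abs_mult
      using p(2)[OF True, of n] cutoff_bounds[of R n x] M0 by (intro mult_mono) auto
    then show ?thesis by simp
  next
    case False
    then have "x \<le> 1 / real (Suc n) \<or> x \<ge> R"
      by (auto simp: not_le) (smt (verit) divide_nonneg_nonneg of_nat_0_le_iff)
    then show ?thesis using gz[of x n] M0 by simp
  qed
  have gm: "g n \<in> borel_measurable (lebesgue_on S)" for n S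
    by (intro borel_measurable_Icc smooth_measurable gs)
  have ne: "AE x in lebesgue. x \<noteq> (c::real)" for c by (rule AE_completion) (rule AE_lborel_singleton)
  have glim: "AE x in lebesgue. x \<in> {0..R} \<longrightarrow> (\<lambda>n. g n x) \<longlonglongrightarrow> v x"
    using p(3) ne[of 0] ne[of R]
  proof eventually_elim
    case (elim x)
    show ?case
    proof
      assume "x \<in> {0..R}"
      then have "(\<lambda>n. g n x) \<longlonglongrightarrow> v x * 1"
        unfolding g_def using elim by (intro tendsto_mult cutoff_tendsto) auto
      then show "(\<lambda>n. g n x) \<longlonglongrightarrow> v x" by simp
    qed
  qed
  define c where "c = (\<lambda>n. LINT x|lebesgue_on {0..R}. g n x)"
  have "c \<longlonglongrightarrow> (LINT x|lebesgue_on {0..R}. v x)"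
    unfolding c_def
  proof (rule integral_dominated_convergence[where w="\<lambda>_. M + 1"])
    show "AE x in lebesgue_on {0..R}. (\<lambda>n. g n x) \<longlonglongrightarrow> v x" using glim by (simp add: AE_lebesgue_on_iff)
  qed (simp_all add: gb gm borel_measurable_Icc[OF vm])
  \<comment> \<open>The zero boundary value enters here: \<open>v\<close> has integral
    \<open>u R - u 0 = 0\<close>, so the corrections to the integrals disappear in the
    limit.\<close>
  also have "(LINT x|lebesgue_on {0..R}. v x) = 0"
    using pw_C1_FTC(2)[OF pw, of 0 R] R uR u0 by simp
  finally have c0: "c \<longlonglongrightarrow> 0" .
  \<comment> \<open>Any smooth function with positive integral and support between 0 and
    \<open>R\<close>, at a distance from 0, would do to absorb the integral
    \<open>c n\<close>.\<close>
  define \<theta> where "\<theta> = bump (R / 2) R 1"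
  have \<theta>s: "smooth_on UNIV \<theta>" unfolding \<theta>_def by (rule smooth_bump)
  have \<theta>b: "\<bar>\<theta> x\<bar> \<le> 1" for x unfolding \<theta>_def using bump_bounds[of "R/2" R 1 x] by simp
  have \<theta>m: "\<theta> \<in> borel_measurable (lebesgue_on S)" for S by (intro borel_measurable_Icc smooth_measurable \<theta>s)
  have \<theta>i: "integrable (lebesgue_on {0..R}) \<theta>"
    by (rule bounded_integrable_Icc[OF \<theta>m \<theta>b])
  define I where "I = (LINT x|lebesgue_on {0..R}. \<theta> x)"
  have I: "I > 0"
  proof -
    have "I \<noteq> 0"
    proof
      assume "I = 0"
      then have "AE x in lebesgue_on {0..R}. \<theta> x = 0"
        using \<theta>i bump_bounds(1) unfolding I_def \<theta>_def
        by (subst (asm) integral_nonneg_eq_0_iff_AE) auto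
      then have "AE x in lebesgue. x \<in> {0..R} \<longrightarrow> \<theta> x = 0" by (simp add: AE_lebesgue_on_iff)
      then have "AE x in lborel. x \<notin> {R/2<..<R}"
        unfolding AE_completion_iff
      proof eventually_elim
        case (elim x)
        then show ?case using bump_pos[of "R/2" x R 1] R by (auto simp: \<theta>_def)
      qed
      then have "emeasure lborel {R/2<..<R} = 0"
        by (subst (asm) AE_iff_measurable[where N="{R/2<..<R}"]) auto
      then show False using R by simp
    qed
    moreover have "I \<ge> 0" unfolding I_def \<theta>_def using bump_bounds(1) by (intro integral_nonneg_AE AE_I2) auto
    ultimately show ?thesis by simp
  qed
  define G where "G = (\<lambda>n x. g n x + (- (c n / I)) * \<theta> x)"
  have Gs: "smooth_on UNIV (G n)" for n
    unfolding G_def by (intro smooth_add smooth_mult smooth_const gs \<theta>s)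
  have "\<exists>\<psi>. \<psi> \<in> Cc_inf \<and> deriv \<psi> = G n \<and> (\<forall>x\<ge>R. \<psi> x = 0)" for n
  proof -
    let ?p = "min (1 / real (Suc n)) (R / 2)"
    have pp: "0 < ?p" "?p \<le> R" using R by auto
    have "(LINT x|lebesgue_on {0..R}. G n x) = c n + (- (c n / I)) * I"
      unfolding G_def c_def I_def
      by (subst Bochner_Integration.integral_add)
         (use \<theta>i bounded_integrable_Icc[OF gm gb] in auto)
    then have 0: "(LINT x|lebesgue_on {0..R}. G n x) = 0" using I by simp
    have 1: "G n x = 0" if "x \<le> ?p \<or> x \<ge> R" for x
      using that gz[of x n] bump_outside[of x "R/2" R 1] unfolding G_def \<theta>_def by auto
    show ?thesis
      by (rule Cc_inf_antiderivative[OF Gs pp(1) 1 pp(2) 0], assumption) auto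
  qed
  then obtain \<psi> where \<psi>: "\<And>n. \<psi> n \<in> Cc_inf" "\<And>n. deriv (\<psi> n) = G n" "\<And>n x. x \<ge> R \<Longrightarrow> \<psi> n x = 0" by metis
  have cb: "\<bar>c n\<bar> \<le> R * (M + 1)" for n
  proof -
    have "\<bar>c n\<bar> \<le> (LINT x|lebesgue_on {0..R}. \<bar>g n x\<bar>)" unfolding c_def using integral_abs_bound by blast
    also have "\<dots> \<le> (LINT x|lebesgue_on {0..R}. M + 1)"
      by (rule integral_mono) (use gb bounded_integrable_Icc[OF gm gb] in auto)
    also have "\<dots> = R * (M + 1)" using R by (simp add: measure_restrict_space)
    finally show ?thesis .
  qed
  \<comment> \<open>The bound \<open>M + 1\<close> on \<open>g n\<close> plus the bound
    \<open>R * (M + 1) / I\<close> on the correcting coefficient, as \<theta> is at most 1.\<close>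
  define K where "K = M + 1 + R * (M + 1) / I"
  have GK: "\<bar>G n x\<bar> \<le> K" for n x
  proof -
    have "\<bar>c n / I * \<theta> x\<bar> \<le> R * (M + 1) / I * 1"
      unfolding abs_mult abs_divide using cb[of n] \<theta>b[of x] I R M0
      by (intro mult_mono divide_right_mono) (auto simp: divide_right_mono)
    then show ?thesis
      unfolding G_def K_def mult_minus_left using gb[of n x] by linarith
  qed
  have \<psi>pw: "pw_C1 R K (\<psi> n) (G n)" for n
    unfolding pw_C1_def
  proof (intro conjI allI impI)
    have s: "smooth_on UNIV (\<psi> n)" using \<psi>(1) by (simp add: Cc_inf_def)
    show "continuous_on {0..} (\<psi> n)" by (rule smooth_continuous[OF s])
    show "\<exists>S. finite S \<and> (\<forall>x\<in>{0<..} - S. (\<psi> n has_real_derivative G n x) (at x))"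
      using smooth_deriv(2)[OF s] \<psi>(2)[of n] by (intro exI[of _ "{}"]) auto
    show "G n x = 0" if "x > R" for x
      using that gz[of x n] bump_outside[of x "R/2" R 1] unfolding G_def \<theta>_def by auto
  qed (use R GK smooth_measurable(1)[OF Gs] \<psi>(3) in auto)
  have \<psi>0: "\<psi> n 0 = 0" for n
    using \<psi>(1)[of n] closure_subset[of "{x. \<psi> n x \<noteq> 0}"] unfolding Cc_inf_def by auto
  have "(\<lambda>n. W12_norm (\<lambda>x. u x - \<psi> n x)) \<longlonglongrightarrow> 0"
  proof (rule pw_C1_W12_norm_tendsto)
    show "pw_C1 R (M + K) (\<lambda>x. u x - \<psi> n x) (\<lambda>x. v x - G n x)" for n
      using pw_C1_diff[OF pw \<psi>pw[of n]] by simp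
    show "AE x in lebesgue. x \<in> {0..R} \<longrightarrow> (\<lambda>n. v x - G n x) \<longlonglongrightarrow> 0"
      using glim
    proof eventually_elim
      case (elim x)
      have "(\<lambda>n. v x - (g n x + (- (c n / I)) * \<theta> x)) \<longlonglongrightarrow> v x - (v x + (- (0 / I)) * \<theta> x)" if "x \<in> {0..R}"
        using elim that I by (intro tendsto_intros c0) auto
      then show ?case by (simp add: G_def)
    qed
  qed (use u0 \<psi>0 in auto)
  then show ?thesis using \<psi>(1) pw_C1_W12[OF pw] unfolding W12_0_def by blast
qed

subsection \<open>The shooting problem for the flux\<close>

text \<open>Truncating the denominator at \<open>V\<close> makes the nonlinearity
  \<open>1 / q\<close> of the flux equation globally Lipschitz, as a contraction argument
  requires.\<close>

lemma inverse_max_lipschitz: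
  fixes a b V :: real
  assumes "V > 0"
  shows "\<bar>1 / max a V - 1 / max b V\<bar> \<le> \<bar>a - b\<bar> / V\<^sup>2"
proof -
  have pos: "max a V > 0" "max b V > 0" using assms by auto
  have "\<bar>1 / max a V - 1 / max b V\<bar> = \<bar>max b V - max a V\<bar> / (max a V * max b V)"
    using pos by (simp add: field_simps abs_divide)
  also have "\<dots> \<le> \<bar>a - b\<bar> / V\<^sup>2"
  proof (rule frac_le)
    show "\<bar>max b V - max a V\<bar> \<le> \<bar>a - b\<bar>" by (auto simp: max_def)
    show "V\<^sup>2 \<le> max a V * max b V"
      unfolding power2_eq_square using assms by (intro mult_mono) auto
  qed (use assms in auto)
  finally show ?thesis .
qed

text \<open>Integrating \<open>q'' = - m k / q\<close> twice from \<open>q = V\<close>,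
  \<open>q' = 1\<close> at 0 gives a Volterra equation with kernel \<open>s - r\<close>; the
  substitution \<open>r = s \<theta>\<close> moves it to a fixed interval. Solving for all
  \<open>m\<close> at once, as a function of two variables, provides continuity in the shooting
  parameter along with the solution.\<close>

lemma volterra_fixed_point:
  fixes k :: "real \<Rightarrow> real"
  assumes k: "continuous_on {0..L} k" and L: "L > 0" and V: "V > 0" and M: "M > 0"
  obtains q :: "real \<times> real \<Rightarrow> real" where "continuous_on (cbox (0,0) (L,M)) q"
    "\<And>s m. s \<in> {0..L} \<Longrightarrow> m \<in> {0..M} \<Longrightarrow>
       q (s, m) = V + s - m * integral {0..1} (\<lambda>\<theta>. s\<^sup>2 * (1 - \<theta>) * k (s * \<theta>) / max (q (s * \<theta>, m)) V)"
proof -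
  obtain K where K: "K > 0" "\<And>s. s \<in> {0..L} \<Longrightarrow> \<bar>k s\<bar> \<le> K" using continuous_bounded_Icc[OF k] by blast
  \<comment> \<open>The iteration is carried out for \<open>exp (- \<Lambda> * s) * q\<close>, a
    weighted sup norm in disguise. The value of \<Lambda> makes the Lipschitz constant
    \<open>M * L * K / V\<^sup>2 / \<Lambda>\<close> equal to 1/2, however large the box is.\<close>
  define \<Lambda> where "\<Lambda> = 2 * M * L * K / V\<^sup>2"
  have \<Lambda>: "\<Lambda> > 0" using M L K V by (simp add: \<Lambda>_def)
  define I where "I = (\<lambda>(y :: real \<times> real \<Rightarrow> real) s m \<theta>.
     s\<^sup>2 * (1 - \<theta>) * k (s * \<theta>) / max (exp (\<Lambda> * (s * \<theta>)) * y (s * \<theta>, m)) V)"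
  define F where "F = (\<lambda>(y :: (real \<times> real) \<Rightarrow>\<^sub>C real) (s, m). exp (- \<Lambda> * s) * (V + s - m * integral {0..1} (I y s m)))"
  let ?B = "cbox (0,0) (L,M) :: (real \<times> real) set"
  have B: "?B = {0..L} \<times> {0..M}" by (auto simp: cbox_Pair_eq)
  have st: "s * \<theta> \<in> {0..L}" if "s \<in> {0..L}" "\<theta> \<in> {0..1}" for s \<theta>
  proof -
    have "s * \<theta> \<le> L * 1" using that L by (intro mult_mono) auto
    then show ?thesis using that by auto
  qed
  have Icont: "continuous_on (?B \<times> {0..1}) (\<lambda>(x, \<theta>). I y (fst x) (snd x) \<theta>)" for y :: "(real \<times> real) \<Rightarrow>\<^sub>C real"
  proof -
    have 1: "continuous_on (?B \<times> {0..1}) (\<lambda>x. k (fst (fst x) * snd x))"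
      by (rule continuous_on_compose2[OF k]) (use B st in \<open>auto intro!: continuous_intros simp: mult_nonneg_nonneg\<close>)
    have 2: "continuous_on (?B \<times> {0..1}) (\<lambda>x. apply_bcontfun y (fst (fst x) * snd x, snd (fst x)))"
      by (rule continuous_on_compose2[of UNIV "apply_bcontfun y"]) (auto intro!: continuous_intros)
    show ?thesis
      unfolding I_def split_def
      by (intro continuous_intros 1 2) (use V in auto)
  qed
  have Icont1: "continuous_on {0..1} (I y s m)" if "(s, m) \<in> ?B" for s m and y :: "(real \<times> real) \<Rightarrow>\<^sub>C real"
  proof -
    have "continuous_on {0..1} (\<lambda>\<theta>. case ((s, m), \<theta>) of (x, \<theta>) \<Rightarrow> I y (fst x) (snd x) \<theta>)"
      by (rule continuous_on_compose2[OF Icont[of y]])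
         (use that in \<open>auto intro!: continuous_intros simp: B image_subset_iff\<close>)
    then show ?thesis by simp
  qed
  have Fcont: "continuous_on ?B (F y)" for y
  proof -
    have "continuous_on ?B (\<lambda>x. integral (cbox 0 1) (I y (fst x) (snd x)))"
      using Icont[of y] by (intro integral_continuous_on_param) auto
    then show ?thesis unfolding F_def split_def by (intro continuous_intros) auto
  qed
  \<comment> \<open>Clamping extends a continuous function from the box to a bounded continuous
    function on the plane, where the complete space of the fixed point theorem lives.\<close>
  have "\<exists>g :: (real \<times> real) \<Rightarrow>\<^sub>C real. (\<forall>x\<in>?B. g x = F y x) \<and> (\<forall>x. g x = F y (clamp (0,0) (L,M) x))" for y
    using continuous_on_cbox_bcontfunE[OF Fcont[of y]] by metis
  then obtain T :: "((real \<times> real) \<Rightarrow>\<^sub>C real) \<Rightarrow> ((real \<times> real) \<Rightarrow>\<^sub>C real)" where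
    T: "\<And>y x. x \<in> ?B \<Longrightarrow> T y x = F y x" "\<And>y x. T y x = F y (clamp (0,0) (L,M) x)" by metis
  have contr: "\<bar>F y x - F z x\<bar> \<le> 1/2 * dist y z" if x: "x \<in> ?B" for x y z
  proof -
    obtain s m where sm: "x = (s, m)" "s \<in> {0..L}" "m \<in> {0..M}" using x B by (cases x) auto
    let ?d = "dist y z"
    \<comment> \<open>One of the two factors \<open>s\<close> is kept, since
      \<open>s * exp (\<Lambda> * (s * \<theta>))\<close> integrates exactly in \<theta> and yields
      the gain \<open>1 / \<Lambda>\<close>; the other is bounded by \<open>L\<close>.\<close>
    have ptw: "norm (I y s m \<theta> - I z s m \<theta>) \<le> L * K / V\<^sup>2 * ?d * (s * exp (\<Lambda> * (s * \<theta>)))" if t: "\<theta> \<in> {0..1}" for \<theta>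
    proof -
      let ?e = "exp (\<Lambda> * (s * \<theta>))"
      have "I y s m \<theta> - I z s m \<theta> = (s\<^sup>2 * (1 - \<theta>) * k (s * \<theta>)) *
          (1 / max (?e * y (s * \<theta>, m)) V - 1 / max (?e * z (s * \<theta>, m)) V)"
        unfolding I_def by (simp add: right_diff_distrib)
      also have "norm \<dots> \<le> (s * L * 1 * K) * (?e * ?d / V\<^sup>2)"
        unfolding real_norm_def abs_mult[of "s\<^sup>2 * (1 - \<theta>) * k (s * \<theta>)"]
      proof (rule mult_mono)
        show "\<bar>s\<^sup>2 * (1 - \<theta>) * k (s * \<theta>)\<bar> \<le> s * L * 1 * K"
          unfolding abs_mult power2_eq_square using sm t K(2)[OF st[OF sm(2) t]]
          by (intro mult_mono) (auto intro: mult_nonneg_nonneg)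
        have "\<bar>1 / max (?e * y (s * \<theta>, m)) V - 1 / max (?e * z (s * \<theta>, m)) V\<bar>
            \<le> \<bar>?e * y (s * \<theta>, m) - ?e * z (s * \<theta>, m)\<bar> / V\<^sup>2"
          by (rule inverse_max_lipschitz[OF V])
        also have "\<bar>?e * y (s * \<theta>, m) - ?e * z (s * \<theta>, m)\<bar> = ?e * dist (y (s * \<theta>, m)) (z (s * \<theta>, m))"
          by (simp add: dist_real_def abs_mult right_diff_distrib[symmetric])
        also have "\<dots> / V\<^sup>2 \<le> ?e * ?d / V\<^sup>2"
          by (intro divide_right_mono mult_left_mono dist_bounded) auto
        finally show "\<bar>1 / max (?e * y (s * \<theta>, m)) V - 1 / max (?e * z (s * \<theta>, m)) V\<bar> \<le> ?e * ?d / V\<^sup>2" .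
      qed (use sm K L in auto)
      also have "\<dots> = L * K / V\<^sup>2 * ?d * (s * ?e)" by simp
      finally show ?thesis .
    qed
    have hi: "((\<lambda>\<theta>. s * exp (\<Lambda> * (s * \<theta>))) has_integral (exp (\<Lambda> * (s * 1)) / \<Lambda> - exp (\<Lambda> * (s * 0)) / \<Lambda>)) {0..1}"
      using \<Lambda> by (intro fundamental_theorem_of_calculus)
        (auto intro!: derivative_eq_intros simp: has_real_derivative_iff_has_vector_derivative[symmetric])
    have int: "I y s m integrable_on {0..1}" for y :: "(real \<times> real) \<Rightarrow>\<^sub>C real"
      using Icont1[of s m y] x sm by (auto intro: integrable_continuous_real)
    have "\<bar>integral {0..1} (I y s m) - integral {0..1} (I z s m)\<bar> = norm (integral {0..1} (\<lambda>\<theta>. I y s m \<theta> - I z s m \<theta>))"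
      by (simp add: Henstock_Kurzweil_Integration.integral_diff int)
    also have "\<dots> \<le> integral {0..1} (\<lambda>\<theta>. L * K / V\<^sup>2 * ?d * (s * exp (\<Lambda> * (s * \<theta>))))"
    proof (rule integral_norm_bound_integral)
      show "(\<lambda>\<theta>. I y s m \<theta> - I z s m \<theta>) integrable_on {0..1}" by (intro Henstock_Kurzweil_Integration.integrable_diff int)
      show "(\<lambda>\<theta>. L * K / V\<^sup>2 * ?d * (s * exp (\<Lambda> * (s * \<theta>)))) integrable_on {0..1}"
        by (intro integrable_continuous_real continuous_intros)
    qed (use ptw in auto)
    also have "\<dots> = L * K / V\<^sup>2 * ?d * (exp (\<Lambda> * s) / \<Lambda> - 1 / \<Lambda>)"
      using integral_unique[OF has_integral_mult_right[OF hi, of "L * K / V\<^sup>2 * ?d"]] by simp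
    also have "\<dots> \<le> L * K / V\<^sup>2 * ?d * (exp (\<Lambda> * s) / \<Lambda>)"
      using L K V \<Lambda> by (intro mult_left_mono) auto
    finally have le: "\<bar>integral {0..1} (I y s m) - integral {0..1} (I z s m)\<bar> \<le> L * K / V\<^sup>2 * ?d * (exp (\<Lambda> * s) / \<Lambda>)" .
    have "F y x - F z x = exp (- \<Lambda> * s) * m * (integral {0..1} (I z s m) - integral {0..1} (I y s m))"
      unfolding F_def sm by (simp add: algebra_simps)
    also have "\<bar>\<dots>\<bar> \<le> exp (- \<Lambda> * s) * M * (L * K / V\<^sup>2 * ?d * (exp (\<Lambda> * s) / \<Lambda>))"
      unfolding abs_mult using le sm M by (intro mult_mono) (auto simp: abs_minus_commute)
    also have "\<dots> = (exp (- \<Lambda> * s) * exp (\<Lambda> * s)) * (M * L * K / V\<^sup>2 / \<Lambda>) * ?d" by simp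
    also have "exp (- \<Lambda> * s) * exp (\<Lambda> * s) = 1" by (simp add: exp_add[symmetric])
    also have "M * L * K / V\<^sup>2 / \<Lambda> = 1/2" unfolding \<Lambda>_def using M L K V by (simp add: field_simps)
    finally show ?thesis by simp
  qed
  have "\<exists>!y. T y = y"
  proof (rule banach_fix_type[of "1/2"], simp, simp, intro allI)
    fix y z
    show "dist (T y) (T z) \<le> 1/2 * dist y z"
    proof (rule dist_bound)
      fix x
      have "clamp (0,0) (L,M) x \<in> ?B" using L M by (intro clamp_in_interval) (auto simp: Basis_prod_def)
      from contr[OF this] show "dist (T y x) (T z x) \<le> 1/2 * dist y z"
        unfolding T(2)[of y x] T(2)[of z x] dist_real_def .
    qed
  qed
  then obtain y where y: "T y = y" by blast
  define q where "q = (\<lambda>x. exp (\<Lambda> * fst x) * y x)"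
  have "continuous_on ?B q" unfolding q_def by (auto intro!: continuous_intros)
  moreover have "q (s, m) = V + s - m * integral {0..1} (\<lambda>\<theta>. s\<^sup>2 * (1 - \<theta>) * k (s * \<theta>) / max (q (s * \<theta>, m)) V)"
    if "s \<in> {0..L}" "m \<in> {0..M}" for s m
  proof -
    have "y (s, m) = F y (s, m)" using T(1)[of "(s, m)" y] y that B by auto
    then have "q (s, m) = (exp (\<Lambda> * s) * exp (- \<Lambda> * s)) * (V + s - m * integral {0..1} (I y s m))"
      by (simp add: q_def F_def)
    also have "exp (\<Lambda> * s) * exp (- \<Lambda> * s) = 1" by (simp add: exp_add[symmetric])
    finally show ?thesis by (simp add: q_def I_def)
  qed
  ultimately show ?thesis using that by blast
qed

lemma integral_rescale_unit:
  fixes h :: "real \<Rightarrow> real"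
  assumes h: "continuous_on {0..s} h" and s: "s \<ge> 0"
  shows "integral {0..1} (\<lambda>\<theta>. s * h (s * \<theta>)) = integral {0..s} h"
proof (cases "s = 0")
  case False
  then have s: "s > 0" using s by simp
  have "(h has_integral integral {0..s} h) {0..s}"
    using h by (intro integrable_integral integrable_continuous_real)
  then have "((\<lambda>\<theta>. h (s * \<theta>)) has_integral (1 / \<bar>s\<bar>) *\<^sub>R integral {0..s} h) ((\<lambda>x. x / s) ` {0..s})"
    by (rule has_integral_stretch_real) (use s in auto)
  also have "(\<lambda>x. x / s) ` {0..s} = {0..1}" using s by (simp add: image_divide_atLeastAtMost)
  finally have "((\<lambda>\<theta>. s * h (s * \<theta>)) has_integral s * ((1 / \<bar>s\<bar>) *\<^sub>R integral {0..s} h)) {0..1}"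
    by (rule has_integral_mult_right)
  from integral_unique[OF this] show ?thesis using s by (simp only:) simp
qed simp

text \<open>The terminal slope is 1 for \<open>m = 0\<close> and nonpositive for
  \<open>m = M\<close>, so it vanishes for some \<open>m\<close> between. For this \<open>m\<close>
  the slope decreases to 0 and is thus nonnegative, the solution stays above \<open>V\<close>, and
  the truncation of the denominator has no effect.\<close>

lemma shooting:
  fixes k :: "real \<Rightarrow> real"
  assumes k: "continuous_on {0..L} k" and kpos: "\<And>s. 0 < s \<Longrightarrow> s \<le> L \<Longrightarrow> k s > 0" and k0: "k 0 \<ge> 0"
    and L: "L > 0" and V: "V > 0"
  obtains q qd :: "real \<Rightarrow> real" and m :: real where "m > 0" "q 0 = V" "qd 0 = 1" "qd L = 0"
    "\<And>s. s \<in> {0..L} \<Longrightarrow> (q has_real_derivative qd s) (at s within {0..L})"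
    "\<And>s. s \<in> {0..L} \<Longrightarrow> (qd has_real_derivative - (m * k s / q s)) (at s within {0..L})"
    "\<And>s. s \<in> {0..L} \<Longrightarrow> q s \<ge> V"
proof -
  have kint: "k integrable_on {0..L}" by (rule integrable_continuous_real[OF k])
  have knn: "k s \<ge> 0" if "s \<in> {0..L}" for s using kpos[of s] k0 that by (cases "s = 0") auto
  define S where "S = integral {0..L} k"
  have S: "S > 0"
  proof -
    have "S \<ge> 0" unfolding S_def by (intro integral_nonneg kint knn)
    moreover have "S \<noteq> 0"
    proof
      assume "S = 0"
      then have "(k has_integral 0) {0..L}" using kint unfolding S_def by (metis integrable_integral)
      then have "k L = 0"
        using has_integral_0_cbox_imp_0[of 0 L k L] k knn L by (auto simp: cbox_interval)
      then show False using kpos[of L] L by simp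
    qed
    ultimately show ?thesis by simp
  qed
  \<comment> \<open>Every solution is at most \<open>V + L\<close>, so the integral of
    \<open>k / q\<close> is at least \<open>S / (V + L)\<close>; for this \<open>M\<close> the loss
    of slope over the interval is at least the initial slope 1.\<close>
  define M where "M = (V + L) / S"
  have M: "M > 0" using V L S by (simp add: M_def)
  obtain Q :: "real \<times> real \<Rightarrow> real" where Q: "continuous_on (cbox (0,0) (L,M)) Q"
    and Qeq: "\<And>s m. s \<in> {0..L} \<Longrightarrow> m \<in> {0..M} \<Longrightarrow>
       Q (s, m) = V + s - m * integral {0..1} (\<lambda>\<theta>. s\<^sup>2 * (1 - \<theta>) * k (s * \<theta>) / max (Q (s * \<theta>, m)) V)"
    using volterra_fixed_point[OF k L V M] by blast
  define h where "h = (\<lambda>m r. k r / max (Q (r, m)) V)"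
  define g where "g = (\<lambda>m s. 1 - m * integral {0..s} (h m))"
  have Qc: "continuous_on {0..L} (\<lambda>r. Q (r, m))" if "m \<in> {0..M}" for m
    by (rule continuous_on_compose2[OF Q]) (use that in \<open>auto intro!: continuous_intros simp: cbox_Pair_eq\<close>)
  have hc: "continuous_on {0..s} (h m)" if "m \<in> {0..M}" "s \<in> {0..L}" for m s
    unfolding h_def
    by (intro continuous_intros continuous_on_subset[OF k] continuous_on_subset[OF Qc]) (use that V in auto)
  have hnn: "h m r \<ge> 0" if "r \<in> {0..L}" for m r
    unfolding h_def using knn[OF that] V by (auto intro!: divide_nonneg_nonneg)
  have hi: "h m integrable_on {a..b}" if "m \<in> {0..M}" "0 \<le> a" "b \<le> L" for m a b
  proof (cases "a \<le> b")
    case True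
    have "continuous_on {0..b} (h m)" by (rule hc) (use that True in auto)
    then show ?thesis using that by (intro integrable_continuous_real) (auto intro: continuous_on_subset)
  qed auto
  \<comment> \<open>Back in the variable \<open>r\<close> the kernel \<open>s - r\<close> is split,
    so that both integrals can be differentiated in their upper limit; the terms
    \<open>s * h m s\<close> cancel.\<close>
  have Qeq2: "Q (s, m) = V + s - m * (s * integral {0..s} (h m) - integral {0..s} (\<lambda>r. r * h m r))"
    if "s \<in> {0..L}" "m \<in> {0..M}" for s m
  proof -
    have "(\<lambda>\<theta>. s\<^sup>2 * (1 - \<theta>) * k (s * \<theta>) / max (Q (s * \<theta>, m)) V) = (\<lambda>\<theta>. s * (\<lambda>r. (s - r) * h m r) (s * \<theta>))"
      by (auto simp: h_def power2_eq_square algebra_simps)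
    moreover have "integral {0..1} (\<lambda>\<theta>. s * (\<lambda>r. (s - r) * h m r) (s * \<theta>)) = integral {0..s} (\<lambda>r. (s - r) * h m r)"
      using that(1) by (intro integral_rescale_unit continuous_intros hc[OF that(2,1)]) auto
    ultimately have "integral {0..1} (\<lambda>\<theta>. s\<^sup>2 * (1 - \<theta>) * k (s * \<theta>) / max (Q (s * \<theta>, m)) V)
        = integral {0..s} (\<lambda>r. (s - r) * h m r)" by simp
    also have "\<dots> = integral {0..s} (\<lambda>r. s * h m r - r * h m r)" by (simp add: left_diff_distrib)
    also have "\<dots> = s * integral {0..s} (h m) - integral {0..s} (\<lambda>r. r * h m r)"
      using hc[OF that(2,1)] by (subst Henstock_Kurzweil_Integration.integral_diff)
        (auto intro!: integrable_continuous_real continuous_intros)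
    finally show ?thesis using Qeq[OF that] by simp
  qed
  have dh: "((\<lambda>s. integral {0..s} (h m)) has_real_derivative h m s) (at s within {0..L})"
    if "s \<in> {0..L}" "m \<in> {0..M}" for s m
    using integral_has_real_derivative[OF hc[of m L] that(1)] that L by simp
  have drh: "((\<lambda>s. integral {0..s} (\<lambda>r. r * h m r)) has_real_derivative s * h m s) (at s within {0..L})"
    if "s \<in> {0..L}" "m \<in> {0..M}" for s m
    using that L hc[of m L] by (intro integral_has_real_derivative) (auto intro!: continuous_intros)
  have dQ: "((\<lambda>s. Q (s, m)) has_real_derivative g m s) (at s within {0..L})" if "s \<in> {0..L}" "m \<in> {0..M}" for s m
  proof -
    have "((\<lambda>s. V + s - m * (s * integral {0..s} (h m) - integral {0..s} (\<lambda>r. r * h m r))) has_real_derivative g m s)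
        (at s within {0..L})"
      unfolding g_def by (auto intro!: derivative_eq_intros dh drh that simp: algebra_simps)
    then show ?thesis
      by (rule has_field_derivative_transform_within[of _ _ _ _ 1]) (use Qeq2 that in auto)
  qed
  have dg: "(g m has_real_derivative - (m * h m s)) (at s within {0..L})" if "s \<in> {0..L}" "m \<in> {0..M}" for s m
    unfolding g_def by (auto intro!: derivative_eq_intros dh that)
  \<comment> \<open>The double integral is nonnegative, hence the solution stays below its initial
    tangent \<open>V + s\<close>.\<close>
  have QV: "Q (s, m) \<le> V + L" if "s \<in> {0..L}" "m \<in> {0..M}" for s m
  proof -
    have "s * integral {0..s} (h m) - integral {0..s} (\<lambda>r. r * h m r) = integral {0..s} (\<lambda>r. s * h m r - r * h m r)"
      using hc[OF that(2,1)] by (subst Henstock_Kurzweil_Integration.integral_diff)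
        (auto intro!: integrable_continuous_real continuous_intros)
    also have "\<dots> \<ge> 0"
      using hc[OF that(2,1)] that hnn
      by (intro integral_nonneg integrable_continuous_real continuous_intros)
         (auto simp: left_diff_distrib[symmetric] intro!: mult_nonneg_nonneg)
    finally have "m * (s * integral {0..s} (h m) - integral {0..s} (\<lambda>r. r * h m r)) \<ge> 0" using that by auto
    then show ?thesis using Qeq2[OF that] that by auto
  qed
  \<comment> \<open>The joint continuity of \<open>Q\<close> in both variables is used here: it
    makes the terminal slope continuous in the parameter.\<close>
  have gc: "continuous_on {0..M} (\<lambda>m. g m L)"
  proof -
    have 1: "continuous_on ({0..M} \<times> {0..L}) (\<lambda>x. k (snd x))"
      by (rule continuous_on_compose2[OF k]) (auto intro!: continuous_intros)
    have 2: "continuous_on ({0..M} \<times> {0..L}) (\<lambda>x. Q (snd x, fst x))"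
      by (rule continuous_on_compose2[OF Q]) (auto intro!: continuous_intros simp: cbox_Pair_eq)
    have "continuous_on ({0..M} \<times> cbox 0 L) (\<lambda>(m, r). h m r)"
      unfolding h_def split_def cbox_interval by (intro continuous_intros 1 2) (use V in auto)
    from integral_continuous_on_param[OF this] show ?thesis
      unfolding g_def by (auto intro!: continuous_intros)
  qed
  have "g M L \<le> 0"
  proof -
    have "S / (V + L) = integral {0..L} (\<lambda>r. k r / (V + L))"
      unfolding S_def by (simp add: divide_inverse Henstock_Kurzweil_Integration.integral_mult_left)
    also have "\<dots> \<le> integral {0..L} (h M)"
    proof (rule integral_le)
      show "(\<lambda>r. k r / (V + L)) integrable_on {0..L}"
        using k V L by (intro integrable_continuous_real continuous_intros) auto
      show "h M integrable_on {0..L}" by (rule hi) (use M in auto)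
      show "k r / (V + L) \<le> h M r" if "r \<in> {0..L}" for r
        unfolding h_def using QV[OF that, of M] knn[OF that] V L M by (intro divide_left_mono) auto
    qed
    finally have "M * (S / (V + L)) \<le> M * integral {0..L} (h M)" using M by (intro mult_left_mono) auto
    moreover have "M * (S / (V + L)) = 1" using S V L by (simp add: M_def)
    ultimately show ?thesis unfolding g_def by linarith
  qed
  moreover have "g 0 L \<ge> 0" by (simp add: g_def)
  ultimately obtain m where m: "0 \<le> m" "m \<le> M" "g m L = 0"
    using IVT2'[of "\<lambda>m. g m L" M 0 0, OF _ _ _ gc] M by auto
  have m0: "m > 0" using m by (cases "m = 0") (auto simp: g_def)
  have mM: "m \<in> {0..M}" using m by auto
  \<comment> \<open>The slope is decreasing in \<open>s\<close> and vanishes at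
    \<open>L\<close>.\<close>
  have gnn: "g m s \<ge> 0" if "s \<in> {0..L}" for s
  proof -
    have "integral {0..L} (h m) = integral {0..s} (h m) + integral {s..L} (h m)"
      using that by (intro Henstock_Kurzweil_Integration.integral_combine[symmetric] hi mM) auto
    moreover have "integral {s..L} (h m) \<ge> 0"
      using that hnn by (intro integral_nonneg hi mM) auto
    ultimately have "integral {0..s} (h m) \<le> integral {0..L} (h m)" by simp
    then have "m * integral {0..s} (h m) \<le> m * integral {0..L} (h m)" using m by (intro mult_left_mono) auto
    then show ?thesis using m(3) by (simp add: g_def)
  qed
  have Q0: "Q (0, m) = V" using Qeq2[of 0 m] mM L by simp
  have QgeV: "Q (s, m) \<ge> V" if "s \<in> {0..L}" for s
  proof -
    have "Q (0, m) \<le> Q (s, m)"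
    proof (rule DERIV_nonneg_imp_increasing_open[of 0 s "\<lambda>s. Q (s, m)"])
      show "\<exists>y. ((\<lambda>s. Q (s, m)) has_real_derivative y) (at x) \<and> 0 \<le> y" if x: "0 < x" "x < s" for x
      proof (intro exI conjI)
        have "at x within {0..L} = at x" using x \<open>s \<in> {0..L}\<close> by (intro at_within_interior) auto
        then show "((\<lambda>s. Q (s, m)) has_real_derivative g m x) (at x)"
          using dQ[of x m] mM x \<open>s \<in> {0..L}\<close> by auto
        show "0 \<le> g m x" using gnn x \<open>s \<in> {0..L}\<close> by auto
      qed
      show "continuous_on {0..s} (\<lambda>s. Q (s, m))"
        using Qc[OF mM] by (rule continuous_on_subset) (use \<open>s \<in> {0..L}\<close> in auto)
    qed (use that in auto)
    then show ?thesis using Q0 by simp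
  qed
  show ?thesis
  proof (rule that[of m "\<lambda>s. Q (s, m)" "g m"])
    show "(g m has_real_derivative - (m * k s / Q (s, m))) (at s within {0..L})" if "s \<in> {0..L}" for s
      using dg[OF that mM] QgeV[OF that] by (simp add: h_def max_absorb1)
  qed (use m0 m Q0 dQ mM QgeV in \<open>auto simp: g_def\<close>)
qed

subsection \<open>The self-similar profile\<close>

lemma deriv_eq_on_open:
  fixes f :: "real \<Rightarrow> real"
  assumes "open A" "x \<in> A" "\<And>y. y \<in> A \<Longrightarrow> f y = g y" "(g has_real_derivative d) (at x)"
  shows "(f has_real_derivative d) (at x)"
proof -
  have "\<forall>\<^sub>F y in nhds x. f y = g y"
    using eventually_nhds_in_open[OF assms(1,2)] by (rule eventually_mono) (rule assms(3))
  then show ?thesis using assms(4) by (subst DERIV_cong_ev[OF refl _ refl])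
qed

text \<open>The profile is the inverse function of \<eta> = a q'. Besides the system itself the
  lemma exports the flux \<open>F\<close> and the slope \<open>fd\<close>: the slope is unbounded
  near \<open>a\<close>, where \<open>deriv \<phi> (f \<eta>)\<close> tends to 0, whereas
  \<open>F\<close> is continuous up to \<open>a\<close> and carries the free boundary condition as
  the plain value \<open>F a\<close>.\<close>

lemma profile_exists:
  fixes \<phi> :: "real \<Rightarrow> real" and U\<^sub>0 V\<^sub>0 :: real
  assumes C2: "C2_on UNIV \<phi>" and mono: "strict_mono_on {0..} (deriv \<phi>)" and d0: "deriv \<phi> 0 = 0"
    and U: "U\<^sub>0 > 0" and V: "V\<^sub>0 > 0"
  obtains a f F fd where "a > 0" "continuous_on {0..a} f" "f 0 = U\<^sub>0" "f a = 0"
    "\<And>\<eta>. \<eta> \<in> {0..<a} \<Longrightarrow> f \<eta> > 0" "\<And>\<eta>. \<eta> \<in> {0..a} \<Longrightarrow> f \<eta> \<le> U\<^sub>0" "\<And>\<eta>. \<eta> > a \<Longrightarrow> f \<eta> = - V\<^sub>0" "\<And>\<eta>. \<eta> < 0 \<Longrightarrow> f \<eta> = U\<^sub>0"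
    "continuous_on {0..a} F" "F a = - (a * V\<^sub>0 / 2)"
    "\<And>\<eta>. \<eta> \<in> {0<..<a} \<Longrightarrow> (f has_real_derivative fd \<eta>) (at \<eta>)"
    "\<And>\<eta>. \<eta> \<in> {0<..<a} \<Longrightarrow> deriv \<phi> (f \<eta>) * fd \<eta> = F \<eta>"
    "\<And>\<eta>. \<eta> \<in> {0<..<a} \<Longrightarrow> (F has_real_derivative - (1/2) * \<eta> * fd \<eta>) (at \<eta>)"
    "self_similar_profile \<phi> U\<^sub>0 V\<^sub>0 a f"
proof -
  define k where "k = deriv \<phi>"
  have dk: "(k has_real_derivative deriv k s) (at s)" for s
    using C2 by (simp add: C2_on_def k_def DERIV_deriv_iff_real_differentiable)
  have kc: "continuous_on A k" for A
    by (meson DERIV_continuous_on dk has_field_derivative_at_within)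
  have k'c: "continuous_on A (deriv k)" for A
    using C2 by (auto simp: C2_on_def k_def intro: continuous_on_subset)
  have kpos: "k s > 0" if "s > 0" for s
    using strict_mono_onD[OF mono, of 0 s] that d0 by (simp add: k_def)
  obtain q qd m where m: "m > 0" and q0: "q 0 = V\<^sub>0" and qd0: "qd 0 = 1" and qdU: "qd U\<^sub>0 = 0"
    and dq: "\<And>s. s \<in> {0..U\<^sub>0} \<Longrightarrow> (q has_real_derivative qd s) (at s within {0..U\<^sub>0})"
    and dqd: "\<And>s. s \<in> {0..U\<^sub>0} \<Longrightarrow> (qd has_real_derivative - (m * k s / q s)) (at s within {0..U\<^sub>0})"
    and qV: "\<And>s. s \<in> {0..U\<^sub>0} \<Longrightarrow> q s \<ge> V\<^sub>0"
    by (rule shooting[of U\<^sub>0 k V\<^sub>0]) (use kc kpos d0 U V in \<open>auto simp: k_def\<close>)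
  have qc: "continuous_on {0..U\<^sub>0} q" and qdc: "continuous_on {0..U\<^sub>0} qd"
    by (rule DERIV_continuous_on[OF dq], simp) (rule DERIV_continuous_on[OF dqd], simp)
  have at: "at s within {0..U\<^sub>0} = at s" if "s \<in> {0<..<U\<^sub>0}" for s
    using that by (intro at_within_interior) auto
  \<comment> \<open>For \<open>p = (a/2) q\<close> the equation \<open>q q'' = - m k\<close> becomes
    \<open>2 p p'' = - (a * a * m / 2) k\<close>; the factor is 1 for this \<open>a\<close>.\<close>
  define a where "a = sqrt (2 / m)"
  have a: "a > 0" "a * a * m = 2" using m by (auto simp: a_def)
  \<comment> \<open>The similarity variable as a function of the profile value \<open>s\<close>: it
    falls strictly from \<open>a\<close> at \<open>s = 0\<close> to 0 at
    \<open>s = U\<^sub>0\<close>.\<close>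
  define e where "e = (\<lambda>s. a * qd s)"
  have e0: "e 0 = a" "e U\<^sub>0 = 0" by (simp_all add: e_def qd0 qdU)
  have ec: "continuous_on {0..U\<^sub>0} e" unfolding e_def by (intro continuous_intros qdc)
  have de: "(e has_real_derivative - (a * m * k s / q s)) (at s)" if "s \<in> {0<..<U\<^sub>0}" for s
    unfolding e_def using dqd[of s] at[OF that] that by (auto intro!: derivative_eq_intros)
  have e_less: "e t < e s" if "0 \<le> s" "s < t" "t \<le> U\<^sub>0" for s t
  proof (rule DERIV_neg_imp_decreasing_open[OF \<open>s < t\<close>])
    show "\<exists>y. (e has_real_derivative y) (at x) \<and> y < 0" if "s < x" "x < t" for x
    proof (intro exI conjI)
      show "(e has_real_derivative - (a * m * k x / q x)) (at x)"
        using that \<open>0 \<le> s\<close> \<open>t \<le> U\<^sub>0\<close> by (intro de) auto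
      have "q x > 0" using qV[of x] that \<open>0 \<le> s\<close> \<open>t \<le> U\<^sub>0\<close> V by auto
      then show "- (a * m * k x / q x) < 0" using a m kpos[of x] that \<open>0 \<le> s\<close> by auto
    qed
    show "continuous_on {s..t} e" using ec by (rule continuous_on_subset) (use that in auto)
  qed
  have inj: "inj_on e {0..U\<^sub>0}"
    by (rule inj_onI) (metis atLeastAtMost_iff e_less less_irrefl linorder_less_linear)
  have im: "e ` {0..U\<^sub>0} = {0..a}"
  proof (intro equalityI subsetI)
    fix y assume "y \<in> e ` {0..U\<^sub>0}"
    then obtain s where s: "s \<in> {0..U\<^sub>0}" "y = e s" by auto
    have "e s \<le> e 0" using e_less[of 0 s] s by (cases "s = 0") auto
    moreover have "e U\<^sub>0 \<le> e s" using e_less[of s U\<^sub>0] s by (cases "s = U\<^sub>0") auto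
    ultimately show "y \<in> {0..a}" using s e0 by auto
  next
    fix y assume "y \<in> {0..a}"
    then obtain x where "0 \<le> x" "x \<le> U\<^sub>0" "e x = y"
      using IVT2'[of e U\<^sub>0 y 0, OF _ _ _ ec] e0 U by auto
    then show "y \<in> e ` {0..U\<^sub>0}" by auto
  qed
  define g where "g = the_inv_into {0..U\<^sub>0} e"
  have ge: "g (e s) = s" if "s \<in> {0..U\<^sub>0}" for s unfolding g_def by (rule the_inv_into_f_f[OF inj that])
  have eg: "e (g y) = y" if "y \<in> {0..a}" for y
    unfolding g_def by (rule f_the_inv_into_f[OF inj]) (use im that in auto)
  have gin: "g y \<in> {0..U\<^sub>0}" if "y \<in> {0..a}" for y
    unfolding g_def by (rule the_inv_into_into[OF inj]) (use im that in auto)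
  have gc: "continuous_on {0..a} g"
    using continuous_on_inv[OF ec, of g] ge im by auto
  have g0: "g 0 = U\<^sub>0" "g a = 0" using ge[of U\<^sub>0] ge[of 0] e0 U by auto
  have gin': "g y \<in> {0<..<U\<^sub>0}" if "y \<in> {0<..<a}" for y
    using gin[of y] eg[of y] that e0 by (cases "g y = 0"; cases "g y = U\<^sub>0") auto
  \<comment> \<open>The reciprocal of the slope of \<open>e\<close>, simplified by
    \<open>inverse (a * m) = a / 2\<close>. It is finite inside the interval because
    \<open>k\<close> is positive at positive arguments.\<close>
  define fd where "fd = (\<lambda>y. - (a / 2) * q (g y) / k (g y))"
  have qpos: "q (g y) > 0" if "y \<in> {0<..<a}" for y using qV[of "g y"] gin'[OF that] V by auto
  have kgpos: "k (g y) > 0" if "y \<in> {0<..<a}" for y using kpos gin'[OF that] by auto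
  have dg: "(g has_real_derivative fd y) (at y)" if y: "y \<in> {0<..<a}" for y
  proof -
    have "(g has_real_derivative inverse (- (a * m * k (g y) / q (g y)))) (at y)"
    proof (rule DERIV_inverse_function[where a=0 and b=a])
      show "(e has_real_derivative - (a * m * k (g y) / q (g y))) (at (g y))" by (rule de[OF gin'[OF y]])
      show "- (a * m * k (g y) / q (g y)) \<noteq> 0" using a m qpos[OF y] kgpos[OF y] by auto
      show "isCont g y" using gc y by (intro continuous_on_interior[OF gc]) auto
    qed (use y eg in auto)
    moreover have "inverse (- (a * m * k (g y) / q (g y))) = fd y"
    proof -
      have im: "inverse (a * m) = a / 2" using a m by (simp add: field_simps)
      have "inverse (- (a * m * k (g y) / q (g y))) = - (inverse (a * m) * (q (g y) / k (g y)))"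
        by (simp add: divide_inverse)
      then show ?thesis unfolding im fd_def by simp
    qed
    ultimately show ?thesis by simp
  qed
  \<comment> \<open>At \<open>a\<close> the value is \<open>g a = 0\<close>, which makes
    \<open>f\<close> continuous on the closed interval. The constant value on the negative axis
    keeps \<open>f\<close> bounded and Borel on the whole line.\<close>
  define f where "f = (\<lambda>y. if y < 0 then U\<^sub>0 else if y \<le> a then g y else - V\<^sub>0)"
  have fg: "f y = g y" if "y \<in> {0..a}" for y using that by (simp add: f_def)
  have df: "(f has_real_derivative fd y) (at y)" if "y \<in> {0<..<a}" for y
    by (rule deriv_eq_on_open[of "{0<..<a}", OF _ that _ dg[OF that]]) (auto simp: fg)
  have fc: "continuous_on {0..a} f" using continuous_on_cong[of "{0..a}" "{0..a}" f g] gc fg by blast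
  define F where "F = (\<lambda>y. - (a / 2) * q (g y))"
  have Fc: "continuous_on {0..a} F"
    unfolding F_def by (intro continuous_intros continuous_on_compose2[OF qc gc]) (use gin in auto)
  have Fa: "F a = - (a * V\<^sub>0 / 2)" by (simp add: F_def g0 q0)
  have fF: "k (f y) * fd y = F y" if "y \<in> {0<..<a}" for y
    using kgpos[OF that] that by (simp add: fg fd_def F_def)
  have dqg: "((\<lambda>y. q (g y)) has_real_derivative qd (g y) * fd y) (at y)" if "y \<in> {0<..<a}" for y
    using DERIV_chain2[OF _ dg[OF that], of q "qd (g y)"] dq[of "g y"] at[OF gin'[OF that]] gin'[OF that] by auto
  \<comment> \<open>The differential equation of the profile is the chain rule for
    \<open>q (g y)\<close> combined with \<open>a * qd (g y) = y\<close>, which says that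
    \<open>g\<close> inverts \<open>e\<close>.\<close>
  have dF: "(F has_real_derivative - (1/2) * y * fd y) (at y)" if "y \<in> {0<..<a}" for y
  proof -
    have "(F has_real_derivative - (a / 2) * (qd (g y) * fd y)) (at y)"
      unfolding F_def by (intro DERIV_cmult dqg that)
    moreover have "- (a / 2) * (qd (g y) * fd y) = - (1/2) * (a * qd (g y)) * fd y" by simp
    moreover have "a * qd (g y) = y" using eg[of y] that by (simp add: e_def)
    ultimately show ?thesis by metis
  qed
  define fdd where "fdd = (\<lambda>y. - (a / 2) * ((qd (g y) * fd y * k (g y) - q (g y) * (deriv k (g y) * fd y)) / (k (g y) * k (g y))))"
  have dfd: "(fd has_real_derivative fdd y) (at y)" if "y \<in> {0<..<a}" for y
  proof -
    have dkg: "((\<lambda>y. k (g y)) has_real_derivative deriv k (g y) * fd y) (at y)"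
      using DERIV_chain2[OF dk dg[OF that]] by simp
    have "((\<lambda>y. - (a / 2) * (q (g y) / k (g y))) has_real_derivative fdd y) (at y)"
      unfolding fdd_def using kgpos[OF that] by (intro DERIV_cmult DERIV_divide dqg dkg that) auto
    then show ?thesis by (simp add: fd_def)
  qed
  have derivf: "deriv f y = fd y" if "y \<in> {0<..<a}" for y using df[OF that] by (rule DERIV_imp_deriv)
  have d2f: "(deriv f has_real_derivative fdd y) (at y)" if "y \<in> {0<..<a}" for y
    by (rule deriv_eq_on_open[of "{0<..<a}", OF _ that _ dfd[OF that]]) (auto simp: derivf)
  have fpos: "f y > 0" if "y \<in> {0..<a}" for y
    using that gin'[of y] g0 U by (cases "y = 0") (auto simp: fg)
  have prof: "self_similar_profile \<phi> U\<^sub>0 V\<^sub>0 a f"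
    unfolding self_similar_profile_def
  proof (intro conjI ballI allI impI)
    show "continuous_on {0..<a} f" using fc by (rule continuous_on_subset) auto
    show "C2_on {0<..<a} f"
      unfolding C2_on_def
    proof (intro conjI ballI)
      show "f differentiable at x" "deriv f differentiable at x" if "x \<in> {0<..<a}" for x
        using df[OF that] d2f[OF that] real_differentiable_def by blast+
      have gc': "continuous_on {0<..<a} g" using gc by (rule continuous_on_subset) auto
      have 1: "continuous_on {0<..<a} (\<lambda>y. q (g y))" "continuous_on {0<..<a} (\<lambda>y. qd (g y))"
        "continuous_on {0<..<a} (\<lambda>y. k (g y))" "continuous_on {0<..<a} (\<lambda>y. deriv k (g y))"
        by (rule continuous_on_compose2[OF qc gc'] continuous_on_compose2[OF qdc gc']
            continuous_on_compose2[OF kc[of UNIV] gc'] continuous_on_compose2[OF k'c[of UNIV] gc'];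
            use gin in auto)+
      have k0: "\<And>y. y \<in> {0<..<a} \<Longrightarrow> k (g y) \<noteq> 0" using kgpos by force
      have "continuous_on {0<..<a} fd"
        unfolding fd_def by (intro continuous_intros 1) (use k0 in auto)
      then have "continuous_on {0<..<a} fdd"
        unfolding fdd_def by (intro continuous_intros 1) (use k0 in auto)
      moreover have "deriv (deriv f) y = fdd y" if "y \<in> {0<..<a}" for y
        using d2f[OF that] by (rule DERIV_imp_deriv)
      ultimately show "continuous_on {0<..<a} (deriv (deriv f))"
        using continuous_on_cong[of "{0<..<a}" "{0<..<a}" "deriv (deriv f)" fdd] by blast
    qed
    show "- (1/2) * y * deriv f y = deriv (\<lambda>y. deriv \<phi> (f y) * deriv f y) y" if "y \<in> {0<..<a}" for y
    proof -
      have "((\<lambda>y. deriv \<phi> (f y) * deriv f y) has_real_derivative - (1/2) * y * fd y) (at y)"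
        by (rule deriv_eq_on_open[of "{0<..<a}", OF _ that _ dF[OF that]])
           (auto simp: derivf fF k_def[symmetric])
      then show ?thesis using derivf[OF that] by (simp add: DERIV_imp_deriv)
    qed
    show "f 0 = U\<^sub>0" using a g0 by (simp add: fg)
    have lim: "(h \<longlongrightarrow> h a) (at_left a)" if "continuous_on {0..a} h" for h :: "real \<Rightarrow> real"
    proof -
      have "(h \<longlongrightarrow> h a) (at a within {0..a})" using that a by (auto simp: continuous_on_def)
      then show ?thesis using a by (simp add: at_within_Icc_at_left)
    qed
    show "(f \<longlongrightarrow> 0) (at_left a)" using lim[OF fc] a g0 by (simp add: fg)
    have "(F \<longlongrightarrow> - (a * V\<^sub>0 / 2)) (at_left a)" using lim[OF Fc] by (simp add: Fa)
    moreover have "\<forall>\<^sub>F y in at_left a. F y = deriv \<phi> (f y) * deriv f y"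
      using a unfolding eventually_at_left_field
      by (intro exI[of _ 0]) (auto simp: derivf fF[symmetric] k_def)
    ultimately show "((\<lambda>y. deriv \<phi> (f y) * deriv f y) \<longlongrightarrow> - (a * V\<^sub>0 / 2)) (at_left a)"
      by (rule Lim_transform_eventually)
  qed (use fpos a in \<open>auto simp: f_def\<close>)
  show ?thesis
    by (rule that[of a f F fd])
       (use a fc fg g0 fpos Fc Fa df fF dF prof gin in \<open>auto simp: k_def[symmetric] f_def\<close>)
qed

subsection \<open>Integration over the strip\<close>

lemma lborel2_integral_snd:
  fixes h :: "real \<times> real \<Rightarrow> real"
  assumes "integrable lborel h"
  shows "(LINT t|lborel. LINT x|lborel. h (x, t)) = (LINT p|lborel. h p)"
    "integrable lborel (\<lambda>t. LINT x|lborel. h (x, t))"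
    "AE t in lborel. integrable lborel (\<lambda>x. h (x, t))"
proof -
  have i: "integrable (lborel \<Otimes>\<^sub>M lborel) (\<lambda>(x, t). h (x, t))" using assms by (simp add: lborel_prod)
  show "(LINT t|lborel. LINT x|lborel. h (x, t)) = (LINT p|lborel. h p)"
    using lborel_pair.integral_snd[OF i] by (simp add: lborel_prod)
  show "integrable lborel (\<lambda>t. LINT x|lborel. h (x, t))"
    "AE t in lborel. integrable lborel (\<lambda>x. h (x, t))"
    using lborel_pair.integrable_snd[OF i] lborel_pair.AE_integrable_snd[OF i] by auto
qed

lemma lborel2_integral_fst:
  fixes h :: "real \<times> real \<Rightarrow> real"
  assumes "integrable lborel h"
  shows "(LINT x|lborel. LINT t|lborel. h (x, t)) = (LINT p|lborel. h p)"
    "integrable lborel (\<lambda>x. LINT t|lborel. h (x, t))"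
    "AE x in lborel. integrable lborel (\<lambda>t. h (x, t))"
proof -
  have i: "integrable (lborel \<Otimes>\<^sub>M lborel) (\<lambda>(x, t). h (x, t))" using assms by (simp add: lborel_prod)
  show "(LINT x|lborel. LINT t|lborel. h (x, t)) = (LINT p|lborel. h p)"
    using lborel_pair.integral_fst[OF i] by (simp add: lborel_prod)
  show "integrable lborel (\<lambda>x. LINT t|lborel. h (x, t))"
    "AE x in lborel. integrable lborel (\<lambda>t. h (x, t))"
    using lborel_pair.integrable_fst[OF i] lborel_pair.AE_integrable_fst[OF i] by auto
qed

lemma lborel2_nn_integral_snd:
  fixes h :: "real \<times> real \<Rightarrow> ennreal"
  assumes "h \<in> borel_measurable borel"
  shows "(\<integral>\<^sup>+ t. (\<integral>\<^sup>+ x. h (x, t) \<partial>lborel) \<partial>lborel) = (\<integral>\<^sup>+ p. h p \<partial>lborel)"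
  using lborel_pair.nn_integral_snd[of h] assms by (simp add: lborel_prod)

lemma lborel2_measurable_section [measurable (raw)]:
  fixes h :: "real \<times> real \<Rightarrow> 'b::{second_countable_topology, t2_space}"
  assumes "h \<in> borel_measurable borel"
  shows "(\<lambda>x. h (x, t)) \<in> borel_measurable borel" "(\<lambda>t. h (x, t)) \<in> borel_measurable borel"
  using assms by (auto intro!: measurable_compose[OF _ assms] borel_measurable_continuous_onI continuous_intros)

text \<open>Fubini's theorem for null sets. Since \<open>P\<close> may be non-measurable, the
  argument passes to a null set \<open>N\<close> of \<open>lborel\<close> that covers its
  exceptions.\<close>

lemma AE_lborel2_sections:
  assumes "AE p in lborel. P (p :: real \<times> real)"
  shows "AE t in lborel. AE x in lborel. P (x, t)" "AE x in lborel. AE t in lborel. P (x, t)"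
proof -
  obtain N where N: "N \<in> null_sets lborel" "{p. \<not> P p} \<subseteq> N"
    using assms unfolding eventually_ae_filter by auto
  have ae: "AE p in lborel \<Otimes>\<^sub>M lborel. p \<notin> N"
    unfolding lborel_prod using N(1) by (rule AE_not_in)
  have m: "{p \<in> space (lborel \<Otimes>\<^sub>M lborel). (fst p, snd p) \<notin> N} \<in> sets (lborel \<Otimes>\<^sub>M lborel)"
  proof -
    have "{p \<in> space (lborel \<Otimes>\<^sub>M lborel). (fst p, snd p) \<notin> N} = space lborel - N"
      by (auto simp: lborel_prod)
    moreover have "space lborel - N \<in> sets lborel" using null_setsD2[OF N(1)] by (rule sets.compl_sets)
    ultimately show ?thesis by (simp only: lborel_prod)
  qed
  have 1: "AE x in lborel. AE t in lborel. (x, t) \<notin> N"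
    using lborel_pair.AE_pair[OF ae] by simp
  have 2: "AE t in lborel. AE x in lborel. (x, t) \<notin> N"
    using lborel_pair.AE_commute[of "\<lambda>x t. (x, t) \<notin> N"] m 1 by simp
  have imp: "(x, t) \<notin> N \<Longrightarrow> P (x, t)" for x t using N(2) by blast
  show "AE t in lborel. AE x in lborel. P (x, t)"
    using 2 by (rule eventually_mono) (erule eventually_mono, rule imp)
  show "AE x in lborel. AE t in lborel. P (x, t)"
    using 1 by (rule eventually_mono) (erule eventually_mono, rule imp)
qed

lemma sets_strip: "strip T \<in> sets borel" "strip T \<in> sets lebesgue"
proof -
  show "strip T \<in> sets borel" unfolding strip_def
    by (simp add: borel_Times)
  then show "strip T \<in> sets lebesgue" by simp
qed

lemma integral_lebesgue_on_borel:
  fixes f :: "'a::euclidean_space \<Rightarrow> real"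
  assumes "S \<in> sets lebesgue" "(\<lambda>x. indicator S x * f x) \<in> borel_measurable borel"
  shows "integral\<^sup>L (lebesgue_on S) f = (LINT x|lborel. indicator S x * f x)"
    "integrable (lebesgue_on S) f \<longleftrightarrow> integrable lborel (\<lambda>x. indicator S x * f x)"
  using assms by (simp_all add: integral_lebesgue_on_eq integrable_lebesgue_on_iff integral_completion integrable_completion)

lemma FTC_lborel:
  fixes g G :: "real \<Rightarrow> real"
  assumes "a \<le> b" "continuous_on {a..b} G" "\<And>x. x \<in> {a<..<b} \<Longrightarrow> (G has_real_derivative g x) (at x)"
    and i: "integrable lborel (\<lambda>x. indicator {a..b} x * g x)"
  shows "(LINT x|lborel. indicator {a..b} x * g x) = G b - G a"
proof -
  have "(g has_integral (G b - G a)) {a..b}"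
    using assms by (intro fundamental_theorem_of_calculus_interior)
      (auto simp: has_real_derivative_iff_has_vector_derivative[symmetric])
  then have "((\<lambda>x. if x \<in> {a..b} then g x else 0) has_integral (G b - G a)) UNIV"
    by (simp only: has_integral_restrict_UNIV)
  moreover have "(\<lambda>x. if x \<in> {a..b} then g x else 0) = (\<lambda>x. indicator {a..b} x * g x)"
    by (auto simp: indicator_def)
  ultimately show ?thesis using has_integral_integral_lborel[OF i] by (metis has_integral_unique)
qed

lemma nn_integral_inverse_sqrt:
  assumes "c \<ge> 0" "T > 0"
  shows "(\<integral>\<^sup>+ t. ennreal (indicator {0<..<T} t * (c / sqrt t)) \<partial>lborel) < \<infinity>"
proof -
  have "((\<lambda>t. c / sqrt t) has_integral (2 * c * sqrt T - 2 * c * sqrt 0)) {0..T}"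
    using assms
    by (intro fundamental_theorem_of_calculus_interior)
       (auto simp: has_real_derivative_iff_has_vector_derivative[symmetric] field_simps
         intro!: derivative_eq_intros continuous_intros)
  then have "((\<lambda>t. c / sqrt t) has_integral (2 * c * sqrt T)) {0<..<T}"
    by (subst has_integral_Icc_iff_Ioo[symmetric]) simp
  then have "((\<lambda>t. if t \<in> {0<..<T} then c / sqrt t else 0) has_integral (2 * c * sqrt T)) UNIV"
    by (simp only: has_integral_restrict_UNIV)
  moreover have "(\<lambda>t. if t \<in> {0<..<T} then c / sqrt t else 0) = (\<lambda>t. indicator {0<..<T} t * (c / sqrt t))"
    by (auto simp: indicator_def)
  ultimately have "(\<integral>\<^sup>+ t. ennreal (indicator {0<..<T} t * (c / sqrt t)) \<partial>lborel) = ennreal (2 * c * sqrt T)"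
    using assms by (intro nn_integral_has_integral_lborel) (auto simp: indicator_def)
  then show ?thesis by simp
qed

text \<open>The part of the strip up to and including the free boundary; in the similarity variable
  it is the closed interval from 0 to \<open>a\<close>, on which profile and flux are
  continuous.\<close>

definition wet_region :: "real \<Rightarrow> real \<Rightarrow> (real \<times> real) set" where
  "wet_region a T = {(x, t). 0 \<le> x \<and> x \<le> a * sqrt t \<and> 0 < t \<and> t < T}"

lemma sets_wet_region: "wet_region a T \<in> sets borel"
proof -
  have "wet_region a T = {p \<in> space borel. 0 \<le> fst p \<and> fst p \<le> a * sqrt (snd p) \<and> 0 < snd p \<and> snd p < T}"
    by (auto simp: wet_region_def)
  also have "\<dots> \<in> sets borel"
    unfolding borel_prod[symmetric] by measurable
  finally show ?thesis .
qed

text \<open>The bound \<open>c / t\<close> is not integrable in time by itself, but the slice at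
  time \<open>t\<close> has length \<open>a * sqrt t\<close>, which leaves the integrable
  \<open>a * c / sqrt t\<close>.\<close>

lemma integrable_on_wet_region:
  fixes h :: "real \<times> real \<Rightarrow> real"
  assumes h: "h \<in> borel_measurable borel" and b: "\<And>x t. \<bar>h (x, t)\<bar> \<le> indicator (wet_region a T) (x, t) * (c / t)"
    and c: "c \<ge> 0" and a: "a \<ge> 0" and T: "T > 0"
  shows "integrable lborel h"
proof (rule integrableI_bounded)
  show "h \<in> borel_measurable lborel" using h by simp
  have m: "(\<lambda>p. indicator (wet_region a T) p * (c / snd p) :: real) \<in> borel_measurable borel"
  proof (intro borel_measurable_times borel_measurable_indicator sets_wet_region)
    have "(\<lambda>p :: real \<times> real. c / snd p) \<in> borel_measurable (borel \<Otimes>\<^sub>M borel)" by measurable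
    then show "(\<lambda>p :: real \<times> real. c / snd p) \<in> borel_measurable borel" by (simp only: borel_prod)
  qed
  have "(\<integral>\<^sup>+ p. ennreal (norm (h p)) \<partial>lborel) \<le> (\<integral>\<^sup>+ p. ennreal (indicator (wet_region a T) p * (c / snd p)) \<partial>lborel)"
    using b by (intro nn_integral_mono ennreal_leI) auto
  also have "\<dots> = (\<integral>\<^sup>+ t. (\<integral>\<^sup>+ x. ennreal (indicator (wet_region a T) (x, t) * (c / t)) \<partial>lborel) \<partial>lborel)"
    using m by (subst lborel2_nn_integral_snd[symmetric]) auto
  also have "\<dots> \<le> (\<integral>\<^sup>+ t. ennreal (indicator {0<..<T} t * (a * c / sqrt t)) \<partial>lborel)"
  proof (rule nn_integral_mono)
    fix t
    show "(\<integral>\<^sup>+ x. ennreal (indicator (wet_region a T) (x, t) * (c / t)) \<partial>lborel) \<le> ennreal (indicator {0<..<T} t * (a * c / sqrt t))"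
    proof (cases "0 < t \<and> t < T")
      case True
      have "(\<integral>\<^sup>+ x. ennreal (indicator (wet_region a T) (x, t) * (c / t)) \<partial>lborel)
          = (\<integral>\<^sup>+ x. ennreal (c / t) * indicator {0..a * sqrt t} x \<partial>lborel)"
        using True by (intro nn_integral_cong) (auto simp: wet_region_def indicator_def)
      also have "\<dots> = ennreal (c / t) * ennreal (a * sqrt t)"
        using True a by (subst nn_integral_cmult_indicator) auto
      also have "\<dots> = ennreal (c / t * (a * sqrt t))"
        using True a c by (intro ennreal_mult[symmetric]) auto
      also have "c / t * (a * sqrt t) = indicator {0<..<T} t * (a * c / sqrt t)"
        using True real_sqrt_mult_self[of t] by (simp add: field_simps)
      finally show ?thesis by simp
    next
      case False
      then have "indicator (wet_region a T) (x, t) = (0::real)" for x by (auto simp: wet_region_def indicator_def)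
      then show ?thesis by simp
    qed
  qed
  also have "\<dots> < \<infinity>" using a c T by (intro nn_integral_inverse_sqrt) auto
  finally show "(\<integral>\<^sup>+ p. ennreal (norm (h p)) \<partial>lborel) < \<infinity>" .
qed

subsection \<open>Test functions\<close>

text \<open>One-sided derivatives on the closed domain suffice along any curve that stays inside it.
  The curves needed are horizontal and vertical lines and the similarity curves
  \<open>x = sqrt t * \<eta>\<close>.\<close>

lemma test_function_chain:
  assumes tf: "test_function T \<xi> \<xi>x \<xi>t" and s: "s \<in> I"
    and p1: "(p1 has_real_derivative d1) (at s within I)" and p2: "(p2 has_real_derivative d2) (at s within I)"
    and I: "\<And>r. r \<in> I \<Longrightarrow> p1 r \<ge> 0" "\<And>r. r \<in> I \<Longrightarrow> p2 r \<in> {0..T}"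
  shows "((\<lambda>r. \<xi> (p1 r, p2 r)) has_real_derivative \<xi>x (p1 s, p2 s) * d1 + \<xi>t (p1 s, p2 s) * d2) (at s within I)"
proof -
  let ?D = "{0..} \<times> {0..T}" and ?p = "(p1 s, p2 s)"
  have "(\<xi> has_derivative (\<lambda>(h, k). \<xi>x ?p * h + \<xi>t ?p * k)) (at ?p within ?D)"
    using tf I s by (auto simp: test_function_def)
  then have 1: "(\<xi> has_derivative (\<lambda>(h, k). \<xi>x ?p * h + \<xi>t ?p * k)) (at ?p within (\<lambda>r. (p1 r, p2 r)) ` I)"
    by (rule has_derivative_subset) (use I in auto)
  have 2: "((\<lambda>r. (p1 r, p2 r)) has_derivative (\<lambda>h. (d1 * h, d2 * h))) (at s within I)"
    using p1 p2 by (intro has_derivative_Pair) (auto simp: has_field_derivative_def)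
  have "((*) (\<xi>x ?p * d1 + \<xi>t ?p * d2)) = (\<lambda>h. case (d1 * h, d2 * h) of (h, k) \<Rightarrow> \<xi>x ?p * h + \<xi>t ?p * k)"
    by (auto simp: algebra_simps)
  with has_derivative_in_compose[OF 2 1] show ?thesis
    by (simp only: has_field_derivative_def)
qed

lemma test_function_dx:
  assumes "test_function T \<xi> \<xi>x \<xi>t" "x \<in> I" "\<And>r. r \<in> I \<Longrightarrow> r \<ge> 0" "t \<in> {0..T}"
  shows "((\<lambda>r. \<xi> (r, t)) has_real_derivative \<xi>x (x, t)) (at x within I)"
  using test_function_chain[OF assms(1,2) DERIV_ident DERIV_const[of t], OF assms(3,4)] by simp

lemma test_function_dt:
  assumes "test_function T \<xi> \<xi>x \<xi>t" "t \<in> I" "\<And>r. r \<in> I \<Longrightarrow> r \<in> {0..T}" "x \<ge> 0"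
  shows "((\<lambda>r. \<xi> (x, r)) has_real_derivative \<xi>t (x, t)) (at t within I)"
  using test_function_chain[OF assms(1,2) DERIV_const[of x] DERIV_ident, OF assms(4,3)] by simp

text \<open>The last bound comes from the vanishing of \<xi> at \<open>x = 0\<close> and the mean
  value theorem. It compensates the factor \<open>1 / sqrt t\<close> that appears along similarity
  curves as \<open>t\<close> tends to 0.\<close>

lemma test_function_bounds:
  assumes tf: "test_function T \<xi> \<xi>x \<xi>t" and T: "T > 0"
  obtains J C where "J > 0" "C > 0" "\<forall>x t. x > J \<longrightarrow> t \<in> {0..T} \<longrightarrow> \<xi> (x, t) = 0"
    "\<forall>x t. x > J \<longrightarrow> t \<in> {0<..<T} \<longrightarrow> \<xi>x (x, t) = 0"
    "\<forall>x t. x > J \<longrightarrow> t \<in> {0<..<T} \<longrightarrow> \<xi>t (x, t) = 0"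
    "\<forall>x t. x \<ge> 0 \<longrightarrow> t \<in> {0<..<T} \<longrightarrow> \<bar>\<xi>x (x, t)\<bar> \<le> C"
    "\<forall>x t. x \<ge> 0 \<longrightarrow> t \<in> {0<..<T} \<longrightarrow> \<bar>\<xi>t (x, t)\<bar> \<le> C"
    "\<forall>x t. x \<ge> 0 \<longrightarrow> t \<in> {0<..<T} \<longrightarrow> \<bar>\<xi> (x, t)\<bar> \<le> C * x"
proof -
  let ?D = "{0..} \<times> {0..T} :: (real \<times> real) set"
  obtain J where J: "J > 0" "closure {p \<in> ?D. \<xi> p \<noteq> 0} \<subseteq> {0..J} \<times> {0..T}"
    using tf unfolding test_function_def by blast
  have z: "\<xi> (x, t) = 0" if "x > J" "t \<in> {0..T}" for x t
  proof (rule ccontr)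
    assume "\<xi> (x, t) \<noteq> 0"
    then have "(x, t) \<in> {p \<in> ?D. \<xi> p \<noteq> 0}" using that J(1) by auto
    then have "(x, t) \<in> {0..J} \<times> {0..T}" using J(2) closure_subset[of "{p \<in> ?D. \<xi> p \<noteq> 0}"] by (meson subsetD)
    then show False using that by auto
  qed
  have zx: "\<xi>x (x, t) = 0" if xt: "x > J" "t \<in> {0<..<T}" for x t
  proof -
    have "((\<lambda>r. \<xi> (r, t)) has_real_derivative \<xi>x (x, t)) (at x within {J<..})"
      using xt J(1) by (intro test_function_dx[OF tf]) auto
    then have "((\<lambda>r. \<xi> (r, t)) has_real_derivative \<xi>x (x, t)) (at x)"
      using xt by (simp add: at_within_open[of x "{J<..}"])
    moreover have "((\<lambda>r. \<xi> (r, t)) has_real_derivative 0) (at x)"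
      by (rule deriv_eq_on_open[of "{J<..}" x _ "\<lambda>_. 0"]) (use xt z in auto)
    ultimately show ?thesis by (rule DERIV_unique)
  qed
  have zt: "\<xi>t (x, t) = 0" if xt: "x > J" "t \<in> {0<..<T}" for x t
  proof -
    have "((\<lambda>r. \<xi> (x, r)) has_real_derivative \<xi>t (x, t)) (at t within {0<..<T})"
      using xt J(1) by (intro test_function_dt[OF tf]) auto
    then have "((\<lambda>r. \<xi> (x, r)) has_real_derivative \<xi>t (x, t)) (at t)"
      using xt by (simp add: at_within_open[of t "{0<..<T}"])
    moreover have "((\<lambda>r. \<xi> (x, r)) has_real_derivative 0) (at t)"
      by (rule deriv_eq_on_open[of "{0<..<T}" t _ "\<lambda>_. 0"]) (use xt z in auto)
    ultimately show ?thesis by (rule DERIV_unique)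
  qed
  have bd: "\<exists>C>0. \<forall>p\<in>{0..J} \<times> {0..T}. \<bar>g p\<bar> \<le> C" if "continuous_on ?D g" for g :: "real \<times> real \<Rightarrow> real"
  proof -
    have "compact ({0..J} \<times> {0..T})" by (intro compact_Times) auto
    moreover have "continuous_on ({0..J} \<times> {0..T}) g" using that by (rule continuous_on_subset) auto
    ultimately have "compact (g ` ({0..J} \<times> {0..T}))" by (intro compact_continuous_image)
    then obtain C where "C > 0" "\<forall>y\<in>g ` ({0..J} \<times> {0..T}). norm y \<le> C"
      using compact_imp_bounded bounded_pos by metis
    then show ?thesis by auto
  qed
  have cx: "continuous_on ?D \<xi>x" and ct: "continuous_on ?D \<xi>t"
    and bd0: "\<And>t. t \<in> {0<..<T} \<Longrightarrow> \<xi> (0, t) = 0"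
    using tf unfolding test_function_def by blast+
  obtain C1 where C1: "C1 > 0" "\<forall>p\<in>{0..J} \<times> {0..T}. \<bar>\<xi>x p\<bar> \<le> C1" using bd[OF cx] by blast
  obtain C2 where C2: "C2 > 0" "\<forall>p\<in>{0..J} \<times> {0..T}. \<bar>\<xi>t p\<bar> \<le> C2" using bd[OF ct] by blast
  define C where "C = C1 + C2"
  have bx: "\<bar>\<xi>x (x, t)\<bar> \<le> C" if "x \<ge> 0" "t \<in> {0<..<T}" for x t
  proof (cases "x \<le> J")
    case True
    then have "(x, t) \<in> {0..J} \<times> {0..T}" using that by auto
    then have "\<bar>\<xi>x (x, t)\<bar> \<le> C1" using C1(2) by blast
    then show ?thesis using C1(1) C2(1) by (simp add: C_def)
  next
    case False
    then show ?thesis using zx[of x t] that C1(1) C2(1) by (simp add: C_def)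
  qed
  have bt: "\<bar>\<xi>t (x, t)\<bar> \<le> C" if "x \<ge> 0" "t \<in> {0<..<T}" for x t
  proof (cases "x \<le> J")
    case True
    then have "(x, t) \<in> {0..J} \<times> {0..T}" using that by auto
    then have "\<bar>\<xi>t (x, t)\<bar> \<le> C2" using C2(2) by blast
    then show ?thesis using C1(1) C2(1) by (simp add: C_def)
  next
    case False
    then show ?thesis using zt[of x t] that C1(1) C2(1) by (simp add: C_def)
  qed
  have b: "\<bar>\<xi> (x, t)\<bar> \<le> C * x" if xt: "x \<ge> 0" "t \<in> {0<..<T}" for x t
  proof -
    have d: "((\<lambda>r. \<xi> (r, t)) has_real_derivative \<xi>x (y, t)) (at y within {0..x})" if "y \<in> {0..x}" for y
      using xt that by (intro test_function_dx[OF tf]) auto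
    have "norm (\<xi> (x, t) - \<xi> (0, t)) \<le> C * norm (x - 0)"
      by (rule field_differentiable_bound[OF _ d]) (use bx xt in auto)
    moreover have "\<xi> (0, t) = 0" using bd0 xt by blast
    ultimately show ?thesis using xt by simp
  qed
  have C: "C > 0" using C1 C2 by (simp add: C_def)
  show ?thesis
    by (rule that[OF J(1) C]; intro allI impI; rule z zx zt bx bt b; assumption)
qed

lemma FTC_lborel_open:
  fixes g G :: "real \<Rightarrow> real"
  assumes "a \<le> b" "continuous_on {a..b} G" "\<And>x. x \<in> {a<..<b} \<Longrightarrow> (G has_real_derivative g x) (at x)"
    and i: "integrable lborel (\<lambda>x. indicator {a<..<b} x * g x)"
  shows "(LINT x|lborel. indicator {a<..<b} x * g x) = G b - G a"
proof -
  have e: "(\<lambda>x. indicator {a..b} x * (indicator {a<..<b} x * g x)) = (\<lambda>x. indicator {a<..<b} x * g x)"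
    by (auto simp: indicator_def)
  have "(LINT x|lborel. indicator {a..b} x * (indicator {a<..<b} x * g x)) = G b - G a"
    by (rule FTC_lborel) (use assms e in \<open>auto simp: indicator_def\<close>)
  then show ?thesis unfolding e .
qed

lemma integrable_lborel_Icc:
  fixes f :: "real \<Rightarrow> real"
  assumes "continuous_on {a..b} f"
  shows "integrable lborel (\<lambda>x. indicator {a..b} x * f x)"
  using borel_integrable_atLeastAtMost'[OF assms] by (simp add: set_integrable_def)

lemma integrable_lborel_bounded_support:
  fixes h :: "real \<times> real \<Rightarrow> real"
  assumes "h \<in> borel_measurable borel" "\<And>p. \<bar>h p\<bar> \<le> C * indicator (cbox u v) p"
  shows "integrable lborel h"
proof (rule Bochner_Integration.integrable_bound)
  show "integrable lborel (\<lambda>p. C * indicator (cbox u v) p :: real)"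
    by (intro integrable_mult_right integrable_real_indicator emeasure_lborel_cbox_finite) auto
qed (use assms in \<open>auto intro!: AE_I2 intro: order_trans[OF _ abs_ge_self]\<close>)

lemma test_function_integrable:
  assumes tf: "test_function T \<xi> \<xi>x \<xi>t" and T: "T > 0"
  shows "(\<lambda>p. indicator (strip T) p * \<xi>t p) \<in> borel_measurable borel" "integrable lborel (\<lambda>p. indicator (strip T) p * \<xi>t p)"
    "(\<lambda>p. indicator (strip T) p * \<xi>x p) \<in> borel_measurable borel" "integrable lborel (\<lambda>p. (indicator (strip T) p * \<xi>x p)\<^sup>2)"
proof -
  let ?D = "{0..} \<times> {0..T} :: (real \<times> real) set"
  obtain J C where J: "J > 0" and C: "C > 0"
    and "\<forall>x t. x > J \<longrightarrow> t \<in> {0..T} \<longrightarrow> \<xi> (x, t) = 0"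
    and zx: "\<forall>x t. x > J \<longrightarrow> t \<in> {0<..<T} \<longrightarrow> \<xi>x (x, t) = 0"
    and zt: "\<forall>x t. x > J \<longrightarrow> t \<in> {0<..<T} \<longrightarrow> \<xi>t (x, t) = 0"
    and bx: "\<forall>x t. x \<ge> 0 \<longrightarrow> t \<in> {0<..<T} \<longrightarrow> \<bar>\<xi>x (x, t)\<bar> \<le> C"
    and bt: "\<forall>x t. x \<ge> 0 \<longrightarrow> t \<in> {0<..<T} \<longrightarrow> \<bar>\<xi>t (x, t)\<bar> \<le> C"
    and "\<forall>x t. x \<ge> 0 \<longrightarrow> t \<in> {0<..<T} \<longrightarrow> \<bar>\<xi> (x, t)\<bar> \<le> C * x"
    by (rule test_function_bounds[OF tf T])
  have cx: "continuous_on ?D \<xi>x" and ct: "continuous_on ?D \<xi>t"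
    using tf unfolding test_function_def by blast+
  have stD: "strip T \<subseteq> ?D" by (auto simp: strip_def)
  have mt: "(\<lambda>p. indicator (strip T) p * \<xi>t p) \<in> borel_measurable borel"
    using borel_measurable_continuous_on_indicator[OF sets_strip(1) continuous_on_subset[OF ct stD]] by simp
  have mx: "(\<lambda>p. indicator (strip T) p * \<xi>x p) \<in> borel_measurable borel"
    using borel_measurable_continuous_on_indicator[OF sets_strip(1) continuous_on_subset[OF cx stD]] by simp
  have b: "\<bar>indicator (strip T) p * h p\<bar> \<le> C * indicator (cbox (0, 0) (J, T)) p"
    if bh: "\<forall>x t. x \<ge> 0 \<longrightarrow> t \<in> {0<..<T} \<longrightarrow> \<bar>h (x, t)\<bar> \<le> C" and zh: "\<forall>x t. x > J \<longrightarrow> t \<in> {0<..<T} \<longrightarrow> h (x, t) = 0"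
    for h :: "real \<times> real \<Rightarrow> real" and p
  proof (cases "p \<in> strip T")
    case True
    then obtain x t where p: "p = (x, t)" "x \<ge> 0" "t \<in> {0<..<T}" by (auto simp: strip_def)
    show ?thesis
    proof (cases "x \<le> J")
      case True
      then have "p \<in> cbox (0, 0) (J, T)" using p by auto
      then show ?thesis using bh p \<open>p \<in> strip T\<close> by simp
    next
      case False
      then have "h p = 0" using zh p by auto
      then show ?thesis using C by simp
    qed
  qed (use C in simp)
  show "(\<lambda>p. indicator (strip T) p * \<xi>t p) \<in> borel_measurable borel" by (rule mt)
  show "integrable lborel (\<lambda>p. indicator (strip T) p * \<xi>t p)"
    by (rule integrable_lborel_bounded_support[OF mt b[OF bt zt]])
  show "(\<lambda>p. indicator (strip T) p * \<xi>x p) \<in> borel_measurable borel" by (rule mx)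
  show "integrable lborel (\<lambda>p. (indicator (strip T) p * \<xi>x p)\<^sup>2)"
  proof (rule integrable_lborel_bounded_support[OF borel_measurable_power[OF mx]])
    fix p
    have "\<bar>indicator (strip T) p * \<xi>x p\<bar>\<^sup>2 \<le> (C * indicator (cbox (0, 0) (J, T)) p)\<^sup>2"
      by (rule power_mono[OF b[OF bx zx]]) simp
    then show "\<bar>(indicator (strip T) p * \<xi>x p)\<^sup>2\<bar> \<le> C\<^sup>2 * indicator (cbox (0, 0) (J, T)) p"
      by (auto simp: indicator_def)
  qed
qed

lemma weak_identity:
  fixes \<xi> \<xi>x \<xi>t w v :: "real \<times> real \<Rightarrow> real" and f F fd :: "real \<Rightarrow> real"
  assumes tf: "test_function T \<xi> \<xi>x \<xi>t" and T: "T > 0" and a: "a > 0"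
    and fc: "continuous_on {0..a} f" and Fc: "continuous_on {0..a} F"
    and fa: "f a = 0" and Fa: "F a = - (a * V / 2)"
    and df: "\<And>\<eta>. \<eta> \<in> {0<..<a} \<Longrightarrow> (f has_real_derivative fd \<eta>) (at \<eta>)"
    and dF: "\<And>\<eta>. \<eta> \<in> {0<..<a} \<Longrightarrow> (F has_real_derivative - (1/2) * \<eta> * fd \<eta>) (at \<eta>)"
    and w: "\<And>x t. 0 \<le> x \<Longrightarrow> 0 < t \<Longrightarrow> t < T \<Longrightarrow> w (x, t) = (if x \<le> a * sqrt t then f (x / sqrt t) else - V)"
    and v: "\<And>x t. 0 \<le> x \<Longrightarrow> 0 < t \<Longrightarrow> t < T \<Longrightarrow> v (x, t) = (if x \<le> a * sqrt t then F (x / sqrt t) / sqrt t else 0)"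
  shows "(LINT x|lebesgue_on {0<..}. - V * \<xi> (x, 0)) + (LINT p|lebesgue_on (strip T). w p * \<xi>t p)
           = (LINT p|lebesgue_on (strip T). v p * \<xi>x p)"
proof -
  let ?D = "{0..} \<times> {0..T} :: (real \<times> real) set" and ?S = "wet_region a T"
  obtain J C where J: "J > 0" and C: "C > 0"
    and "\<forall>x t. x > J \<longrightarrow> t \<in> {0..T} \<longrightarrow> \<xi> (x, t) = 0"
    and "\<forall>x t. x > J \<longrightarrow> t \<in> {0<..<T} \<longrightarrow> \<xi>x (x, t) = 0"
    and "\<forall>x t. x > J \<longrightarrow> t \<in> {0<..<T} \<longrightarrow> \<xi>t (x, t) = 0"
    and bx': "\<forall>x t. x \<ge> 0 \<longrightarrow> t \<in> {0<..<T} \<longrightarrow> \<bar>\<xi>x (x, t)\<bar> \<le> C"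
    and bt': "\<forall>x t. x \<ge> 0 \<longrightarrow> t \<in> {0<..<T} \<longrightarrow> \<bar>\<xi>t (x, t)\<bar> \<le> C"
    and b': "\<forall>x t. x \<ge> 0 \<longrightarrow> t \<in> {0<..<T} \<longrightarrow> \<bar>\<xi> (x, t)\<bar> \<le> C * x"
    by (rule test_function_bounds[OF tf T])
  note bx = bx'[rule_format] and bt = bt'[rule_format] and b = b'[rule_format]
  have cx: "continuous_on ?D \<xi>x" and ct: "continuous_on ?D \<xi>t"
    and bd0: "\<And>t. t \<in> {0<..<T} \<Longrightarrow> \<xi> (0, t) = 0" and bdT: "\<And>x. x \<ge> 0 \<Longrightarrow> \<xi> (x, T) = 0"
    and dxi: "\<And>p. p \<in> ?D \<Longrightarrow> (\<xi> has_derivative (\<lambda>(h, k). \<xi>x p * h + \<xi>t p * k)) (at p within ?D)"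
    using tf unfolding test_function_def by blast+
  have c: "continuous_on ?D \<xi>" using dxi by (rule has_derivative_continuous_on)
  have SD: "?S \<subseteq> ?D" by (auto simp: wet_region_def)
  \<comment> \<open>The profile above the background value \<open>- V\<close>; this part of
    \<open>w\<close> lives on the wet region only.\<close>
  define g where "g = (\<lambda>\<eta>. f \<eta> + V)"
  have gc: "continuous_on {0..a} g" unfolding g_def by (intro continuous_intros fc)
  obtain G where G: "G > 0" "\<And>\<eta>. \<eta> \<in> {0..a} \<Longrightarrow> \<bar>g \<eta>\<bar> \<le> G" using continuous_bounded_Icc[OF gc] by blast
  obtain B where B: "B > 0" "\<And>\<eta>. \<eta> \<in> {0..a} \<Longrightarrow> \<bar>F \<eta>\<bar> \<le> B" using continuous_bounded_Icc[OF Fc] by blast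
  have Sq: "x / sqrt t \<in> {0..a}" "0 < t" "t < T" "0 \<le> x" if "(x, t) \<in> ?S" for x t
    using that by (auto simp: wet_region_def field_simps)
  have qc: "continuous_on ?S (\<lambda>p. fst p / sqrt (snd p))"
    by (intro continuous_intros) (auto simp: wet_region_def)
  have qim: "(\<lambda>p. fst p / sqrt (snd p)) ` ?S \<subseteq> {0..a}" using Sq by auto
  note ximt = test_function_integrable(1)[OF tf T] and iA = test_function_integrable(2)[OF tf T]
  \<comment> \<open>The constant background contributes exactly the term that cancels the initial
    datum.\<close>
  have A: "(LINT p|lborel. indicator (strip T) p * \<xi>t p) = - (LINT x|lborel. indicator {0<..} x * \<xi> (x, 0))"
  proof -
    have "(LINT t|lborel. indicator (strip T) (x, t) * \<xi>t (x, t)) = - (indicator {0..} x * \<xi> (x, 0))" for x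
    proof (cases "x \<ge> 0")
      case True
      have e: "indicator (strip T) (x, t) * \<xi>t (x, t) = indicator {0<..<T} t * \<xi>t (x, t)" for t
        using True by (auto simp: indicator_def strip_def)
      have m: "(\<lambda>t. indicator {0<..<T} t * \<xi>t (x, t)) \<in> borel_measurable borel"
        using lborel2_measurable_section(2)[OF ximt, of x] by (simp add: e)
      have i: "integrable lborel (\<lambda>t. indicator {0<..<T} t * \<xi>t (x, t))"
      proof (rule Bochner_Integration.integrable_bound)
        show "integrable lborel (\<lambda>t. C * indicator {0<..<T} t :: real)" using T by simp
      qed (use m bt[OF True] C in \<open>auto simp: indicator_def intro!: AE_I2\<close>)
      have "(LINT t|lborel. indicator {0<..<T} t * \<xi>t (x, t)) = \<xi> (x, T) - \<xi> (x, 0)"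
      proof (rule FTC_lborel_open[OF _ _ _ i])
        show "continuous_on {0..T} (\<lambda>t. \<xi> (x, t))"
          by (rule continuous_on_compose2[OF c]) (use True in \<open>auto intro!: continuous_intros\<close>)
        show "((\<lambda>t. \<xi> (x, t)) has_real_derivative \<xi>t (x, t)) (at t)" if t: "t \<in> {0<..<T}" for t
          using test_function_dt[OF tf t _ True] t by (auto simp: at_within_open[of t "{0<..<T}"])
      qed (use T in auto)
      then show ?thesis using bdT[OF True] True by (simp add: e)
    next
      case False
      then have "indicator (strip T) (x, t) = (0::real)" for t by (auto simp: strip_def)
      then show ?thesis using False by simp
    qed
    then have "(LINT p|lborel. indicator (strip T) p * \<xi>t p) = (LINT x|lborel. - (indicator {0..} x * \<xi> (x, 0)))"
      using lborel2_integral_fst(1)[OF iA] by simp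
    also have "\<dots> = (LINT x|lborel. - (indicator {0<..} x * \<xi> (x, 0)))"
    proof (rule integral_cong_AE)
      have cc: "continuous_on {0..} (\<lambda>x. \<xi> (x, 0))"
        by (rule continuous_on_compose2[OF c]) (use T in \<open>auto intro!: continuous_intros\<close>)
      have "(\<lambda>x. indicator {0..} x * \<xi> (x, 0)) \<in> borel_measurable borel"
        using borel_measurable_continuous_on_indicator[OF _ cc] by simp
      then show "(\<lambda>x. - (indicator {0..} x * \<xi> (x, 0))) \<in> borel_measurable lborel" by simp
      have "continuous_on {0<..} (\<lambda>x. \<xi> (x, 0))" using cc by (rule continuous_on_subset) auto
      then have "(\<lambda>x. indicator {0<..} x * \<xi> (x, 0)) \<in> borel_measurable borel"
        using borel_measurable_continuous_on_indicator[of "{0<..}" "\<lambda>x. \<xi> (x, 0)"] by simp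
      then show "(\<lambda>x. - (indicator {0<..} x * \<xi> (x, 0))) \<in> borel_measurable lborel" by simp
      show "AE x in lborel. - (indicator {0..} x * \<xi> (x, 0)) = - (indicator {0<..} x * \<xi> (x, 0))"
        using AE_lborel_singleton[of "0::real"] by eventually_elim (auto simp: indicator_def)
    qed
    finally show ?thesis by simp
  qed
  \<comment> \<open>One constant for both integrands: for \<open>0 < t < T\<close> it dominates
    \<open>G * C\<close> as well as \<open>B * C / sqrt t\<close> after division by
    \<open>t\<close>.\<close>
  define c0 where "c0 = G * C * T + B * C * sqrt T"
  have c0: "c0 \<ge> 0" using G B C T by (simp add: c0_def)
  have bnd: "G * C \<le> c0 / t" "B / sqrt t * C \<le> c0 / t" if "0 < t" "t < T" for t
  proof -
    have "G * C * t \<le> G * C * T" using G C that by (intro mult_left_mono) auto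
    then have "G * C * t \<le> c0" using B C T by (simp add: c0_def add_increasing2)
    then show "G * C \<le> c0 / t" using that by (simp add: pos_le_divide_eq)
    have "B * C * sqrt t \<le> B * C * sqrt T" using B C that by (intro mult_left_mono) auto
    then have "B * C * sqrt t \<le> c0" using G C T by (simp add: c0_def add_increasing)
    moreover have "B / sqrt t * C * t = B * C * sqrt t" using that real_sqrt_mult_self[of t] by (simp add: field_simps)
    ultimately show "B / sqrt t * C \<le> c0 / t" using that by (simp add: pos_le_divide_eq)
  qed
  define \<Psi>1 where "\<Psi>1 = (\<lambda>p. indicator ?S p * (g (fst p / sqrt (snd p)) * \<xi>t p))"
  define \<Psi>2 where "\<Psi>2 = (\<lambda>p. indicator ?S p * (F (fst p / sqrt (snd p)) / sqrt (snd p) * \<xi>x p))"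
  have m1: "\<Psi>1 \<in> borel_measurable borel"
  proof -
    have "continuous_on ?S (\<lambda>p. g (fst p / sqrt (snd p)) * \<xi>t p)"
      by (intro continuous_intros continuous_on_compose2[OF gc qc] continuous_on_subset[OF ct SD]) (use qim in auto)
    from borel_measurable_continuous_on_indicator[OF sets_wet_region this] show ?thesis by (simp add: \<Psi>1_def)
  qed
  have m2: "\<Psi>2 \<in> borel_measurable borel"
  proof -
    have "continuous_on ?S (\<lambda>p. F (fst p / sqrt (snd p)) / sqrt (snd p) * \<xi>x p)"
      by (intro continuous_intros continuous_on_compose2[OF Fc qc] continuous_on_subset[OF cx SD]) (use qim in \<open>auto simp: wet_region_def\<close>)
    from borel_measurable_continuous_on_indicator[OF sets_wet_region this] show ?thesis by (simp add: \<Psi>2_def)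
  qed
  have i1: "integrable lborel \<Psi>1"
  proof (rule integrable_on_wet_region[OF m1 _ c0 _ T])
    fix x t
    show "\<bar>\<Psi>1 (x, t)\<bar> \<le> indicator ?S (x, t) * (c0 / t)"
    proof (cases "(x, t) \<in> ?S")
      case True
      have "\<bar>g (x / sqrt t) * \<xi>t (x, t)\<bar> \<le> G * C"
        unfolding abs_mult using G(2)[OF Sq(1)[OF True]] bt[of x t] Sq[OF True] G C by (intro mult_mono) auto
      also have "\<dots> \<le> c0 / t" using bnd Sq[OF True] by auto
      finally show ?thesis using True by (simp add: \<Psi>1_def)
    qed (simp add: \<Psi>1_def)
  qed (use a in auto)
  have i2: "integrable lborel \<Psi>2"
  proof (rule integrable_on_wet_region[OF m2 _ c0 _ T])
    fix x t
    show "\<bar>\<Psi>2 (x, t)\<bar> \<le> indicator ?S (x, t) * (c0 / t)"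
    proof (cases "(x, t) \<in> ?S")
      case True
      have "\<bar>F (x / sqrt t) / sqrt t * \<xi>x (x, t)\<bar> \<le> B / sqrt t * C"
        unfolding abs_mult abs_divide
        using B(2)[OF Sq(1)[OF True]] bx[of x t] Sq[OF True] B C by (intro mult_mono divide_mono) auto
      also have "\<dots> \<le> c0 / t" using bnd Sq[OF True] by auto
      finally show ?thesis using True by (simp add: \<Psi>2_def)
    qed (simp add: \<Psi>2_def)
  qed (use a in auto)
  \<comment> \<open>This is the derivative in \<open>t\<close> of
    \<open>g \<eta> * sqrt t * \<xi> (sqrt t * \<eta>, t)\<close> at fixed \<eta>. The factor
    \<open>sqrt t\<close> is the Jacobian of \<open>x = sqrt t * \<eta>\<close>.\<close>
  define H where "H = (\<lambda>(\<eta>, t). g \<eta> * (sqrt t * \<xi>t (sqrt t * \<eta>, t) + \<eta> / 2 * \<xi>x (sqrt t * \<eta>, t) + \<xi> (sqrt t * \<eta>, t) / (2 * sqrt t)))"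
  let ?R = "{0..a} \<times> {0<..<T}"
  have pull: "continuous_on ?R (\<lambda>p. h (sqrt (snd p) * fst p, snd p))" if "continuous_on ?D h" for h :: "real \<times> real \<Rightarrow> real"
    by (rule continuous_on_compose2[OF that]) (auto intro!: continuous_intros mult_nonneg_nonneg)
  have mR: "?R \<in> sets borel" by (intro borel_Times) auto
  have mH: "(\<lambda>p. indicator ?R p * H p) \<in> borel_measurable borel"
  proof -
    have "continuous_on ?R H"
      unfolding H_def split_def
      by (intro continuous_intros pull[OF c] pull[OF cx] pull[OF ct] continuous_on_compose2[OF gc]) auto
    from borel_measurable_continuous_on_indicator[OF mR this] show ?thesis by simp
  qed
  let ?C = "G * (sqrt T * C + a / 2 * C + C * a / 2)"
  \<comment> \<open>The singular term is harmless: along a similarity curve \<xi> is at most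
    \<open>C * sqrt t * \<eta>\<close>.\<close>
  have Hb: "\<bar>H (\<eta>, t)\<bar> \<le> ?C" if e: "\<eta> \<in> {0..a}" "t \<in> {0<..<T}" for \<eta> t
  proof -
    have nn: "sqrt t * \<eta> \<ge> 0" using e by auto
    have "\<bar>\<xi> (sqrt t * \<eta>, t)\<bar> \<le> C * (sqrt t * \<eta>)" using b[OF nn e(2)] .
    then have "\<bar>\<xi> (sqrt t * \<eta>, t) / (2 * sqrt t)\<bar> \<le> C * \<eta> / 2" using e by (simp add: abs_mult field_simps)
    also have "\<dots> \<le> C * a / 2" using e C by simp
    finally have 3: "\<bar>\<xi> (sqrt t * \<eta>, t) / (2 * sqrt t)\<bar> \<le> C * a / 2" .
    have 1: "\<bar>sqrt t * \<xi>t (sqrt t * \<eta>, t)\<bar> \<le> sqrt T * C"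
      unfolding abs_mult using bt[OF nn e(2)] e C by (intro mult_mono) auto
    have 2: "\<bar>\<eta> / 2 * \<xi>x (sqrt t * \<eta>, t)\<bar> \<le> a / 2 * C"
      unfolding abs_mult using bx[OF nn e(2)] e C a by (intro mult_mono) auto
    show ?thesis
      unfolding H_def prod.case abs_mult[of "g \<eta>"]
      using G(2)[OF e(1)] G(1) 1 2 3 by (intro mult_mono) linarith+
  qed
  have iH: "integrable lborel (\<lambda>p. indicator ?R p * H p)"
  proof (rule integrable_lborel_bounded_support[OF mH])
    fix p :: "real \<times> real"
    show "\<bar>indicator ?R p * H p\<bar> \<le> ?C * indicator (cbox (0, 0) (a, T)) p"
    proof (cases "p \<in> ?R")
      case True
      then show ?thesis using Hb[of "fst p" "snd p"] by (cases p) (auto simp: indicator_def)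
    next
      case False
      then show ?thesis using G C a T by (auto simp: indicator_def)
    qed
  qed
  have inner_t: "(LINT t|lborel. indicator ?R (\<eta>, t) * H (\<eta>, t)) = 0" for \<eta>
  proof (cases "\<eta> \<in> {0..a}")
    case True
    then have e: "indicator ?R (\<eta>, t) * H (\<eta>, t) = indicator {0<..<T} t * H (\<eta>, t)" for t
      by (auto simp: indicator_def)
    have nn: "sqrt t * \<eta> \<ge> 0" if "t \<ge> 0" for t using True that by auto
    have m: "(\<lambda>t. indicator {0<..<T} t * H (\<eta>, t)) \<in> borel_measurable borel"
      using lborel2_measurable_section(2)[OF mH, of \<eta>] by (simp add: e)
    have i: "integrable lborel (\<lambda>t. indicator {0<..<T} t * H (\<eta>, t))"
    proof (rule Bochner_Integration.integrable_bound)
      show "integrable lborel (\<lambda>t. ?C * indicator {0<..<T} t :: real)" using T by simp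
      show "AE t in lborel. norm (indicator {0<..<T} t * H (\<eta>, t)) \<le> norm (?C * indicator {0<..<T} t)"
      proof (intro AE_I2)
        fix t
        show "norm (indicator {0<..<T} t * H (\<eta>, t)) \<le> norm (?C * indicator {0<..<T} t)"
          using order_trans[OF Hb[OF True, of t] abs_ge_self] by (cases "t \<in> {0<..<T}") auto
      qed
    qed (use m in auto)
    \<comment> \<open>Both boundary terms vanish, the one at \<open>T\<close> because \<xi> does and
      the one at 0 because of the factor \<open>sqrt t\<close>.\<close>
    have "(LINT t|lborel. indicator {0<..<T} t * H (\<eta>, t))
        = g \<eta> * (sqrt T * \<xi> (sqrt T * \<eta>, T)) - g \<eta> * (sqrt 0 * \<xi> (sqrt 0 * \<eta>, 0))"
    proof (rule FTC_lborel_open[OF _ _ _ i])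
      show "continuous_on {0..T} (\<lambda>t. g \<eta> * (sqrt t * \<xi> (sqrt t * \<eta>, t)))"
        by (intro continuous_intros continuous_on_compose2[OF c]) (use True in auto)
      show "((\<lambda>t. g \<eta> * (sqrt t * \<xi> (sqrt t * \<eta>, t))) has_real_derivative H (\<eta>, t)) (at t)" if t: "t \<in> {0<..<T}" for t
      proof -
        have "((\<lambda>r. \<xi> (sqrt r * \<eta>, r)) has_real_derivative
            \<xi>x (sqrt t * \<eta>, t) * (inverse (sqrt t) / 2 * \<eta>) + \<xi>t (sqrt t * \<eta>, t) * 1) (at t within {0<..<T})"
          using t by (intro test_function_chain[OF tf t] DERIV_cmult_right DERIV_ident nn
              has_field_derivative_at_within[OF DERIV_real_sqrt]) auto
        then have d: "((\<lambda>r. \<xi> (sqrt r * \<eta>, r)) has_real_derivative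
            \<xi>x (sqrt t * \<eta>, t) * (inverse (sqrt t) / 2 * \<eta>) + \<xi>t (sqrt t * \<eta>, t)) (at t)"
          using t by (simp add: at_within_open[of t "{0<..<T}"])
        have ds: "(sqrt has_real_derivative inverse (sqrt t) / 2) (at t)" using t by (intro DERIV_real_sqrt) auto
        have "((\<lambda>t. g \<eta> * (sqrt t * \<xi> (sqrt t * \<eta>, t))) has_real_derivative
           g \<eta> * (inverse (sqrt t) / 2 * \<xi> (sqrt t * \<eta>, t) + (\<xi>x (sqrt t * \<eta>, t) * (inverse (sqrt t) / 2 * \<eta>) + \<xi>t (sqrt t * \<eta>, t)) * sqrt t)) (at t)"
          by (intro DERIV_cmult DERIV_mult d ds)
        moreover have "inverse (sqrt t) / 2 * \<xi> (sqrt t * \<eta>, t) + (\<xi>x (sqrt t * \<eta>, t) * (inverse (sqrt t) / 2 * \<eta>) + \<xi>t (sqrt t * \<eta>, t)) * sqrt t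
           = sqrt t * \<xi>t (sqrt t * \<eta>, t) + \<eta> / 2 * \<xi>x (sqrt t * \<eta>, t) + \<xi> (sqrt t * \<eta>, t) / (2 * sqrt t)"
          using t by (simp add: field_simps)
        ultimately show ?thesis by (simp add: H_def)
      qed
    qed (use T in auto)
    then show ?thesis using bdT[of "sqrt T * \<eta>"] nn[of T] T by (simp add: e)
  next
    case False
    then have "indicator ?R (\<eta>, t) = (0::real)" for t by auto
    then show ?thesis by simp
  qed
  have inner_x: "(LINT x|lborel. \<Psi>1 (x, t) - \<Psi>2 (x, t)) = (LINT \<eta>|lborel. indicator ?R (\<eta>, t) * H (\<eta>, t))" for t
  proof (cases "t \<in> {0<..<T}")
    case True
    then have st: "sqrt t > 0" by simp
    let ?X = "\<lambda>\<eta>. \<xi>x (sqrt t * \<eta>, t)" and ?Y = "\<lambda>\<eta>. \<xi>t (sqrt t * \<eta>, t)" and ?Z = "\<lambda>\<eta>. \<xi> (sqrt t * \<eta>, t)"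
    have cp: "continuous_on {0..a} (\<lambda>\<eta>. h (sqrt t * \<eta>, t))" if "continuous_on ?D h" for h :: "real \<times> real \<Rightarrow> real"
      by (rule continuous_on_compose2[OF that]) (use True in \<open>auto intro!: continuous_intros\<close>)
    have inS: "(sqrt t * \<eta>, t) \<in> ?S \<longleftrightarrow> \<eta> \<in> {0..a}" for \<eta>
      using True st by (auto simp: wet_region_def zero_le_mult_iff mult.commute)
    have "(LINT x|lborel. \<Psi>1 (x, t) - \<Psi>2 (x, t)) = sqrt t * (LINT \<eta>|lborel. \<Psi>1 (sqrt t * \<eta>, t) - \<Psi>2 (sqrt t * \<eta>, t))"
      using st by (subst lborel_integral_real_affine[of "sqrt t" _ 0]) auto
    also have "\<dots> = (LINT \<eta>|lborel. sqrt t * (\<Psi>1 (sqrt t * \<eta>, t) - \<Psi>2 (sqrt t * \<eta>, t)))" by simp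
    also have "\<dots> = (LINT \<eta>|lborel. indicator {0..a} \<eta> * (sqrt t * g \<eta> * ?Y \<eta> - F \<eta> * ?X \<eta>))"
    proof (rule Bochner_Integration.integral_cong[OF refl])
      fix \<eta>
      show "sqrt t * (\<Psi>1 (sqrt t * \<eta>, t) - \<Psi>2 (sqrt t * \<eta>, t)) = indicator {0..a} \<eta> * (sqrt t * g \<eta> * ?Y \<eta> - F \<eta> * ?X \<eta>)"
        unfolding \<Psi>1_def \<Psi>2_def using inS[of \<eta>] st by (cases "\<eta> \<in> {0..a}") (auto simp: field_simps)
    qed
    finally have 1: "(LINT x|lborel. \<Psi>1 (x, t) - \<Psi>2 (x, t)) = (LINT \<eta>|lborel. indicator {0..a} \<eta> * (sqrt t * g \<eta> * ?Y \<eta> - F \<eta> * ?X \<eta>))" .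
    \<comment> \<open>Its derivative is \<open>g\<close>: the terms with \<open>fd\<close> cancel by
      the equation for \<open>F\<close>. The value at \<open>a\<close> is 0, which is the flux
      condition there.\<close>
    define hh where "hh = (\<lambda>\<eta>. 2 * F \<eta> + \<eta> * g \<eta>)"
    have hc: "continuous_on {0..a} hh" unfolding hh_def by (intro continuous_intros gc Fc)
    \<comment> \<open>The \<eta>-derivative of \<open>hh \<eta> * \<xi> / (2 * sqrt t)\<close>. Its
      integral is 0, as \<open>hh\<close> vanishes at \<open>a\<close> and \<xi> at the axis; adding
      it replaces the flux term and completes the integrand to \<open>H\<close>.\<close>
    let ?E = "\<lambda>\<eta>. 1/2 * (g \<eta> * ?Z \<eta> / sqrt t + hh \<eta> * ?X \<eta>)"
    have iE: "integrable lborel (\<lambda>\<eta>. indicator {0..a} \<eta> * ?E \<eta>)"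
      using st by (intro integrable_lborel_Icc continuous_intros gc hc cp[OF c] cp[OF cx]) auto
    have "(LINT \<eta>|lborel. indicator {0..a} \<eta> * ?E \<eta>) = 1/2 * (hh a * (?Z a / sqrt t)) - 1/2 * (hh 0 * (?Z 0 / sqrt t))"
    proof (rule FTC_lborel[OF _ _ _ iE])
      show "continuous_on {0..a} (\<lambda>\<eta>. 1/2 * (hh \<eta> * (?Z \<eta> / sqrt t)))"
        using st by (intro continuous_intros hc cp[OF c]) auto
      show "((\<lambda>\<eta>. 1/2 * (hh \<eta> * (?Z \<eta> / sqrt t))) has_real_derivative ?E \<eta>) (at \<eta>)" if e: "\<eta> \<in> {0<..<a}" for \<eta>
      proof -
        have dg: "(g has_real_derivative fd \<eta>) (at \<eta>)" unfolding g_def using df[OF e] by (auto intro!: derivative_eq_intros)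
        have "(hh has_real_derivative 2 * (- (1/2) * \<eta> * fd \<eta>) + (1 * g \<eta> + fd \<eta> * \<eta>)) (at \<eta>)"
          unfolding hh_def by (intro DERIV_add DERIV_cmult DERIV_mult dF e dg DERIV_ident)
        then have dh: "(hh has_real_derivative g \<eta>) (at \<eta>)" by (simp add: algebra_simps)
        have "((\<lambda>r. \<xi> (sqrt t * r, t)) has_real_derivative ?X \<eta> * (sqrt t * 1) + ?Y \<eta> * 0) (at \<eta> within {0<..<a})"
          using True by (intro test_function_chain[OF tf e] DERIV_cmult DERIV_ident DERIV_const) auto
        then have dz: "(?Z has_real_derivative ?X \<eta> * sqrt t) (at \<eta>)"
          using e by (simp add: at_within_open[of \<eta> "{0<..<a}"])
        have "((\<lambda>\<eta>. 1/2 * (hh \<eta> * (?Z \<eta> / sqrt t))) has_real_derivative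
            1/2 * (g \<eta> * (?Z \<eta> / sqrt t) + ?X \<eta> * sqrt t / sqrt t * hh \<eta>)) (at \<eta>)"
          by (intro DERIV_cmult DERIV_mult dh DERIV_cdivide dz)
        then show ?thesis using st by (simp add: mult.commute)
      qed
    qed (use a in auto)
    also have "\<dots> = 0" using bd0[OF True] by (simp add: hh_def g_def fa Fa)
    finally have 2: "(LINT \<eta>|lborel. indicator {0..a} \<eta> * ?E \<eta>) = 0" .
    have iY: "integrable lborel (\<lambda>\<eta>. indicator {0..a} \<eta> * (sqrt t * g \<eta> * ?Y \<eta> - F \<eta> * ?X \<eta>))"
      by (intro integrable_lborel_Icc continuous_intros gc Fc cp[OF ct] cp[OF cx])
    have "(LINT \<eta>|lborel. indicator ?R (\<eta>, t) * H (\<eta>, t))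
        = (LINT \<eta>|lborel. indicator {0..a} \<eta> * (sqrt t * g \<eta> * ?Y \<eta> - F \<eta> * ?X \<eta>) + indicator {0..a} \<eta> * ?E \<eta>)"
    proof (rule Bochner_Integration.integral_cong[OF refl])
      fix \<eta>
      show "indicator ?R (\<eta>, t) * H (\<eta>, t) = indicator {0..a} \<eta> * (sqrt t * g \<eta> * ?Y \<eta> - F \<eta> * ?X \<eta>) + indicator {0..a} \<eta> * ?E \<eta>"
        using True st by (cases "\<eta> \<in> {0..a}") (auto simp: H_def hh_def field_simps)
    qed
    also have "\<dots> = (LINT \<eta>|lborel. indicator {0..a} \<eta> * (sqrt t * g \<eta> * ?Y \<eta> - F \<eta> * ?X \<eta>)) + (LINT \<eta>|lborel. indicator {0..a} \<eta> * ?E \<eta>)"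
      by (rule Bochner_Integration.integral_add[OF iY iE])
    finally show ?thesis using 1 2 by simp
  next
    case False
    then have "\<Psi>1 (x, t) = 0" "\<Psi>2 (x, t) = 0" "indicator ?R (x, t) = (0::real)" for x by (auto simp: \<Psi>1_def \<Psi>2_def wet_region_def)
    then show ?thesis by simp
  qed
  have "(LINT p|lborel. \<Psi>1 p - \<Psi>2 p) = (LINT t|lborel. LINT x|lborel. \<Psi>1 (x, t) - \<Psi>2 (x, t))"
    using lborel2_integral_snd(1)[of "\<lambda>p. \<Psi>1 p - \<Psi>2 p"] i1 i2 by simp
  also have "\<dots> = (LINT t|lborel. LINT \<eta>|lborel. indicator ?R (\<eta>, t) * H (\<eta>, t))" by (simp only: inner_x)
  also have "\<dots> = (LINT \<eta>|lborel. LINT t|lborel. indicator ?R (\<eta>, t) * H (\<eta>, t))"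
    using lborel2_integral_snd(1)[OF iH] lborel2_integral_fst(1)[OF iH] by simp
  also have "\<dots> = 0" by (simp only: inner_t) simp
  finally have E: "(LINT p|lborel. \<Psi>1 p) = (LINT p|lborel. \<Psi>2 p)" using i1 i2 by simp
  have ew: "indicator (strip T) p * (w p * \<xi>t p) = - V * (indicator (strip T) p * \<xi>t p) + \<Psi>1 p" for p
    using w[of "fst p" "snd p"] by (cases p) (auto simp: \<Psi>1_def g_def indicator_def strip_def wet_region_def algebra_simps)
  have ev: "indicator (strip T) p * (v p * \<xi>x p) = \<Psi>2 p" for p
    using v[of "fst p" "snd p"] by (cases p) (auto simp: \<Psi>2_def indicator_def strip_def wet_region_def)
  have mw: "(\<lambda>p. indicator (strip T) p * (w p * \<xi>t p)) \<in> borel_measurable borel"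
    unfolding ew by (rule borel_measurable_add[OF borel_measurable_times[OF borel_measurable_const ximt] m1])
  have mv: "(\<lambda>p. indicator (strip T) p * (v p * \<xi>x p)) \<in> borel_measurable borel"
    unfolding ev using m2 .
  have "(LINT p|lebesgue_on (strip T). w p * \<xi>t p) = (LINT p|lborel. - V * (indicator (strip T) p * \<xi>t p) + \<Psi>1 p)"
    using integral_lebesgue_on_borel(1)[OF sets_strip(2) mw] by (simp only: ew)
  also have "\<dots> = - V * (LINT p|lborel. indicator (strip T) p * \<xi>t p) + (LINT p|lborel. \<Psi>1 p)"
    using iA i1 by simp
  finally have W: "(LINT p|lebesgue_on (strip T). w p * \<xi>t p) = V * (LINT x|lborel. indicator {0<..} x * \<xi> (x, 0)) + (LINT p|lborel. \<Psi>2 p)"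
    by (simp add: A E)
  have Vv: "(LINT p|lebesgue_on (strip T). v p * \<xi>x p) = (LINT p|lborel. \<Psi>2 p)"
    using integral_lebesgue_on_borel(1)[OF sets_strip(2) mv] by (simp only: ev)
  have "continuous_on {0<..} (\<lambda>x. - V * \<xi> (x, 0))"
    by (intro continuous_intros continuous_on_compose2[OF c]) (use T in auto)
  then have "(\<lambda>x. indicator {0<..} x * (- V * \<xi> (x, 0))) \<in> borel_measurable borel"
    using borel_measurable_continuous_on_indicator[of "{0<..}" "\<lambda>x. - V * \<xi> (x, 0)"] by simp
  then have "(LINT x|lebesgue_on {0<..}. - V * \<xi> (x, 0)) = (LINT x|lborel. indicator {0<..} x * (- V * \<xi> (x, 0)))"
    by (intro integral_lebesgue_on_borel) auto
  also have "\<dots> = (LINT x|lborel. - V * (indicator {0<..} x * \<xi> (x, 0)))"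
    by (intro Bochner_Integration.integral_cong) (auto simp: indicator_def)
  also have "\<dots> = - V * (LINT x|lborel. indicator {0<..} x * \<xi> (x, 0))" by simp
  finally show ?thesis using W Vv by linarith
qed

subsection \<open>The self-similar function is a weak solution\<close>

lemma pw_C1_mono_R:
  assumes "pw_C1 R M u v" "R \<le> R'" "M \<le> M'"
  shows "pw_C1 R' M' u v"
  using assms unfolding pw_C1_def by (meson le_less_trans less_le_trans order_trans)

lemma pw_C1_square_integrals:
  assumes pw: "pw_C1 R M u v" and b: "\<And>x. x \<ge> 0 \<Longrightarrow> \<bar>u x\<bar> \<le> B"
  shows "(LINT x|lebesgue_on {0<..}. (u x)\<^sup>2) \<le> R * B\<^sup>2" "(LINT x|lebesgue_on {0<..}. (v x)\<^sup>2) \<le> R * M\<^sup>2"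
proof -
  have R: "R > 0" using pw by (simp add: pw_C1_def)
  have *: "(LINT x|lebesgue_on {0<..}. (g x)\<^sup>2) \<le> R * C\<^sup>2"
    if m: "g \<in> borel_measurable (lebesgue_on {0..R})" and C: "\<And>x. x \<in> {0..R} \<Longrightarrow> \<bar>g x\<bar> \<le> C" and z: "\<And>x. x > R \<Longrightarrow> g x = 0"
    for g :: "real \<Rightarrow> real" and C
  proof -
    interpret finite_measure "lebesgue_on {0..R}" by (rule finite_measure_lebesgue_on) auto
    have sq: "(g x)\<^sup>2 \<le> C\<^sup>2" if "x \<in> {0..R}" for x using power_mono[OF C[OF that], of 2] by simp
    have i: "integrable (lebesgue_on {0..R}) (\<lambda>x. (g x)\<^sup>2)"
      by (rule bounded_integrable_Icc[OF borel_measurable_power[OF m], where B="C\<^sup>2"]) (use sq in auto)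
    have "(LINT x|lebesgue_on {0<..}. (g x)\<^sup>2) = (LINT x|lebesgue_on {0..R}. (g x)\<^sup>2)"
      by (rule half_line_integral(2)[OF _ i]) (simp add: z)
    also have "\<dots> \<le> (LINT x|lebesgue_on {0..R}. C\<^sup>2)"
      by (rule integral_mono[OF i]) (use sq in auto)
    also have "\<dots> = R * C\<^sup>2" using R by (simp add: measure_restrict_space)
    finally show ?thesis .
  qed
  show "(LINT x|lebesgue_on {0<..}. (u x)\<^sup>2) \<le> R * B\<^sup>2"
    by (rule *) (use pw_C1_measurable(1)[OF pw, of "{0..R}"] b pw in \<open>auto simp: pw_C1_def\<close>)
  show "(LINT x|lebesgue_on {0<..}. (v x)\<^sup>2) \<le> R * M\<^sup>2"
    by (rule *) (use pw_C1_measurable(2)[OF pw, of "{0..R}"] pw in \<open>auto simp: pw_C1_def\<close>)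
qed

lemma L2_integral_diff_square:
  assumes "u \<in> L2_on S" "v \<in> L2_on S"
  shows "(LINT x|lebesgue_on S. (u x - v x)\<^sup>2) \<le> 2 * (LINT x|lebesgue_on S. (u x)\<^sup>2) + 2 * (LINT x|lebesgue_on S. (v x)\<^sup>2)"
proof -
  have i: "integrable (lebesgue_on S) (\<lambda>x. (u x)\<^sup>2)" "integrable (lebesgue_on S) (\<lambda>x. (v x)\<^sup>2)"
    using assms by (auto simp: L2_on_def)
  have "integrable (lebesgue_on S) (\<lambda>x. (1 * u x + (-1) * v x)\<^sup>2)"
    using L2_onD(2)[OF L2_on_linear[OF assms, of 1 "-1"]] .
  then have "(LINT x|lebesgue_on S. (u x - v x)\<^sup>2) \<le> (LINT x|lebesgue_on S. 2 * (u x)\<^sup>2 + 2 * (v x)\<^sup>2)"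
  proof (intro integral_mono)
    fix x
    have "0 \<le> (u x + v x)\<^sup>2" by simp
    then show "(u x - v x)\<^sup>2 \<le> 2 * (u x)\<^sup>2 + 2 * (v x)\<^sup>2" by (simp add: power2_eq_square algebra_simps)
  qed (use i in auto)
  then show ?thesis using i by simp
qed

lemma smooth_on_continuous_on: "smooth_on S g \<Longrightarrow> continuous_on S g"
proof -
  assume "smooth_on S g"
  then obtain D where D: "\<forall>x\<in>S. D 0 x = g x" "\<forall>n. \<forall>x\<in>S. (D n has_real_derivative D (Suc n) x) (at x within S)"
    unfolding smooth_on_def by blast
  have "continuous_on S (D 0)" by (rule DERIV_continuous_on) (use D(2) in blast)
  then show ?thesis using continuous_on_cong[of S S "D 0" g] D(1) by simp
qed

text \<open>The flux \<open>F\<close> is a parameter of its own, because at \<open>a\<close> the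
  product of \<open>deriv \<phi> (f \<eta>)\<close> and the slope is of the form zero times
  infinity.\<close>

locale self_similar =
  fixes \<phi> f F fd w_hat :: "real \<Rightarrow> real" and T U V a :: real
  assumes C2: "C2_on UNIV \<phi>" and phi_mono: "strict_mono_on {0..} \<phi>" and phi0: "\<phi> 0 = 0" and dphi0: "deriv \<phi> 0 = 0"
    and T: "T > 0" and U: "U > 0" and V: "V > 0" and a: "a > 0"
    and fc: "continuous_on {0..a} f" and f0: "f 0 = U" and fa: "f a = 0"
    and fpos: "\<And>\<eta>. \<eta> \<in> {0..<a} \<Longrightarrow> f \<eta> > 0" and fle: "\<And>\<eta>. \<eta> \<in> {0..a} \<Longrightarrow> f \<eta> \<le> U"
    and fgt: "\<And>\<eta>. \<eta> > a \<Longrightarrow> f \<eta> = - V" and flt: "\<And>\<eta>. \<eta> < 0 \<Longrightarrow> f \<eta> = U"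
    and Fc: "continuous_on {0..a} F" and Fa: "F a = - (a * V / 2)"
    and df: "\<And>\<eta>. \<eta> \<in> {0<..<a} \<Longrightarrow> (f has_real_derivative fd \<eta>) (at \<eta>)"
    and fF: "\<And>\<eta>. \<eta> \<in> {0<..<a} \<Longrightarrow> deriv \<phi> (f \<eta>) * fd \<eta> = F \<eta>"
    and dF: "\<And>\<eta>. \<eta> \<in> {0<..<a} \<Longrightarrow> (F has_real_derivative - (1/2) * \<eta> * fd \<eta>) (at \<eta>)"
    and what: "smooth_on {0..} w_hat" and what0: "w_hat 0 = U" and what1: "\<And>x. x > 1 \<Longrightarrow> w_hat x = - V"

text \<open>The two branches fit together at 0 because \<phi> and its derivative vanish there.
  Writing the argument as \<open>max s 0\<close> covers both branches by one continuous
  formula.\<close>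

lemma DERIV_\<D>:
  assumes "C2_on UNIV \<phi>" "\<phi> 0 = 0" "deriv \<phi> 0 = 0"
  shows "(\<D> \<phi> has_real_derivative deriv \<phi> (max s 0)) (at s)"
proof -
  have d: "(\<phi> has_real_derivative deriv \<phi> s) (at s)" for s
    using assms(1) by (simp add: C2_on_def DERIV_deriv_iff_real_differentiable)
  consider "s > 0" | "s < 0" | "s = 0" by linarith
  then show ?thesis
  proof cases
    case 1
    then have "(\<D> \<phi> has_real_derivative deriv \<phi> s) (at s)"
      by (intro deriv_eq_on_open[OF _ _ _ d, of "{0<..}"]) (auto simp: \<D>_def)
    then show ?thesis using 1 by (simp add: max_absorb1)
  next
    case 2
    then have "(\<D> \<phi> has_real_derivative 0) (at s)"
      by (intro deriv_eq_on_open[OF _ _ _ DERIV_const, of "{..<0}"]) (auto simp: \<D>_def)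
    then show ?thesis using 2 assms by (simp add: max_absorb2)
  next
    case 3
    have "((\<lambda>h. \<phi> h / h) \<longlongrightarrow> 0) (at 0)" using d[of 0] assms by (simp add: has_field_derivative_iff)
    then have l: "((\<lambda>h. \<bar>\<phi> h / h\<bar>) \<longlongrightarrow> 0) (at 0)" by (rule tendsto_rabs_zero)
    have "((\<lambda>h. \<D> \<phi> h / h) \<longlongrightarrow> 0) (at 0)"
      by (rule Lim_null_comparison[OF _ l]) (auto simp: \<D>_def intro!: always_eventually divide_nonneg_nonpos)
    then show ?thesis using 3 assms by (simp add: has_field_derivative_iff \<D>_def)
  qed
qed

lemma continuous_on_\<D>:
  assumes "C2_on UNIV \<phi>" "\<phi> 0 = 0" "deriv \<phi> 0 = 0"
  shows "continuous_on A (\<D> \<phi>)"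
  using DERIV_\<D>[OF assms] by (meson DERIV_continuous_on has_field_derivative_at_within)

context self_similar
begin

definition "w = (\<lambda>p :: real \<times> real. f (fst p / sqrt (snd p)))"
text \<open>The extension by 0 gives a bounded Borel function on the line;
  \<open>flux (x / sqrt t) / sqrt t\<close> is the spatial derivative of \<D>(w) on both sides of
  the free boundary.\<close>

definition "flux = (\<lambda>\<eta>. if \<eta> \<in> {0..a} then F \<eta> else 0)"
definition "v = (\<lambda>p :: real \<times> real. flux (fst p / sqrt (snd p)) / sqrt (snd p))"
definition "excess = (\<lambda>t x. \<D> \<phi> (w (x, t)) - \<D> \<phi> (w_hat x))"

lemmas dD = DERIV_\<D>[OF C2 phi0 dphi0] and cD = continuous_on_\<D>[OF C2 phi0 dphi0]

lemma D_nonpos: "s \<le> 0 \<Longrightarrow> \<D> \<phi> s = 0"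
  using phi0 by (auto simp: \<D>_def)

lemma f_ge: "\<eta> \<ge> a \<Longrightarrow> f \<eta> \<le> 0"
  using fgt[of \<eta>] fa V by (cases "\<eta> = a") auto

lemma f_borel: "f \<in> borel_measurable borel"
proof -
  have "(\<lambda>\<eta>. indicator {0..a} \<eta> *\<^sub>R f \<eta>) \<in> borel_measurable borel"
    by (rule borel_measurable_continuous_on_indicator[OF _ fc]) simp
  then have "(\<lambda>\<eta>. indicator {0..a} \<eta> *\<^sub>R f \<eta> + U * indicator {..<0} \<eta> - V * indicator {a<..} \<eta>) \<in> borel_measurable borel"
    by (intro borel_measurable_diff borel_measurable_add borel_measurable_times) auto
  also have "(\<lambda>\<eta>. indicator {0..a} \<eta> *\<^sub>R f \<eta> + U * indicator {..<0} \<eta> - V * indicator {a<..} \<eta>) = f"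
    using fgt flt a by (auto simp: indicator_def fun_eq_iff not_le)
  finally show ?thesis .
qed

lemma flux_borel: "flux \<in> borel_measurable borel"
proof -
  have "(\<lambda>\<eta>. indicator {0..a} \<eta> *\<^sub>R F \<eta>) \<in> borel_measurable borel"
    by (rule borel_measurable_continuous_on_indicator[OF _ Fc]) simp
  also have "(\<lambda>\<eta>. indicator {0..a} \<eta> *\<^sub>R F \<eta>) = flux" by (auto simp: flux_def indicator_def)
  finally show ?thesis .
qed

lemma quotient_borel: "(\<lambda>p :: real \<times> real. fst p / sqrt (snd p)) \<in> borel_measurable borel"
proof -
  have "(\<lambda>p :: real \<times> real. fst p / sqrt (snd p)) \<in> borel_measurable (borel \<Otimes>\<^sub>M borel)" by measurable
  then show ?thesis by (simp only: borel_prod)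
qed

lemma w_borel: "w \<in> borel_measurable borel"
  unfolding w_def by (rule measurable_compose[OF quotient_borel f_borel])

lemma v_borel: "v \<in> borel_measurable borel"
proof -
  have "(\<lambda>p :: real \<times> real. sqrt (snd p)) \<in> borel_measurable (borel \<Otimes>\<^sub>M borel)" by measurable
  then have "(\<lambda>p :: real \<times> real. sqrt (snd p)) \<in> borel_measurable borel" by (simp only: borel_prod)
  then show ?thesis
    unfolding v_def by (intro borel_measurable_divide measurable_compose[OF quotient_borel flux_borel])
qed

lemma flux_bound: obtains B where "B > 0" "\<And>\<eta>. \<bar>flux \<eta>\<bar> \<le> B"
proof -
  obtain B where B: "B > 0" "\<And>\<eta>. \<eta> \<in> {0..a} \<Longrightarrow> \<bar>F \<eta>\<bar> \<le> B" using continuous_bounded_Icc[OF Fc] by blast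
  show ?thesis by (rule that[OF B(1)]) (use B in \<open>auto simp: flux_def\<close>)
qed

lemma Df_continuous: "continuous_on {0..} (\<lambda>\<eta>. \<D> \<phi> (f \<eta>))"
proof -
  have 1: "continuous_on {0..a} (\<lambda>\<eta>. \<D> \<phi> (f \<eta>))"
    by (rule continuous_on_compose2[OF cD[of UNIV] fc]) auto
  have 2: "continuous_on {a..} (\<lambda>\<eta>. \<D> \<phi> (f \<eta>))"
    using continuous_on_cong[of "{a..}" "{a..}" "\<lambda>\<eta>. \<D> \<phi> (f \<eta>)" "\<lambda>_. 0"] D_nonpos f_ge by auto
  have "{0..} = {0..a} \<union> {a..}" using a by auto
  then show ?thesis using continuous_on_closed_Un[OF _ _ 1 2] by simp
qed

text \<open>The jump of \<open>w\<close> at the free boundary is invisible to \<D>, which vanishes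
  at 0 and below; what remains is a kink at \<open>x = a * sqrt t\<close>. The slope bound
  \<open>B / sqrt t\<close> reflects the scaling in \<open>x\<close>.\<close>

lemma Dw_pw_C1:
  assumes t: "t > 0" and B: "\<And>\<eta>. \<bar>flux \<eta>\<bar> \<le> B"
  shows "pw_C1 (a * sqrt t) (B / sqrt t) (\<lambda>x. \<D> \<phi> (w (x, t))) (\<lambda>x. v (x, t))"
  unfolding pw_C1_def
proof (intro conjI allI impI)
  have st: "sqrt t > 0" using t by simp
  show "a * sqrt t > 0" using a st by simp
  show "continuous_on {0..} (\<lambda>x. \<D> \<phi> (w (x, t)))"
    unfolding w_def fst_conv snd_conv
    by (rule continuous_on_compose2[OF Df_continuous]) (use st in \<open>auto intro!: continuous_intros\<close>)
  show "(\<lambda>x. v (x, t)) \<in> borel_measurable borel" by (rule lborel2_measurable_section(1)[OF v_borel])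
  show "\<bar>v (x, t)\<bar> \<le> B / sqrt t" for x
    unfolding v_def using B st by (simp add: divide_right_mono)
  show "v (x, t) = 0" if "a * sqrt t < x" for x
    using that st by (auto simp: v_def flux_def field_simps)
  show "\<D> \<phi> (w (x, t)) = 0" if "a * sqrt t \<le> x" for x
  proof -
    have "a \<le> x / sqrt t" using that st by (simp add: pos_le_divide_eq)
    then show ?thesis unfolding w_def using f_ge D_nonpos by simp
  qed
  have "((\<lambda>x. \<D> \<phi> (w (x, t))) has_real_derivative v (x, t)) (at x)" if x: "x > 0" "x \<noteq> a * sqrt t" for x
  proof (cases "x < a * sqrt t")
    case True
    define \<eta> where "\<eta> = x / sqrt t"
    have e: "\<eta> \<in> {0<..<a}" using True x st by (auto simp: \<eta>_def field_simps)
    have "((\<lambda>x. f (x / sqrt t)) has_real_derivative fd \<eta> * (1 / sqrt t)) (at x)"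
      using DERIV_chain2[OF df[OF e, unfolded \<eta>_def] DERIV_cdivide[OF DERIV_ident]] by (simp only: \<eta>_def)
    from DERIV_chain2[OF dD this]
    have "((\<lambda>x. \<D> \<phi> (f (x / sqrt t))) has_real_derivative deriv \<phi> (max (f \<eta>) 0) * (fd \<eta> * (1 / sqrt t))) (at x)"
      by (simp only: \<eta>_def)
    moreover have "deriv \<phi> (max (f \<eta>) 0) * (fd \<eta> * (1 / sqrt t)) = v (x, t)"
      using fpos[of \<eta>] e fF[OF e] by (simp add: v_def flux_def \<eta>_def[symmetric] max_absorb1)
    ultimately show ?thesis by (simp add: w_def)
  next
    case False
    then have x': "x \<in> {a * sqrt t<..}" using x by auto
    have "((\<lambda>x. \<D> \<phi> (w (x, t))) has_real_derivative 0) (at x)"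
    proof (rule deriv_eq_on_open[OF _ x', of _ "\<lambda>_. 0"])
      show "\<D> \<phi> (w (y, t)) = 0" if "y \<in> {a * sqrt t<..}" for y
      proof -
        have "a \<le> y / sqrt t" using that st by (simp add: pos_le_divide_eq)
        then show ?thesis unfolding w_def using f_ge D_nonpos by simp
      qed
    qed auto
    moreover have "v (x, t) = 0" using x' st by (auto simp: v_def flux_def field_simps)
    ultimately show ?thesis by simp
  qed
  then show "\<exists>S. finite S \<and> (\<forall>x\<in>{0<..} - S. ((\<lambda>x. \<D> \<phi> (w (x, t))) has_real_derivative v (x, t)) (at x))"
    by (intro exI[of _ "{a * sqrt t}"]) auto
qed

lemma Dw_hat_pw_C1: obtains M vh where "pw_C1 1 M (\<lambda>x. \<D> \<phi> (w_hat x)) vh"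
proof -
  obtain D where D: "\<And>x. x \<ge> 0 \<Longrightarrow> D 0 x = w_hat x"
    "\<And>n x. x \<ge> 0 \<Longrightarrow> (D n has_real_derivative D (Suc n) x) (at x within {0..})"
    using what unfolding smooth_on_def by (metis atLeast_iff)
  have cDn: "continuous_on {0..} (D n)" for n
    by (rule DERIV_continuous_on[of _ _ "D (Suc n)"]) (use D(2) in auto)
  note wc = smooth_on_continuous_on[OF what]
  \<comment> \<open>The hypothesis on \<open>w_hat\<close> starts beyond 1; the value at 1 follows
    by continuity, so that \<D>(w_hat) vanishes from 1 onwards.\<close>
  have w1: "w_hat 1 = - V"
  proof -
    have "(w_hat \<longlongrightarrow> w_hat 1) (at 1 within {0..})" using wc by (simp add: continuous_on_def)
    then have "(w_hat \<longlongrightarrow> w_hat 1) (at_right 1)" by (rule tendsto_within_subset) auto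
    moreover have "(w_hat \<longlongrightarrow> - V) (at_right 1)"
      by (rule Lim_transform_eventually[OF tendsto_const])
         (auto simp: eventually_at_right_field what1 intro!: exI[of _ 2])
    ultimately show ?thesis by (rule tendsto_unique[rotated]) simp
  qed
  have kc: "continuous_on A (deriv \<phi>)" for A
    using C2 unfolding C2_on_def by (meson UNIV_I continuous_at_imp_continuous_on differentiable_imp_continuous_within)
  define g where "g = (\<lambda>x. deriv \<phi> (max (w_hat x) 0) * D 1 x)"
  have gc: "continuous_on {0..1} g"
    unfolding g_def
    by (intro continuous_intros continuous_on_compose2[OF kc[of UNIV]] continuous_on_subset[OF wc] continuous_on_subset[OF cDn]) auto
  obtain M where M: "M > 0" "\<And>x. x \<in> {0..1} \<Longrightarrow> \<bar>g x\<bar> \<le> M" using continuous_bounded_Icc[OF gc] by blast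
  define vh where "vh = (\<lambda>x. indicator {0..1} x *\<^sub>R g x)"
  have "pw_C1 1 M (\<lambda>x. \<D> \<phi> (w_hat x)) vh"
    unfolding pw_C1_def
  proof (intro conjI allI impI)
    show "continuous_on {0..} (\<lambda>x. \<D> \<phi> (w_hat x))" by (rule continuous_on_compose2[OF cD[of UNIV] wc]) auto
    show "vh \<in> borel_measurable borel" unfolding vh_def by (rule borel_measurable_continuous_on_indicator[OF _ gc]) simp
    show "\<bar>vh x\<bar> \<le> M" for x using M by (auto simp: vh_def indicator_def)
    show "\<D> \<phi> (w_hat x) = 0" if "1 \<le> x" for x using that w1 what1[of x] V by (cases "x = 1") (auto intro: D_nonpos)
    have "((\<lambda>x. \<D> \<phi> (w_hat x)) has_real_derivative vh x) (at x)" if x: "x > 0" "x \<noteq> 1" for x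
    proof (cases "x < 1")
      case True
      have "(D 0 has_real_derivative D 1 x) (at x)"
        using D(2)[of x 0] x at_within_interior[of x "{0..}"] by simp
      then have "(w_hat has_real_derivative D 1 x) (at x)"
        by (intro deriv_eq_on_open[of "{0<..}" x w_hat "D 0"]) (use x D(1) in auto)
      from DERIV_chain2[OF dD this] show ?thesis using x True by (simp add: vh_def g_def)
    next
      case False
      have "((\<lambda>x. \<D> \<phi> (w_hat x)) has_real_derivative 0) (at x)"
        by (rule deriv_eq_on_open[of "{1<..}" x _ "\<lambda>_. 0"]) (use x False what1 V in \<open>auto intro: D_nonpos\<close>)
      then show ?thesis using x False by (simp add: vh_def)
    qed
    then show "\<exists>S. finite S \<and> (\<forall>x\<in>{0<..} - S. ((\<lambda>x. \<D> \<phi> (w_hat x)) has_real_derivative vh x) (at x))"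
      by (intro exI[of _ "{1}"]) auto
  qed (auto simp: vh_def)
  then show ?thesis by (rule that)
qed

section \<open>The excess over the boundary data as an element of the Bochner space\<close>

lemma w_0: "w (0, t) = U"
  by (simp add: w_def f0)

lemma excess_W12_0:
  assumes "t > 0" shows "excess t \<in> W12_0"
proof -
  obtain B where B: "B > 0" "\<And>\<eta>. \<bar>flux \<eta>\<bar> \<le> B" by (rule flux_bound) blast
  obtain M vh where h: "pw_C1 1 M (\<lambda>x. \<D> \<phi> (w_hat x)) vh" by (rule Dw_hat_pw_C1)
  show ?thesis
    unfolding excess_def
    by (rule pw_C1_W12_0[OF pw_C1_diff[OF Dw_pw_C1[OF assms B(2)] h]]) (simp add: w_0 what0)
qed

text \<open>Time rounded up to the next node of a grid of \<open>n + 1\<close> cells. Rounding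
  upwards keeps the nodes positive and the factor \<open>1 / sqrt (\<tau> n t)\<close> below
  \<open>1 / sqrt t\<close>, so the singular initial time is avoided.\<close>

definition "\<tau> = (\<lambda>n t. T * real_of_int \<lceil>real (Suc n) * t / T\<rceil> / real (Suc n))"
definition "excess_step = (\<lambda>(n::nat) t x. \<Sum>i<Suc n. indicator {T * real i / real (Suc n)<..T * real (Suc i) / real (Suc n)} t * excess (T * real (Suc i) / real (Suc n)) x)"

lemma excess_step_simple: "W12_0_simple (excess_step n)"
  unfolding W12_0_simple_def
proof (intro exI conjI allI impI)
  fix i assume "i < Suc n"
  show "{T * real i / real (Suc n)<..T * real (Suc i) / real (Suc n)} \<in> sets lebesgue" by simp
  show "excess (T * real (Suc i) / real (Suc n)) \<in> W12_0" using T by (intro excess_W12_0) simp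
qed (simp add: excess_step_def)

lemma \<tau>_bounds:
  assumes "t > 0"
  shows "t \<le> \<tau> n t" "\<tau> n t \<le> t + T / real (Suc n)"
proof -
  define N where "N = real (Suc n)"
  have N: "N > 0" by (simp add: N_def)
  have "N * t / T \<le> of_int \<lceil>N * t / T\<rceil>" "of_int \<lceil>N * t / T\<rceil> \<le> N * t / T + 1" by linarith+
  then have 1: "N * t / T * (T / N) \<le> of_int \<lceil>N * t / T\<rceil> * (T / N)" "of_int \<lceil>N * t / T\<rceil> * (T / N) \<le> (N * t / T + 1) * (T / N)"
    using T N by (intro mult_right_mono; simp)+
  have 2: "N * t / T * (T / N) = t" using T N by simp
  have 3: "(N * t / T + 1) * (T / N) = t + T / N" using T N by (simp add: field_simps)
  have 4: "\<tau> n t = of_int \<lceil>N * t / T\<rceil> * (T / N)" by (simp add: \<tau>_def N_def)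
  show "t \<le> \<tau> n t" using 1(1) unfolding 2 4 .
  have "\<tau> n t \<le> t + T / N" using 1(2) unfolding 3 4 .
  then show "\<tau> n t \<le> t + T / real (Suc n)" by (simp only: N_def)
qed

lemma \<tau>_tendsto:
  assumes "t > 0"
  shows "(\<lambda>n. \<tau> n t) \<longlonglongrightarrow> t"
proof (rule tendsto_sandwich[OF _ _ tendsto_const])
  have "(\<lambda>n. t + T * inverse (real (Suc n))) \<longlonglongrightarrow> t + T * 0"
    by (intro tendsto_intros LIMSEQ_inverse_real_of_nat)
  then show "(\<lambda>n. t + T / real (Suc n)) \<longlonglongrightarrow> t" by (simp add: divide_inverse)
qed (use \<tau>_bounds[OF assms] in auto)

lemma excess_step_eq:
  assumes t: "0 < t" "t < T"
  shows "excess_step n t = excess (\<tau> n t)"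
proof
  fix x
  define N where "N = real (Suc n)"
  have N: "N > 0" by (simp add: N_def)
  \<comment> \<open>The cells are open on the left and closed on the right, in agreement with the
    ceiling: \<open>t\<close> lies in the cell whose upper node has number
    \<open>\<lceil>N * t / T\<rceil>\<close>, hence the shift by 1.\<close>
  define j where "j = nat (\<lceil>N * t / T\<rceil> - 1)"
  have c1: "\<lceil>N * t / T\<rceil> \<ge> 1" using t N T by (simp add: le_ceiling_iff)
  have "N * t / T \<le> N" using t N T by (simp add: field_simps)
  then have c2: "\<lceil>N * t / T\<rceil> \<le> int (Suc n)" by (simp add: ceiling_le_iff N_def)
  have j: "j < Suc n" using c1 c2 by (auto simp: j_def)
  have Sj: "real (Suc j) = real_of_int \<lceil>N * t / T\<rceil>" using c1 by (simp add: j_def)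
  have iff: "t \<in> {T * real i / N<..T * real (Suc i) / N} \<longleftrightarrow> i = j" for i
  proof -
    have "t \<in> {T * real i / N<..T * real (Suc i) / N} \<longleftrightarrow> real i < N * t / T \<and> N * t / T \<le> real (Suc i)"
      using N T by (simp add: field_simps)
    also have "\<dots> \<longleftrightarrow> \<lceil>N * t / T\<rceil> = int (Suc i)" by (simp add: ceiling_eq_iff)
    also have "\<dots> \<longleftrightarrow> i = j" using c1 unfolding j_def by linarith
    finally show ?thesis .
  qed
  have ind: "indicator {T * real i / N<..T * real (Suc i) / N} t = (if i = j then 1 else 0 :: real)" for i
    unfolding indicator_def of_bool_def iff ..
  have "excess_step n t x = (\<Sum>i<Suc n. if i = j then excess (T * real (Suc i) / N) x else 0)"
    unfolding excess_step_def N_def[symmetric] ind by (intro sum.cong refl) (simp del: of_nat_Suc)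
  also have "\<dots> = excess (T * real (Suc j) / N) x" using j by simp
  also have "T * real (Suc j) / N = \<tau> n t" unfolding Sj \<tau>_def N_def ..
  finally show "excess_step n t x = excess (\<tau> n t) x" .
qed

text \<open>Strong measurability comes from continuity in time: \<open>w_hat\<close> cancels, the
  difference vanishes at \<open>x = 0\<close>, and its derivatives are uniformly bounded and tend to
  0 at every \<open>x\<close> off the free boundary.\<close>

lemma excess_step_tendsto:
  assumes t: "0 < t" "t < T"
  shows "(\<lambda>n. W12_norm (\<lambda>x. excess t x - excess_step n t x)) \<longlonglongrightarrow> 0"
proof -
  obtain B where B: "B > 0" "\<And>\<eta>. \<bar>flux \<eta>\<bar> \<le> B" by (rule flux_bound) blast
  have e: "(\<lambda>x. excess t x - excess_step n t x) = (\<lambda>x. \<D> \<phi> (w (x, t)) - \<D> \<phi> (w (x, \<tau> n t)))" for n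
    unfolding excess_step_eq[OF t] by (simp add: excess_def)
  have \<tau>: "t \<le> \<tau> n t" "\<tau> n t \<le> t + T" for n
  proof -
    show "t \<le> \<tau> n t" using \<tau>_bounds(1)[OF t(1)] .
    have "T / real (Suc n) \<le> T / 1" using T by (intro divide_left_mono) auto
    then show "\<tau> n t \<le> t + T" using \<tau>_bounds(2)[OF t(1), of n] by simp
  qed
  have st: "sqrt t > 0" using t by simp
  have ns: "(\<lambda>n. sqrt (\<tau> n t)) \<longlonglongrightarrow> sqrt t" by (intro tendsto_real_sqrt \<tau>_tendsto t)
  show ?thesis
    unfolding e
  proof (rule pw_C1_W12_norm_tendsto)
    fix n
    have \<tau>p: "\<tau> n t > 0" using \<tau>(1)[of n] t by simp
    show "pw_C1 (a * sqrt (t + T)) (B / sqrt t + B / sqrt t) (\<lambda>x. \<D> \<phi> (w (x, t)) - \<D> \<phi> (w (x, \<tau> n t))) (\<lambda>x. v (x, t) - v (x, \<tau> n t))"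
    proof (rule pw_C1_mono_R[OF pw_C1_diff[OF Dw_pw_C1[OF t(1) B(2)] Dw_pw_C1[OF \<tau>p B(2)]]])
      show "max (a * sqrt t) (a * sqrt (\<tau> n t)) \<le> a * sqrt (t + T)" using a \<tau>[of n] T by auto
      have "B / sqrt (\<tau> n t) \<le> B / sqrt t" using \<tau>(1)[of n] t B(1) st \<tau>p by (intro divide_left_mono) auto
      then show "B / sqrt t + B / sqrt (\<tau> n t) \<le> B / sqrt t + B / sqrt t" by simp
    qed
    show "\<D> \<phi> (w (0, t)) - \<D> \<phi> (w (0, \<tau> n t)) = 0" by (simp add: w_0)
  next
    have "AE x in lebesgue. x \<noteq> a * sqrt t" by (rule AE_completion) (rule AE_lborel_singleton)
    then show "AE x in lebesgue. x \<in> {0..a * sqrt (t + T)} \<longrightarrow> (\<lambda>n. v (x, t) - v (x, \<tau> n t)) \<longlonglongrightarrow> 0"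
    proof eventually_elim
      case (elim x)
      show ?case
      proof
        assume x: "x \<in> {0..a * sqrt (t + T)}"
        have lim: "(\<lambda>n. x / sqrt (\<tau> n t)) \<longlonglongrightarrow> x / sqrt t" using st by (intro tendsto_divide tendsto_const ns) auto
        have "(\<lambda>n. flux (x / sqrt (\<tau> n t))) \<longlonglongrightarrow> flux (x / sqrt t)"
        proof (cases "x < a * sqrt t")
          case True
          have in0: "x / sqrt t \<in> {0..a}" using True x st by (auto simp: field_simps)
          have inn: "x / sqrt (\<tau> n t) \<in> {0..a}" for n
          proof -
            have "x / sqrt (\<tau> n t) \<le> x / sqrt t" using x \<tau>(1)[of n] t st by (intro divide_left_mono) auto
            moreover have "0 \<le> x / sqrt (\<tau> n t)" using x \<tau>(1)[of n] t by auto
            ultimately show ?thesis using in0 by auto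
          qed
          have "(\<lambda>n. F (x / sqrt (\<tau> n t))) \<longlonglongrightarrow> F (x / sqrt t)"
            by (rule continuous_on_tendsto_compose[OF Fc lim in0]) (use inn in auto)
          then show ?thesis using in0 inn by (simp add: flux_def)
        next
          case False
          then have "a < x / sqrt t" using elim st by (simp add: pos_less_divide_eq)
          then have "\<forall>\<^sub>F n in sequentially. a < x / sqrt (\<tau> n t)" by (rule order_tendstoD(1)[OF lim])
          then have "\<forall>\<^sub>F n in sequentially. flux (x / sqrt (\<tau> n t)) = flux (x / sqrt t)"
            by eventually_elim (use \<open>a < x / sqrt t\<close> in \<open>simp add: flux_def\<close>)
          then show ?thesis by (rule tendsto_eventually)
        qed
        then have "(\<lambda>n. flux (x / sqrt (\<tau> n t)) / sqrt (\<tau> n t)) \<longlonglongrightarrow> flux (x / sqrt t) / sqrt t"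
          using st by (intro tendsto_divide ns) auto
        then have "(\<lambda>n. v (x, t) - v (x, \<tau> n t)) \<longlonglongrightarrow> v (x, t) - v (x, t)"
          by (intro tendsto_diff tendsto_const) (simp add: v_def)
        then show "(\<lambda>n. v (x, t) - v (x, \<tau> n t)) \<longlonglongrightarrow> 0" by simp
      qed
    qed
  qed
qed

text \<open>The slope is of size \<open>B / sqrt t\<close> on an interval of length
  \<open>a * sqrt t\<close>, so its square integral grows only like \<open>1 / sqrt t\<close>, which
  is integrable in time.\<close>

lemma excess_norm_bound:
  obtains C1 C2 where "C1 \<ge> 0" "C2 \<ge> 0" "\<And>t. 0 < t \<Longrightarrow> t < T \<Longrightarrow> (W12_norm (excess t))\<^sup>2 \<le> C1 + C2 / sqrt t"
proof -
  obtain B where B: "B > 0" "\<And>\<eta>. \<bar>flux \<eta>\<bar> \<le> B" by (rule flux_bound) blast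
  obtain M vh where h: "pw_C1 1 M (\<lambda>x. \<D> \<phi> (w_hat x)) vh" by (rule Dw_hat_pw_C1)
  obtain Bh where Bh: "Bh > 0" "\<And>x. x \<ge> 0 \<Longrightarrow> \<bar>\<D> \<phi> (w_hat x)\<bar> \<le> Bh" using pw_C1_bound[OF h] by blast
  have "continuous_on {0..a} (\<lambda>\<eta>. \<D> \<phi> (f \<eta>))" using Df_continuous by (rule continuous_on_subset) auto
  then obtain Bw where Bw: "Bw > 0" "\<And>\<eta>. \<eta> \<in> {0..a} \<Longrightarrow> \<bar>\<D> \<phi> (f \<eta>)\<bar> \<le> Bw"
    using continuous_bounded_Icc by blast
  have bw: "\<bar>\<D> \<phi> (w (x, t))\<bar> \<le> Bw" if "t > 0" "x \<ge> 0" for x t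
  proof (cases "x / sqrt t \<le> a")
    case True
    then show ?thesis unfolding w_def using Bw(2)[of "x / sqrt t"] that by auto
  next
    case False
    then show ?thesis unfolding w_def using Bw(1) f_ge[of "x / sqrt t"] D_nonpos by auto
  qed
  define C1 where "C1 = 2 * (a * sqrt T * Bw\<^sup>2) + 2 * (1 * Bh\<^sup>2) + 2 * (1 * M\<^sup>2)"
  define C2 where "C2 = 2 * (a * B\<^sup>2)"
  show ?thesis
  proof (rule that[of C1 C2])
    show "C1 \<ge> 0" "C2 \<ge> 0" using a T by (auto simp: C1_def C2_def)
    fix t assume t: "0 < t" "t < T"
    note p = Dw_pw_C1[OF t(1) B(2)]
    note s1 = pw_C1_square_integrals[OF p bw[OF t(1)]] and s2 = pw_C1_square_integrals[OF h Bh(2)]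
    have "(W12_norm (excess t))\<^sup>2 = (LINT x|lebesgue_on {0<..}. (\<D> \<phi> (w (x, t)) - \<D> \<phi> (w_hat x))\<^sup>2) + (LINT x|lebesgue_on {0<..}. (v (x, t) - vh x)\<^sup>2)"
      unfolding excess_def by (subst W12_norm_eq[OF pw_C1_has_weak_deriv[OF pw_C1_diff[OF p h]]]) simp
    also have "\<dots> \<le> (2 * (a * sqrt t * Bw\<^sup>2) + 2 * (1 * Bh\<^sup>2)) + (2 * (a * sqrt t * (B / sqrt t)\<^sup>2) + 2 * (1 * M\<^sup>2))"
      using L2_integral_diff_square[OF pw_C1_L2(1)[OF p] pw_C1_L2(1)[OF h]]
        L2_integral_diff_square[OF pw_C1_L2(2)[OF p] pw_C1_L2(2)[OF h]] s1 s2 by linarith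
    also have "a * sqrt t * (B / sqrt t)\<^sup>2 = a * B\<^sup>2 / sqrt t"
      using t by (simp add: power2_eq_square field_simps)
    also have "(2 * (a * sqrt t * Bw\<^sup>2) + 2 * (1 * Bh\<^sup>2)) + (2 * (a * B\<^sup>2 / sqrt t) + 2 * (1 * M\<^sup>2)) \<le> C1 + C2 / sqrt t"
    proof -
      have "a * sqrt t * Bw\<^sup>2 \<le> a * sqrt T * Bw\<^sup>2" using a t by (intro mult_right_mono mult_left_mono) auto
      then show ?thesis by (simp add: C1_def C2_def)
    qed
    finally show "(W12_norm (excess t))\<^sup>2 \<le> C1 + C2 / sqrt t" .
  qed
qed

lemma excess_L2_W12_0: "excess \<in> L2_W12_0 T"
  unfolding L2_W12_0_def mem_Collect_eq
proof (intro conjI exI[of _ excess_step] allI excess_step_simple)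
  have S: "{0<..<T} \<in> sets lebesgue" by simp
  show "AE t in lebesgue_on {0<..<T}. excess t \<in> W12_0"
    unfolding AE_lebesgue_on_iff[OF S] by (intro AE_I2) (auto intro: excess_W12_0)
  show "AE t in lebesgue_on {0<..<T}. (\<lambda>n. W12_norm (\<lambda>x. excess t x - excess_step n t x)) \<longlonglongrightarrow> 0"
    unfolding AE_lebesgue_on_iff[OF S] by (intro AE_I2) (auto intro: excess_step_tendsto)
  obtain C1 C2 where C: "C1 \<ge> 0" "C2 \<ge> 0" "\<And>t. 0 < t \<Longrightarrow> t < T \<Longrightarrow> (W12_norm (excess t))\<^sup>2 \<le> C1 + C2 / sqrt t"
    using excess_norm_bound by blast
  have "(\<integral>\<^sup>+ t. ennreal ((W12_norm (excess t))\<^sup>2) \<partial>lebesgue_on {0<..<T}) \<le> (\<integral>\<^sup>+ t. ennreal ((C1 * sqrt T + C2) / sqrt t) \<partial>lebesgue_on {0<..<T})"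
  proof (rule nn_integral_mono)
    fix t assume "t \<in> space (lebesgue_on {0<..<T})"
    then have t: "0 < t" "t < T" by auto
    have "C1 * sqrt t \<le> C1 * sqrt T" using C t by (intro mult_left_mono) auto
    then have "C1 \<le> C1 * sqrt T / sqrt t" using t by (simp add: pos_le_divide_eq)
    then have "C1 + C2 / sqrt t \<le> (C1 * sqrt T + C2) / sqrt t" by (simp add: add_divide_distrib)
    then show "ennreal ((W12_norm (excess t))\<^sup>2) \<le> ennreal ((C1 * sqrt T + C2) / sqrt t)"
      using C(3)[OF t] by (intro ennreal_leI) linarith
  qed
  also have "\<dots> = (\<integral>\<^sup>+ t. ennreal ((C1 * sqrt T + C2) / sqrt t) * indicator {0<..<T} t \<partial>lebesgue)"
    by (subst nn_integral_restrict_space) auto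
  also have "\<dots> = (\<integral>\<^sup>+ t. ennreal (indicator {0<..<T} t * ((C1 * sqrt T + C2) / sqrt t)) \<partial>lborel)"
    unfolding nn_integral_completion by (intro nn_integral_cong) (auto simp: indicator_def)
  also have "\<dots> < \<infinity>" using C T by (intro nn_integral_inverse_sqrt) auto
  finally show "(\<integral>\<^sup>+ t. ennreal ((W12_norm (excess t))\<^sup>2) \<partial>lebesgue_on {0<..<T}) < \<infinity>" .
qed

text \<open>The square of \<open>v\<close> is at most \<open>B\<^sup>2 / t\<close> and vanishes off
  the wet region, exactly the growth that \<open>integrable_on_wet_region\<close> tolerates.\<close>

lemma v_L2: "v \<in> L2_on (strip T)"
proof -
  obtain B where B: "B > 0" "\<And>\<eta>. \<bar>flux \<eta>\<bar> \<le> B" by (rule flux_bound) blast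
  have m: "(\<lambda>p. indicator (strip T) p * (v p)\<^sup>2) \<in> borel_measurable borel"
    using sets_strip(1) v_borel by (intro borel_measurable_times borel_measurable_indicator borel_measurable_power)
  have "integrable lborel (\<lambda>p. indicator (strip T) p * (v p)\<^sup>2)"
  proof (rule integrable_on_wet_region[OF m _ _ less_imp_le[OF a] T])
    show "0 \<le> B\<^sup>2" by simp
    fix x t
    show "\<bar>indicator (strip T) (x, t) * (v (x, t))\<^sup>2\<bar> \<le> indicator (wet_region a T) (x, t) * (B\<^sup>2 / t)"
    proof (cases "(x, t) \<in> strip T \<and> x / sqrt t \<in> {0..a}")
      case True
      then have t: "0 < t" "t < T" "0 \<le> x" by (auto simp: strip_def)
      have "(x, t) \<in> wet_region a T" using True t by (auto simp: wet_region_def field_simps)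
      moreover have "(v (x, t))\<^sup>2 \<le> B\<^sup>2 / t"
      proof -
        have "(flux (x / sqrt t))\<^sup>2 \<le> B\<^sup>2" using power_mono[OF B(2)[of "x / sqrt t"], of 2] by simp
        then show ?thesis using t by (simp add: v_def power_divide divide_right_mono)
      qed
      ultimately show ?thesis using True by simp
    next
      case False
      then have "indicator (strip T) (x, t) * (v (x, t))\<^sup>2 = 0" by (auto simp: v_def flux_def)
      moreover have "0 \<le> indicator (wet_region a T) (x, t) * (B\<^sup>2 / t)" by (auto simp: wet_region_def indicator_def)
      ultimately show ?thesis by (simp only: abs_zero)
    qed
  qed
  then show ?thesis
    unfolding L2_on_def using v_borel integral_lebesgue_on_borel(2)[OF sets_strip(2) m]
    by (simp add: measurable_completion measurable_restrict_space1)
qed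

lemma weak_solution_w: "weak_solution \<phi> T V w_hat w"
  unfolding weak_solution_def
proof (intro conjI bexI[of _ v] v_L2 allI impI)
  have "\<bar>w p\<bar> \<le> max U V" for p
  proof -
    define \<eta> where "\<eta> = fst p / sqrt (snd p)"
    consider "\<eta> < 0" | "\<eta> \<in> {0..<a}" | "\<eta> = a" | "\<eta> > a" by fastforce
    then have "\<bar>f \<eta>\<bar> \<le> max U V"
      using flt[of \<eta>] fpos[of \<eta>] fle[of \<eta>] fgt[of \<eta>] fa U V by cases (auto simp: max_def)
    then show ?thesis by (simp add: w_def \<eta>_def)
  qed
  then show "w \<in> Linf_on (strip T)"
    unfolding Linf_on_def using w_borel
    by (intro CollectI conjI exI[of _ "max U V"] AE_I2) (simp_all add: measurable_completion measurable_restrict_space1)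
  show "(\<lambda>t x. \<D> \<phi> (w (x, t)) - \<D> \<phi> (w_hat x)) \<in> L2_W12_0 T"
    using excess_L2_W12_0 unfolding excess_def .
  obtain B where B: "B > 0" "\<And>\<eta>. \<bar>flux \<eta>\<bar> \<le> B" by (rule flux_bound) blast
  have S: "{0<..<T} \<in> sets lebesgue" by simp
  show "AE t in lebesgue_on {0<..<T}. has_weak_deriv (\<lambda>x. \<D> \<phi> (w (x, t))) (\<lambda>x. v (x, t))"
    unfolding AE_lebesgue_on_iff[OF S]
    by (intro AE_I2 impI pw_C1_has_weak_deriv[OF Dw_pw_C1[OF _ B(2)]]) auto
  fix \<xi> \<xi>x \<xi>t assume tf: "test_function T \<xi> \<xi>x \<xi>t"
  show "(LINT x|lebesgue_on {0<..}. - V * \<xi> (x, 0)) + (LINT p|lebesgue_on (strip T). w p * \<xi>t p)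
      = (LINT p|lebesgue_on (strip T). v p * \<xi>x p)"
  proof (rule weak_identity[OF tf T a fc Fc fa Fa df dF])
    fix x t :: real assume x: "0 \<le> x" "0 < t" "t < T"
    have iff: "x / sqrt t \<le> a \<longleftrightarrow> x \<le> a * sqrt t" using x by (simp add: pos_divide_le_eq)
    show "w (x, t) = (if x \<le> a * sqrt t then f (x / sqrt t) else - V)"
      using fgt[of "x / sqrt t"] iff by (auto simp: w_def not_le)
    show "v (x, t) = (if x \<le> a * sqrt t then F (x / sqrt t) / sqrt t else 0)"
      using iff x by (simp add: v_def flux_def)
  qed
qed

end

subsection \<open>Uniqueness: the equation for almost every time\<close>

lemma integrable_lborel2_tensor:
  fixes f g :: "real \<Rightarrow> real"
  assumes f: "integrable lborel f" and g: "integrable lborel g" and A: "A \<in> sets borel"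
  shows "integrable lborel (\<lambda>p. indicator A p * (f (fst p) * g (snd p)))"
proof -
  have [measurable]: "f \<in> borel_measurable borel" "g \<in> borel_measurable borel" using f g by auto
  have m: "(\<lambda>p. f (fst p) * g (snd p)) \<in> borel_measurable (lborel \<Otimes>\<^sub>M lborel)" by measurable
  have "integrable (lborel \<Otimes>\<^sub>M lborel) (\<lambda>p. f (fst p) * g (snd p))"
  proof (rule lborel_pair.Fubini_integrable[OF m])
    have "(\<lambda>x. LINT y|lborel. norm (f (fst (x, y)) * g (snd (x, y)))) = (\<lambda>x. \<bar>f x\<bar> * (LINT y|lborel. \<bar>g y\<bar>))"
      by (simp add: abs_mult)
    then show "integrable lborel (\<lambda>x. LINT y|lborel. norm (f (fst (x, y)) * g (snd (x, y))))"
      using f by simp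
    show "AE x in lborel. integrable lborel (\<lambda>y. f (fst (x, y)) * g (snd (x, y)))" using g by simp
  qed
  then have i: "integrable lborel (\<lambda>p. f (fst p) * g (snd p))" by (simp add: lborel_prod)
  have "integrable lborel (\<lambda>p. (f (fst p) * g (snd p)) * indicator A p)"
    by (rule integrable_real_mult_indicator[OF _ i]) (use A in simp)
  then show ?thesis by (simp add: mult.commute)
qed

lemma sets_less: "{p :: real \<times> real. fst p < snd p} \<in> sets borel" "{p :: real \<times> real. snd p < fst p} \<in> sets borel"
  by (auto intro!: borel_open open_Collect_less continuous_intros)

lemma measurable_fst_snd_lborel2:
  fixes f :: "real \<Rightarrow> real"
  assumes "f \<in> borel_measurable borel"
  shows "(\<lambda>p :: real \<times> real. f (fst p)) \<in> borel_measurable borel" "(\<lambda>p :: real \<times> real. f (snd p)) \<in> borel_measurable borel"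
  by (rule measurable_compose[OF _ assms], rule borel_measurable_continuous_onI, intro continuous_intros)+

text \<open>The situation of a difference of two weak solutions: the initial data cancel. Everywhere
  defined Borel functions that vanish off the strip allow all integrals, and Fubini's theorem, to be
  used on the full plane.\<close>

locale weak_equation =
  fixes T M :: real and W v :: "real \<times> real \<Rightarrow> real"
  assumes T: "T > 0"
    and W_borel: "W \<in> borel_measurable borel" and v_borel: "v \<in> borel_measurable borel"
    and W_bound: "\<And>p. \<bar>W p\<bar> \<le> M"
    and W_out: "\<And>p. p \<notin> strip T \<Longrightarrow> W p = 0" and v_out: "\<And>p. p \<notin> strip T \<Longrightarrow> v p = 0"
    and v2: "integrable lborel (\<lambda>p. (v p)\<^sup>2)"
    and eq: "\<And>\<xi> \<xi>x \<xi>t. test_function T \<xi> \<xi>x \<xi>t \<Longrightarrow> (LINT p|lborel. W p * \<xi>t p) = (LINT p|lborel. v p * \<xi>x p)"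

text \<open>Smooth test functions will be multiplied by the cutoff \<open>chi\<close>, which is only
  once continuously differentiable; this class is closed under that product.\<close>

definition C1_compact :: "real \<Rightarrow> real \<Rightarrow> (real \<Rightarrow> real) \<Rightarrow> (real \<Rightarrow> real) \<Rightarrow> bool" where
  "C1_compact p q g g' \<longleftrightarrow> 0 < p \<and> p < q \<and> (\<forall>x. (g has_real_derivative g' x) (at x)) \<and> continuous_on UNIV g' \<and>
     (\<forall>x. x \<notin> {p..q} \<longrightarrow> g x = 0 \<and> g' x = 0)"

lemma C1_compactD:
  assumes "C1_compact p q g g'"
  shows "continuous_on A g" "continuous_on A g'" "g \<in> borel_measurable borel" "g' \<in> borel_measurable borel"
    "\<exists>C>0. (\<forall>x. \<bar>g x\<bar> \<le> C * indicator {p..q} x) \<and> (\<forall>x. \<bar>g' x\<bar> \<le> C * indicator {p..q} x)"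
proof -
  have gc: "continuous_on A g" for A
    using assms unfolding C1_compact_def by (meson DERIV_continuous_on has_field_derivative_at_within)
  have g'c: "continuous_on A g'" for A
    using assms unfolding C1_compact_def by (meson continuous_on_subset subset_UNIV)
  show "continuous_on A g" "continuous_on A g'" by (rule gc g'c)+
  show "g \<in> borel_measurable borel" "g' \<in> borel_measurable borel"
    using gc g'c by (auto intro: borel_measurable_continuous_onI)
  obtain C1 where C1: "C1 > 0" "\<And>x. x \<in> {p..q} \<Longrightarrow> \<bar>g x\<bar> \<le> C1" using continuous_bounded_Icc[OF gc] by blast
  obtain C2 where C2: "C2 > 0" "\<And>x. x \<in> {p..q} \<Longrightarrow> \<bar>g' x\<bar> \<le> C2" using continuous_bounded_Icc[OF g'c] by blast
  show "\<exists>C>0. (\<forall>x. \<bar>g x\<bar> \<le> C * indicator {p..q} x) \<and> (\<forall>x. \<bar>g' x\<bar> \<le> C * indicator {p..q} x)"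
  proof (intro exI[of _ "C1 + C2"] conjI allI)
    fix x
    have z: "g x = 0 \<and> g' x = 0" if "x \<notin> {p..q}" using assms that by (simp add: C1_compact_def)
    show "\<bar>g x\<bar> \<le> (C1 + C2) * indicator {p..q} x"
    proof (cases "x \<in> {p..q}")
      case True
      then show ?thesis using C1(2)[OF True] C2(1) by simp
    qed (use z in simp)
    show "\<bar>g' x\<bar> \<le> (C1 + C2) * indicator {p..q} x"
    proof (cases "x \<in> {p..q}")
      case True
      then show ?thesis using C2(2)[OF True] C1(1) by simp
    qed (use z in simp)
  qed (use C1 C2 in auto)
qed

text \<open>The time factor vanishes at \<open>T\<close> but is free at time 0. This freedom encodes
  the zero initial value and produces identities integrated from time 0.\<close>

lemma test_function_tensor:
  assumes g: "C1_compact p q g g'" and T: "T > 0"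
    and h: "\<And>t. t \<in> {0..T} \<Longrightarrow> (h has_real_derivative k t) (at t within {0..T})"
    and k: "continuous_on {0..T} k" and hT: "h T = 0"
  shows "test_function T (\<lambda>p. g (fst p) * h (snd p)) (\<lambda>p. g' (fst p) * h (snd p)) (\<lambda>p. g (fst p) * k (snd p))"
proof -
  let ?D = "{0..} \<times> {0..T} :: (real \<times> real) set"
  have hc: "continuous_on {0..T} h" using h by (rule DERIV_continuous_on)
  have deriv: "((\<lambda>p. g (fst p) * h (snd p)) has_derivative (\<lambda>(a, b). g' (fst p) * h (snd p) * a + g (fst p) * k (snd p) * b)) (at p within ?D)"
    if p: "p \<in> ?D" for p
  proof -
  have 1: "((\<lambda>p. g (fst p)) has_derivative (\<lambda>d. g' (fst p) * fst d)) (at p within ?D)"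
  proof (rule has_derivative_in_compose[where f=fst and f'=fst and g=g and g'="(*) (g' (fst p))"])
    show "(fst has_derivative fst) (at p within ?D)" by (auto intro!: derivative_intros)
    have "(g has_real_derivative g' (fst p)) (at (fst p) within fst ` ?D)"
      using g by (auto simp: C1_compact_def intro: has_field_derivative_at_within)
    then show "(g has_derivative (*) (g' (fst p))) (at (fst p) within fst ` ?D)" by (simp add: has_field_derivative_def)
  qed
  have 2: "((\<lambda>p. h (snd p)) has_derivative (\<lambda>d. k (snd p) * snd d)) (at p within ?D)"
  proof (rule has_derivative_in_compose[where f=snd and f'=snd and g=h and g'="(*) (k (snd p))"])
    show "(snd has_derivative snd) (at p within ?D)" by (auto intro!: derivative_intros)
    have "(h has_derivative (*) (k (snd p))) (at (snd p) within {0..T})"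
      using h[of "snd p"] p by (auto simp: has_field_derivative_def)
    then show "(h has_derivative (*) (k (snd p))) (at (snd p) within snd ` ?D)"
      by (rule has_derivative_subset) auto
  qed
  have "(\<lambda>d. g (fst p) * (k (snd p) * snd d) + g' (fst p) * fst d * h (snd p))
      = (\<lambda>(a, b). g' (fst p) * h (snd p) * a + g (fst p) * k (snd p) * b)" by auto
    with has_derivative_mult[OF 1 2] show ?thesis by simp
  qed
  have c1: "continuous_on ?D (\<lambda>p. g' (fst p) * h (snd p))"
    by (intro continuous_intros continuous_on_compose2[OF C1_compactD(2)[OF g, of UNIV]] continuous_on_compose2[OF hc]) auto
  have c2: "continuous_on ?D (\<lambda>p. g (fst p) * k (snd p))"
    by (intro continuous_intros continuous_on_compose2[OF C1_compactD(1)[OF g, of UNIV]] continuous_on_compose2[OF k]) auto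
  have z1: "g (fst (0, t)) * h (snd (0, t)) = 0" for t :: real using g by (simp add: C1_compact_def)
  have z2: "g (fst (x, T)) * h (snd (x, T)) = 0" for x :: real using hT by simp
  have "{p \<in> ?D. g (fst p) * h (snd p) \<noteq> 0} \<subseteq> {0..q} \<times> {0..T}"
  proof
    fix r assume r: "r \<in> {p \<in> ?D. g (fst p) * h (snd p) \<noteq> 0}"
    then have "g (fst r) \<noteq> 0" by auto
    then have "fst r \<in> {p..q}" using g unfolding C1_compact_def by blast
    then show "r \<in> {0..q} \<times> {0..T}" using r by (cases r) auto
  qed
  then have "closure {p \<in> ?D. g (fst p) * h (snd p) \<noteq> 0} \<subseteq> {0..q} \<times> {0..T}"
    by (rule closure_minimal) (intro closed_Times; simp)
  moreover have "q > 0" using g by (auto simp: C1_compact_def)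
  ultimately have supp: "\<exists>J>0. closure {p \<in> ?D. g (fst p) * h (snd p) \<noteq> 0} \<subseteq> {0..J} \<times> {0..T}" by blast
  show ?thesis
    unfolding test_function_def
    by (intro conjI) (use deriv in blast, use c1 in blast, use c2 in blast, use z1 in blast, use z2 in blast, use supp in blast)
qed

section \<open>The equation integrated in time, for a fixed spatial test function\<close>

context weak_equation
begin

text \<open>The integral of the flux over the times before \<open>s\<close>; the lower limit 0 is
  implicit, since \<open>v\<close> vanishes off the strip.\<close>

definition "Vb = (\<lambda>x s. LINT t|lborel. indicator {..<s} t * v (x, t))"

lemma v_integrable_weight:
  assumes "g \<in> borel_measurable borel" "\<And>x. \<bar>g x\<bar> \<le> C * indicator {p..q} x" "C > 0"
  shows "integrable lborel (\<lambda>r. v r * g (fst r))"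
proof (rule Bochner_Integration.integrable_bound)
  show "integrable lborel (\<lambda>r. C * ((v r)\<^sup>2 + indicator (cbox (p, 0) (q, T)) r))"
    by (intro integrable_mult_right Bochner_Integration.integrable_add v2 integrable_real_indicator emeasure_lborel_cbox_finite) auto
  show "(\<lambda>r. v r * g (fst r)) \<in> borel_measurable lborel"
    using borel_measurable_times[OF v_borel measurable_fst_snd_lborel2(1)[OF assms(1)]] by simp
  show "AE r in lborel. norm (v r * g (fst r)) \<le> norm (C * ((v r)\<^sup>2 + indicator (cbox (p, 0) (q, T)) r))"
  proof (intro AE_I2)
    fix r :: "real \<times> real"
    have le: "\<bar>y\<bar> \<le> y\<^sup>2 + 1" for y :: real
      using sum_squares_bound[of "\<bar>y\<bar>" 1] by simp
    show "norm (v r * g (fst r)) \<le> norm (C * ((v r)\<^sup>2 + indicator (cbox (p, 0) (q, T)) r))"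
    proof (cases "r \<in> strip T \<and> fst r \<in> {p..q}")
      case True
      then have r: "r \<in> cbox (p, 0) (q, T)" by (cases r) (auto simp: strip_def cbox_Pair_eq)
      have "\<bar>v r * g (fst r)\<bar> \<le> ((v r)\<^sup>2 + 1) * C"
        unfolding abs_mult using le[of "v r"] assms(2)[of "fst r"] True by (intro mult_mono) auto
      then show ?thesis using r assms(3) by (simp add: abs_mult mult.commute)
    next
      case False
      then have z: "v r * g (fst r) = 0" using v_out[of r] assms(2)[of "fst r"] by auto
      show ?thesis unfolding z by simp
    qed
  qed
qed

lemma W_integrable_weight:
  assumes "g \<in> borel_measurable borel" "\<And>x. \<bar>g x\<bar> \<le> C * indicator {p..q} x" "C > 0"
  shows "integrable lborel (\<lambda>r. W r * g (fst r))"
proof (rule integrable_lborel_bounded_support)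
  show "(\<lambda>r. W r * g (fst r)) \<in> borel_measurable borel"
    using borel_measurable_times[OF W_borel measurable_fst_snd_lborel2(1)[OF assms(1)]] by simp
  fix r :: "real \<times> real"
  show "\<bar>W r * g (fst r)\<bar> \<le> M * C * indicator (cbox (p, 0) (q, T)) r"
  proof (cases "r \<in> strip T \<and> fst r \<in> {p..q}")
    case True
    then have r: "r \<in> cbox (p, 0) (q, T)" by (cases r) (auto simp: strip_def cbox_Pair_eq)
    have "\<bar>W r * g (fst r)\<bar> \<le> M * C"
      unfolding abs_mult using W_bound[of r] assms(2)[of "fst r"] True by (intro mult_mono) auto
    then show ?thesis using r by simp
  next
    case False
    then have z: "W r * g (fst r) = 0" using W_out[of r] assms(2)[of "fst r"] by auto
    have "M \<ge> 0" using W_bound[of r] by linarith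
    then show ?thesis unfolding z using assms(3) by (simp add: indicator_def)
  qed
qed

text \<open>For \<open>\<xi> = g h\<close> with \<open>h' = k\<close> and \<open>h T = 0\<close>,
  moving \<open>h\<close> onto the flux by Fubini's theorem shows that the left-hand side, as a
  function of \<open>s\<close>, is orthogonal to every bump \<open>k\<close>. The fundamental lemma,
  applied in the time variable, concludes.\<close>

lemma time_slices:
  assumes g: "C1_compact p q g g'"
  shows "AE s in lborel. s \<in> {0<..<T} \<longrightarrow>
      (LINT x|lborel. W (x, s) * g x) + (LINT t|lborel. indicator {..<s} t * (LINT x|lborel. v (x, t) * g' x)) = 0"
proof -
  obtain C where C: "C > 0" "\<And>x. \<bar>g x\<bar> \<le> C * indicator {p..q} x" "\<And>x. \<bar>g' x\<bar> \<le> C * indicator {p..q} x"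
    using C1_compactD(5)[OF g] by blast
  note gm = C1_compactD(3,4)[OF g]
  define Wg where "Wg = (\<lambda>s. LINT x|lborel. W (x, s) * g x)"
  define vg where "vg = (\<lambda>t. LINT x|lborel. v (x, t) * g' x)"
  define P where "P = (\<lambda>s. LINT t|lborel. indicator {..<s} t * vg t)"
  have iW: "integrable lborel (\<lambda>r. W r * g (fst r))" by (rule W_integrable_weight[OF gm(1) C(2,1)])
  have iv: "integrable lborel (\<lambda>r. v r * g' (fst r))" by (rule v_integrable_weight[OF gm(2) C(3,1)])
  have iWg: "integrable lborel Wg" using lborel2_integral_snd(2)[OF iW] by (simp add: Wg_def)
  have ivg: "integrable lborel vg" using lborel2_integral_snd(2)[OF iv] by (simp add: vg_def)
  have Wg0: "Wg s = 0" "vg s = 0" if "s \<notin> {0<..<T}" for s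
    using that W_out v_out by (simp_all add: Wg_def vg_def strip_def)
  \<comment> \<open>Integration by parts in time without differentiability: both sides are integrals
    over the triangle of pairs with the flux time before \<open>s\<close>.\<close>
  have tensor: "(LINT t|lborel. vg t * (LINT s|lborel. indicator {t<..} s * j s)) = (LINT s|lborel. j s * P s)"
    "integrable lborel (\<lambda>s. j s * P s)" if j: "integrable lborel j" for j
  proof -
    let ?K = "\<lambda>r :: real \<times> real. indicator {r. fst r < snd r} r * (vg (fst r) * j (snd r))"
    have K: "integrable lborel ?K" by (rule integrable_lborel2_tensor[OF ivg j sets_less(1)])
    have e1: "(\<lambda>x. LINT t|lborel. ?K (x, t)) = (\<lambda>t. vg t * (LINT s|lborel. indicator {t<..} s * j s))"
    proof
      fix t
      have "(LINT s|lborel. ?K (t, s)) = (LINT s|lborel. vg t * (indicator {t<..} s * j s))"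
        by (intro Bochner_Integration.integral_cong) (auto simp: indicator_def)
      then show "(LINT s|lborel. ?K (t, s)) = vg t * (LINT s|lborel. indicator {t<..} s * j s)" by simp
    qed
    have e2: "(\<lambda>s. LINT t|lborel. ?K (t, s)) = (\<lambda>s. j s * P s)"
    proof
      fix s
      have "(LINT t|lborel. ?K (t, s)) = (LINT t|lborel. j s * (indicator {..<s} t * vg t))"
        by (intro Bochner_Integration.integral_cong) (auto simp: indicator_def)
      then show "(LINT t|lborel. ?K (t, s)) = j s * P s" by (simp add: P_def)
    qed
    show "(LINT t|lborel. vg t * (LINT s|lborel. indicator {t<..} s * j s)) = (LINT s|lborel. j s * P s)"
      using lborel2_integral_fst(1)[OF K] lborel2_integral_snd(1)[OF K] unfolding e1 e2 by simp
    show "integrable lborel (\<lambda>s. j s * P s)" using lborel2_integral_snd(2)[OF K] unfolding e2 .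
  qed
  define E where "E = (\<lambda>s. indicator {0<..<T} s * (Wg s + P s))"
  have iE: "integrable lborel E"
  proof -
    have "integrable lborel (indicator {0<..<T} :: real \<Rightarrow> real)" using T by simp
    from tensor(2)[OF this] iWg have "integrable lborel (\<lambda>s. Wg s + indicator {0<..<T} s * P s)" by simp
    also have "(\<lambda>s. Wg s + indicator {0<..<T} s * P s) = E"
      using Wg0 by (auto simp: E_def indicator_def fun_eq_iff)
    finally show ?thesis .
  qed
  have Em: "E \<in> borel_measurable borel" using iE by auto
  \<comment> \<open>The half line of the fundamental lemma is here the time axis; \<open>E\<close>
    carries the indicator of the interval from 0 to \<open>T\<close>.\<close>
  have "AE s in lebesgue_on {0<..}. E s = 0"
  proof (rule AE_zero_if_rat_bumps)
    show "integrable (lebesgue_on {p..q}) E" for p q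
    proof -
      have "integrable lborel (\<lambda>x. E x * indicator {p..q} x)"
        by (rule integrable_real_mult_indicator[OF _ iE]) simp
      then show ?thesis using Em by (subst integral_lebesgue_on_borel(2)) (auto simp: mult.commute)
    qed
    fix k assume k: "k \<in> rat_bumps"
    have ks: "smooth_on UNIV k" using k rat_bumps_Cc_inf by (auto simp: Cc_inf_def)
    have kc: "continuous_on A k" for A using ks by (rule smooth_continuous)
    have km: "k \<in> borel_measurable borel" using ks by (rule smooth_measurable)
    \<comment> \<open>The primitive of the bump normalised at the final time, so that between 0 and
      \<open>T\<close> it is minus the integral of \<open>k\<close> over the remaining
      times.\<close>
    define h where "h = (\<lambda>t. integral {0..t} k - integral {0..T} k)"
    have dh: "(h has_real_derivative k t) (at t within {0..T})" if "t \<in> {0..T}" for t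
      unfolding h_def using integral_has_real_derivative[OF kc that] by (auto intro!: derivative_eq_intros)
    have hT: "h T = 0" by (simp add: h_def)
    have tf: "test_function T (\<lambda>p. g (fst p) * h (snd p)) (\<lambda>p. g' (fst p) * h (snd p)) (\<lambda>p. g (fst p) * k (snd p))"
      by (rule test_function_tensor[OF g T dh kc hT])
    have hc: "continuous_on {0..T} h" using dh by (rule DERIV_continuous_on)
    define j where "j = (\<lambda>s. indicator {0<..<T} s * k s)"
    have ij: "integrable lborel j"
    proof -
      have "integrable lborel (\<lambda>s. (indicator {0..T} s * k s) * indicator {0<..<T} s)"
        by (rule integrable_real_mult_indicator[OF _ integrable_lborel_Icc[OF kc]]) simp
      also have "(\<lambda>s. (indicator {0..T} s * k s) * indicator {0<..<T} s) = j" by (auto simp: j_def indicator_def)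
      finally show ?thesis .
    qed
    have hj: "(LINT s|lborel. indicator {t<..} s * j s) = - h t" if t: "t \<in> {0<..<T}" for t
    proof -
      have "(LINT s|lborel. indicator {t<..} s * j s) = (LINT s|lborel. indicator {t<..<T} s * k s)"
        using t by (intro Bochner_Integration.integral_cong) (auto simp: j_def indicator_def)
      also have "\<dots> = h T - h t"
      proof (rule FTC_lborel_open)
        show "continuous_on {t..T} h" using hc by (rule continuous_on_subset) (use t in auto)
        show "(h has_real_derivative k x) (at x)" if "x \<in> {t<..<T}" for x
          using dh[of x] that t at_within_interior[of x "{0..T}"] by auto
        have "integrable lborel (\<lambda>s. (indicator {0..T} s * k s) * indicator {t<..<T} s)"
          by (rule integrable_real_mult_indicator[OF _ integrable_lborel_Icc[OF kc]]) simp
        also have "(\<lambda>s. (indicator {0..T} s * k s) * indicator {t<..<T} s) = (\<lambda>s. indicator {t<..<T} s * k s)"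
          using t by (auto simp: indicator_def)
        finally show "integrable lborel (\<lambda>s. indicator {t<..<T} s * k s)" .
      qed (use t in auto)
      finally show ?thesis using hT by simp
    qed
    obtain Ck where Ck: "Ck > 0" "\<And>t. t \<in> {0..T} \<Longrightarrow> \<bar>k t\<bar> \<le> Ck" using continuous_bounded_Icc[OF kc] by blast
    obtain Ch where Ch: "Ch > 0" "\<And>t. t \<in> {0..T} \<Longrightarrow> \<bar>h t\<bar> \<le> Ch" using continuous_bounded_Icc[OF hc] by blast
    have strip_t: "snd r \<in> {0<..<T}" if "r \<in> strip T" for r using that by (auto simp: strip_def)
    have iWk: "integrable lborel (\<lambda>r. W r * (g (fst r) * k (snd r)))"
    proof (rule Bochner_Integration.integrable_bound)
      show "integrable lborel (\<lambda>r. Ck * (W r * g (fst r)))" using iW by simp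
      show "(\<lambda>r. W r * (g (fst r) * k (snd r))) \<in> borel_measurable lborel"
        using borel_measurable_times[OF W_borel borel_measurable_times[OF measurable_fst_snd_lborel2(1)[OF gm(1)] measurable_fst_snd_lborel2(2)[OF km]]] by simp
      show "AE r in lborel. norm (W r * (g (fst r) * k (snd r))) \<le> norm (Ck * (W r * g (fst r)))"
      proof (intro AE_I2)
        fix r
        show "norm (W r * (g (fst r) * k (snd r))) \<le> norm (Ck * (W r * g (fst r)))"
        proof (cases "r \<in> strip T")
          case True
          have "\<bar>W r * g (fst r)\<bar> * \<bar>k (snd r)\<bar> \<le> \<bar>W r * g (fst r)\<bar> * Ck"
            using Ck(2)[of "snd r"] strip_t[OF True] by (intro mult_left_mono) auto
          then show ?thesis using Ck(1) by (simp add: abs_mult ac_simps)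
        qed (simp add: W_out)
      qed
    qed
    have h0m: "(\<lambda>t. indicator {0..T} t * h t) \<in> borel_measurable borel"
      using borel_measurable_continuous_on_indicator[OF _ hc] by simp
    have evh: "v r * (g' (fst r) * h (snd r)) = v r * g' (fst r) * (indicator {0..T} (snd r) * h (snd r))" for r
      using v_out[of r] strip_t[of r] by (cases "r \<in> strip T") (auto simp: indicator_def)
    have ivh: "integrable lborel (\<lambda>r. v r * (g' (fst r) * h (snd r)))"
    proof (rule Bochner_Integration.integrable_bound)
      show "integrable lborel (\<lambda>r. Ch * (v r * g' (fst r)))" using iv by simp
      show "(\<lambda>r. v r * (g' (fst r) * h (snd r))) \<in> borel_measurable lborel"
        unfolding evh
        using borel_measurable_times[OF borel_measurable_times[OF v_borel measurable_fst_snd_lborel2(1)[OF gm(2)]] measurable_fst_snd_lborel2(2)[OF h0m]] by simp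
      show "AE r in lborel. norm (v r * (g' (fst r) * h (snd r))) \<le> norm (Ch * (v r * g' (fst r)))"
      proof (intro AE_I2)
        fix r
        show "norm (v r * (g' (fst r) * h (snd r))) \<le> norm (Ch * (v r * g' (fst r)))"
        proof (cases "r \<in> strip T")
          case True
          have "\<bar>v r * g' (fst r)\<bar> * \<bar>h (snd r)\<bar> \<le> \<bar>v r * g' (fst r)\<bar> * Ch"
            using Ch(2)[of "snd r"] strip_t[OF True] by (intro mult_left_mono) auto
          then show ?thesis using Ch(1) by (simp add: abs_mult ac_simps)
        qed (simp add: v_out)
      qed
    qed
    have "(LINT s|lborel. Wg s * k s) = (LINT p|lborel. W p * (g (fst p) * k (snd p)))"
    proof -
      have "(LINT s|lborel. Wg s * k s) = (LINT s|lborel. LINT x|lborel. W (x, s) * (g x * k s))"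
        unfolding Wg_def by (simp add: mult.assoc[symmetric])
      then show ?thesis using lborel2_integral_snd(1)[OF iWk] by simp
    qed
    also have "\<dots> = (LINT p|lborel. v p * (g' (fst p) * h (snd p)))" by (rule eq[OF tf])
    also have "\<dots> = (LINT s|lborel. vg s * h s)"
    proof -
      have "(LINT s|lborel. vg s * h s) = (LINT s|lborel. LINT x|lborel. v (x, s) * (g' x * h s))"
        unfolding vg_def by (simp add: mult.assoc[symmetric])
      then show ?thesis using lborel2_integral_snd(1)[OF ivh] by simp
    qed
    also have "\<dots> = (LINT t|lborel. - (vg t * (LINT s|lborel. indicator {t<..} s * j s)))"
    proof (rule Bochner_Integration.integral_cong[OF refl])
      fix t
      show "vg t * h t = - (vg t * (LINT s|lborel. indicator {t<..} s * j s))"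
        using hj[of t] Wg0(2)[of t] by (cases "t \<in> {0<..<T}") auto
    qed
    also have "\<dots> = - (LINT s|lborel. j s * P s)" using tensor(1)[OF ij] by simp
    finally have 1: "(LINT s|lborel. Wg s * k s) + (LINT s|lborel. j s * P s) = 0" by simp
    have iWgk: "integrable lborel (\<lambda>s. Wg s * k s)"
      using lborel2_integral_snd(2)[OF iWk] unfolding Wg_def by (simp add: mult.assoc[symmetric])
    have "(LINT x|lebesgue_on {0<..}. E x * k x) = (LINT x|lborel. indicator {0<..} x * (E x * k x))"
    proof (rule integral_lebesgue_on_borel)
      show "(\<lambda>x. indicator {0<..} x * (E x * k x)) \<in> borel_measurable borel"
        using Em km by (intro borel_measurable_times borel_measurable_indicator) auto
    qed simp
    also have "\<dots> = (LINT s|lborel. Wg s * k s + j s * P s)"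
    proof (rule Bochner_Integration.integral_cong[OF refl])
      fix s
      show "indicator {0<..} s * (E s * k s) = Wg s * k s + j s * P s"
        using Wg0(1)[of s] by (cases "s \<in> {0<..<T}") (auto simp: E_def j_def algebra_simps)
    qed
    also have "\<dots> = (LINT s|lborel. Wg s * k s) + (LINT s|lborel. j s * P s)"
      by (rule Bochner_Integration.integral_add[OF iWgk tensor(2)[OF ij]])
    finally show "(LINT x|lebesgue_on {0<..}. E x * k x) = 0" using 1 by simp
  qed
  then have "AE s in lebesgue. s \<in> {0<..} \<longrightarrow> E s = 0" by (simp add: AE_lebesgue_on_iff)
  then have "AE s in lborel. s \<in> {0<..} \<longrightarrow> E s = 0" by (simp only: AE_completion_iff)
  then show ?thesis
    by eventually_elim (auto simp: E_def Wg_def P_def vg_def)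
qed

text \<open>Fubini's theorem brings the time integral inside, where it acts on \<open>v\<close>
  alone.\<close>

lemma Vb_integral:
  assumes g: "C1_compact p q g g'"
  shows "(LINT t|lborel. indicator {..<s} t * (LINT x|lborel. v (x, t) * g' x)) = (LINT x|lborel. Vb x s * g' x)"
proof -
  obtain C where C: "C > 0" "\<And>x. \<bar>g x\<bar> \<le> C * indicator {p..q} x" "\<And>x. \<bar>g' x\<bar> \<le> C * indicator {p..q} x"
    using C1_compactD(5)[OF g] by blast
  have iv: "integrable lborel (\<lambda>r. v r * g' (fst r))" by (rule v_integrable_weight[OF C1_compactD(4)[OF g] C(3,1)])
  let ?A = "UNIV \<times> {..<s} :: (real \<times> real) set"
  have "integrable lborel (\<lambda>r. v r * g' (fst r) * indicator ?A r)"
    by (rule integrable_real_mult_indicator[OF _ iv]) (simp add: borel_Times)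
  note fub = lborel2_integral_snd(1)[OF this] lborel2_integral_fst(1)[OF this]
  have "(LINT t|lborel. indicator {..<s} t * (LINT x|lborel. v (x, t) * g' x))
      = (LINT t|lborel. LINT x|lborel. v (x, t) * g' (fst (x, t)) * indicator ?A (x, t))"
  proof (rule Bochner_Integration.integral_cong[OF refl])
    fix t
    show "indicator {..<s} t * (LINT x|lborel. v (x, t) * g' x) = (LINT x|lborel. v (x, t) * g' (fst (x, t)) * indicator ?A (x, t))"
      by (cases "t < s") (auto simp: indicator_def)
  qed
  also have "\<dots> = (LINT x|lborel. LINT t|lborel. v (x, t) * g' (fst (x, t)) * indicator ?A (x, t))"
    using fub by simp
  also have "\<dots> = (LINT x|lborel. Vb x s * g' x)"
  proof (rule Bochner_Integration.integral_cong[OF refl])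
    fix x
    have "(LINT t|lborel. v (x, t) * g' (fst (x, t)) * indicator ?A (x, t)) = (LINT t|lborel. (indicator {..<s} t * v (x, t)) * g' x)"
      by (intro Bochner_Integration.integral_cong) (auto simp: indicator_def)
    then show "(LINT t|lborel. v (x, t) * g' (fst (x, t)) * indicator ?A (x, t)) = Vb x s * g' x"
      by (simp add: Vb_def)
  qed
  finally show ?thesis .
qed

end

text \<open>The kernel of the bounded functional on the Sobolev space given by two square integrable
  weights. It is a closed subspace; the next lemmas prove this, so that an identity for test
  functions extends to \<D>(w) at almost every time.\<close>

definition annihilates :: "(real \<Rightarrow> real) \<Rightarrow> (real \<Rightarrow> real) \<Rightarrow> (real \<Rightarrow> real) \<Rightarrow> bool" where
  "annihilates \<gamma> \<delta> u \<longleftrightarrow> u \<in> W12 \<and> (LINT x|lebesgue_on {0<..}. \<gamma> x * u x + \<delta> x * weak_deriv u x) = 0"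

lemma annihilates_integrable:
  assumes "\<gamma> \<in> L2_on {0<..}" "\<delta> \<in> L2_on {0<..}" "u \<in> W12"
  shows "integrable (lebesgue_on {0<..}) (\<lambda>x. \<gamma> x * u x + \<delta> x * weak_deriv u x)"
  by (intro Bochner_Integration.integrable_add L2_on_times assms W12D)

lemma annihilates_functional_linear:
  assumes L2: "\<gamma> \<in> L2_on {0<..}" "\<delta> \<in> L2_on {0<..}" and u: "u \<in> W12" "u' \<in> W12"
  shows "(LINT x|lebesgue_on {0<..}. \<gamma> x * (a * u x + b * u' x) + \<delta> x * weak_deriv (\<lambda>x. a * u x + b * u' x) x)
    = a * (LINT x|lebesgue_on {0<..}. \<gamma> x * u x + \<delta> x * weak_deriv u x)
      + b * (LINT x|lebesgue_on {0<..}. \<gamma> x * u' x + \<delta> x * weak_deriv u' x)"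
proof -
  note i = annihilates_integrable[OF L2]
  have "(LINT x|lebesgue_on {0<..}. \<gamma> x * (a * u x + b * u' x) + \<delta> x * weak_deriv (\<lambda>x. a * u x + b * u' x) x)
      = (LINT x|lebesgue_on {0<..}. a * (\<gamma> x * u x + \<delta> x * weak_deriv u x) + b * (\<gamma> x * u' x + \<delta> x * weak_deriv u' x))"
  proof (rule integral_cong_AE)
    show "AE x in lebesgue_on {0<..}. \<gamma> x * (a * u x + b * u' x) + \<delta> x * weak_deriv (\<lambda>x. a * u x + b * u' x) x
        = a * (\<gamma> x * u x + \<delta> x * weak_deriv u x) + b * (\<gamma> x * u' x + \<delta> x * weak_deriv u' x)"
      using W12_linear(2)[OF u, of a b] by eventually_elim (simp add: algebra_simps)
  qed (use i[OF W12_linear(1)[OF u, of a b]] i[OF u(1)] i[OF u(2)] in auto)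
  also have "\<dots> = a * (LINT x|lebesgue_on {0<..}. \<gamma> x * u x + \<delta> x * weak_deriv u x)
      + b * (LINT x|lebesgue_on {0<..}. \<gamma> x * u' x + \<delta> x * weak_deriv u' x)"
    using i[OF u(1)] i[OF u(2)] by simp
  finally show ?thesis .
qed

lemma annihilates_linear:
  assumes "\<gamma> \<in> L2_on {0<..}" "\<delta> \<in> L2_on {0<..}" "annihilates \<gamma> \<delta> u" "annihilates \<gamma> \<delta> u'"
  shows "annihilates \<gamma> \<delta> (\<lambda>x. a * u x + b * u' x)"
  using assms annihilates_functional_linear[OF assms(1,2), of u u' a b] W12_linear(1)[of u u' a b]
  unfolding annihilates_def by simp

lemma annihilates_sum:
  assumes "\<gamma> \<in> L2_on {0<..}" "\<delta> \<in> L2_on {0<..}" "\<And>i. i < (k::nat) \<Longrightarrow> annihilates \<gamma> \<delta> (g i)"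
  shows "annihilates \<gamma> \<delta> (\<lambda>x. \<Sum>i<k. c i * g i x)"
  using assms(3)
proof (induction k)
  case 0
  have "pw_C1 1 0 (\<lambda>_. 0) (\<lambda>_. 0)" by (auto simp: pw_C1_def)
  then have w: "(\<lambda>_::real. 0::real) \<in> W12" by (rule pw_C1_W12)
  from annihilates_functional_linear[OF assms(1,2) w w, of 0 0] w show ?case by (simp add: annihilates_def)
next
  case (Suc k)
  have "annihilates \<gamma> \<delta> (\<lambda>x. 1 * (\<Sum>i<k. c i * g i x) + c k * g k x)"
    by (rule annihilates_linear[OF assms(1,2)]) (use Suc in auto)
  then show ?case by simp
qed

lemma W12_norm_power2:
  "(W12_norm u)\<^sup>2 = (LINT x|lebesgue_on {0<..}. (u x)\<^sup>2) + (LINT x|lebesgue_on {0<..}. (weak_deriv u x)\<^sup>2)"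
  unfolding W12_norm_def by (simp add: integral_nonneg_AE)

text \<open>Young's inequality with a free parameter takes the place of Cauchy--Schwarz: the term
  with the norm of \<open>d\<close> vanishes in the limit for fixed \<open>e\<close>, and
  \<open>e\<close> is arbitrary.\<close>

lemma annihilates_functional_bound:
  assumes L2: "\<gamma> \<in> L2_on {0<..}" "\<delta> \<in> L2_on {0<..}" and d: "d \<in> W12" and e: "e > 0"
  shows "\<bar>LINT x|lebesgue_on {0<..}. \<gamma> x * d x + \<delta> x * weak_deriv d x\<bar>
    \<le> e * ((LINT x|lebesgue_on {0<..}. (\<gamma> x)\<^sup>2) + (LINT x|lebesgue_on {0<..}. (\<delta> x)\<^sup>2)) + (W12_norm d)\<^sup>2 / e"
proof -
  note D = W12D[OF d]
  have am: "\<bar>x * y\<bar> \<le> e * x\<^sup>2 + y\<^sup>2 / e" for x y :: real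
  proof -
    define s where "s = sqrt e"
    have s: "s > 0" "e = s\<^sup>2" using e by (auto simp: s_def)
    have "2 * \<bar>s * x\<bar> * \<bar>y / s\<bar> \<le> \<bar>s * x\<bar>\<^sup>2 + \<bar>y / s\<bar>\<^sup>2" by (rule sum_squares_bound)
    moreover have "\<bar>s * x\<bar> * \<bar>y / s\<bar> = \<bar>x * y\<bar>" using s by (simp add: abs_mult abs_divide)
    moreover have "\<bar>s * x\<bar>\<^sup>2 = e * x\<^sup>2" "\<bar>y / s\<bar>\<^sup>2 = y\<^sup>2 / e" using s by (simp_all add: power_mult_distrib power_divide)
    moreover have "0 \<le> \<bar>x * y\<bar>" by simp
    ultimately show ?thesis by linarith
  qed
  have i: "integrable (lebesgue_on {0<..}) (\<lambda>x. (\<gamma> x)\<^sup>2)" "integrable (lebesgue_on {0<..}) (\<lambda>x. (\<delta> x)\<^sup>2)"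
    "integrable (lebesgue_on {0<..}) (\<lambda>x. (d x)\<^sup>2)" "integrable (lebesgue_on {0<..}) (\<lambda>x. (weak_deriv d x)\<^sup>2)"
    using L2 D(1,3) by (auto simp: L2_on_def)
  have "\<bar>LINT x|lebesgue_on {0<..}. \<gamma> x * d x + \<delta> x * weak_deriv d x\<bar>
      \<le> (LINT x|lebesgue_on {0<..}. \<bar>\<gamma> x * d x + \<delta> x * weak_deriv d x\<bar>)"
    using integral_abs_bound by blast
  also have "\<dots> \<le> (LINT x|lebesgue_on {0<..}. (e * (\<gamma> x)\<^sup>2 + (d x)\<^sup>2 / e) + (e * (\<delta> x)\<^sup>2 + (weak_deriv d x)\<^sup>2 / e))"
  proof (rule integral_mono)
    show "integrable (lebesgue_on {0<..}) (\<lambda>x. \<bar>\<gamma> x * d x + \<delta> x * weak_deriv d x\<bar>)"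
      using annihilates_integrable[OF L2 d] by simp
    show "integrable (lebesgue_on {0<..}) (\<lambda>x. (e * (\<gamma> x)\<^sup>2 + (d x)\<^sup>2 / e) + (e * (\<delta> x)\<^sup>2 + (weak_deriv d x)\<^sup>2 / e))"
      using i by simp
    show "\<bar>\<gamma> x * d x + \<delta> x * weak_deriv d x\<bar> \<le> (e * (\<gamma> x)\<^sup>2 + (d x)\<^sup>2 / e) + (e * (\<delta> x)\<^sup>2 + (weak_deriv d x)\<^sup>2 / e)" for x
      using am[of "\<gamma> x" "d x"] am[of "\<delta> x" "weak_deriv d x"] by linarith
  qed
  also have "\<dots> = e * ((LINT x|lebesgue_on {0<..}. (\<gamma> x)\<^sup>2) + (LINT x|lebesgue_on {0<..}. (\<delta> x)\<^sup>2)) + (W12_norm d)\<^sup>2 / e"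
    unfolding W12_norm_power2 using i by (simp add: algebra_simps add_divide_distrib)
  finally show ?thesis .
qed

lemma annihilates_limit:
  assumes L2: "\<gamma> \<in> L2_on {0<..}" "\<delta> \<in> L2_on {0<..}" and u: "u \<in> W12"
    and \<psi>: "\<And>n. annihilates \<gamma> \<delta> (\<psi> n)" and lim: "(\<lambda>n. W12_norm (\<lambda>x. u x - \<psi> n x)) \<longlonglongrightarrow> 0"
  shows "annihilates \<gamma> \<delta> u"
proof -
  define l where "l = (LINT x|lebesgue_on {0<..}. \<gamma> x * u x + \<delta> x * weak_deriv u x)"
  define N where "N = (LINT x|lebesgue_on {0<..}. (\<gamma> x)\<^sup>2) + (LINT x|lebesgue_on {0<..}. (\<delta> x)\<^sup>2)"
  have le: "\<bar>l\<bar> \<le> e * N" if e: "e > 0" for e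
  proof (rule tendsto_lowerbound)
    have "(\<lambda>n. e * N + (W12_norm (\<lambda>x. u x - \<psi> n x))\<^sup>2 / e) \<longlonglongrightarrow> e * N + 0\<^sup>2 / e"
      by (intro tendsto_intros lim) (use e in auto)
    then show "(\<lambda>n. e * N + (W12_norm (\<lambda>x. u x - \<psi> n x))\<^sup>2 / e) \<longlonglongrightarrow> e * N" by simp
    show "\<forall>\<^sub>F n in sequentially. \<bar>l\<bar> \<le> e * N + (W12_norm (\<lambda>x. u x - \<psi> n x))\<^sup>2 / e"
    proof (intro always_eventually allI)
      fix n
      have p: "\<psi> n \<in> W12" using \<psi>[of n] by (simp add: annihilates_def)
      have d: "(\<lambda>x. u x - \<psi> n x) \<in> W12" using W12_linear(1)[OF u p, of 1 "-1"] by simp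
      have "(LINT x|lebesgue_on {0<..}. \<gamma> x * (u x - \<psi> n x) + \<delta> x * weak_deriv (\<lambda>x. u x - \<psi> n x) x) = l"
        using annihilates_functional_linear[OF L2 u p, of 1 "-1"] \<psi>[of n] by (simp add: annihilates_def l_def)
      then show "\<bar>l\<bar> \<le> e * N + (W12_norm (\<lambda>x. u x - \<psi> n x))\<^sup>2 / e"
        using annihilates_functional_bound[OF L2 d e] by (simp add: N_def)
    qed
  qed simp
  \<comment> \<open>The approximation index is already gone; \<open>e / (N + 1)\<close> is used in
    place of \<open>e / N\<close> to avoid the case \<open>N = 0\<close>.\<close>
  have "\<bar>l\<bar> \<le> 0"
  proof (rule field_le_epsilon)
    fix e :: real assume e: "e > 0"
    have N: "N \<ge> 0" unfolding N_def by (intro add_nonneg_nonneg integral_nonneg_AE AE_I2) auto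
    have "\<bar>l\<bar> \<le> e / (N + 1) * N" using e N by (intro le) auto
    also have "\<dots> \<le> e" using e N by (simp add: field_simps)
    finally show "\<bar>l\<bar> \<le> 0 + e" by simp
  qed
  then show ?thesis using u by (simp add: annihilates_def l_def)
qed

lemma annihilates_Cc_inf:
  assumes L2: "\<gamma> \<in> L2_on {0<..}" "\<delta> \<in> L2_on {0<..}" and \<psi>: "\<psi> \<in> Cc_inf"
    and 0: "(LINT x|lebesgue_on {0<..}. \<gamma> x * \<psi> x + \<delta> x * deriv \<psi> x) = 0"
  shows "annihilates \<gamma> \<delta> \<psi>"
proof -
  note w = Cc_inf_W12[OF \<psi>]
  obtain R M where pw: "pw_C1 R M \<psi> (deriv \<psi>)" using Cc_inf_pw_C1[OF \<psi>] .
  have "(LINT x|lebesgue_on {0<..}. \<gamma> x * \<psi> x + \<delta> x * weak_deriv \<psi> x) = (LINT x|lebesgue_on {0<..}. \<gamma> x * \<psi> x + \<delta> x * deriv \<psi> x)"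
  proof (rule integral_cong_AE)
    show "AE x in lebesgue_on {0<..}. \<gamma> x * \<psi> x + \<delta> x * weak_deriv \<psi> x = \<gamma> x * \<psi> x + \<delta> x * deriv \<psi> x"
      using weak_deriv_AE[OF w(2)] by eventually_elim simp
    show "(\<lambda>x. \<gamma> x * \<psi> x + \<delta> x * weak_deriv \<psi> x) \<in> borel_measurable (lebesgue_on {0<..})"
      using annihilates_integrable[OF L2 w(1)] by auto
    show "(\<lambda>x. \<gamma> x * \<psi> x + \<delta> x * deriv \<psi> x) \<in> borel_measurable (lebesgue_on {0<..})"
      by (intro borel_measurable_integrable Bochner_Integration.integrable_add L2_on_times L2 pw_C1_L2[OF pw])
  qed
  then show ?thesis using 0 w by (simp add: annihilates_def)
qed

text \<open>Strong measurability provides a countable family of test functions that suffices for almost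
  every time.\<close>

lemma L2_W12_0_countable:
  assumes "U \<in> L2_W12_0 T"
  obtains \<Psi> where "countable \<Psi>" "\<Psi> \<subseteq> Cc_inf"
    "AE t in lebesgue_on {0<..<T}. U t \<in> W12 \<and> (\<forall>\<gamma>\<in>L2_on {0<..}. \<forall>\<delta>\<in>L2_on {0<..}.
       (\<forall>\<psi>\<in>\<Psi>. (LINT x|lebesgue_on {0<..}. \<gamma> x * \<psi> x + \<delta> x * deriv \<psi> x) = 0) \<longrightarrow> annihilates \<gamma> \<delta> (U t))"
proof -
  obtain s where s: "\<And>n. W12_0_simple (s n)"
    and lim: "AE t in lebesgue_on {0<..<T}. (\<lambda>n. W12_norm (\<lambda>x. U t x - s n t x)) \<longlonglongrightarrow> 0"
    and U0: "AE t in lebesgue_on {0<..<T}. U t \<in> W12_0"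
    using assms unfolding L2_W12_0_def by blast
  have "\<exists>k A g. (\<forall>i<k. g i \<in> W12_0) \<and> (\<forall>t x. s n t x = (\<Sum>i<(k::nat). indicator (A i) t * g i x))" for n
    using s[of n] unfolding W12_0_simple_def by metis
  then obtain k A g where g: "\<And>n i. i < (k n :: nat) \<Longrightarrow> g n i \<in> W12_0"
    and sg: "\<And>n t x. s n t x = (\<Sum>i<k n. indicator (A n i) t * g n i x)" by metis
  have "\<forall>n i. \<exists>\<psi>. i < k n \<longrightarrow> (\<forall>m::nat. \<psi> m \<in> Cc_inf) \<and> (\<lambda>m. W12_norm (\<lambda>x. g n i x - \<psi> m x)) \<longlonglongrightarrow> 0"
    using g unfolding W12_0_def by blast
  then obtain \<psi> where \<psi>: "\<And>n i m. i < k n \<Longrightarrow> \<psi> n i (m::nat) \<in> Cc_inf"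
    "\<And>n i. i < k n \<Longrightarrow> (\<lambda>m. W12_norm (\<lambda>x. g n i x - \<psi> n i m x)) \<longlonglongrightarrow> 0" by metis
  \<comment> \<open>All approximants of all values of all step functions: a countable set that
    depends on neither the time nor the weights. Annihilation passes from it to the values by
    closedness, to the step functions by linearity, and to \<open>U t\<close> by closedness
    again.\<close>
  define \<Psi> where "\<Psi> = (\<lambda>(n, i, m). \<psi> n i m) ` {(n, i, m). i < k n}"
  show ?thesis
  proof (rule that[of \<Psi>])
    show "countable \<Psi>" unfolding \<Psi>_def by (intro countable_image countableI_type)
    show "\<Psi> \<subseteq> Cc_inf" unfolding \<Psi>_def using \<psi>(1) by auto
    show "AE t in lebesgue_on {0<..<T}. U t \<in> W12 \<and> (\<forall>\<gamma>\<in>L2_on {0<..}. \<forall>\<delta>\<in>L2_on {0<..}.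
       (\<forall>\<psi>\<in>\<Psi>. (LINT x|lebesgue_on {0<..}. \<gamma> x * \<psi> x + \<delta> x * deriv \<psi> x) = 0) \<longrightarrow> annihilates \<gamma> \<delta> (U t))"
      using lim U0
    proof eventually_elim
      case (elim t)
      have Ut: "U t \<in> W12" using elim(2) by (simp add: W12_0_def)
      show ?case
      proof (intro conjI Ut ballI impI)
        fix \<gamma> \<delta> assume L2: "\<gamma> \<in> L2_on {0<..}" "\<delta> \<in> L2_on {0<..}"
          and 0: "\<forall>\<psi>\<in>\<Psi>. (LINT x|lebesgue_on {0<..}. \<gamma> x * \<psi> x + \<delta> x * deriv \<psi> x) = 0"
        have 1: "annihilates \<gamma> \<delta> (\<psi> n i m)" if "i < k n" for n i m
        proof (rule annihilates_Cc_inf[OF L2 \<psi>(1)[OF that]])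
          have "\<psi> n i m \<in> \<Psi>" unfolding \<Psi>_def using that by force
          then show "(LINT x|lebesgue_on {0<..}. \<gamma> x * \<psi> n i m x + \<delta> x * deriv (\<psi> n i m) x) = 0"
            using 0 by blast
        qed
        have 2: "annihilates \<gamma> \<delta> (g n i)" if i: "i < k n" for n i
        proof (rule annihilates_limit[OF L2 _ 1[OF i] \<psi>(2)[OF i]])
          show "g n i \<in> W12" using g[OF i] by (simp add: W12_0_def)
        qed
        have "annihilates \<gamma> \<delta> (s n t)" for n
        proof -
          have e: "s n t = (\<lambda>x. \<Sum>i<k n. indicator (A n i) t * g n i x)" by (rule ext) (rule sg)
          show ?thesis unfolding e by (rule annihilates_sum[OF L2 2])
        qed
        then show "annihilates \<gamma> \<delta> (U t)" using elim(1) by (rule annihilates_limit[OF L2 Ut])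
      qed
    qed
  qed
qed

subsection \<open>Uniqueness: the energy identity\<close>

text \<open>An explicit spatial cutoff with slope at most \<open>4 / R\<close>, positive exactly for
  \<open>\<bar>x\<bar> < R\<close> and increasing in \<open>R\<close>. It does not vanish at 0,
  where the zero boundary values of the tested functions do the work.\<close>

definition chi :: "real \<Rightarrow> real \<Rightarrow> real" where
  "chi R x = (max (1 - (x / R)\<^sup>2) 0)\<^sup>2"

definition chi' :: "real \<Rightarrow> real \<Rightarrow> real" where
  "chi' R x = 2 * max (1 - (x / R)\<^sup>2) 0 * (- 2 * x / R\<^sup>2)"

text \<open>The squared positive part is \<D> of the square function, so its differentiability at
  the kink is a case of \<open>DERIV_\<D>\<close>.\<close>

lemma DERIV_chi: "R > 0 \<Longrightarrow> (chi R has_real_derivative chi' R x) (at x)"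
proof -
  assume R: "R > 0"
  have ds: "((\<lambda>s::real. s\<^sup>2) has_real_derivative 2 * s) (at s)" for s :: real by (auto intro!: derivative_eq_intros)
  have d1: "deriv (\<lambda>s::real. s\<^sup>2) = (\<lambda>s. 2 * s)" using ds by (auto intro!: DERIV_imp_deriv)
  have d2: "((\<lambda>s::real. 2 * s) has_real_derivative 2) (at s)" for s :: real by (auto intro!: derivative_eq_intros)
  have d3: "deriv (\<lambda>s::real. 2 * s) = (\<lambda>_. 2)" using d2 by (auto intro!: DERIV_imp_deriv)
  have "C2_on UNIV (\<lambda>s::real. s\<^sup>2)"
    unfolding C2_on_def d1 d3 real_differentiable_def
    by (intro conjI ballI exI) (rule ds d2 continuous_on_const)+
  from DERIV_\<D>[OF this] have D: "(\<D> (\<lambda>s. s\<^sup>2) has_real_derivative 2 * max s 0) (at s)" for s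
    by (simp add: d1)
  have "((\<lambda>x. 1 - (x / R)\<^sup>2) has_real_derivative - 2 * x / R\<^sup>2) (at x)"
    using R by (auto intro!: derivative_eq_intros simp: power2_eq_square field_simps)
  from DERIV_chain2[OF D this] have "((\<lambda>x. \<D> (\<lambda>s. s\<^sup>2) (1 - (x / R)\<^sup>2)) has_real_derivative chi' R x) (at x)"
    by (simp only: chi'_def)
  moreover have "(\<lambda>x. \<D> (\<lambda>s. s\<^sup>2) (1 - (x / R)\<^sup>2)) = chi R"
    by (auto simp: \<D>_def chi_def fun_eq_iff max_def)
  ultimately show ?thesis by simp
qed

lemma chi_facts:
  assumes R: "R > 0"
  shows "0 \<le> chi R x" "chi R x \<le> 1" "\<bar>x\<bar> > R \<Longrightarrow> chi R x = 0" "\<bar>x\<bar> < R \<Longrightarrow> chi R x > 0"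
    "\<bar>chi' R x\<bar> \<le> 4 / R" "R \<le> R' \<Longrightarrow> chi R x \<le> chi R' x" "continuous_on A (chi R)" "continuous_on A (chi' R)"
proof -
  have m: "max (1 - (x / R)\<^sup>2) 0 \<le> 1" by simp
  show "0 \<le> chi R x" by (simp add: chi_def)
  show "chi R x \<le> 1" unfolding chi_def using m by (intro power_le_one) auto
  have big: "max (1 - (x / R)\<^sup>2) 0 = 0" if "\<bar>x\<bar> > R"
  proof -
    have "1 \<le> \<bar>x / R\<bar>" using that R by (simp add: abs_divide)
    then have "1\<^sup>2 \<le> \<bar>x / R\<bar>\<^sup>2" by (intro power_mono) auto
    then have "1 \<le> (x / R)\<^sup>2" by (simp only: power2_abs one_power2)
    then show ?thesis by simp
  qed
  then show "\<bar>x\<bar> > R \<Longrightarrow> chi R x = 0" by (simp add: chi_def)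
  show "chi R x > 0" if "\<bar>x\<bar> < R"
  proof -
    have "\<bar>x / R\<bar> < 1" using that R by (simp add: abs_divide)
    then have "(x / R)\<^sup>2 < 1" by (simp add: abs_square_less_1)
    then show ?thesis by (simp add: chi_def)
  qed
  show "\<bar>chi' R x\<bar> \<le> 4 / R"
  proof (cases "\<bar>x\<bar> > R")
    case True
    then show ?thesis using big R by (simp add: chi'_def)
  next
    case False
    then have "\<bar>x\<bar> * 1 \<le> R" by simp
    then have "\<bar>x\<bar> / R\<^sup>2 \<le> 1 / R" using R by (simp add: power2_eq_square field_simps)
    then have "max (1 - (x / R)\<^sup>2) 0 * (\<bar>x\<bar> / R\<^sup>2) \<le> 1 * (1 / R)" using m R by (intro mult_mono) auto
    moreover have "\<bar>chi' R x\<bar> = 4 * (max (1 - (x / R)\<^sup>2) 0 * (\<bar>x\<bar> / R\<^sup>2))"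
      by (simp add: chi'_def abs_mult)
    ultimately show ?thesis by simp
  qed
  show "chi R x \<le> chi R' x" if "R \<le> R'"
  proof -
    have "\<bar>x / R'\<bar> \<le> \<bar>x / R\<bar>" using that R by (simp add: abs_divide frac_le)
    then have "\<bar>x / R'\<bar>\<^sup>2 \<le> \<bar>x / R\<bar>\<^sup>2" by (intro power_mono) auto
    then have "(x / R')\<^sup>2 \<le> (x / R)\<^sup>2" by (simp only: power2_abs)
    then have "max (1 - (x / R)\<^sup>2) 0 \<le> max (1 - (x / R')\<^sup>2) 0" by (intro max.mono) simp_all
    then show ?thesis unfolding chi_def by (intro power_mono) auto
  qed
  show "continuous_on A (chi R)" "continuous_on A (chi' R)"
    unfolding chi_def[abs_def] chi'_def[abs_def] using R by (auto intro!: continuous_intros)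
qed

lemma C1_compact_Cc_inf:
  assumes "\<psi> \<in> Cc_inf"
  obtains p q where "C1_compact p q \<psi> (deriv \<psi>)"
proof -
  obtain p q where pq: "0 < p" "p < q" "\<And>x. x \<notin> {p..q} \<Longrightarrow> \<psi> x = 0" "\<And>x. x \<notin> {p..q} \<Longrightarrow> deriv \<psi> x = 0"
    using Cc_infE[OF assms] by metis
  have s: "smooth_on UNIV \<psi>" using assms by (simp add: Cc_inf_def)
  show ?thesis
    by (rule that[of p q])
       (use pq smooth_deriv[OF s] smooth_continuous[OF smooth_deriv(1)[OF s]] in \<open>simp add: C1_compact_def\<close>)
qed

lemma C1_compact_times_chi:
  assumes "C1_compact p q g g'" "R > 0"
  shows "C1_compact p q (\<lambda>x. g x * chi R x) (\<lambda>x. g' x * chi R x + chi' R x * g x)"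
  using assms C1_compactD(1)[OF assms(1), of UNIV] chi_facts(7,8)[OF assms(2), of UNIV] DERIV_chi[OF assms(2)]
  unfolding C1_compact_def
  by (auto intro!: DERIV_mult continuous_intros)

text \<open>Cauchy--Schwarz against the constant 1 on an interval of length \<open>T\<close>,
  obtained by expanding the nonnegative variance around the mean \<open>m\<close>.\<close>

lemma integral_square_bound:
  fixes f :: "real \<Rightarrow> real"
  assumes f: "f \<in> borel_measurable borel" and z: "\<And>t. t \<notin> {0<..<T} \<Longrightarrow> f t = 0" and T: "T > 0"
    and i: "integrable lborel (\<lambda>t. (f t)\<^sup>2)" and A: "A \<in> sets borel"
  shows "integrable lborel f" "(LINT t|lborel. indicator A t * f t)\<^sup>2 \<le> T * (LINT t|lborel. (f t)\<^sup>2)"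
proof -
  have iT: "integrable lborel (indicator {0<..<T} :: real \<Rightarrow> real)" using T by simp
  show fi: "integrable lborel f"
  proof (rule Bochner_Integration.integrable_bound)
    show "integrable lborel (\<lambda>t. (f t)\<^sup>2 + indicator {0<..<T} t :: real)" using i iT by simp
    show "AE t in lborel. norm (f t) \<le> norm ((f t)\<^sup>2 + indicator {0<..<T} t :: real)"
    proof (intro AE_I2)
      fix t
      have "\<bar>f t\<bar> \<le> (f t)\<^sup>2 + 1" using sum_squares_bound[of "\<bar>f t\<bar>" 1] by simp
      then show "norm (f t) \<le> norm ((f t)\<^sup>2 + indicator {0<..<T} t :: real)"
        using z[of t] by (cases "t \<in> {0<..<T}") auto
    qed
  qed (use f in simp)
  define h where "h = (\<lambda>t. indicator A t * f t)"
  have hi: "integrable lborel h"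
    using integrable_real_mult_indicator[OF _ fi, of A] A by (simp add: h_def mult.commute)
  have h2: "integrable lborel (\<lambda>t. (h t)\<^sup>2)"
  proof -
    have "(\<lambda>t. (h t)\<^sup>2) = (\<lambda>t. (f t)\<^sup>2 * indicator A t)" by (auto simp: h_def indicator_def)
    then show ?thesis using integrable_real_mult_indicator[OF _ i, of A] A by simp
  qed
  define m where "m = (LINT t|lborel. h t) / T"
  have "0 \<le> (LINT t|lborel. (h t - m * indicator {0<..<T} t)\<^sup>2)" by (intro integral_nonneg_AE AE_I2) auto
  also have "\<dots> = (LINT t|lborel. (h t)\<^sup>2 - 2 * m * h t + m\<^sup>2 * indicator {0<..<T} t)"
  proof (rule Bochner_Integration.integral_cong[OF refl])
    fix t
    show "(h t - m * indicator {0<..<T} t)\<^sup>2 = (h t)\<^sup>2 - 2 * m * h t + m\<^sup>2 * indicator {0<..<T} t"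
      using z[of t] by (cases "t \<in> {0<..<T}") (auto simp: h_def power2_eq_square algebra_simps)
  qed
  also have "\<dots> = (LINT t|lborel. (h t)\<^sup>2) - 2 * m * (LINT t|lborel. h t) + m\<^sup>2 * T"
    using h2 hi iT T by simp
  also have "\<dots> = (LINT t|lborel. (h t)\<^sup>2) - (LINT t|lborel. h t)\<^sup>2 / T"
    using T by (simp add: m_def power2_eq_square field_simps)
  finally have "(LINT t|lborel. h t)\<^sup>2 \<le> T * (LINT t|lborel. (h t)\<^sup>2)" using T by (simp add: field_simps)
  also have "\<dots> \<le> T * (LINT t|lborel. (f t)\<^sup>2)"
    using T by (intro mult_left_mono integral_mono h2 i) (auto simp: h_def indicator_def)
  finally show "(LINT t|lborel. indicator A t * f t)\<^sup>2 \<le> T * (LINT t|lborel. (f t)\<^sup>2)" by (simp add: h_def)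
qed

text \<open>By symmetry the integrals of \<open>f s * f t\<close> over the two triangles coincide,
  and the diagonal is a null set, so twice the expression is the square of the integral of
  \<open>f\<close>. This provides the sign of the flux term in the energy identity.\<close>

lemma iterated_integral_nonneg:
  fixes f :: "real \<Rightarrow> real"
  assumes f: "integrable lborel f"
  shows "0 \<le> (LINT t|lborel. (LINT s|lborel. indicator {..<t} s * f s) * f t)"
proof -
  let ?L = "\<lambda>r :: real \<times> real. indicator {r. fst r < snd r} r * (f (fst r) * f (snd r))"
  let ?G = "\<lambda>r :: real \<times> real. indicator {r. snd r < fst r} r * (f (fst r) * f (snd r))"
  let ?A = "\<lambda>r :: real \<times> real. indicator UNIV r * (f (fst r) * f (snd r))"
  have iL: "integrable lborel ?L" and iG: "integrable lborel ?G" and iA: "integrable lborel ?A"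
    by (intro integrable_lborel2_tensor f sets_less; simp)+
  define I where "I = (LINT t|lborel. (LINT s|lborel. indicator {..<t} s * f s) * f t)"
  have L: "(LINT r|lborel. ?L r) = I"
  proof -
    have "(LINT s|lborel. ?L (s, t)) = (LINT s|lborel. indicator {..<t} s * f s) * f t" for t
    proof -
      have "(LINT s|lborel. ?L (s, t)) = (LINT s|lborel. (indicator {..<t} s * f s) * f t)"
        by (intro Bochner_Integration.integral_cong) (auto simp: indicator_def)
      then show ?thesis by simp
    qed
    then show ?thesis using lborel2_integral_snd(1)[OF iL] by (simp add: I_def)
  qed
  have G: "(LINT r|lborel. ?G r) = I"
  proof -
    have "(LINT s|lborel. ?G (t, s)) = (LINT s|lborel. indicator {..<t} s * f s) * f t" for t
    proof -
      have "(LINT s|lborel. ?G (t, s)) = (LINT s|lborel. (indicator {..<t} s * f s) * f t)"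
        by (intro Bochner_Integration.integral_cong) (auto simp: indicator_def)
      then show ?thesis by simp
    qed
    then show ?thesis using lborel2_integral_fst(1)[OF iG] by (simp add: I_def)
  qed
  have A: "(LINT r|lborel. ?A r) = (LINT t|lborel. f t) * (LINT t|lborel. f t)"
    using lborel2_integral_fst(1)[OF iA] by simp
  have D: "(LINT r|lborel. ?A r - (?L r + ?G r)) = 0"
  proof -
    have i: "integrable lborel (\<lambda>r. ?A r - (?L r + ?G r))" using iA iL iG by (intro Bochner_Integration.integrable_diff Bochner_Integration.integrable_add)
    have "(LINT t|lborel. ?A (s, t) - (?L (s, t) + ?G (s, t))) = 0" for s
    proof -
      have "AE t in lborel. ?A (s, t) - (?L (s, t) + ?G (s, t)) = 0"
        using AE_lborel_singleton[of s] by eventually_elim (auto simp: indicator_def)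
      then show ?thesis by (rule integral_eq_zero_AE)
    qed
    then show ?thesis using lborel2_integral_fst(1)[OF i] by simp
  qed
  have "(LINT r|lborel. ?A r) = (LINT r|lborel. ?L r) + (LINT r|lborel. ?G r)"
    using D iA iL iG by simp
  then have "2 * I = (LINT t|lborel. f t) * (LINT t|lborel. f t)" unfolding L G A by simp
  moreover have "0 \<le> (LINT t|lborel. f t) * (LINT t|lborel. f t)" by simp
  ultimately show ?thesis unfolding I_def[symmetric] by linarith
qed

lemma lborel2_nn_integral_fst:
  fixes h :: "real \<times> real \<Rightarrow> ennreal"
  assumes "h \<in> borel_measurable borel"
  shows "(\<integral>\<^sup>+ x. (\<integral>\<^sup>+ t. h (x, t) \<partial>lborel) \<partial>lborel) = (\<integral>\<^sup>+ p. h p \<partial>lborel)"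
  using lborel.nn_integral_fst[of h lborel] assms by (simp add: lborel_prod)

section \<open>The primitive of the flux, the weights, and the energy identity\<close>

context weak_equation
begin

text \<open>For \<open>s \<ge> T\<close> the primitive \<open>Vb x s\<close> keeps its final value,
  so square integrability over the plane requires the restriction to the strip.\<close>

definition "Vs = (\<lambda>p. indicator (strip T) p * Vb (fst p) (snd p))"

lemma v_section: "(\<lambda>t. v (x, t)) \<in> borel_measurable borel" "(\<lambda>x. v (x, t)) \<in> borel_measurable borel"
  by (rule lborel2_measurable_section[OF v_borel])+

lemma v_section_out: "t \<notin> {0<..<T} \<Longrightarrow> v (x, t) = 0"
  using v_out[of "(x, t)"] by (auto simp: strip_def)

lemma v2_sections:
  "AE x in lborel. integrable lborel (\<lambda>t. (v (x, t))\<^sup>2)" "integrable lborel (\<lambda>x. LINT t|lborel. (v (x, t))\<^sup>2)"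
  using lborel2_integral_fst(2,3)[OF v2] by auto

lemma Vb_measurable: "(\<lambda>p. Vb (fst p) (snd p)) \<in> borel_measurable borel"
proof -
  have "(\<lambda>q :: (real \<times> real) \<times> real. indicator {q. snd q < snd (fst q)} q * v (fst (fst q), snd q)) \<in> borel_measurable borel"
  proof (intro borel_measurable_times borel_measurable_indicator)
    show "{q :: (real \<times> real) \<times> real. snd q < snd (fst q)} \<in> sets borel"
      by (intro borel_open open_Collect_less continuous_intros)
    have "(\<lambda>q :: (real \<times> real) \<times> real. (fst (fst q), snd q)) \<in> borel_measurable borel"
      by (intro borel_measurable_continuous_onI continuous_intros)
    from measurable_compose[OF this v_borel] show "(\<lambda>q :: (real \<times> real) \<times> real. v (fst (fst q), snd q)) \<in> borel_measurable borel" .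
  qed
  also have "(\<lambda>q :: (real \<times> real) \<times> real. indicator {q. snd q < snd (fst q)} q * v (fst (fst q), snd q))
      = (\<lambda>(p, t). indicator {q :: (real \<times> real) \<times> real. snd q < snd (fst q)} (p, t) * v (fst p, t))" by auto
  finally have 1: "(\<lambda>(p, t). indicator {q :: (real \<times> real) \<times> real. snd q < snd (fst q)} (p, t) * v (fst p, t)) \<in> borel_measurable borel" .
  have "(borel :: ((real \<times> real) \<times> real) measure) = borel \<Otimes>\<^sub>M borel" by (simp only: borel_prod)
  also have "sets \<dots> = sets (borel \<Otimes>\<^sub>M lborel)" by (intro sets_pair_measure_cong) auto
  finally have s: "sets (borel :: ((real \<times> real) \<times> real) measure) = sets (borel \<Otimes>\<^sub>M lborel)" .
  have "(\<lambda>p. LINT t|lborel. indicator {q :: (real \<times> real) \<times> real. snd q < snd (fst q)} (p, t) * v (fst p, t)) \<in> borel_measurable borel"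
    by (rule lborel.borel_measurable_lebesgue_integral) (use 1 in \<open>simp only: measurable_cong_sets[OF s refl]\<close>)
  also have "(\<lambda>p. LINT t|lborel. indicator {q :: (real \<times> real) \<times> real. snd q < snd (fst q)} (p, t) * v (fst p, t))
      = (\<lambda>p. Vb (fst p) (snd p))"
    unfolding Vb_def by (intro ext Bochner_Integration.integral_cong) (auto simp: indicator_def)
  finally show ?thesis .
qed

lemma Vb_section_measurable: "(\<lambda>x. Vb x s) \<in> borel_measurable borel"
  using lborel2_measurable_section(1)[OF Vb_measurable, of s] by simp

text \<open>The exceptional null set of positions does not depend on \<open>s\<close>. That makes
  every slice, and also the whole function on the strip, square integrable.\<close>

lemma Vb_square: "AE x in lborel. \<forall>s. (Vb x s)\<^sup>2 \<le> T * (LINT t|lborel. (v (x, t))\<^sup>2)"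
  using v2_sections(1)
proof eventually_elim
  case (elim x)
  show ?case unfolding Vb_def
    by (intro allI integral_square_bound(2)[OF v_section(1) v_section_out T elim]) auto
qed

lemma Vb_section_L2: "integrable lborel (\<lambda>x. (Vb x s)\<^sup>2)"
proof (rule Bochner_Integration.integrable_bound)
  show "integrable lborel (\<lambda>x. T * (LINT t|lborel. (v (x, t))\<^sup>2))" using v2_sections(2) by simp
  show "(\<lambda>x. (Vb x s)\<^sup>2) \<in> borel_measurable lborel" using Vb_section_measurable by simp
  show "AE x in lborel. norm ((Vb x s)\<^sup>2) \<le> norm (T * (LINT t|lborel. (v (x, t))\<^sup>2))"
    using Vb_square
  proof eventually_elim
    case (elim x)
    then have "(Vb x s)\<^sup>2 \<le> T * (LINT t|lborel. (v (x, t))\<^sup>2)" by blast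
    then show ?case by (metis abs_ge_self abs_power2 order_trans real_norm_def)
  qed
qed

lemma Vs_measurable: "Vs \<in> borel_measurable borel"
  unfolding Vs_def by (intro borel_measurable_times borel_measurable_indicator sets_strip Vb_measurable)

lemma Vs_L2: "integrable lborel (\<lambda>p. (Vs p)\<^sup>2)"
proof (rule integrableI_bounded)
  show "(\<lambda>p. (Vs p)\<^sup>2) \<in> borel_measurable lborel" using Vs_measurable by simp
  have m: "(\<lambda>p. ennreal (norm ((Vs p)\<^sup>2))) \<in> borel_measurable borel" using Vs_measurable by simp
  have "(\<integral>\<^sup>+ p. ennreal (norm ((Vs p)\<^sup>2)) \<partial>lborel) = (\<integral>\<^sup>+ x. (\<integral>\<^sup>+ s. ennreal (norm ((Vs (x, s))\<^sup>2)) \<partial>lborel) \<partial>lborel)"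
    by (rule lborel2_nn_integral_fst[OF m, symmetric])
  also have "\<dots> \<le> (\<integral>\<^sup>+ x. ennreal (T * (T * (LINT t|lborel. (v (x, t))\<^sup>2))) \<partial>lborel)"
  proof (rule nn_integral_mono_AE)
    show "AE x in lborel. (\<integral>\<^sup>+ s. ennreal (norm ((Vs (x, s))\<^sup>2)) \<partial>lborel) \<le> ennreal (T * (T * (LINT t|lborel. (v (x, t))\<^sup>2)))"
      using Vb_square
    proof eventually_elim
      case (elim x)
      let ?q = "T * (LINT t|lborel. (v (x, t))\<^sup>2)"
      have q: "?q \<ge> 0" using T by (intro mult_nonneg_nonneg integral_nonneg_AE AE_I2) auto
      have "(\<integral>\<^sup>+ s. ennreal (norm ((Vs (x, s))\<^sup>2)) \<partial>lborel) \<le> (\<integral>\<^sup>+ s. ennreal ?q * indicator {0<..<T} s \<partial>lborel)"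
      proof (rule nn_integral_mono)
        fix s
        have "(Vb x s)\<^sup>2 \<le> ?q" using elim by blast
        then show "ennreal (norm ((Vs (x, s))\<^sup>2)) \<le> ennreal ?q * indicator {0<..<T} s"
          using q by (auto simp: Vs_def strip_def indicator_def power_mult_distrib intro!: ennreal_leI)
      qed
      also have "\<dots> = ennreal ?q * ennreal T" using T by (subst nn_integral_cmult_indicator) auto
      also have "\<dots> = ennreal (T * ?q)" using q T by (subst ennreal_mult[symmetric]) (auto simp: mult.commute)
      finally show ?case .
    qed
  qed
  also have "\<dots> < \<infinity>"
    using v2_sections(2) T by (subst nn_integral_eq_integral) (auto intro!: AE_I2 mult_nonneg_nonneg integral_nonneg_AE)
  finally show "(\<integral>\<^sup>+ p. ennreal (norm ((Vs p)\<^sup>2)) \<partial>lborel) < \<infinity>" .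
qed

text \<open>Testing the integrated equation with \<open>Z * chi\<close> gives
  \<open>W Z chi + Vb (Z chi)_x\<close>. The product rule collects the factor of \<open>Z\<close> in
  \<open>weight\<close> and the factor of \<open>Z_x\<close> in \<open>deriv_weight\<close>; the
  cutoff radius is \<open>n + 1\<close>.\<close>

definition "weight = (\<lambda>n s x. W (x, s) * chi (real (Suc n)) x + Vb x s * chi' (real (Suc n)) x)"
definition "deriv_weight = (\<lambda>n s x. Vb x s * chi (real (Suc n)) x)"

lemma chi_meas: "R > 0 \<Longrightarrow> chi R \<in> borel_measurable borel" "R > 0 \<Longrightarrow> chi' R \<in> borel_measurable borel"
  by (intro borel_measurable_continuous_onI chi_facts; assumption)+

lemma W_section: "(\<lambda>x. W (x, s)) \<in> borel_measurable borel"
  by (rule lborel2_measurable_section[OF W_borel])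

lemma weights_measurable: "weight n s \<in> borel_measurable borel" "deriv_weight n s \<in> borel_measurable borel"
  unfolding weight_def deriv_weight_def
  by (intro borel_measurable_add borel_measurable_times W_section Vb_section_measurable chi_meas; simp)+

lemma L2_on_borelI:
  fixes u :: "real \<Rightarrow> real"
  assumes "u \<in> borel_measurable borel" "integrable lborel (\<lambda>x. (u x)\<^sup>2)"
  shows "u \<in> L2_on {0<..}"
proof -
  have "integrable lborel (\<lambda>x. (u x)\<^sup>2 * indicator {0<..} x)"
    by (rule integrable_real_mult_indicator[OF _ assms(2)]) simp
  then have "integrable (lebesgue_on {0<..}) (\<lambda>x. (u x)\<^sup>2)"
    using assms(1) by (subst integral_lebesgue_on_borel(2)) (auto simp: mult.commute)
  then show ?thesis using borel_measurable_Icc[OF assms(1)] by (simp add: L2_on_def)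
qed

lemma weights_L2: "weight n s \<in> L2_on {0<..}" "deriv_weight n s \<in> L2_on {0<..}"
proof -
  let ?R = "real (Suc n)"
  have R: "?R > 0" by simp
  \<comment> \<open>The radius is at least 1, so 4 bounds both the cutoff and its slope, and 16 is
    its square.\<close>
  have b: "(Vb x s * c)\<^sup>2 \<le> 16 * (Vb x s)\<^sup>2" if "\<bar>c\<bar> \<le> 4" for x c
  proof -
    have "c\<^sup>2 \<le> 4\<^sup>2" using power_mono[OF that, of 2] by simp
    then have "(Vb x s)\<^sup>2 * c\<^sup>2 \<le> (Vb x s)\<^sup>2 * 4\<^sup>2" by (intro mult_left_mono) auto
    then show ?thesis by (simp add: power_mult_distrib)
  qed
  have c1: "\<bar>chi ?R x\<bar> \<le> 4" for x using chi_facts(1,2)[OF R, of x] by linarith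
  have c2: "\<bar>chi' ?R x\<bar> \<le> 4" for x
  proof -
    have "\<bar>chi' ?R x\<bar> \<le> 4 / ?R" by (rule chi_facts(5)[OF R])
    also have "\<dots> \<le> 4 / 1" by (intro divide_left_mono) auto
    finally show ?thesis by simp
  qed
  have i: "integrable lborel (\<lambda>x. (Vb x s * c x)\<^sup>2)" if "c \<in> borel_measurable borel" "\<And>x. \<bar>c x\<bar> \<le> 4" for c
  proof (rule Bochner_Integration.integrable_bound)
    show "integrable lborel (\<lambda>x. 16 * (Vb x s)\<^sup>2)" using Vb_section_L2 by simp
    show "(\<lambda>x. (Vb x s * c x)\<^sup>2) \<in> borel_measurable lborel" using that(1) Vb_section_measurable by simp
  qed (use b[OF that(2)] in auto)
  show "deriv_weight n s \<in> L2_on {0<..}"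
    by (rule L2_on_borelI[OF weights_measurable(2)]) (use i[OF chi_meas(1)[OF R] c1] in \<open>simp add: deriv_weight_def\<close>)
  have w: "(\<lambda>x. W (x, s) * chi ?R x) \<in> L2_on {0<..}"
  proof (rule L2_on_borelI)
    show m: "(\<lambda>x. W (x, s) * chi ?R x) \<in> borel_measurable borel"
      by (intro borel_measurable_times W_section chi_meas R)
    show "integrable lborel (\<lambda>x. (W (x, s) * chi ?R x)\<^sup>2)"
    proof (rule Bochner_Integration.integrable_bound)
      show "integrable lborel (\<lambda>x. M\<^sup>2 * indicator {-?R..?R} x :: real)" by simp
      show "AE x in lborel. norm ((W (x, s) * chi ?R x)\<^sup>2) \<le> norm (M\<^sup>2 * indicator {-?R..?R} x :: real)"
      proof (intro AE_I2)
        fix x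
        show "norm ((W (x, s) * chi ?R x)\<^sup>2) \<le> norm (M\<^sup>2 * indicator {-?R..?R} x :: real)"
        proof (cases "\<bar>x\<bar> \<le> ?R")
          case True
          have "\<bar>W (x, s) * chi ?R x\<bar> \<le> M * 1"
            unfolding abs_mult using W_bound[of "(x, s)"] chi_facts(1,2)[OF R, of x] by (intro mult_mono) auto
          then have "(W (x, s) * chi ?R x)\<^sup>2 \<le> M\<^sup>2" using power_mono[of "\<bar>W (x, s) * chi ?R x\<bar>" M 2] by simp
          moreover have "x \<in> {-?R..?R}" using True by (simp only: atLeastAtMost_iff) linarith
          ultimately show ?thesis by simp
        next
          case False
          then have "chi ?R x = 0" using chi_facts(3)[OF R, of x] by simp
          then show ?thesis by simp
        qed
      qed
    qed (use m in simp)
  qed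
  have g: "(\<lambda>x. Vb x s * chi' ?R x) \<in> L2_on {0<..}"
    by (rule L2_on_borelI) (intro borel_measurable_times Vb_section_measurable chi_meas R i c2)+
  show "weight n s \<in> L2_on {0<..}" using L2_on_linear[OF w g, of 1 1] by (simp add: weight_def)
qed

text \<open>\<open>time_slices\<close> is applied to \<psi> times the cutoff. As only countably many
  \<psi> and \<open>n\<close> occur, one null set of times serves for all of them.\<close>

lemma annihilation_slices:
  assumes "countable \<Psi>" "\<Psi> \<subseteq> Cc_inf"
  shows "AE s in lborel. s \<in> {0<..<T} \<longrightarrow> (\<forall>\<psi>\<in>\<Psi>. \<forall>n. (LINT x|lebesgue_on {0<..}. weight n s x * \<psi> x + deriv_weight n s x * deriv \<psi> x) = 0)"
proof -
  have 1: "AE s in lborel. s \<in> {0<..<T} \<longrightarrow> (LINT x|lebesgue_on {0<..}. weight n s x * \<psi> x + deriv_weight n s x * deriv \<psi> x) = 0"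
    if \<psi>: "\<psi> \<in> \<Psi>" for \<psi> n
  proof -
    let ?R = "real (Suc n)"
    have R: "?R > 0" by simp
    have \<psi>C: "\<psi> \<in> Cc_inf" using \<psi> assms by auto
    have s: "smooth_on UNIV \<psi>" using \<psi>C by (simp add: Cc_inf_def)
    obtain p q where c: "C1_compact p q \<psi> (deriv \<psi>)" using C1_compact_Cc_inf[OF \<psi>C] .
    define g where "g = (\<lambda>x. \<psi> x * chi ?R x)"
    define g' where "g' = (\<lambda>x. deriv \<psi> x * chi ?R x + chi' ?R x * \<psi> x)"
    have gC: "C1_compact p q g g'" unfolding g_def g'_def by (rule C1_compact_times_chi[OF c R])
    obtain C where C: "C > 0" "\<And>x. \<bar>g x\<bar> \<le> C * indicator {p..q} x" "\<And>x. \<bar>g' x\<bar> \<le> C * indicator {p..q} x"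
      using C1_compactD(5)[OF gC] by blast
    note gm = C1_compactD(3,4)[OF gC]
    have ipq: "integrable lborel (indicator {p..q} :: real \<Rightarrow> real)"
      using c by (intro integrable_real_indicator) (auto simp: C1_compact_def)
    have iW: "integrable lborel (\<lambda>x. W (x, s) * g x)" for s
    proof (rule Bochner_Integration.integrable_bound)
      show "integrable lborel (\<lambda>x. M * C * indicator {p..q} x :: real)" using ipq by simp
      show "(\<lambda>x. W (x, s) * g x) \<in> borel_measurable lborel" using W_section gm by simp
      show "AE x in lborel. norm (W (x, s) * g x) \<le> norm (M * C * indicator {p..q} x :: real)"
      proof (intro AE_I2)
        fix x
        have M: "M \<ge> 0" using W_bound[of "(x, s)"] by linarith
        have "\<bar>W (x, s) * g x\<bar> \<le> M * (C * indicator {p..q} x)"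
          unfolding abs_mult using W_bound[of "(x, s)"] C(2)[of x] M by (intro mult_mono) auto
        also have "\<dots> = norm (M * C * indicator {p..q} x :: real)" using M C(1) by (simp add: abs_mult)
        finally show "norm (W (x, s) * g x) \<le> norm (M * C * indicator {p..q} x :: real)" by simp
      qed
    qed
    have iV: "integrable lborel (\<lambda>x. Vb x s * g' x)" for s
    proof (rule Bochner_Integration.integrable_bound)
      show "integrable lborel (\<lambda>x. (Vb x s)\<^sup>2 + C\<^sup>2 * indicator {p..q} x)" using Vb_section_L2 ipq by simp
      show "(\<lambda>x. Vb x s * g' x) \<in> borel_measurable lborel" using Vb_section_measurable gm by simp
      show "AE x in lborel. norm (Vb x s * g' x) \<le> norm ((Vb x s)\<^sup>2 + C\<^sup>2 * indicator {p..q} x)"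
      proof (intro AE_I2)
        fix x
        have "\<bar>Vb x s * g' x\<bar> \<le> (Vb x s)\<^sup>2 + (g' x)\<^sup>2" by (rule abs_mult_le_squares)
        also have "(g' x)\<^sup>2 \<le> C\<^sup>2 * indicator {p..q} x"
          using power_mono[OF C(3)[of x], of 2] by (auto simp: indicator_def)
        finally show "norm (Vb x s * g' x) \<le> norm ((Vb x s)\<^sup>2 + C\<^sup>2 * indicator {p..q} x)" by simp
      qed
    qed
    show ?thesis
      using time_slices[OF gC]
    proof eventually_elim
      case (elim s)
      show ?case
      proof
        assume "s \<in> {0<..<T}"
        then have e: "(LINT x|lborel. W (x, s) * g x) + (LINT x|lborel. Vb x s * g' x) = 0"
          using elim unfolding Vb_integral[OF gC] by blast
        have "(LINT x|lebesgue_on {0<..}. weight n s x * \<psi> x + deriv_weight n s x * deriv \<psi> x)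
            = (LINT x|lborel. indicator {0<..} x * (weight n s x * \<psi> x + deriv_weight n s x * deriv \<psi> x))"
        proof (rule integral_lebesgue_on_borel(1))
          show "(\<lambda>x. indicator {0<..} x * (weight n s x * \<psi> x + deriv_weight n s x * deriv \<psi> x)) \<in> borel_measurable borel"
            by (intro borel_measurable_times borel_measurable_add borel_measurable_indicator weights_measurable
                smooth_measurable s smooth_deriv) auto
        qed simp
        also have "\<dots> = (LINT x|lborel. W (x, s) * g x + Vb x s * g' x)"
        proof (rule Bochner_Integration.integral_cong[OF refl])
          fix x
          have "\<psi> x = 0 \<and> deriv \<psi> x = 0" if "x \<le> 0" using c that unfolding C1_compact_def by auto
          then show "indicator {0<..} x * (weight n s x * \<psi> x + deriv_weight n s x * deriv \<psi> x) = W (x, s) * g x + Vb x s * g' x"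
            by (cases "x > 0") (simp_all add: weight_def deriv_weight_def g_def g'_def algebra_simps)
        qed
        also have "\<dots> = 0" using e iW iV by simp
        finally show "(LINT x|lebesgue_on {0<..}. weight n s x * \<psi> x + deriv_weight n s x * deriv \<psi> x) = 0" .
      qed
    qed
  qed
  have "AE s in lborel. \<forall>\<psi>\<in>\<Psi>. \<forall>n. s \<in> {0<..<T} \<longrightarrow> (LINT x|lebesgue_on {0<..}. weight n s x * \<psi> x + deriv_weight n s x * deriv \<psi> x) = 0"
    by (simp only: AE_ball_countable[OF assms(1)] AE_all_countable) (intro ballI allI 1)
  then show ?thesis by eventually_elim blast
qed

text \<open>Integrated over time, the slice identity has three terms: the nonnegative
  \<open>A n\<close>, a nonnegative flux term, and a cutoff error of size at most
  \<open>4 / (n + 1)\<close> times a fixed integral. Hence \<open>A n\<close> is bounded by the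
  error, while it increases with \<open>n\<close>; so it is 0.\<close>

lemma energy:
  assumes Z: "Z \<in> borel_measurable borel" and Zb: "\<And>p. \<bar>Z p\<bar> \<le> K" and Zout: "\<And>p. p \<notin> strip T \<Longrightarrow> Z p = 0"
    and Z2: "integrable lborel (\<lambda>p. (Z p)\<^sup>2)" and WZ: "\<And>p. 0 \<le> W p * Z p"
    and axis: "\<And>t. W (0, t) = 0" "\<And>t. v (0, t) = 0" "\<And>t. Z (0, t) = 0"
    and slices: "AE s in lborel. s \<in> {0<..<T} \<longrightarrow> (\<forall>n. (LINT x|lebesgue_on {0<..}. weight n s x * Z (x, s) + deriv_weight n s x * v (x, s)) = 0)"
  shows "AE p in lborel. W p * Z p = 0"
proof -
  define A where "A = (\<lambda>n. LINT p|lborel. W p * Z p * chi (real (Suc n)) (fst p))"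
  define C where "C = (LINT p|lborel. \<bar>Vs p * Z p\<bar>)"
  have R: "real (Suc n) > 0" for n by simp
  have K: "K \<ge> 0" using Zb[of "(0,0)"] by linarith
  have M: "M \<ge> 0" using W_bound[of "(0,0)"] by linarith
  note cm1 = measurable_fst_snd_lborel2(1)[OF chi_meas(1)[OF R]] and cm2 = measurable_fst_snd_lborel2(1)[OF chi_meas(2)[OF R]]
  have iA: "integrable lborel (\<lambda>p. W p * Z p * chi (real (Suc n)) (fst p))" for n
  proof (rule integrable_lborel_bounded_support)
    show "(\<lambda>p. W p * Z p * chi (real (Suc n)) (fst p)) \<in> borel_measurable borel"
      by (intro borel_measurable_times W_borel Z cm1)
    fix p :: "real \<times> real"
    show "\<bar>W p * Z p * chi (real (Suc n)) (fst p)\<bar> \<le> M * K * 1 * indicator (cbox (0, 0) (real (Suc n), T)) p"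
    proof (cases "p \<in> strip T \<and> \<bar>fst p\<bar> \<le> real (Suc n)")
      case True
      then have "p \<in> cbox (0, 0) (real (Suc n), T)" by (cases p) (auto simp: strip_def cbox_Pair_eq)
      moreover have "\<bar>W p * Z p * chi (real (Suc n)) (fst p)\<bar> \<le> M * K * 1"
        unfolding abs_mult using W_bound[of p] Zb[of p] chi_facts(1,2)[OF R, of n "fst p"] M K by (intro mult_mono) auto
      ultimately show ?thesis by simp
    next
      case False
      then have z: "W p * Z p * chi (real (Suc n)) (fst p) = 0"
        using Zout[of p] chi_facts(3)[OF R, of n "fst p"] by fastforce
      show ?thesis unfolding z using M K by (simp add: indicator_def)
    qed
  qed
  have iVZ: "integrable lborel (\<lambda>p. Vs p * Z p)"
  proof (rule Bochner_Integration.integrable_bound)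
    show "integrable lborel (\<lambda>p. (Vs p)\<^sup>2 + (Z p)\<^sup>2)" using Vs_L2 Z2 by simp
    show "(\<lambda>p. Vs p * Z p) \<in> borel_measurable lborel" using Vs_measurable Z by simp
    show "AE p in lborel. norm (Vs p * Z p) \<le> norm ((Vs p)\<^sup>2 + (Z p)\<^sup>2)"
      using abs_mult_le_squares[of "Vs _" "Z _"] by (intro AE_I2) simp
  qed
  have iVv: "integrable lborel (\<lambda>p. Vs p * v p)"
  proof (rule Bochner_Integration.integrable_bound)
    show "integrable lborel (\<lambda>p. (Vs p)\<^sup>2 + (v p)\<^sup>2)" using Vs_L2 v2 by simp
    show "(\<lambda>p. Vs p * v p) \<in> borel_measurable lborel" using Vs_measurable v_borel by simp
    show "AE p in lborel. norm (Vs p * v p) \<le> norm ((Vs p)\<^sup>2 + (v p)\<^sup>2)"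
      using abs_mult_le_squares[of "Vs _" "v _"] by (intro AE_I2) simp
  qed
  have iB: "integrable lborel (\<lambda>p. Vs p * v p * chi (real (Suc n)) (fst p))" for n
  proof (rule Bochner_Integration.integrable_bound[OF iVv])
    show "(\<lambda>p. Vs p * v p * chi (real (Suc n)) (fst p)) \<in> borel_measurable lborel"
      using borel_measurable_times[OF borel_measurable_times[OF Vs_measurable v_borel] cm1] by simp
    show "AE p in lborel. norm (Vs p * v p * chi (real (Suc n)) (fst p)) \<le> norm (Vs p * v p)"
      using chi_facts(1,2)[OF R] by (intro AE_I2) (simp add: abs_mult mult_left_le)
  qed
  have bC: "\<bar>Vs p * Z p * chi' (real (Suc n)) (fst p)\<bar> \<le> 4 / real (Suc n) * \<bar>Vs p * Z p\<bar>" for n p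
    using mult_left_mono[OF chi_facts(5)[OF R, of n "fst p"], of "\<bar>Vs p * Z p\<bar>"]
    by (simp add: abs_mult mult.commute)
  have iC: "integrable lborel (\<lambda>p. Vs p * Z p * chi' (real (Suc n)) (fst p))" for n
  proof (rule Bochner_Integration.integrable_bound)
    show "integrable lborel (\<lambda>p. 4 / real (Suc n) * (Vs p * Z p))" using iVZ by simp
    show "(\<lambda>p. Vs p * Z p * chi' (real (Suc n)) (fst p)) \<in> borel_measurable lborel"
      using borel_measurable_times[OF borel_measurable_times[OF Vs_measurable Z] cm2] by simp
    show "AE p in lborel. norm (Vs p * Z p * chi' (real (Suc n)) (fst p)) \<le> norm (4 / real (Suc n) * (Vs p * Z p))"
      using bC by (intro AE_I2) (simp add: abs_mult)
  qed
  \<comment> \<open>For fixed \<open>x\<close> the time integrand is a function times its own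
    primitive, and the cutoff depends on \<open>x\<close> only.\<close>
  have B_nonneg: "0 \<le> (LINT p|lborel. Vs p * v p * chi (real (Suc n)) (fst p))" for n
  proof -
    have "(LINT p|lborel. Vs p * v p * chi (real (Suc n)) (fst p)) = (LINT x|lborel. LINT t|lborel. Vs (x, t) * v (x, t) * chi (real (Suc n)) x)"
      using lborel2_integral_fst(1)[OF iB[of n]] by simp
    also have "\<dots> \<ge> 0"
    proof (rule integral_nonneg_AE)
      show "AE x in lborel. 0 \<le> (LINT t|lborel. Vs (x, t) * v (x, t) * chi (real (Suc n)) x)"
        using v2_sections(1)
      proof eventually_elim
        case (elim x)
        have "integrable lborel (\<lambda>t. v (x, t))"
          by (rule integral_square_bound(1)[OF v_section(1) v_section_out T elim]) auto
        from iterated_integral_nonneg[OF this]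
        have 0: "0 \<le> (LINT t|lborel. Vb x t * v (x, t))" by (simp add: Vb_def)
        have "Vs (x, t) * v (x, t) = Vb x t * v (x, t)" for t
          using v_out[of "(x, t)"] by (cases "(x, t) \<in> strip T") (auto simp: Vs_def)
        then have "(LINT t|lborel. Vs (x, t) * v (x, t) * chi (real (Suc n)) x)
            = (LINT t|lborel. Vb x t * v (x, t)) * chi (real (Suc n)) x"
          by (simp only: integral_mult_left_zero)
        then show ?case using mult_nonneg_nonneg[OF 0 chi_facts(1)[OF R, of n x]] by (simp only:)
      qed
    qed
    finally show ?thesis .
  qed
  have total: "(LINT p|lborel. W p * Z p * chi (real (Suc n)) (fst p) + Vs p * Z p * chi' (real (Suc n)) (fst p)
      + Vs p * v p * chi (real (Suc n)) (fst p)) = 0" for n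
  proof -
    let ?h = "\<lambda>p. W p * Z p * chi (real (Suc n)) (fst p) + Vs p * Z p * chi' (real (Suc n)) (fst p) + Vs p * v p * chi (real (Suc n)) (fst p)"
    have i: "integrable lborel ?h" using iA iB iC by (intro Bochner_Integration.integrable_add)
    have "AE s in lborel. (LINT x|lborel. ?h (x, s)) = 0"
      using slices
    proof eventually_elim
      case (elim s)
      show ?case
      proof (cases "s \<in> {0<..<T}")
        case True
        have e: "?h (x, s) = indicator {0<..} x * (weight n s x * Z (x, s) + deriv_weight n s x * v (x, s))" for x
        proof (cases "x > 0")
          case x: True
          then show ?thesis using True by (simp add: Vs_def strip_def weight_def deriv_weight_def algebra_simps)
        next
          case False
          have "(x, s) \<notin> strip T \<or> x = 0" using False by (auto simp: strip_def)
          then show ?thesis using False Zout[of "(x, s)"] v_out[of "(x, s)"] axis by auto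
        qed
        have "(LINT x|lborel. ?h (x, s)) = (LINT x|lebesgue_on {0<..}. weight n s x * Z (x, s) + deriv_weight n s x * v (x, s))"
          unfolding e
        proof (rule integral_lebesgue_on_borel(1)[symmetric])
          show "(\<lambda>x. indicator {0<..} x * (weight n s x * Z (x, s) + deriv_weight n s x * v (x, s))) \<in> borel_measurable borel"
            by (intro borel_measurable_times borel_measurable_add borel_measurable_indicator weights_measurable
                v_section lborel2_measurable_section[OF Z]) simp
        qed simp
        then show ?thesis using elim True by simp
      next
        case False
        then have "(x, s) \<notin> strip T" for x by (auto simp: strip_def)
        then have "?h (x, s) = 0" for x using Zout v_out by simp
        then show ?thesis by simp
      qed
    qed
    then have "(LINT s|lborel. LINT x|lborel. ?h (x, s)) = 0" by (rule integral_eq_zero_AE)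
    then show ?thesis using lborel2_integral_snd(1)[OF i] by simp
  qed
  have Ale: "A n \<le> 4 / real (Suc n) * C" for n
  proof -
    have "A n + (LINT p|lborel. Vs p * Z p * chi' (real (Suc n)) (fst p)) + (LINT p|lborel. Vs p * v p * chi (real (Suc n)) (fst p)) = 0"
      using total[of n] iA[of n] iB[of n] iC[of n] by (simp add: A_def)
    then have "A n \<le> \<bar>LINT p|lborel. Vs p * Z p * chi' (real (Suc n)) (fst p)\<bar>" using B_nonneg[of n] by linarith
    also have "\<dots> \<le> (LINT p|lborel. \<bar>Vs p * Z p * chi' (real (Suc n)) (fst p)\<bar>)" using integral_abs_bound by blast
    also have "\<dots> \<le> (LINT p|lborel. 4 / real (Suc n) * \<bar>Vs p * Z p\<bar>)"
      by (rule integral_mono) (use iC[of n] iVZ bC in auto)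
    also have "\<dots> = 4 / real (Suc n) * C" by (simp add: C_def)
    finally show ?thesis .
  qed
  have nn: "0 \<le> W p * Z p * chi (real (Suc n)) (fst p)" for n p
    using WZ[of p] chi_facts(1)[OF R, of n "fst p"] by simp
  have Amono: "A n \<le> A m" if "n \<le> m" for n m
    unfolding A_def
  proof (rule integral_mono[OF iA iA])
    fix p
    show "W p * Z p * chi (real (Suc n)) (fst p) \<le> W p * Z p * chi (real (Suc m)) (fst p)"
      using that WZ[of p] by (intro mult_left_mono chi_facts(6)[OF R]) auto
  qed
  \<comment> \<open>The error bound at index \<open>n\<close> alone is not enough:
    \<open>A n\<close> is compared with \<open>A m\<close> for all larger \<open>m\<close>, and
    \<open>m\<close> tends to infinity.\<close>
  have A0: "A n = 0" for n
  proof (rule antisym)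
    have "(\<lambda>m. 4 * C * inverse (real (Suc m))) \<longlonglongrightarrow> 4 * C * 0"
      by (intro tendsto_mult tendsto_const LIMSEQ_inverse_real_of_nat)
    then have l: "(\<lambda>m. 4 / real (Suc m) * C) \<longlonglongrightarrow> 0" by (simp add: divide_inverse mult.commute mult.left_commute)
    show "A n \<le> 0"
    proof (rule tendsto_lowerbound[OF l])
      show "\<forall>\<^sub>F m in sequentially. A n \<le> 4 / real (Suc m) * C"
        using eventually_ge_at_top[of n] by eventually_elim (use Amono Ale order_trans in blast)
    qed simp
    show "0 \<le> A n" unfolding A_def using nn by (intro integral_nonneg_AE AE_I2)
  qed
  have "AE p in lborel. W p * Z p * chi (real (Suc n)) (fst p) = 0" for n
    using A0[of n] integral_nonneg_eq_0_iff_AE[OF iA[of n]] nn[of _ n] unfolding A_def by auto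
  then have "AE p in lborel. \<forall>n. W p * Z p * chi (real (Suc n)) (fst p) = 0" by (simp only: AE_all_countable) blast
  then show ?thesis
  proof eventually_elim
    case (elim p)
    obtain n where "\<bar>fst p\<bar> < real n" using reals_Archimedean2 by blast
    then have "chi (real (Suc n)) (fst p) > 0" by (intro chi_facts(4)[OF R]) simp
    then show ?case using elim by (metis mult_eq_0_iff less_irrefl)
  qed
qed

text \<open>With vanishing flux the time-integrated equation reduces to orthogonality of
  \<open>W\<close> at almost every time to all rational bumps, and the fundamental lemma in space
  applies.\<close>

lemma W_zero_if_v_zero:
  assumes v0: "AE s in lborel. AE x in lborel. v (x, s) = 0" and axis: "\<And>t. W (0, t) = 0"
  shows "AE p in lborel. W p = 0"
proof -
  have "AE s in lborel. s \<in> {0<..<T} \<longrightarrow> (LINT x|lebesgue_on {0<..}. W (x, s) * g x) = 0" if g: "g \<in> rat_bumps" for g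
  proof -
    have gC: "g \<in> Cc_inf" using g rat_bumps_Cc_inf by auto
    have gs: "smooth_on UNIV g" using gC by (simp add: Cc_inf_def)
    obtain p q where c: "C1_compact p q g (deriv g)" using C1_compact_Cc_inf[OF gC] .
    have "AE t in lborel. (LINT x|lborel. v (x, t) * deriv g x) = 0"
      using v0
    proof eventually_elim
      case (elim t)
      then have "AE x in lborel. v (x, t) * deriv g x = 0" by eventually_elim simp
      then show ?case by (rule integral_eq_zero_AE)
    qed
    then have "AE t in lborel. indicator {..<s} t * (LINT x|lborel. v (x, t) * deriv g x) = 0" for s :: real
      by eventually_elim simp
    then have z: "(LINT t|lborel. indicator {..<s} t * (LINT x|lborel. v (x, t) * deriv g x)) = 0" for s
      by (rule integral_eq_zero_AE)
    show ?thesis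
      using time_slices[OF c]
    proof eventually_elim
      case (elim s)
      have "(LINT x|lebesgue_on {0<..}. W (x, s) * g x) = (LINT x|lborel. indicator {0<..} x * (W (x, s) * g x))"
        by (rule integral_lebesgue_on_borel(1))
           (simp, rule borel_measurable_times[OF borel_measurable_indicator borel_measurable_times[OF W_section smooth_measurable(1)[OF gs]]], simp)
      also have "\<dots> = (LINT x|lborel. W (x, s) * g x)"
      proof (rule Bochner_Integration.integral_cong[OF refl])
        fix x
        have "g x = 0" if "x \<le> 0" using c that unfolding C1_compact_def by auto
        then show "indicator {0<..} x * (W (x, s) * g x) = W (x, s) * g x" by (cases "x > 0") auto
      qed
      finally show ?case using elim z[of s] by simp
    qed
  qed
  then have "AE s in lborel. \<forall>g\<in>rat_bumps. s \<in> {0<..<T} \<longrightarrow> (LINT x|lebesgue_on {0<..}. W (x, s) * g x) = 0"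
    by (simp only: AE_ball_countable[OF countable_rat_bumps]) blast
  then have "AE s in lborel. (\<integral>\<^sup>+ x. ennreal \<bar>W (x, s)\<bar> \<partial>lborel) = 0"
  proof eventually_elim
    case (elim s)
    have "AE x in lborel. W (x, s) = 0"
    proof (cases "s \<in> {0<..<T}")
      case True
      have "AE x in lebesgue_on {0<..}. W (x, s) = 0"
      proof (rule AE_zero_if_rat_bumps)
        show "integrable (lebesgue_on {p..q}) (\<lambda>x. W (x, s))" for p q
          by (rule bounded_integrable_Icc[OF borel_measurable_Icc[OF W_section] W_bound])
      qed (use elim True in blast)
      then have "AE x in lborel. x \<in> {0<..} \<longrightarrow> W (x, s) = 0"
        by (simp add: AE_lebesgue_on_iff AE_completion_iff)
      then show ?thesis
      proof eventually_elim
        case (elim x)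
        then show ?case using W_out[of "(x, s)"] axis[of s] by (cases "x > 0"; cases "x = 0") (auto simp: strip_def)
      qed
    next
      case False
      then show ?thesis using W_out by (intro AE_I2) (auto simp: strip_def)
    qed
    then show ?case using W_section by (subst nn_integral_0_iff_AE) auto
  qed
  then have "(\<integral>\<^sup>+ s. (\<integral>\<^sup>+ x. ennreal \<bar>W (x, s)\<bar> \<partial>lborel) \<partial>lborel) = (\<integral>\<^sup>+ s. 0 \<partial>(lborel :: real measure))"
    by (rule nn_integral_cong_AE)
  moreover have Wm: "(\<lambda>p. ennreal \<bar>W p\<bar>) \<in> borel_measurable borel" using W_borel by simp
  ultimately have "(\<integral>\<^sup>+ p. ennreal \<bar>W p\<bar> \<partial>lborel) = 0"
    using lborel2_nn_integral_snd[OF Wm] by simp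
  then show ?thesis using Wm by (subst (asm) nn_integral_0_iff_AE) auto
qed

end

subsection \<open>Uniqueness of weak solutions\<close>

lemma borel_representative:
  fixes h :: "'a::euclidean_space \<Rightarrow> real"
  assumes "h \<in> borel_measurable (lebesgue_on S)" "S \<in> sets lebesgue"
  obtains h' where "h' \<in> borel_measurable borel" "AE p in lborel. p \<in> S \<longrightarrow> h p = h' p"
proof -
  have "(\<lambda>x. if x \<in> S then h x else 0) \<in> borel_measurable lebesgue"
    using assms by (rule borel_measurable_if_I)
  then obtain h' where h': "h' \<in> borel_measurable lborel" "AE x in lborel. (if x \<in> S then h x else 0) = h' x"
    using completion_ex_borel_measurable_real[of "\<lambda>x. if x \<in> S then h x else 0" lborel] by auto
  have "AE p in lborel. p \<in> S \<longrightarrow> h p = h' p" using h'(2) by eventually_elim auto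
  then show ?thesis using that[of h'] h'(1) by simp
qed

lemma AE_fst_nonzero: "AE p in (lborel :: (real \<times> real) measure). fst p \<noteq> 0"
proof -
  have "negligible {p :: real \<times> real. p \<bullet> (1, 0) = 0}"
    by (rule negligible_standard_hyperplane) (simp add: Basis_prod_def)
  then have "{p :: real \<times> real. fst p = 0} \<in> null_sets lebesgue"
    by (simp add: negligible_iff_null_sets inner_prod_def)
  then have "AE p in lebesgue. p \<notin> {p :: real \<times> real. fst p = 0}" by (rule AE_not_in)
  then show ?thesis by (simp add: AE_completion_iff)
qed

text \<open>The Sobolev spaces live on the open half line, whereas \<open>strip\<close> contains the
  axis \<open>x = 0\<close>. Representatives are set to 0 on this null set, which makes integrals
  over the two sets agree pointwise.\<close>

definition open_strip :: "real \<Rightarrow> (real \<times> real) set" where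
  "open_strip T = {0<..} \<times> {0<..<T}"

lemma open_strip_borel: "open_strip T \<in> sets borel"
  unfolding open_strip_def by (intro borel_Times) auto

text \<open>Fubini arguments call for Borel functions on the plane with bounds that hold everywhere.
  At fixed time the Borel version of the flux agrees with the weak derivative only for almost every
  \<open>x\<close>, hence the intermediate function \<open>u\<close>.\<close>

lemma weak_solution_representative:
  assumes sol: "weak_solution \<phi> T V w_hat w" and T: "T > 0"
  obtains W v M where "W \<in> borel_measurable borel" "v \<in> borel_measurable borel" "M \<ge> 0" "\<forall>p. \<bar>W p\<bar> \<le> M"
    "\<forall>p. p \<notin> open_strip T \<longrightarrow> W p = 0" "\<forall>p. p \<notin> open_strip T \<longrightarrow> v p = 0"
    "AE p in lborel. p \<in> strip T \<longrightarrow> w p = W p" "integrable lborel (\<lambda>p. (v p)\<^sup>2)"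
    "AE t in lborel. t \<in> {0<..<T} \<longrightarrow> (\<exists>u. has_weak_deriv (\<lambda>x. \<D> \<phi> (w (x, t))) u \<and> (AE x in lborel. x > 0 \<longrightarrow> u x = v (x, t)))"
    "\<forall>\<xi> \<xi>x \<xi>t. test_function T \<xi> \<xi>x \<xi>t \<longrightarrow> integrable lborel (\<lambda>p. W p * \<xi>t p) \<and> integrable lborel (\<lambda>p. v p * \<xi>x p) \<and>
       (LINT x|lebesgue_on {0<..}. - V * \<xi> (x, 0)) + (LINT p|lborel. W p * \<xi>t p) = (LINT p|lborel. v p * \<xi>x p)"
proof -
  have wm: "w \<in> borel_measurable (lebesgue_on (strip T))" and wb: "\<exists>M. AE x in lebesgue_on (strip T). \<bar>w x\<bar> \<le> M"
    using sol by (auto simp: weak_solution_def Linf_on_def)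
  obtain M0 where M0: "AE x in lebesgue_on (strip T). \<bar>w x\<bar> \<le> M0" using wb by blast
  obtain v0 where v0: "v0 \<in> L2_on (strip T)"
    and wd: "AE t in lebesgue_on {0<..<T}. has_weak_deriv (\<lambda>x. \<D> \<phi> (w (x, t))) (\<lambda>x. v0 (x, t))"
    and id: "\<And>\<xi> \<xi>x \<xi>t. test_function T \<xi> \<xi>x \<xi>t \<Longrightarrow>
           (LINT x|lebesgue_on {0<..}. - V * \<xi> (x, 0)) + (LINT p|lebesgue_on (strip T). w p * \<xi>t p)
             = (LINT p|lebesgue_on (strip T). v0 p * \<xi>x p)"
    using sol unfolding weak_solution_def by blast
  define M where "M = max M0 0"
  obtain w1 where w1: "w1 \<in> borel_measurable borel" "AE p in lborel. p \<in> strip T \<longrightarrow> w p = w1 p"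
    using borel_representative[OF wm sets_strip(2)] .
  obtain v1 where v1: "v1 \<in> borel_measurable borel" "AE p in lborel. p \<in> strip T \<longrightarrow> v0 p = v1 p"
    using borel_representative[OF L2_onD(1)[OF v0] sets_strip(2)] .
  \<comment> \<open>Clamping at \<open>M\<close> turns the essential bound on \<open>w\<close> into
    a bound at every point without changing the function almost everywhere.\<close>
  define W where "W = (\<lambda>p. indicator (open_strip T) p * max (- M) (min M (w1 p)))"
  define v where "v = (\<lambda>p. indicator (open_strip T) p * v1 p)"
  have Wm: "W \<in> borel_measurable borel" unfolding W_def
    using w1(1) open_strip_borel by (intro borel_measurable_times borel_measurable_indicator borel_measurable_max borel_measurable_min) auto
  have vm: "v \<in> borel_measurable borel" unfolding v_def
    using v1(1) open_strip_borel by (intro borel_measurable_times borel_measurable_indicator)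
  have M: "M \<ge> 0" by (simp add: M_def)
  have Wb: "\<bar>W p\<bar> \<le> M" for p using M by (auto simp: W_def indicator_def)
  have Wz: "W p = 0" "v p = 0" if "p \<notin> open_strip T" for p using that by (simp_all add: W_def v_def)
  have st: "p \<in> open_strip T \<longleftrightarrow> p \<in> strip T" if "fst p \<noteq> 0" for p
    using that by (cases p) (auto simp: open_strip_def strip_def)
  have sub: "open_strip T \<subseteq> strip T" by (auto simp: open_strip_def strip_def)
  have M0': "AE p in lborel. p \<in> strip T \<longrightarrow> \<bar>w p\<bar> \<le> M0"
    using M0 by (simp add: AE_lebesgue_on_iff[OF sets_strip(2)] AE_completion_iff)
  have Weq: "AE p in lborel. p \<in> strip T \<longrightarrow> w p = W p"
    using w1(2) M0' AE_fst_nonzero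
  proof eventually_elim
    case (elim p)
    show ?case
    proof
      assume p: "p \<in> strip T"
      then have "p \<in> open_strip T" using st elim(3) by blast
      then show "w p = W p" using elim p by (auto simp: W_def M_def max_def min_def)
    qed
  qed
  have veq: "AE p in lborel. p \<in> strip T \<longrightarrow> v0 p = v p"
    using v1(2) AE_fst_nonzero
  proof eventually_elim
    case (elim p)
    then show ?case using st[of p] by (auto simp: v_def)
  qed
  have v2: "integrable lborel (\<lambda>p. (v p)\<^sup>2)"
  proof -
    have "integrable lebesgue (\<lambda>p. indicator (strip T) p * (v0 p)\<^sup>2)"
      using L2_onD(2)[OF v0] by (simp add: integrable_lebesgue_on_iff[OF sets_strip(2)])
    moreover have "AE p in lebesgue. indicator (strip T) p * (v0 p)\<^sup>2 = (v p)\<^sup>2"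
      unfolding AE_completion_iff using veq
    proof eventually_elim
      case (elim p)
      then show ?case using Wz(2)[of p] sub by (cases "p \<in> strip T") auto
    qed
    moreover have "(\<lambda>p. (v p)\<^sup>2) \<in> borel_measurable lebesgue" using vm by (simp add: measurable_completion)
    ultimately have "integrable lebesgue (\<lambda>p. (v p)\<^sup>2)"
      by (subst integrable_cong_AE[of _ _ "\<lambda>p. indicator (strip T) p * (v0 p)\<^sup>2"]) (auto elim: eventually_mono)
    then show ?thesis using vm by (simp add: integrable_completion)
  qed
  have WD: "AE t in lborel. t \<in> {0<..<T} \<longrightarrow> (\<exists>u. has_weak_deriv (\<lambda>x. \<D> \<phi> (w (x, t))) u \<and> (AE x in lborel. x > 0 \<longrightarrow> u x = v (x, t)))"
  proof -
    have "AE t in lborel. t \<in> {0<..<T} \<longrightarrow> has_weak_deriv (\<lambda>x. \<D> \<phi> (w (x, t))) (\<lambda>x. v0 (x, t))"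
      using wd by (simp add: AE_lebesgue_on_iff AE_completion_iff)
    then show ?thesis
      using AE_lborel2_sections(1)[OF veq]
    proof eventually_elim
      case (elim t)
      show ?case
      proof
        assume t: "t \<in> {0<..<T}"
        have "AE x in lborel. x > 0 \<longrightarrow> v0 (x, t) = v (x, t)"
          using elim(2) by eventually_elim (use t in \<open>auto simp: strip_def\<close>)
        then show "\<exists>u. has_weak_deriv (\<lambda>x. \<D> \<phi> (w (x, t))) u \<and> (AE x in lborel. x > 0 \<longrightarrow> u x = v (x, t))"
          using elim(1) t by blast
      qed
    qed
  qed
  have replace: "(LINT p|lebesgue_on (strip T). h p * z p) = (LINT p|lborel. H p * z p)"
    if h: "h \<in> borel_measurable (lebesgue_on (strip T))" and H: "H \<in> borel_measurable borel" and Hz: "\<And>p. p \<notin> open_strip T \<Longrightarrow> H p = 0"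
      and eq: "AE p in lborel. p \<in> strip T \<longrightarrow> h p = H p" and z: "(\<lambda>p. indicator (strip T) p * z p) \<in> borel_measurable borel"
    for h H z :: "real \<times> real \<Rightarrow> real"
  proof -
    have zl: "z \<in> borel_measurable (lebesgue_on (strip T))"
    proof -
      have "(\<lambda>p. if p \<in> strip T then z p else 0) = (\<lambda>p. indicator (strip T) p * z p)" by (auto simp: indicator_def)
      then have "(\<lambda>p. if p \<in> strip T then z p else 0) \<in> borel_measurable lebesgue"
        using z by (simp add: measurable_completion)
      then show ?thesis by (rule borel_measurable_if_D)
    qed
    have e: "H p * z p = H p * (indicator (strip T) p * z p)" for p using Hz[of p] sub by (cases "p \<in> strip T") auto
    have Hm: "(\<lambda>p. H p * z p) \<in> borel_measurable borel" unfolding e by (rule borel_measurable_times[OF H z])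
    have "(LINT p|lebesgue_on (strip T). h p * z p) = (LINT p|lebesgue. indicator (strip T) p * (h p * z p))"
      by (rule integral_lebesgue_on_eq[OF sets_strip(2)])
    also have "\<dots> = (LINT p|lebesgue. H p * z p)"
    proof (rule integral_cong_AE)
      have "(\<lambda>p. if p \<in> strip T then h p * z p else 0) \<in> borel_measurable lebesgue"
        by (rule borel_measurable_if_I[OF borel_measurable_times[OF h zl] sets_strip(2)])
      also have "(\<lambda>p. if p \<in> strip T then h p * z p else 0) = (\<lambda>p. indicator (strip T) p * (h p * z p))" by (auto simp: indicator_def)
      finally show "(\<lambda>p. indicator (strip T) p * (h p * z p)) \<in> borel_measurable lebesgue" .
      show "(\<lambda>p. H p * z p) \<in> borel_measurable lebesgue" using Hm by (simp add: measurable_completion)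
      show "AE p in lebesgue. indicator (strip T) p * (h p * z p) = H p * z p"
        unfolding AE_completion_iff using eq
      proof eventually_elim
        case (elim p)
        then show ?case using Hz[of p] sub by (cases "p \<in> strip T") auto
      qed
    qed
    also have "\<dots> = (LINT p|lborel. H p * z p)" using Hm by (intro integral_completion) simp
    finally show ?thesis .
  qed
  have ident: "integrable lborel (\<lambda>p. W p * \<xi>t p) \<and> integrable lborel (\<lambda>p. v p * \<xi>x p) \<and>
       (LINT x|lebesgue_on {0<..}. - V * \<xi> (x, 0)) + (LINT p|lborel. W p * \<xi>t p) = (LINT p|lborel. v p * \<xi>x p)"
    if tf: "test_function T \<xi> \<xi>x \<xi>t" for \<xi> \<xi>x \<xi>t
  proof (intro conjI)
    note I = test_function_integrable[OF tf T]
    have e: "W p * \<xi>t p = W p * (indicator (strip T) p * \<xi>t p)" "v p * \<xi>x p = v p * (indicator (strip T) p * \<xi>x p)" for p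
      using Wz[of p] sub by (cases "p \<in> strip T"; auto)+
    show "integrable lborel (\<lambda>p. W p * \<xi>t p)"
      unfolding e
    proof (rule Bochner_Integration.integrable_bound)
      show "integrable lborel (\<lambda>p. M * (indicator (strip T) p * \<xi>t p))" using I(2) by simp
      show "(\<lambda>p. W p * (indicator (strip T) p * \<xi>t p)) \<in> borel_measurable lborel"
        using borel_measurable_times[OF Wm I(1)] by simp
      show "AE p in lborel. norm (W p * (indicator (strip T) p * \<xi>t p)) \<le> norm (M * (indicator (strip T) p * \<xi>t p))"
      proof (intro AE_I2)
        fix p
        show "norm (W p * (indicator (strip T) p * \<xi>t p)) \<le> norm (M * (indicator (strip T) p * \<xi>t p))"
          unfolding real_norm_def abs_mult[of _ "indicator (strip T) p * \<xi>t p"]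
          using Wb[of p] by (intro mult_right_mono) auto
      qed
    qed
    show "integrable lborel (\<lambda>p. v p * \<xi>x p)"
      unfolding e
    proof (rule Bochner_Integration.integrable_bound)
      show "integrable lborel (\<lambda>p. (v p)\<^sup>2 + (indicator (strip T) p * \<xi>x p)\<^sup>2)" using v2 I(4) by (rule Bochner_Integration.integrable_add)
      show "(\<lambda>p. v p * (indicator (strip T) p * \<xi>x p)) \<in> borel_measurable lborel"
        using borel_measurable_times[OF vm I(3)] by simp
      show "AE p in lborel. norm (v p * (indicator (strip T) p * \<xi>x p)) \<le> norm ((v p)\<^sup>2 + (indicator (strip T) p * \<xi>x p)\<^sup>2)"
      proof (intro AE_I2)
        fix p
        show "norm (v p * (indicator (strip T) p * \<xi>x p)) \<le> norm ((v p)\<^sup>2 + (indicator (strip T) p * \<xi>x p)\<^sup>2)"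
          using abs_mult_le_squares[of "v p" "indicator (strip T) p * \<xi>x p"]
          unfolding real_norm_def by linarith
      qed
    qed
    show "(LINT x|lebesgue_on {0<..}. - V * \<xi> (x, 0)) + (LINT p|lborel. W p * \<xi>t p) = (LINT p|lborel. v p * \<xi>x p)"
      using id[OF tf] replace[OF wm Wm Wz(1) Weq I(1)] replace[OF L2_onD(1)[OF v0] vm Wz(2) veq I(3)] by simp
  qed
  show ?thesis
    by (rule that[OF Wm vm M _ _ _ Weq v2 WD]) (use Wb Wz ident in blast)+
qed

lemma \<D>_mono:
  assumes "strict_mono_on {0..} \<phi>" "\<phi> 0 = 0" "s \<le> s'"
  shows "\<D> \<phi> s \<le> \<D> \<phi> s'"
proof -
  have m: "\<phi> x \<le> \<phi> y" if "0 \<le> x" "x \<le> y" for x y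
    using strict_mono_onD[OF assms(1), of x y] that by (cases "x = y") auto
  show ?thesis using m[of s s'] m[of 0 s'] assms(2,3) by (auto simp: \<D>_def)
qed

text \<open>The Bochner norm controls slices only. Joint measurability is supplied by the Borel
  function \<open>z\<close>, and integrating the slice norms over time gives square integrability on
  the plane.\<close>

lemma square_integrable_slices:
  assumes z: "z \<in> borel_measurable borel" and out: "\<And>x t. t \<notin> {0<..<T} \<or> x \<le> 0 \<Longrightarrow> z (x, t) = 0"
    and U: "U \<in> L2_W12_0 T" and W12: "AE t in lborel. t \<in> {0<..<T} \<longrightarrow> U t \<in> W12"
    and eq: "AE t in lborel. t \<in> {0<..<T} \<longrightarrow> (AE x in lborel. x > 0 \<longrightarrow> z (x, t) = U t x)"
  shows "integrable lborel (\<lambda>p. (z p)\<^sup>2)"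
proof (rule integrableI_bounded)
  show "(\<lambda>p. (z p)\<^sup>2) \<in> borel_measurable lborel" using z by simp
  have m: "(\<lambda>p. ennreal (norm ((z p)\<^sup>2))) \<in> borel_measurable borel" using z by simp
  have "(\<integral>\<^sup>+ p. ennreal (norm ((z p)\<^sup>2)) \<partial>lborel) = (\<integral>\<^sup>+ t. (\<integral>\<^sup>+ x. ennreal (norm ((z (x, t))\<^sup>2)) \<partial>lborel) \<partial>lborel)"
    by (rule lborel2_nn_integral_snd[OF m, symmetric])
  also have "\<dots> \<le> (\<integral>\<^sup>+ t. ennreal ((W12_norm (U t))\<^sup>2) * indicator {0<..<T} t \<partial>lborel)"
  proof (rule nn_integral_mono_AE)
    show "AE t in lborel. (\<integral>\<^sup>+ x. ennreal (norm ((z (x, t))\<^sup>2)) \<partial>lborel) \<le> ennreal ((W12_norm (U t))\<^sup>2) * indicator {0<..<T} t"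
      using W12 eq
    proof eventually_elim
      case (elim t)
      show ?case
      proof (cases "t \<in> {0<..<T}")
        case True
        have w: "U t \<in> W12" using elim True by blast
        have i: "integrable (lebesgue_on {0<..}) (\<lambda>x. (U t x)\<^sup>2)" using L2_onD(2)[OF W12D(1)[OF w]] .
        have "(\<integral>\<^sup>+ x. ennreal (norm ((z (x, t))\<^sup>2)) \<partial>lborel) = (\<integral>\<^sup>+ x. ennreal ((U t x)\<^sup>2) * indicator {0<..} x \<partial>lborel)"
        proof (rule nn_integral_cong_AE)
          have "AE x in lborel. x > 0 \<longrightarrow> z (x, t) = U t x" using elim True by blast
          then show "AE x in lborel. ennreal (norm ((z (x, t))\<^sup>2)) = ennreal ((U t x)\<^sup>2) * indicator {0<..} x"
          proof eventually_elim
            case (elim x)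
            then show ?case using out[where x=x and t=t] by (cases "x > 0") auto
          qed
        qed
        also have "\<dots> = (\<integral>\<^sup>+ x. ennreal ((U t x)\<^sup>2) * indicator {0<..} x \<partial>lebesgue)" by (rule nn_integral_completion[symmetric])
        also have "\<dots> = (\<integral>\<^sup>+ x. ennreal ((U t x)\<^sup>2) \<partial>lebesgue_on {0<..})"
          by (rule nn_integral_restrict_space[symmetric]) simp
        also have "\<dots> = ennreal (LINT x|lebesgue_on {0<..}. (U t x)\<^sup>2)"
          by (rule nn_integral_eq_integral[OF i]) auto
        also have "\<dots> \<le> ennreal ((W12_norm (U t))\<^sup>2)"
          unfolding W12_norm_power2 by (intro ennreal_leI) (simp add: integral_nonneg_AE)
        finally show ?thesis using True by simp
      next
        case False
        then have "z (x, t) = 0" for x using out[where x=x and t=t] by blast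
        then show ?thesis by simp
      qed
    qed
  qed
  also have "\<dots> = (\<integral>\<^sup>+ t. ennreal ((W12_norm (U t))\<^sup>2) * indicator {0<..<T} t \<partial>lebesgue)" by (rule nn_integral_completion[symmetric])
  also have "\<dots> = (\<integral>\<^sup>+ t. ennreal ((W12_norm (U t))\<^sup>2) \<partial>lebesgue_on {0<..<T})"
    by (rule nn_integral_restrict_space[symmetric]) simp
  also have "\<dots> < \<infinity>" using U by (simp add: L2_W12_0_def)
  finally show "(\<integral>\<^sup>+ p. ennreal (norm ((z p)\<^sup>2)) \<partial>lborel) < \<infinity>" .
qed

lemma AE_half_line_iff: "(AE x in lebesgue_on {0<..}. P x) \<longleftrightarrow> (AE x in lborel. x > (0::real) \<longrightarrow> P x)"
  by (simp add: AE_lebesgue_on_iff AE_completion_iff)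

text \<open>Monotonicity of \<D> gives \<open>W Z\<close> its sign. The bridge from the Bochner
  space to the energy identity is that both excesses over \<open>w_hat\<close> are annihilated by
  the weights at almost every time, hence so is their difference.\<close>

lemma weak_solution_unique:
  assumes C2: "C2_on UNIV \<phi>" and mono: "strict_mono_on {0..} \<phi>" and phi0: "\<phi> 0 = 0" and dphi0: "deriv \<phi> 0 = 0"
    and T: "T > 0" and what: "continuous_on {0..} w_hat"
    and s1: "weak_solution \<phi> T V w_hat w1" and s2: "weak_solution \<phi> T V w_hat w2"
  shows "AE p in lebesgue_on (strip T). w1 p = w2 p"
proof -
  obtain W1 v1 M1 where W1: "W1 \<in> borel_measurable borel" and v1: "v1 \<in> borel_measurable borel" and M1: "M1 \<ge> 0"
    and W1b: "\<forall>p. \<bar>W1 p\<bar> \<le> M1" and W1z: "\<forall>p. p \<notin> open_strip T \<longrightarrow> W1 p = 0" and v1z: "\<forall>p. p \<notin> open_strip T \<longrightarrow> v1 p = 0"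
    and W1e: "AE p in lborel. p \<in> strip T \<longrightarrow> w1 p = W1 p" and v12: "integrable lborel (\<lambda>p. (v1 p)\<^sup>2)"
    and d1: "AE t in lborel. t \<in> {0<..<T} \<longrightarrow> (\<exists>u. has_weak_deriv (\<lambda>x. \<D> \<phi> (w1 (x, t))) u \<and> (AE x in lborel. x > 0 \<longrightarrow> u x = v1 (x, t)))"
    and i1: "\<forall>\<xi> \<xi>x \<xi>t. test_function T \<xi> \<xi>x \<xi>t \<longrightarrow> integrable lborel (\<lambda>p. W1 p * \<xi>t p) \<and> integrable lborel (\<lambda>p. v1 p * \<xi>x p) \<and>
       (LINT x|lebesgue_on {0<..}. - V * \<xi> (x, 0)) + (LINT p|lborel. W1 p * \<xi>t p) = (LINT p|lborel. v1 p * \<xi>x p)"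
    by (rule weak_solution_representative[OF s1 T])
  obtain W2 v2 M2 where W2: "W2 \<in> borel_measurable borel" and v2: "v2 \<in> borel_measurable borel" and M2: "M2 \<ge> 0"
    and W2b: "\<forall>p. \<bar>W2 p\<bar> \<le> M2" and W2z: "\<forall>p. p \<notin> open_strip T \<longrightarrow> W2 p = 0" and v2z: "\<forall>p. p \<notin> open_strip T \<longrightarrow> v2 p = 0"
    and W2e: "AE p in lborel. p \<in> strip T \<longrightarrow> w2 p = W2 p" and v22: "integrable lborel (\<lambda>p. (v2 p)\<^sup>2)"
    and d2: "AE t in lborel. t \<in> {0<..<T} \<longrightarrow> (\<exists>u. has_weak_deriv (\<lambda>x. \<D> \<phi> (w2 (x, t))) u \<and> (AE x in lborel. x > 0 \<longrightarrow> u x = v2 (x, t)))"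
    and i2: "\<forall>\<xi> \<xi>x \<xi>t. test_function T \<xi> \<xi>x \<xi>t \<longrightarrow> integrable lborel (\<lambda>p. W2 p * \<xi>t p) \<and> integrable lborel (\<lambda>p. v2 p * \<xi>x p) \<and>
       (LINT x|lebesgue_on {0<..}. - V * \<xi> (x, 0)) + (LINT p|lborel. W2 p * \<xi>t p) = (LINT p|lborel. v2 p * \<xi>x p)"
    by (rule weak_solution_representative[OF s2 T])
  have sub: "open_strip T \<subseteq> strip T" by (auto simp: open_strip_def strip_def)
  define W where "W = (\<lambda>p. W1 p - W2 p)"
  define v where "v = (\<lambda>p. v1 p - v2 p)"
  define Z where "Z = (\<lambda>p. \<D> \<phi> (W1 p) - \<D> \<phi> (W2 p))"
  interpret weak_equation T "M1 + M2" W v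
  proof
    show "T > 0" by (rule T)
    show "W \<in> borel_measurable borel" "v \<in> borel_measurable borel" unfolding W_def v_def using W1 W2 v1 v2 by auto
    show "\<bar>W p\<bar> \<le> M1 + M2" for p
    proof -
      have "\<bar>W1 p\<bar> \<le> M1" "\<bar>W2 p\<bar> \<le> M2" using W1b W2b by blast+
      then show ?thesis unfolding W_def by linarith
    qed
    show "W p = 0" "v p = 0" if "p \<notin> strip T" for p
      using that sub W1z W2z v1z v2z unfolding W_def v_def by (metis diff_self subsetD)+
    show "integrable lborel (\<lambda>p. (v p)\<^sup>2)"
    proof (rule Bochner_Integration.integrable_bound)
      show "integrable lborel (\<lambda>p. 2 * (v1 p)\<^sup>2 + 2 * (v2 p)\<^sup>2)" using v12 v22 by simp
      show "(\<lambda>p. (v p)\<^sup>2) \<in> borel_measurable lborel" unfolding v_def using v1 v2 by simp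
      show "AE p in lborel. norm ((v p)\<^sup>2) \<le> norm (2 * (v1 p)\<^sup>2 + 2 * (v2 p)\<^sup>2)"
      proof (intro AE_I2)
        fix p
        have "0 \<le> (v1 p + v2 p)\<^sup>2" by simp
        then have "(v p)\<^sup>2 \<le> 2 * (v1 p)\<^sup>2 + 2 * (v2 p)\<^sup>2" by (simp add: v_def power2_eq_square algebra_simps)
        then show "norm ((v p)\<^sup>2) \<le> norm (2 * (v1 p)\<^sup>2 + 2 * (v2 p)\<^sup>2)" by simp
      qed
    qed
    fix \<xi> \<xi>x \<xi>t assume tf: "test_function T \<xi> \<xi>x \<xi>t"
    note a = i1[rule_format, OF tf] and b = i2[rule_format, OF tf]
    show "(LINT p|lborel. W p * \<xi>t p) = (LINT p|lborel. v p * \<xi>x p)"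
      using a b by (simp add: W_def v_def left_diff_distrib)
  qed
  note cD = continuous_on_\<D>[OF C2 phi0 dphi0]
  have Dm: "\<D> \<phi> \<in> borel_measurable borel" using cD by (rule borel_measurable_continuous_onI)
  have Zm: "Z \<in> borel_measurable borel"
    unfolding Z_def by (intro borel_measurable_diff measurable_compose[OF _ Dm] W1 W2)
  obtain K where K: "\<And>s. s \<in> {- (M1 + M2)..M1 + M2} \<Longrightarrow> \<bar>\<D> \<phi> s\<bar> \<le> K" using continuous_bounded_Icc[OF cD] by blast
  have Zb: "\<bar>Z p\<bar> \<le> K + K" for p
  proof -
    have "\<bar>W1 p\<bar> \<le> M1" "\<bar>W2 p\<bar> \<le> M2" using W1b W2b by blast+
    then have "W1 p \<in> {- (M1 + M2)..M1 + M2}" "W2 p \<in> {- (M1 + M2)..M1 + M2}" using M1 M2 by auto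
    from K[OF this(1)] K[OF this(2)] show ?thesis unfolding Z_def by linarith
  qed
  have Zopen: "Z p = 0" if "p \<notin> open_strip T" for p
    using W1z[rule_format, OF that] W2z[rule_format, OF that] by (simp add: Z_def)
  have Zout: "Z p = 0" if "p \<notin> strip T" for p using Zopen sub that by blast
  have WZ: "0 \<le> W p * Z p" for p
    unfolding W_def Z_def using \<D>_mono[OF mono phi0, of "W1 p" "W2 p"] \<D>_mono[OF mono phi0, of "W2 p" "W1 p"]
    by (cases "W1 p \<le> W2 p") (auto intro: mult_nonneg_nonneg mult_nonpos_nonpos)
  have ax: "(0, t) \<notin> open_strip T" for t by (simp add: open_strip_def)
  have axis: "W (0, t) = 0" "v (0, t) = 0" "Z (0, t) = 0" for t
    using ax[of t] W1z W2z v1z v2z Zopen by (simp_all add: W_def v_def)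
  define U1 where "U1 = (\<lambda>t x. \<D> \<phi> (w1 (x, t)) - \<D> \<phi> (w_hat x))"
  define U2 where "U2 = (\<lambda>t x. \<D> \<phi> (w2 (x, t)) - \<D> \<phi> (w_hat x))"
  have U1: "U1 \<in> L2_W12_0 T" and U2: "U2 \<in> L2_W12_0 T"
    using s1 s2 unfolding weak_solution_def U1_def U2_def by blast+
  obtain \<Psi>1 where \<Psi>1: "countable \<Psi>1" "\<Psi>1 \<subseteq> Cc_inf"
    and ae1: "AE t in lebesgue_on {0<..<T}. U1 t \<in> W12 \<and> (\<forall>\<gamma>\<in>L2_on {0<..}. \<forall>\<delta>\<in>L2_on {0<..}.
       (\<forall>\<psi>\<in>\<Psi>1. (LINT x|lebesgue_on {0<..}. \<gamma> x * \<psi> x + \<delta> x * deriv \<psi> x) = 0) \<longrightarrow> annihilates \<gamma> \<delta> (U1 t))"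
    by (rule L2_W12_0_countable[OF U1])
  obtain \<Psi>2 where \<Psi>2: "countable \<Psi>2" "\<Psi>2 \<subseteq> Cc_inf"
    and ae2: "AE t in lebesgue_on {0<..<T}. U2 t \<in> W12 \<and> (\<forall>\<gamma>\<in>L2_on {0<..}. \<forall>\<delta>\<in>L2_on {0<..}.
       (\<forall>\<psi>\<in>\<Psi>2. (LINT x|lebesgue_on {0<..}. \<gamma> x * \<psi> x + \<delta> x * deriv \<psi> x) = 0) \<longrightarrow> annihilates \<gamma> \<delta> (U2 t))"
    by (rule L2_W12_0_countable[OF U2])
  have ae1': "AE t in lborel. t \<in> {0<..<T} \<longrightarrow> U1 t \<in> W12 \<and> (\<forall>\<gamma>\<in>L2_on {0<..}. \<forall>\<delta>\<in>L2_on {0<..}.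
       (\<forall>\<psi>\<in>\<Psi>1. (LINT x|lebesgue_on {0<..}. \<gamma> x * \<psi> x + \<delta> x * deriv \<psi> x) = 0) \<longrightarrow> annihilates \<gamma> \<delta> (U1 t))"
    using ae1 by (subst (asm) AE_lebesgue_on_iff) (simp_all only: AE_completion_iff, simp)
  have ae2': "AE t in lborel. t \<in> {0<..<T} \<longrightarrow> U2 t \<in> W12 \<and> (\<forall>\<gamma>\<in>L2_on {0<..}. \<forall>\<delta>\<in>L2_on {0<..}.
       (\<forall>\<psi>\<in>\<Psi>2. (LINT x|lebesgue_on {0<..}. \<gamma> x * \<psi> x + \<delta> x * deriv \<psi> x) = 0) \<longrightarrow> annihilates \<gamma> \<delta> (U2 t))"
    using ae2 by (subst (asm) AE_lebesgue_on_iff) (simp_all only: AE_completion_iff, simp)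
  have sec: "AE t in lborel. t \<in> {0<..<T} \<longrightarrow> (AE x in lborel. x > 0 \<longrightarrow> w (x, t) = W' (x, t))"
    if "AE p in lborel. p \<in> strip T \<longrightarrow> w p = W' p" for w W' :: "real \<times> real \<Rightarrow> real"
    using AE_lborel2_sections(1)[OF that]
  proof eventually_elim
    case (elim t)
    show ?case
    proof
      assume t: "t \<in> {0<..<T}"
      show "AE x in lborel. x > 0 \<longrightarrow> w (x, t) = W' (x, t)"
        using elim by eventually_elim (use t in \<open>auto simp: strip_def\<close>)
    qed
  qed
  have hm: "(\<lambda>x. indicator {0<..} x * \<D> \<phi> (w_hat x)) \<in> borel_measurable borel"
  proof -
    have "continuous_on {0<..} (\<lambda>x. \<D> \<phi> (w_hat x))"
      by (rule continuous_on_compose2[OF cD[of UNIV] continuous_on_subset[OF what]]) auto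
    from borel_measurable_continuous_on_indicator[OF _ this] show ?thesis by simp
  qed
  \<comment> \<open>Membership in the Bochner space is known for the excess over
    \<open>w_hat\<close>, so this function, and not \<D>(w) itself, is shown to be square
    integrable; it is stated once for both solutions.\<close>
  have zi: "integrable lborel (\<lambda>p. (indicator (open_strip T) p * (\<D> \<phi> (W' p) - \<D> \<phi> (w_hat (fst p))))\<^sup>2)"
    "(\<lambda>p. indicator (open_strip T) p * (\<D> \<phi> (W' p) - \<D> \<phi> (w_hat (fst p)))) \<in> borel_measurable borel"
    if W': "W' \<in> borel_measurable borel" and we: "AE p in lborel. p \<in> strip T \<longrightarrow> w p = W' p"
      and U: "U = (\<lambda>t x. \<D> \<phi> (w (x, t)) - \<D> \<phi> (w_hat x))" "U \<in> L2_W12_0 T" and UW: "AE t in lborel. t \<in> {0<..<T} \<longrightarrow> U t \<in> W12"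
    for W' w U
  proof -
    have e: "(\<lambda>p. indicator (open_strip T) p * (\<D> \<phi> (W' p) - \<D> \<phi> (w_hat (fst p))))
        = (\<lambda>p. indicator (open_strip T) p * (\<D> \<phi> (W' p) - indicator {0<..} (fst p) * \<D> \<phi> (w_hat (fst p))))"
      by (auto simp: open_strip_def indicator_def)
    show m: "(\<lambda>p. indicator (open_strip T) p * (\<D> \<phi> (W' p) - \<D> \<phi> (w_hat (fst p)))) \<in> borel_measurable borel"
      unfolding e
      by (intro borel_measurable_times borel_measurable_diff borel_measurable_indicator open_strip_borel measurable_compose[OF W' Dm]
          measurable_fst_snd_lborel2(1)[OF hm])
    show "integrable lborel (\<lambda>p. (indicator (open_strip T) p * (\<D> \<phi> (W' p) - \<D> \<phi> (w_hat (fst p))))\<^sup>2)"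
    proof (rule square_integrable_slices[OF m _ U(2) UW])
      show "indicator (open_strip T) (x, t) * (\<D> \<phi> (W' (x, t)) - \<D> \<phi> (w_hat (fst (x, t)))) = 0" if "t \<notin> {0<..<T} \<or> x \<le> 0" for x t
        using that by (auto simp: open_strip_def)
      show "AE t in lborel. t \<in> {0<..<T} \<longrightarrow> (AE x in lborel. x > 0 \<longrightarrow>
          indicator (open_strip T) (x, t) * (\<D> \<phi> (W' (x, t)) - \<D> \<phi> (w_hat (fst (x, t)))) = U t x)"
        using sec[OF we]
      proof eventually_elim
        case (elim t)
        show ?case
        proof
          assume t: "t \<in> {0<..<T}"
          then have "AE x in lborel. x > 0 \<longrightarrow> w (x, t) = W' (x, t)" using elim by blast
          then show "AE x in lborel. x > 0 \<longrightarrow>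
              indicator (open_strip T) (x, t) * (\<D> \<phi> (W' (x, t)) - \<D> \<phi> (w_hat (fst (x, t)))) = U t x"
            by eventually_elim (use t in \<open>simp add: U(1) open_strip_def\<close>)
        qed
      qed
    qed
  qed
  have UW1: "AE t in lborel. t \<in> {0<..<T} \<longrightarrow> U1 t \<in> W12" using ae1' by eventually_elim blast
  have UW2: "AE t in lborel. t \<in> {0<..<T} \<longrightarrow> U2 t \<in> W12" using ae2' by eventually_elim blast
  note z1 = zi[OF W1 W1e U1_def U1 UW1] and z2 = zi[OF W2 W2e U2_def U2 UW2]
  have Z2: "integrable lborel (\<lambda>p. (Z p)\<^sup>2)"
  proof (rule Bochner_Integration.integrable_bound)
    let ?z = "\<lambda>W' p. indicator (open_strip T) p * (\<D> \<phi> (W' p) - \<D> \<phi> (w_hat (fst p)))"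
    show "integrable lborel (\<lambda>p. 2 * (?z W1 p)\<^sup>2 + 2 * (?z W2 p)\<^sup>2)" using z1(1) z2(1) by simp
    show "(\<lambda>p. (Z p)\<^sup>2) \<in> borel_measurable lborel" using Zm by simp
    show "AE p in lborel. norm ((Z p)\<^sup>2) \<le> norm (2 * (?z W1 p)\<^sup>2 + 2 * (?z W2 p)\<^sup>2)"
    proof (intro AE_I2)
      fix p
      have Ze: "Z p = ?z W1 p - ?z W2 p" using Zopen[of p] by (cases "p \<in> open_strip T") (auto simp: Z_def)
      have "0 \<le> (?z W1 p + ?z W2 p)\<^sup>2" by simp
      then have "(Z p)\<^sup>2 \<le> 2 * (?z W1 p)\<^sup>2 + 2 * (?z W2 p)\<^sup>2" unfolding Ze power2_eq_square by (simp only: algebra_simps)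
      then show "norm ((Z p)\<^sup>2) \<le> norm (2 * (?z W1 p)\<^sup>2 + 2 * (?z W2 p)\<^sup>2)" by simp
    qed
  qed
  have same: "AE x in lborel. x > 0 \<longrightarrow> \<D> \<phi> (w1 (x, t)) - \<D> \<phi> (w2 (x, t)) = Z (x, t)"
    if "AE x in lborel. x > 0 \<longrightarrow> w1 (x, t) = W1 (x, t)" "AE x in lborel. x > 0 \<longrightarrow> w2 (x, t) = W2 (x, t)" for t
    using that by eventually_elim (simp add: Z_def)
  have slices: "AE s in lborel. s \<in> {0<..<T} \<longrightarrow> (\<forall>n. (LINT x|lebesgue_on {0<..}. weight n s x * Z (x, s) + deriv_weight n s x * v (x, s)) = 0)"
    using annihilation_slices[OF \<Psi>1] annihilation_slices[OF \<Psi>2] ae1' ae2' sec[OF W1e] sec[OF W2e] d1 d2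
  proof eventually_elim
    case (elim s)
    show ?case
    proof (intro impI allI)
      fix n assume s: "s \<in> {0<..<T}"
      note L2 = weights_L2[of n s]
      have A1: "annihilates (weight n s) (deriv_weight n s) (U1 s)"
        using elim(1,3) s L2 by blast
      have A2: "annihilates (weight n s) (deriv_weight n s) (U2 s)"
        using elim(2,4) s L2 by blast
      have wx: "AE x in lborel. x > 0 \<longrightarrow> w1 (x, s) = W1 (x, s)" "AE x in lborel. x > 0 \<longrightarrow> w2 (x, s) = W2 (x, s)"
        using elim(5,6) s by blast+
      obtain r1 where r1: "has_weak_deriv (\<lambda>x. \<D> \<phi> (w1 (x, s))) r1" "AE x in lborel. x > 0 \<longrightarrow> r1 x = v1 (x, s)"
        using elim(7) s by blast
      obtain r2 where r2: "has_weak_deriv (\<lambda>x. \<D> \<phi> (w2 (x, s))) r2" "AE x in lborel. x > 0 \<longrightarrow> r2 x = v2 (x, s)"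
        using elim(8) s by blast
      \<comment> \<open>The boundary data cancel, so \<open>u\<close> is a Sobolev function that
        represents \<open>Z\<close> at this time, and its weak derivative represents
        \<open>v\<close>.\<close>
      define u where "u = (\<lambda>x. 1 * U1 s x + (-1) * U2 s x)"
      have ue: "u = (\<lambda>x. 1 * \<D> \<phi> (w1 (x, s)) + (-1) * \<D> \<phi> (w2 (x, s)))"
        by (simp add: u_def U1_def U2_def fun_eq_iff)
      have A: "annihilates (weight n s) (deriv_weight n s) u"
        unfolding u_def by (rule annihilates_linear[OF L2 A1 A2])
      have uW: "u \<in> W12" using A by (simp add: annihilates_def)
      have "has_weak_deriv u (\<lambda>x. 1 * r1 x + (-1) * r2 x)"
        unfolding ue by (rule has_weak_deriv_linear[OF r1(1) r2(1)])
      from weak_deriv_AE[OF this] have "AE x in lborel. x > 0 \<longrightarrow> weak_deriv u x = 1 * r1 x + (-1) * r2 x"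
        by (simp only: AE_half_line_iff)
      then have wd: "AE x in lborel. x > 0 \<longrightarrow> weak_deriv u x = v (x, s)"
        using r1(2) r2(2) by eventually_elim (simp add: v_def)
      have uz: "AE x in lborel. x > 0 \<longrightarrow> u x = Z (x, s)"
        using same[OF wx] by eventually_elim (simp add: ue)
      have "(LINT x|lebesgue_on {0<..}. weight n s x * Z (x, s) + deriv_weight n s x * v (x, s))
          = (LINT x|lebesgue_on {0<..}. weight n s x * u x + deriv_weight n s x * weak_deriv u x)"
      proof (rule integral_cong_AE)
        show "(\<lambda>x. weight n s x * Z (x, s) + deriv_weight n s x * v (x, s)) \<in> borel_measurable (lebesgue_on {0<..})"
          by (intro borel_measurable_Icc borel_measurable_add borel_measurable_times weights_measurable
              lborel2_measurable_section[OF Zm] v_section)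
        show "(\<lambda>x. weight n s x * u x + deriv_weight n s x * weak_deriv u x) \<in> borel_measurable (lebesgue_on {0<..})"
          by (rule borel_measurable_integrable[OF annihilates_integrable[OF L2 uW]])
        show "AE x in lebesgue_on {0<..}. weight n s x * Z (x, s) + deriv_weight n s x * v (x, s) = weight n s x * u x + deriv_weight n s x * weak_deriv u x"
          unfolding AE_half_line_iff using wd uz by eventually_elim simp
      qed
      also have "\<dots> = 0" using A by (simp add: annihilates_def)
      finally show "(LINT x|lebesgue_on {0<..}. weight n s x * Z (x, s) + deriv_weight n s x * v (x, s)) = 0" .
    qed
  qed
  have "AE p in lborel. W p * Z p = 0"
    by (rule energy[OF Zm Zb Zout Z2 WZ axis slices])
  \<comment> \<open>Where \<open>W\<close> vanishes the two values agree and \<open>Z\<close>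
    vanishes too, so in either case the product being 0 forces \<open>Z = 0\<close>.\<close>
  then have Z0: "AE p in lborel. Z p = 0"
    by eventually_elim (auto simp: W_def Z_def)
  \<comment> \<open>At almost every time the two functions \<D>(w) agree almost everywhere in space,
    and weak derivatives are unique.\<close>
  have v0: "AE s in lborel. AE x in lborel. v (x, s) = 0"
    using AE_lborel2_sections(1)[OF Z0] sec[OF W1e] sec[OF W2e] d1 d2
  proof eventually_elim
    case (elim s)
    show ?case
    proof (cases "s \<in> {0<..<T}")
      case True
      obtain r1 where r1: "has_weak_deriv (\<lambda>x. \<D> \<phi> (w1 (x, s))) r1" "AE x in lborel. x > 0 \<longrightarrow> r1 x = v1 (x, s)"
        using elim(4) True by blast
      obtain r2 where r2: "has_weak_deriv (\<lambda>x. \<D> \<phi> (w2 (x, s))) r2" "AE x in lborel. x > 0 \<longrightarrow> r2 x = v2 (x, s)"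
        using elim(5) True by blast
      have "AE x in lborel. x > 0 \<longrightarrow> \<D> \<phi> (w1 (x, s)) = \<D> \<phi> (w2 (x, s))"
        using same[of s] elim(1,2,3) True by (auto elim: eventually_elim2)
      then have "AE x in lebesgue_on {0<..}. \<D> \<phi> (w1 (x, s)) = \<D> \<phi> (w2 (x, s))" by (simp only: AE_half_line_iff)
      from weak_deriv_unique[OF r1(1) r2(1) this] have "AE x in lborel. x > 0 \<longrightarrow> r1 x = r2 x"
        by (simp only: AE_half_line_iff)
      then show ?thesis
        using r1(2) r2(2)
      proof eventually_elim
        case (elim x)
        have "x \<le> 0 \<Longrightarrow> (x, s) \<notin> open_strip T" by (auto simp: open_strip_def)
        then show ?case using elim v1z v2z by (cases "x > 0") (auto simp: v_def)
      qed
    next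
      case False
      then have "(x, s) \<notin> open_strip T" for x by (auto simp: open_strip_def)
      then have "v (x, s) = 0" for x using v1z v2z by (simp add: v_def)
      then show ?thesis by simp
    qed
  qed
  have "AE p in lborel. W p = 0" by (rule W_zero_if_v_zero[OF v0 axis(1)])
  then have "AE p in lborel. p \<in> strip T \<longrightarrow> w1 p = w2 p"
    using W1e W2e by eventually_elim (auto simp: W_def)
  then show ?thesis by (simp only: AE_lebesgue_on_iff[OF sets_strip(2)] AE_completion_iff)
qed

theorem theorem2p9:
  fixes \<phi> w_hat :: "real \<Rightarrow> real" and T U\<^sub>0 V\<^sub>0 :: real
  assumes "C2_on UNIV \<phi>"
    and "strict_mono_on {0..} \<phi>" and "strict_mono_on {0..} (deriv \<phi>)"
    and "\<And>s. s > 0 \<Longrightarrow> \<phi> s > 0" and "\<phi> 0 = 0" and "deriv \<phi> 0 = 0"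
    and "(\<integral>\<^sup>+ s\<in>{0<..<1}. ennreal (deriv \<phi> s / s) \<partial>lborel) < \<infinity>"
    and "(\<integral>\<^sup>+ s\<in>{1<..}. ennreal (deriv \<phi> s / s) \<partial>lborel) = \<infinity>"
    and "T > 0" and "U\<^sub>0 > 0" and "V\<^sub>0 > 0"
    and "smooth_on {0..} w_hat" and "w_hat 0 = U\<^sub>0" and "\<And>x. x > 1 \<Longrightarrow> w_hat x = - V\<^sub>0"
  shows "\<exists>w. weak_solution \<phi> T V\<^sub>0 w_hat w \<and>
           (\<forall>w'. weak_solution \<phi> T V\<^sub>0 w_hat w' \<longrightarrow> (AE p in lebesgue_on (strip T). w' p = w p)) \<and>
           (\<exists>f a. a > 0 \<and>
              (AE (x, t) in lebesgue_on (strip T). w (x, t) = f (x / sqrt t)) \<and>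
              is_free_boundary T w (\<lambda>t. a * sqrt t) \<and>
              self_similar_profile \<phi> U\<^sub>0 V\<^sub>0 a f)"
proof -
  note C2 = assms(1) and mono = assms(2) and phi0 = assms(5) and dphi0 = assms(6)
    and T = assms(9) and U = assms(10) and V = assms(11) and what = assms(12)
  obtain a f F fd where a: "a > 0" and fc: "continuous_on {0..a} f" and f0: "f 0 = U\<^sub>0" and fa: "f a = 0"
    and fpos: "\<And>\<eta>. \<eta> \<in> {0..<a} \<Longrightarrow> f \<eta> > 0" and fle: "\<And>\<eta>. \<eta> \<in> {0..a} \<Longrightarrow> f \<eta> \<le> U\<^sub>0"
    and fgt: "\<And>\<eta>. \<eta> > a \<Longrightarrow> f \<eta> = - V\<^sub>0" and flt: "\<And>\<eta>. \<eta> < 0 \<Longrightarrow> f \<eta> = U\<^sub>0"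
    and Fc: "continuous_on {0..a} F" and Fa: "F a = - (a * V\<^sub>0 / 2)"
    and df: "\<And>\<eta>. \<eta> \<in> {0<..<a} \<Longrightarrow> (f has_real_derivative fd \<eta>) (at \<eta>)"
    and fF: "\<And>\<eta>. \<eta> \<in> {0<..<a} \<Longrightarrow> deriv \<phi> (f \<eta>) * fd \<eta> = F \<eta>"
    and dF: "\<And>\<eta>. \<eta> \<in> {0<..<a} \<Longrightarrow> (F has_real_derivative - (1/2) * \<eta> * fd \<eta>) (at \<eta>)"
    and prof: "self_similar_profile \<phi> U\<^sub>0 V\<^sub>0 a f"
    using profile_exists[OF C2 assms(3) dphi0 U V] by blast
  interpret self_similar \<phi> f F fd w_hat T U\<^sub>0 V\<^sub>0 a
    by unfold_locales (fact C2 mono phi0 dphi0 T U V a fc f0 fa fpos fle fgt flt Fc Fa df fF dF what assms(13,14))+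
  show ?thesis
  proof (intro exI[of _ w] conjI allI impI weak_solution_w exI[of _ f] exI[of _ a] a prof)
    show "AE p in lebesgue_on (strip T). w' p = w p" if "weak_solution \<phi> T V\<^sub>0 w_hat w'" for w'
      by (rule weak_solution_unique[OF C2 mono phi0 dphi0 T smooth_on_continuous_on[OF what] that weak_solution_w])
    show "AE (x, t) in lebesgue_on (strip T). w (x, t) = f (x / sqrt t)"
      by (simp add: w_def split_def)
    show "is_free_boundary T w (\<lambda>t. a * sqrt t)"
      unfolding is_free_boundary_def
    \<comment> \<open>The signs hold at every point of the strip; on the curve itself both
      implications are vacuous.\<close>
    proof (rule AE_I2)
      fix p assume "p \<in> space (lebesgue_on (strip T))"
      then obtain x t where p: "p = (x, t)" "0 \<le> x" "0 < t" by (auto simp: strip_def)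
      have "x / sqrt t < a \<longleftrightarrow> x < a * sqrt t" "a < x / sqrt t \<longleftrightarrow> a * sqrt t < x"
        using p by (simp_all add: pos_divide_less_eq pos_less_divide_eq)
      then show "case p of (x, t) \<Rightarrow> (x < a * sqrt t \<longrightarrow> w (x, t) > 0) \<and> (x > a * sqrt t \<longrightarrow> w (x, t) < 0)"
        using fpos[of "x / sqrt t"] fgt[of "x / sqrt t"] V p by (auto simp: w_def)
    qed
  qed
qed

end
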